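(* Let $F$, $B$, $u_0$ and the $s$-stage stochastic Runge-Kutta method with coefficients $(A,b,\widetilde A,\widetilde b,c)$ be as in the context. Let $p\ge2$, let $u_0$ be an $\mathcal F_0$-measurable $\mathbb H$-valued random variable with $\|u_0\|_{L^p(\Omega;\mathbb H)}<\infty$, and let $B(t)\in HS(U_0,\mathcal D(M))$ for every $t\in[0,T]$ with $\sup_{t\in[0,T]}\|B(t)\|_{HS(U_0,\mathcal D(M))}<\infty$. Let the Runge-Kutta method $(A,b)$ be algebraically stable and let $A$ satisfy the coercivity condition. Fix $T=t_N>0$. Then, for sufficiently small step size $\tau\le\tau^*$ with $\tau^*=\tau^*(\|u_0\|_{\mathbb H},T)$, there exists a unique $\mathbb H$-valued $\{\mathcal F_{t_n}\}_{0\le n\le N}$-adapted discrete solution $\{u^n;\ n=0,1,\dots,N\}$ of the method, and there is a constant $C=C\big(p,T,\sup_{t\in[0,T]}\|B(t)\|_{HS(U_0,\mathcal D(M))}\big)>0$ such that $$\max_{1\le i\le s}\mathbb E\|U_{ni}\|_{\mathbb H}^p\le C\big(\mathbb E\|u^n\|_{\mathbb H}^p+\tau\big)\quad (n=0,\dots,N-1),$$ $$\max_{1\le n\le N}\mathbb E\|u^n\|_{\mathbb H}^p\le C\big(1+\|u_0\|_{L^p(\Omega;\mathbb H)}^p\big).$$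
   Context: Setting. $D\subset\mathbb R^3$ is a bounded domain with unit outward normal $\mathbf n$ on $\partial D$; $T\in(0,\infty)$; $\varepsilon,\mu\in L^\infty(D)$ with $\varepsilon,\mu\ge\delta>0$. The functions $\mathbf J_e,\mathbf J_m:[0,T]\times D\times\mathbb R^3\times\mathbb R^3\to\mathbb R^3$ are continuous and, for $\mathbf J\in\{\mathbf J_e,\mathbf J_m\}$ and a constant $L>0$, satisfy $|\mathbf J(t,\mathbf x,u,v)|\le L(1+|u|+|v|)$ and $|\mathbf J(t,\mathbf x,u_1,v_1)-\mathbf J(s,\mathbf x,u_2,v_2)|\le L(|t-s|+|u_1-u_2|+|v_1-v_2|)$. The functions $\mathbf J_e^r,\mathbf J_m^r:[0,T]\times D\to\mathbb R^3$ are continuous and bounded. $U=L^2(D)$; $Q$ is a symmetric positive definite operator on $U$ with finite trace; $W$ is a $Q$-Wiener process on a filtered probability space $(\Omega,\mathcal F,\{\mathcal F_t\}_{0\le t\le T},\mathbb P)$; $U_0:=Q^{1/2}U$. $HS(U_0,H)$ denotes the Hilbert-Schmidt operators from $U_0$ to $H$. $\mathbb H=L^2(D)^3\times L^2(D)^3$ has inner product $\langle(\mathbf E_1,\mathbf H_1),(\mathbf E_2,\mathbf H_2)\rangle_{\mathbb H}=\int_D(\varepsilon\mathbf E_1\cdot\mathbf E_2+\mu\mathbf H_1\cdot\mathbf H_2)\,d\mathbf x$. The Maxwell operator is $M(\mathbf E,\mathbf H)=(\varepsilon^{-1}\nabla\times\mathbf H,\,-\mu^{-1}\nabla\times\mathbf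 E)$ with domain $\mathcal D(M)=H_0(\mathrm{curl},D)\times H(\mathrm{curl},D)$, where $H(\mathrm{curl},D)=\{v\in L^2(D)^3:\nabla\times v\in L^2(D)^3\}$ and $H_0(\mathrm{curl},D)=\{v\in H(\mathrm{curl},D):\mathbf n\times v|_{\partial D}=0\}$; it is skew-adjoint on $\mathbb H$. $\mathcal D(M)$ has norm $\|u\|_{\mathcal D(M)}=(\|u\|_{\mathbb H}^2+\|Mu\|_{\mathbb H}^2)^{1/2}$. For $u=(\mathbf E,\mathbf H)\in\mathbb H$, $F(t,u)(\mathbf x)=(-\varepsilon^{-1}\mathbf J_e(t,\mathbf x,\mathbf E(\mathbf x),\mathbf H(\mathbf x)),\,-\mu^{-1}\mathbf J_m(t,\mathbf x,\mathbf E(\mathbf x),\mathbf H(\mathbf x)))$; for $v\in U_0$, $(B(t)v)(\mathbf x)=(-\varepsilon^{-1}\mathbf J_e^r(t,\mathbf x)v(\mathbf x),\,-\mu^{-1}\mathbf J_m^r(t,\mathbf x)v(\mathbf x))$. Stochastic Runge-Kutta method (for $du=[Mu+F(t,u)]dt+B(t)dW$, $u(0)=u_0$). Let $\tau=T/N$, $t_n=n\tau$, $\Delta W^{n+1}=W(t_{n+1})-W(t_n)$, $A=(a_{ij})$, $\widetilde A=(\widetilde a_{ij})$ real $s\times s$ matrices, $b,\widetilde b\in\mathbb R^s$, and nodes $c_1,\dots,c_s\in[0,1]$. With $u^0=u_0$, for $n=0,\dots,N-1$ and $i=1,\dots,s$: $U_{ni}=u^n+\tau\sum_{j=1}^sa_{ij}\big(MU_{nj}+F(t_n+c_j\tau,U_{nj})\big)+\sum_{j=1}^s\widetilde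 a_{ij}B(t_n+c_j\tau)\Delta W^{n+1}$, $u^{n+1}=u^n+\tau\sum_{i=1}^sb_i\big(MU_{ni}+F(t_n+c_i\tau,U_{ni})\big)+\sum_{i=1}^s\widetilde b_iB(t_n+c_i\tau)\Delta W^{n+1}$. $(A,b)$ is algebraically stable if $b_i\ge0$ for all $i$ and the matrix $(m_{ij})$, $m_{ij}=b_ia_{ij}+b_ja_{ji}-b_ib_j$, is positive semidefinite. $A$ satisfies the coercivity condition if $A$ is invertible and there are a diagonal positive definite matrix $\mathcal K$ and $\alpha>0$ with $v^T\mathcal KA^{-1}v\ge\alpha v^T\mathcal Kv$ for all $v\in\mathbb R^s$. *)

theory Defs
  imports "HOL-Probability.Probability"
begin

section \<open>Square-integrable functions modulo equality almost everywhere\<close>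

definition square_integrable :: "('a::euclidean_space \<Rightarrow> 'b::euclidean_space) \<Rightarrow> bool" where
  "square_integrable f \<longleftrightarrow>
     f \<in> borel_measurable lebesgue \<and> integrable lebesgue (\<lambda>x. (norm (f x))\<^sup>2)"

lemma square_integrable_zero: "square_integrable (\<lambda>_. 0)"
  by (simp add: square_integrable_def)

lemma square_integrable_scaleR:
  assumes "square_integrable f"
  shows "square_integrable (\<lambda>x. r *\<^sub>R f x)"
  using assms by (auto simp: square_integrable_def power_mult_distrib)

lemma square_integrable_add:
  assumes f: "square_integrable f" and g: "square_integrable g"
  shows "square_integrable (\<lambda>x. f x + g x)"
proof -
  have [measurable]: "f \<in> borel_measurable lebesgue" "g \<in> borel_measurable lebesgue"
    using f g by (auto simp: square_integrable_def)
  have int: "integrable lebesgue (\<lambda>x. 2 * (norm (f x))\<^sup>2 + 2 * (norm (g x))\<^sup>2)"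
    using f g by (auto simp: square_integrable_def)
  have le: "(norm (f x + g x))\<^sup>2 \<le> 2 * (norm (f x))\<^sup>2 + 2 * (norm (g x))\<^sup>2" for x
  proof -
    have "(norm (f x + g x))\<^sup>2 \<le> (norm (f x) + norm (g x))\<^sup>2"
      by (simp add: norm_triangle_ineq power_mono)
    also have "\<dots> \<le> 2 * (norm (f x))\<^sup>2 + 2 * (norm (g x))\<^sup>2"
      using sum_squares_bound[of "norm (f x)" "norm (g x)"] by (simp add: power2_sum)
    finally show ?thesis .
  qed
  have "integrable lebesgue (\<lambda>x. (norm (f x + g x))\<^sup>2)"
    by (rule Bochner_Integration.integrable_bound[OF int]) (use le in \<open>auto intro!: AE_I2\<close>)
  then show ?thesis
    by (simp add: square_integrable_def)
qed

lemma square_integrable_inner: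
  assumes f: "square_integrable f" and g: "square_integrable g"
  shows "integrable lebesgue (\<lambda>x. inner (f x) (g x))"
proof -
  have [measurable]: "f \<in> borel_measurable lebesgue" "g \<in> borel_measurable lebesgue"
    using f g by (auto simp: square_integrable_def)
  have int: "integrable lebesgue (\<lambda>x. (norm (f x))\<^sup>2 + (norm (g x))\<^sup>2)"
    using f g by (auto simp: square_integrable_def)
  have le: "\<bar>inner (f x) (g x)\<bar> \<le> (norm (f x))\<^sup>2 + (norm (g x))\<^sup>2" for x
  proof -
    have "\<bar>inner (f x) (g x)\<bar> \<le> norm (f x) * norm (g x)"
      by (rule Cauchy_Schwarz_ineq2)
    also have "\<dots> \<le> 2 * norm (f x) * norm (g x)"
      by simp
    also have "\<dots> \<le> (norm (f x))\<^sup>2 + (norm (g x))\<^sup>2"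
      by (rule sum_squares_bound)
    finally show ?thesis .
  qed
  show ?thesis
    by (rule Bochner_Integration.integrable_bound[OF int]) (use le in \<open>auto intro!: AE_I2\<close>)
qed

text \<open>\<open>('a, 'b) l2\<close> is \<open>L\<^sup>2('a; 'b)\<close> for Lebesgue measure on the whole space \<open>'a\<close>. The space over
  a subset \<open>D\<close> is the closed subspace \<open>L2_on D\<close> below.\<close>

definition l2_rel :: "('a::euclidean_space \<Rightarrow> 'b::euclidean_space) \<Rightarrow> ('a \<Rightarrow> 'b) \<Rightarrow> bool" where
  "l2_rel f g \<longleftrightarrow> square_integrable f \<and> square_integrable g \<and> (AE x in lebesgue. f x = g x)"

lemma part_equivp_l2_rel: "part_equivp l2_rel"
proof (rule part_equivpI)
  show "\<exists>f. l2_rel f (f :: 'a \<Rightarrow> 'b)"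
    by (rule exI[of _ "\<lambda>_. 0"]) (simp add: l2_rel_def square_integrable_zero)
  show "symp (l2_rel :: ('a \<Rightarrow> 'b) \<Rightarrow> _)"
    by (auto intro!: sympI simp: l2_rel_def elim!: eventually_mono)
  show "transp (l2_rel :: ('a \<Rightarrow> 'b) \<Rightarrow> _)"
    by (rule transpI) (auto simp: l2_rel_def elim: eventually_elim2)
qed

quotient_type (overloaded) ('a, 'b) l2 =
    "'a::euclidean_space \<Rightarrow> 'b::euclidean_space" / partial: l2_rel
  by (rule part_equivp_l2_rel)

instantiation l2 :: (euclidean_space, euclidean_space) real_inner
begin

lift_definition zero_l2 :: "('a, 'b) l2" is "\<lambda>_. 0"
  by (simp add: l2_rel_def square_integrable_zero)

lift_definition plus_l2 :: "('a, 'b) l2 \<Rightarrow> ('a, 'b) l2 \<Rightarrow> ('a, 'b) l2" is "\<lambda>f g x. f x + g x"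
  by (auto simp: l2_rel_def square_integrable_add elim: eventually_elim2)

lift_definition scaleR_l2 :: "real \<Rightarrow> ('a, 'b) l2 \<Rightarrow> ('a, 'b) l2" is "\<lambda>r f x. r *\<^sub>R f x"
  by (auto simp: l2_rel_def square_integrable_scaleR elim: eventually_mono)

lift_definition uminus_l2 :: "('a, 'b) l2 \<Rightarrow> ('a, 'b) l2" is "\<lambda>f x. - f x"
  using square_integrable_scaleR[of _ "-1"]
  by (auto simp: l2_rel_def elim: eventually_mono)

definition minus_l2 :: "('a, 'b) l2 \<Rightarrow> ('a, 'b) l2 \<Rightarrow> ('a, 'b) l2" where
  "minus_l2 u v = u + - v"

lift_definition inner_l2 :: "('a, 'b) l2 \<Rightarrow> ('a, 'b) l2 \<Rightarrow> real"
  is "\<lambda>f g. LINT x|lebesgue. inner (f x) (g x)"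
proof -
  fix f f' g g' :: "'a \<Rightarrow> 'b"
  assume f: "l2_rel f f'" and g: "l2_rel g g'"
  show "(LINT x|lebesgue. inner (f x) (g x)) = (LINT x|lebesgue. inner (f' x) (g' x))"
    by (rule integral_cong_AE)
      (use f g in \<open>auto simp: l2_rel_def square_integrable_def elim: eventually_elim2\<close>)
qed

definition norm_l2 :: "('a, 'b) l2 \<Rightarrow> real" where
  "norm_l2 u = sqrt (inner u u)"

definition sgn_l2 :: "('a, 'b) l2 \<Rightarrow> ('a, 'b) l2" where
  "sgn_l2 u = inverse (norm u) *\<^sub>R u"

definition dist_l2 :: "('a, 'b) l2 \<Rightarrow> ('a, 'b) l2 \<Rightarrow> real" where
  "dist_l2 u v = norm (u - v)"

definition uniformity_l2 :: "(('a, 'b) l2 \<times> ('a, 'b) l2) filter" where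
  "uniformity_l2 = (INF e\<in>{0 <..}. principal {(u, v). dist u v < e})"

definition open_l2 :: "('a, 'b) l2 set \<Rightarrow> bool" where
  "open_l2 S = (\<forall>u\<in>S. \<forall>\<^sub>F (u', v) in uniformity. u' = u \<longrightarrow> v \<in> S)"

instance
proof
  fix u v w :: "('a, 'b) l2" and r q :: real
  show "u + v + w = u + (v + w)"
    by transfer (auto simp: l2_rel_def square_integrable_add add.assoc)
  show "u + v = v + u"
    by transfer (auto simp: l2_rel_def square_integrable_add add.commute)
  show "0 + u = u"
    by transfer (auto simp: l2_rel_def)
  show "- u + u = 0"
    by transfer (auto simp: l2_rel_def square_integrable_zero)
  show "u - v = u + - v"
    by (rule minus_l2_def)
  show "r *\<^sub>R (u + v) = r *\<^sub>R u + r *\<^sub>R v"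
    by transfer (auto simp: l2_rel_def square_integrable_add square_integrable_scaleR scaleR_add_right)
  show "(r + q) *\<^sub>R u = r *\<^sub>R u + q *\<^sub>R u"
    by transfer (auto simp: l2_rel_def square_integrable_add square_integrable_scaleR scaleR_add_left)
  show "r *\<^sub>R q *\<^sub>R u = (r * q) *\<^sub>R u"
    by transfer (auto simp: l2_rel_def square_integrable_scaleR)
  show "1 *\<^sub>R u = u"
    by transfer (auto simp: l2_rel_def)
  show "inner u v = inner v u"
    by transfer (simp add: inner_commute)
  show "inner (u + v) w = inner u w + inner v w"
    by transfer (auto simp: l2_rel_def inner_add_left square_integrable_inner)
  show "inner (r *\<^sub>R u) v = r * inner u v"
    by transfer simp
  show "0 \<le> inner u u"
    by transfer simp
  show "(inner u u = 0) = (u = 0)"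
  proof transfer
    fix f :: "'a \<Rightarrow> 'b"
    assume f: "l2_rel f f"
    have "integrable lebesgue (\<lambda>x. inner (f x) (f x))"
      using f by (auto simp: l2_rel_def square_integrable_inner)
    then have "((LINT x|lebesgue. inner (f x) (f x)) = 0) \<longleftrightarrow> (AE x in lebesgue. inner (f x) (f x) = 0)"
      by (intro integral_nonneg_eq_0_iff_AE) auto
    then show "((LINT x|lebesgue. inner (f x) (f x)) = 0) = l2_rel f (\<lambda>_. 0)"
      using f by (simp add: l2_rel_def square_integrable_zero)
  qed
qed (simp_all add: norm_l2_def sgn_l2_def dist_l2_def uniformity_l2_def open_l2_def)

end

definition L2_on :: "'a::euclidean_space set \<Rightarrow> ('a, 'b::euclidean_space) l2 set" where
  "L2_on D = {u. AE x in lebesgue. x \<notin> D \<longrightarrow> rep_l2 u x = 0}"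

text \<open>The class of a function given on \<open>D\<close>, extended by zero; meaningful only if that extension is
  square integrable.\<close>

definition l2_class_on :: "'a::euclidean_space set \<Rightarrow> ('a \<Rightarrow> 'b::euclidean_space) \<Rightarrow> ('a, 'b) l2" where
  "l2_class_on D f = abs_l2 (\<lambda>x. if x \<in> D then f x else 0)"

section \<open>Curl spaces\<close>

definition partial_deriv :: "'n::finite \<Rightarrow> (real^'n \<Rightarrow> real) \<Rightarrow> real^'n \<Rightarrow> real" where
  "partial_deriv i f x = frechet_derivative f (at x) (axis i 1)"

text \<open>\<open>C\<^sup>\<infinity>\<close>: all iterated partial derivatives are (totally) differentiable everywhere.\<close>

definition smooth :: "(real^'n::finite \<Rightarrow> real) \<Rightarrow> bool" where
  "smooth f \<longleftrightarrow> (\<forall>is x. foldr partial_deriv is f differentiable (at x))"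

definition test_fields :: "(real^3) set \<Rightarrow> (real^3 \<Rightarrow> real^3) set" where
  "test_fields D = {\<phi>. (\<forall>i. smooth (\<lambda>x. \<phi> x $ i)) \<and>
     compact (closure {x. \<phi> x \<noteq> 0}) \<and> closure {x. \<phi> x \<noteq> 0} \<subseteq> D}"

definition curl :: "(real^3 \<Rightarrow> real^3) \<Rightarrow> real^3 \<Rightarrow> real^3" where
  "curl \<phi> x = vector
     [partial_deriv 2 (\<lambda>y. \<phi> y $ 3) x - partial_deriv 3 (\<lambda>y. \<phi> y $ 2) x,
      partial_deriv 3 (\<lambda>y. \<phi> y $ 1) x - partial_deriv 1 (\<lambda>y. \<phi> y $ 3) x,
      partial_deriv 1 (\<lambda>y. \<phi> y $ 2) x - partial_deriv 2 (\<lambda>y. \<phi> y $ 1) x]"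

type_synonym field = "(real^3, real^3) l2"

definition has_weak_curl :: "(real^3) set \<Rightarrow> field \<Rightarrow> field \<Rightarrow> bool" where
  "has_weak_curl D v w \<longleftrightarrow> v \<in> L2_on D \<and> w \<in> L2_on D \<and>
     (\<forall>\<phi>\<in>test_fields D.
        (LINT x:D|lebesgue. inner (rep_l2 v x) (curl \<phi> x)) =
        (LINT x:D|lebesgue. inner (rep_l2 w x) (\<phi> x)))"

definition weak_curl :: "(real^3) set \<Rightarrow> field \<Rightarrow> field" where
  "weak_curl D v = (THE w. has_weak_curl D v w)"

definition Hcurl :: "(real^3) set \<Rightarrow> field set" where
  "Hcurl D = {v. \<exists>w. has_weak_curl D v w}"

text \<open>A field in \<open>Hcurl D\<close> has no pointwise boundary values. Its tangential trace \<open>n \<times> v\<close> on the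
  boundary is, as usual, the functional given by Green's formula: since
  \<open>div (v \<times> w) = w \<bullet> curl v - v \<bullet> curl w\<close>, for regular fields and boundary the value below is the
  surface integral of \<open>(n \<times> v) \<bullet> w\<close>. Testing with all \<open>w \<in> Hcurl D\<close> requires no regularity of
  the boundary; on a Lipschitz domain, where smooth fields are dense in \<open>Hcurl D\<close>, it gives the same
  space \<open>H0curl D\<close> as testing with smooth \<open>w\<close>.\<close>

definition tangential_trace :: "(real^3) set \<Rightarrow> field \<Rightarrow> field \<Rightarrow> real" where
  "tangential_trace D v w = (LINT x:D|lebesgue.
     inner (rep_l2 (weak_curl D v) x) (rep_l2 w x) - inner (rep_l2 v x) (rep_l2 (weak_curl D w) x))"

definition H0curl :: "(real^3) set \<Rightarrow> field set" where
  "H0curl D = {v \<in> Hcurl D. \<forall>w\<in>Hcurl D. tangential_trace D v w = 0}"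

section \<open>The Maxwell operator and the coefficients of the equation\<close>

type_synonym em = "field \<times> field"

definition HH :: "(real^3) set \<Rightarrow> em set" where
  "HH D = L2_on D \<times> L2_on D"

definition inner_HH ::
    "(real^3) set \<Rightarrow> (real^3 \<Rightarrow> real) \<Rightarrow> (real^3 \<Rightarrow> real) \<Rightarrow> em \<Rightarrow> em \<Rightarrow> real" where
  "inner_HH D eps mu u v = (LINT x:D|lebesgue.
     eps x * inner (rep_l2 (fst u) x) (rep_l2 (fst v) x) +
     mu x * inner (rep_l2 (snd u) x) (rep_l2 (snd v) x))"

definition norm_HH ::
    "(real^3) set \<Rightarrow> (real^3 \<Rightarrow> real) \<Rightarrow> (real^3 \<Rightarrow> real) \<Rightarrow> em \<Rightarrow> real" where
  "norm_HH D eps mu u = sqrt (inner_HH D eps mu u u)"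

definition dom_maxwell :: "(real^3) set \<Rightarrow> em set" where
  "dom_maxwell D = H0curl D \<times> Hcurl D"

definition maxwell_op ::
    "(real^3) set \<Rightarrow> (real^3 \<Rightarrow> real) \<Rightarrow> (real^3 \<Rightarrow> real) \<Rightarrow> em \<Rightarrow> em" where
  "maxwell_op D eps mu u =
     (l2_class_on D (\<lambda>x. inverse (eps x) *\<^sub>R rep_l2 (weak_curl D (snd u)) x),
      l2_class_on D (\<lambda>x. - inverse (mu x) *\<^sub>R rep_l2 (weak_curl D (fst u)) x))"

definition norm_dom_maxwell ::
    "(real^3) set \<Rightarrow> (real^3 \<Rightarrow> real) \<Rightarrow> (real^3 \<Rightarrow> real) \<Rightarrow> em \<Rightarrow> real" where
  "norm_dom_maxwell D eps mu u =
     sqrt ((norm_HH D eps mu u)\<^sup>2 + (norm_HH D eps mu (maxwell_op D eps mu u))\<^sup>2)"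

definition material_coefficient :: "(real^3) set \<Rightarrow> real \<Rightarrow> (real^3 \<Rightarrow> real) \<Rightarrow> bool" where
  "material_coefficient D \<delta> eps \<longleftrightarrow>
     eps \<in> borel_measurable (lebesgue_on D) \<and>
     (\<exists>K. AE x in lebesgue_on D. \<bar>eps x\<bar> \<le> K) \<and>
     (AE x in lebesgue_on D. eps x \<ge> \<delta>)"

type_synonym current = "real \<Rightarrow> real^3 \<Rightarrow> real^3 \<Rightarrow> real^3 \<Rightarrow> real^3"
type_synonym noise_current = "real \<Rightarrow> real^3 \<Rightarrow> real^3"

definition admissible_current :: "(real^3) set \<Rightarrow> real \<Rightarrow> real \<Rightarrow> current \<Rightarrow> bool" where
  "admissible_current D T L J \<longleftrightarrow>
     continuous_on ({0..T} \<times> D \<times> UNIV \<times> UNIV) (\<lambda>(t, x, u, v). J t x u v) \<and>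
     (\<forall>t\<in>{0..T}. \<forall>x\<in>D. \<forall>u v. norm (J t x u v) \<le> L * (1 + norm u + norm v)) \<and>
     (\<forall>t\<in>{0..T}. \<forall>s\<in>{0..T}. \<forall>x\<in>D. \<forall>u1 v1 u2 v2.
        norm (J t x u1 v1 - J s x u2 v2) \<le> L * (\<bar>t - s\<bar> + norm (u1 - u2) + norm (v1 - v2)))"

definition admissible_noise_current :: "(real^3) set \<Rightarrow> real \<Rightarrow> noise_current \<Rightarrow> bool" where
  "admissible_noise_current D T J \<longleftrightarrow>
     continuous_on ({0..T} \<times> D) (\<lambda>(t, x). J t x) \<and>
     (\<exists>K. \<forall>t\<in>{0..T}. \<forall>x\<in>D. norm (J t x) \<le> K)"

definition drift ::
    "(real^3) set \<Rightarrow> (real^3 \<Rightarrow> real) \<Rightarrow> (real^3 \<Rightarrow> real) \<Rightarrow> current \<Rightarrow> current \<Rightarrow>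
     real \<Rightarrow> em \<Rightarrow> em" where
  "drift D eps mu Je Jm t u =
     (l2_class_on D (\<lambda>x. - inverse (eps x) *\<^sub>R Je t x (rep_l2 (fst u) x) (rep_l2 (snd u) x)),
      l2_class_on D (\<lambda>x. - inverse (mu x) *\<^sub>R Jm t x (rep_l2 (fst u) x) (rep_l2 (snd u) x)))"

text \<open>The pointwise formula makes sense for every \<open>v \<in> L2_on D\<close>, not only for
  \<open>v\<close> in the Cameron-Martin space. This is needed because increments of the Wiener process lie in
  \<open>L2_on D\<close> only.\<close>

definition diffusion ::
    "(real^3) set \<Rightarrow> (real^3 \<Rightarrow> real) \<Rightarrow> (real^3 \<Rightarrow> real) \<Rightarrow> noise_current \<Rightarrow> noise_current \<Rightarrow>
     real \<Rightarrow> (real^3, real) l2 \<Rightarrow> em" where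
  "diffusion D eps mu Jer Jmr t v =
     (l2_class_on D (\<lambda>x. - inverse (eps x) *\<^sub>R (rep_l2 v x *\<^sub>R Jer t x)),
      l2_class_on D (\<lambda>x. - inverse (mu x) *\<^sub>R (rep_l2 v x *\<^sub>R Jmr t x)))"

section \<open>Operators on Hilbert spaces given by a carrier and an inner product\<close>

definition linear_on :: "'a::real_vector set \<Rightarrow> ('a \<Rightarrow> 'b::real_vector) \<Rightarrow> bool" where
  "linear_on S f \<longleftrightarrow> (\<forall>x\<in>S. \<forall>y\<in>S. f (x + y) = f x + f y) \<and>
     (\<forall>r. \<forall>x\<in>S. f (r *\<^sub>R x) = r *\<^sub>R f x)"

definition orthonormal_basis_on ::
    "'a::real_vector set \<Rightarrow> ('a \<Rightarrow> 'a \<Rightarrow> real) \<Rightarrow> 'a set \<Rightarrow> bool" where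
  "orthonormal_basis_on S ip E \<longleftrightarrow> E \<subseteq> S \<and>
     (\<forall>e\<in>E. \<forall>f\<in>E. ip e f = (if e = f then 1 else 0)) \<and>
     (\<forall>x\<in>S. (\<forall>e\<in>E. ip x e = 0) \<longrightarrow> x = 0)"

text \<open>\<open>f \<in> HS(S, R)\<close>, where \<open>S\<close> carries the inner product \<open>ip\<close> and \<open>R\<close> the norm \<open>nrm\<close>. Neither the
  summability nor the norm depends on the choice of the basis.\<close>

definition hilbert_schmidt ::
    "'a::real_vector set \<Rightarrow> ('a \<Rightarrow> 'a \<Rightarrow> real) \<Rightarrow> 'b::real_vector set \<Rightarrow> ('b \<Rightarrow> real) \<Rightarrow>
     ('a \<Rightarrow> 'b) \<Rightarrow> bool" where
  "hilbert_schmidt S ip R nrm f \<longleftrightarrow> linear_on S f \<and> f ` S \<subseteq> R \<and>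
     (\<exists>K. \<forall>x\<in>S. nrm (f x) \<le> K * sqrt (ip x x)) \<and>
     (\<exists>E. orthonormal_basis_on S ip E \<and> (\<lambda>e. (nrm (f e))\<^sup>2) summable_on E)"

definition hs_norm ::
    "'a::real_vector set \<Rightarrow> ('a \<Rightarrow> 'a \<Rightarrow> real) \<Rightarrow> ('b \<Rightarrow> real) \<Rightarrow> ('a \<Rightarrow> 'b) \<Rightarrow> real" where
  "hs_norm S ip nrm f =
     sqrt (infsum (\<lambda>e. (nrm (f e))\<^sup>2) (SOME E. orthonormal_basis_on S ip E))"

definition symmetric_op_on :: "'a::real_inner set \<Rightarrow> ('a \<Rightarrow> 'a) \<Rightarrow> bool" where
  "symmetric_op_on S Q \<longleftrightarrow> linear_on S Q \<and> Q ` S \<subseteq> S \<and>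
     (\<exists>K. \<forall>x\<in>S. norm (Q x) \<le> K * norm x) \<and>
     (\<forall>x\<in>S. \<forall>y\<in>S. inner (Q x) y = inner x (Q y))"

definition covariance_op_on :: "'a::real_inner set \<Rightarrow> ('a \<Rightarrow> 'a) \<Rightarrow> bool" where
  "covariance_op_on S Q \<longleftrightarrow> symmetric_op_on S Q \<and>
     (\<forall>x\<in>S. x \<noteq> 0 \<longrightarrow> inner (Q x) x > 0) \<and>
     (\<exists>E. orthonormal_basis_on S inner E \<and> (\<lambda>e. inner (Q e) e) summable_on E)"

text \<open>The nonnegative square root. Its values are determined on \<open>S\<close> only, which is why this is not a
  definite description.\<close>

definition sqrt_op_on :: "'a::real_inner set \<Rightarrow> ('a \<Rightarrow> 'a) \<Rightarrow> 'a \<Rightarrow> 'a" where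
  "sqrt_op_on S Q = (SOME R. symmetric_op_on S R \<and> (\<forall>x\<in>S. inner (R x) x \<ge> 0) \<and>
     (\<forall>x\<in>S. R (R x) = Q x))"

definition cameron_martin :: "'a::real_inner set \<Rightarrow> ('a \<Rightarrow> 'a) \<Rightarrow> 'a set" where
  "cameron_martin S Q = sqrt_op_on S Q ` S"

definition inner_cm :: "'a::real_inner set \<Rightarrow> ('a \<Rightarrow> 'a) \<Rightarrow> 'a \<Rightarrow> 'a \<Rightarrow> real" where
  "inner_cm S Q x y =
     inner (inv_into S (sqrt_op_on S Q) x) (inv_into S (sqrt_op_on S Q) y)"

text \<open>The operator \<open>B\<close> as an element of \<open>HS(U\<^sub>0, D(M))\<close>, with \<open>U\<^sub>0 = Q\<^sup>1\<^sup>/\<^sup>2 L\<^sup>2(D)\<close>.\<close>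

definition HS_U0_DM ::
    "(real^3) set \<Rightarrow> (real^3 \<Rightarrow> real) \<Rightarrow> (real^3 \<Rightarrow> real) \<Rightarrow>
     ((real^3, real) l2 \<Rightarrow> (real^3, real) l2) \<Rightarrow> ((real^3, real) l2 \<Rightarrow> em) \<Rightarrow> bool" where
  "HS_U0_DM D eps mu Q B \<longleftrightarrow>
     hilbert_schmidt (cameron_martin (L2_on D) Q) (inner_cm (L2_on D) Q)
       (dom_maxwell D) (norm_dom_maxwell D eps mu) B"

definition norm_HS_U0_DM ::
    "(real^3) set \<Rightarrow> (real^3 \<Rightarrow> real) \<Rightarrow> (real^3 \<Rightarrow> real) \<Rightarrow>
     ((real^3, real) l2 \<Rightarrow> (real^3, real) l2) \<Rightarrow> ((real^3, real) l2 \<Rightarrow> em) \<Rightarrow> real" where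
  "norm_HS_U0_DM D eps mu Q B =
     hs_norm (cameron_martin (L2_on D) Q) (inner_cm (L2_on D) Q) (norm_dom_maxwell D eps mu) B"

section \<open>Wiener process and random variables\<close>

definition filtered_prob_space :: "'w measure \<Rightarrow> real \<Rightarrow> (real \<Rightarrow> 'w measure) \<Rightarrow> bool" where
  "filtered_prob_space P T Fil \<longleftrightarrow> prob_space P \<and>
     (\<forall>t\<in>{0..T}. subalgebra P (Fil t)) \<and>
     (\<forall>s t. 0 \<le> s \<and> s \<le> t \<and> t \<le> T \<longrightarrow> sets (Fil s) \<subseteq> sets (Fil t))"

text \<open>The law of an increment is the Gaussian measure \<open>N(0, (t - s) Q)\<close> on \<open>S\<close>: the increment tested
  with \<open>h\<close> is \<open>N(0, (t - s) \<langle>Q h, h\<rangle>)\<close>-distributed. As \<open>Q\<close> is positive definite, these variances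
  vanish only for \<open>h = 0\<close>.\<close>

definition q_wiener_process ::
    "'a::real_inner set \<Rightarrow> ('a \<Rightarrow> 'a) \<Rightarrow> 'w measure \<Rightarrow> real \<Rightarrow> (real \<Rightarrow> 'w measure) \<Rightarrow>
     (real \<Rightarrow> 'w \<Rightarrow> 'a) \<Rightarrow> bool" where
  "q_wiener_process S Q P T Fil W \<longleftrightarrow>
     (\<forall>t\<in>{0..T}. W t \<in> borel_measurable (Fil t) \<and> (\<forall>\<omega>\<in>space P. W t \<omega> \<in> S)) \<and>
     (AE \<omega> in P. W 0 \<omega> = 0) \<and>
     (AE \<omega> in P. continuous_on {0..T} (\<lambda>t. W t \<omega>)) \<and>
     (\<forall>s t. 0 \<le> s \<and> s < t \<and> t \<le> T \<longrightarrow>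
        prob_space.indep_set P (sets (Fil s))
          (sets (vimage_algebra (space P) (\<lambda>\<omega>. W t \<omega> - W s \<omega>) borel)) \<and>
        (\<forall>h\<in>S. h \<noteq> 0 \<longrightarrow>
           distributed P lborel (\<lambda>\<omega>. inner (W t \<omega> - W s \<omega>) h)
             (\<lambda>x. ennreal (normal_density 0 (sqrt ((t - s) * inner (Q h) h)) x))))"

definition moment :: "'w measure \<Rightarrow> real \<Rightarrow> ('a \<Rightarrow> real) \<Rightarrow> ('w \<Rightarrow> 'a) \<Rightarrow> ennreal" where
  "moment P p nrm X = (\<integral>\<^sup>+\<omega>. ennreal (nrm (X \<omega>) powr p) \<partial>P)"

definition Lp_norm :: "'w measure \<Rightarrow> real \<Rightarrow> ('a \<Rightarrow> real) \<Rightarrow> ('w \<Rightarrow> 'a) \<Rightarrow> real" where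
  "Lp_norm P p nrm X = enn2real (moment P p nrm X) powr (1 / p)"

section \<open>Stochastic Runge-Kutta methods\<close>

definition algebraically_stable :: "real^'s^'s \<Rightarrow> real^'s \<Rightarrow> bool" where
  "algebraically_stable A b \<longleftrightarrow> (\<forall>i. b $ i \<ge> 0) \<and>
     (\<forall>v. inner v ((\<chi> i j. b $ i * A $ i $ j + b $ j * A $ j $ i - b $ i * b $ j) *v v) \<ge> 0)"

definition coercivity_condition :: "real^'s^'s \<Rightarrow> bool" where
  "coercivity_condition A \<longleftrightarrow> invertible A \<and>
     (\<exists>K \<alpha>. (\<forall>i j. i \<noteq> j \<longrightarrow> K $ i $ j = 0) \<and> (\<forall>v. v \<noteq> 0 \<longrightarrow> inner v (K *v v) > 0) \<and> \<alpha> > 0 \<and>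
        (\<forall>v. inner v ((K ** matrix_inv A) *v v) \<ge> \<alpha> * inner v (K *v v)))"

text \<open>\<open>u n\<close> are the values at the grid points \<open>n T / N\<close> and \<open>U n i\<close> the stages; the equations hold
  almost surely. The space \<open>X\<close>, the operator \<open>M\<close> with domain \<open>DM\<close> and the coefficients \<open>F\<close>, \<open>B\<close> are
  parameters. The stages have to lie in \<open>DM\<close> for the method to be meaningful.\<close>

definition srk_solution ::
    "'w measure \<Rightarrow> (real \<Rightarrow> 'w measure) \<Rightarrow> 'h::real_normed_vector set \<Rightarrow> 'h set \<Rightarrow> ('h \<Rightarrow> 'h) \<Rightarrow>
     (real \<Rightarrow> 'h \<Rightarrow> 'h) \<Rightarrow> (real \<Rightarrow> 'u::real_normed_vector \<Rightarrow> 'h) \<Rightarrow> (real \<Rightarrow> 'w \<Rightarrow> 'u) \<Rightarrow>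
     real^'s^'s \<Rightarrow> real^'s \<Rightarrow> real^'s^'s \<Rightarrow> real^'s \<Rightarrow> real^'s \<Rightarrow>
     real \<Rightarrow> nat \<Rightarrow> ('w \<Rightarrow> 'h) \<Rightarrow> (nat \<Rightarrow> 'w \<Rightarrow> 'h) \<Rightarrow> (nat \<Rightarrow> 's \<Rightarrow> 'w \<Rightarrow> 'h) \<Rightarrow> bool" where
  "srk_solution P Fil X DM M F B W A b At bt c T N u0 u U \<longleftrightarrow>
     (let \<tau> = T / real N; t = (\<lambda>n. real n * \<tau>); dW = (\<lambda>n \<omega>. W (t (Suc n)) \<omega> - W (t n) \<omega>) in
       (\<forall>n\<le>N. u n \<in> borel_measurable (Fil (t n)) \<and> (\<forall>\<omega>\<in>space P. u n \<omega> \<in> X)) \<and>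
       (\<forall>n<N. \<forall>i. U n i \<in> borel_measurable P \<and> (\<forall>\<omega>\<in>space P. U n i \<omega> \<in> X)) \<and>
       (AE \<omega> in P. u 0 \<omega> = u0 \<omega>) \<and>
       (\<forall>n<N. AE \<omega> in P.
          (\<forall>i. U n i \<omega> \<in> DM \<and>
             U n i \<omega> = u n \<omega>
               + \<tau> *\<^sub>R (\<Sum>j\<in>UNIV. A $ i $ j *\<^sub>R (M (U n j \<omega>) + F (t n + c $ j * \<tau>) (U n j \<omega>)))
               + (\<Sum>j\<in>UNIV. At $ i $ j *\<^sub>R B (t n + c $ j * \<tau>) (dW n \<omega>))) \<and>
          u (Suc n) \<omega> = u n \<omega>
            + \<tau> *\<^sub>R (\<Sum>i\<in>UNIV. b $ i *\<^sub>R (M (U n i \<omega>) + F (t n + c $ i * \<tau>) (U n i \<omega>)))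
            + (\<Sum>i\<in>UNIV. bt $ i *\<^sub>R B (t n + c $ i * \<tau>) (dW n \<omega>))))"

end

theory Submission
  imports Defs
begin

text \<open>The boundary condition in \<open>H0curl\<close> is Green's formula, which makes the Maxwell operator \<open>M\<close>
  skew-adjoint. Multiplied by \<open>A\<^sup>-\<^sup>1\<close>, the stage equations without drift are then coercive by the condition
  on \<open>A\<close>, hence uniquely solvable, and for small \<open>\<tau>\<close> the Lipschitz drift is a contraction. The solution
  depends continuously on \<open>u\<^sup>n\<close> and the increment, which gives measurability.

  For the moments, let \<open>\<xi>\<close> be the noise added in a step and let \<open>\<zeta>\<close> bound all noise terms of the step in
  the norm of \<open>D(M)\<close>. Algebraic stability and skew-adjointness give
  \<open>\<parallel>u\<^sup>n\<^sup>+\<^sup>1\<parallel>\<^sup>2 \<le> \<parallel>u\<^sup>n + \<xi>\<parallel>\<^sup>2 + C \<tau> (1 + \<parallel>u\<^sup>n\<parallel> + \<zeta>)\<^sup>2\<close>. Raise this to the power \<open>p / 2\<close> and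
  expand \<open>\<parallel>u\<^sup>n + \<xi>\<parallel>\<^sup>p\<close> to second order: the linear term has mean zero, as the increment is independent of
  \<open>u\<^sup>n\<close>, and \<open>E \<zeta>\<^sup>p \<le> C \<tau>\<^sup>p\<^sup>/\<^sup>2\<close> by the Hilbert-Schmidt bound and Gaussian moments. That \<open>B dW\<close> lies in \<open>D(M)\<close> although \<open>dW\<close> lies in \<open>L\<^sup>2(D)\<close> only is seen by
  expanding \<open>M B dW\<close> in an orthonormal system contained in \<open>D(M)\<close>.\<close>

section \<open>Hilbert spaces given by a closed subspace and a coercive form\<close>

text \<open>Two norms are in play. The step inequality needs the factor exactly 1 in front of
  \<open>(nrm (u + \<xi>))\<^sup>2\<close>, because a fixed factor above 1 would be raised to the
  number of steps; this is available only for the weighted form \<open>ip\<close>, in which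
  \<open>M\<close> is skew. Contraction, continuity and measurability use the norm of the type,
  which is merely equivalent on the carrier. Hence a form, a carrier and a coercivity constant,
  instead of the inner product of a type.

  The theorem also forces an order of the constants: the step threshold and the growth constant must
  be fixed before the probability space, \<open>Q\<close> and the noise coefficients are. Stages and
  the one-step inequality are therefore treated for deterministic data, the noise entering only
  through a bound \<open>z\<close> of its size.

  Young's inequality at the scale \<open>sqrt \<tau>\<close> leaves the noise as
  \<open>\<tau> * \<tau> powr - (p / 2) * z powr p\<close>, of mean order \<open>\<tau>\<close>; the
  \<open>T / \<tau>\<close> steps then accumulate to a bound that depends on
  \<open>T\<close>.\<close>

locale hilbert_form =
  fixes ip :: "'h::banach \<Rightarrow> 'h \<Rightarrow> real" and X :: "'h set" and \<kappa> :: real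
  assumes bilinear: "bounded_bilinear ip"
    and sym: "ip x y = ip y x"
    and subspace_X: "subspace X" and closed_X: "closed X"
    and coercive: "x \<in> X \<Longrightarrow> \<kappa> * (norm x)\<^sup>2 \<le> ip x x"
    and kappa_pos: "\<kappa> > 0"
begin

sublocale ip: bounded_bilinear ip
  by (rule bilinear)

definition nrm :: "'h \<Rightarrow> real" where
  "nrm x = sqrt (ip x x)"

lemmas ip_simps = ip.add_left ip.add_right ip.diff_left ip.diff_right ip.minus_left ip.minus_right
  ip.scaleR_left ip.scaleR_right ip.zero_left ip.zero_right ip.sum_left ip.sum_right

lemmas X_intros = subspace_X[THEN subspace_add] subspace_X[THEN subspace_diff]
  subspace_X[THEN subspace_scale] subspace_X[THEN subspace_0] subspace_X[THEN subspace_neg]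
  subspace_X[THEN subspace_sum]

lemma ip_nonneg: "x \<in> X \<Longrightarrow> 0 \<le> ip x x"
  by (rule order_trans[OF _ coercive]) (use kappa_pos in auto)

lemma ip_self_eq_0: "x \<in> X \<Longrightarrow> ip x x = 0 \<longleftrightarrow> x = 0"
  using coercive[of x] kappa_pos by (auto simp: ip_simps mult_le_0_iff)

lemma ip_pos: "x \<in> X \<Longrightarrow> x \<noteq> 0 \<Longrightarrow> 0 < ip x x"
  using ip_nonneg[of x] ip_self_eq_0[of x] by linarith

lemma nrm_nonneg: "x \<in> X \<Longrightarrow> 0 \<le> nrm x"
  by (simp add: nrm_def ip_nonneg)

lemma nrm_square: "x \<in> X \<Longrightarrow> (nrm x)\<^sup>2 = ip x x"
  by (simp add: nrm_def ip_nonneg)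

lemma nrm_0 [simp]: "nrm 0 = 0"
  by (simp add: nrm_def ip_simps)

lemma nrm_scaleR: "nrm (r *\<^sub>R x) = \<bar>r\<bar> * nrm x"
  by (simp add: nrm_def ip_simps real_sqrt_mult flip: mult.assoc)

lemma Cauchy_Schwarz_square:
  assumes "x \<in> X" "y \<in> X"
  shows "(ip x y)\<^sup>2 \<le> ip x x * ip y y"
proof (cases "y = 0")
  case True
  then show ?thesis by (simp add: ip_simps)
next
  case False
  then have pos: "0 < ip y y" using assms ip_pos by blast
  have "0 \<le> ip (x - (ip x y / ip y y) *\<^sub>R y) (x - (ip x y / ip y y) *\<^sub>R y)"
    by (intro ip_nonneg X_intros assms)
  also have "\<dots> = ip x x - (ip x y)\<^sup>2 / ip y y"
    using pos by (simp add: ip_simps sym[of y x] power2_eq_square field_simps)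
  finally show ?thesis
    using pos by (simp add: field_simps)
qed

lemma Cauchy_Schwarz:
  assumes "x \<in> X" "y \<in> X"
  shows "\<bar>ip x y\<bar> \<le> nrm x * nrm y"
  using real_sqrt_le_mono[OF Cauchy_Schwarz_square[OF assms]] by (simp add: nrm_def real_sqrt_mult)

lemma nrm_triangle:
  assumes "x \<in> X" "y \<in> X"
  shows "nrm (x + y) \<le> nrm x + nrm y"
proof (rule power2_le_imp_le)
  have "(nrm (x + y))\<^sup>2 = (nrm x)\<^sup>2 + (nrm y)\<^sup>2 + 2 * ip x y"
    using assms by (simp add: nrm_square X_intros ip_simps sym[of y x])
  also have "\<dots> \<le> (nrm x + nrm y)\<^sup>2"
    using Cauchy_Schwarz[OF assms] by (simp add: power2_sum)
  finally show "(nrm (x + y))\<^sup>2 \<le> (nrm x + nrm y)\<^sup>2" .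
qed (use assms nrm_nonneg in auto)

lemma nrm_sum:
  assumes "\<And>i. i \<in> I \<Longrightarrow> f i \<in> X"
  shows "nrm (\<Sum>i\<in>I. f i) \<le> (\<Sum>i\<in>I. nrm (f i))"
  using assms
proof (induction I rule: infinite_finite_induct)
  case (insert i I)
  then have "nrm (f i + (\<Sum>i\<in>I. f i)) \<le> nrm (f i) + nrm (\<Sum>i\<in>I. f i)"
    by (intro nrm_triangle X_intros) auto
  with insert show ?case by force
qed auto

lemma norm_le_nrm: "x \<in> X \<Longrightarrow> norm x \<le> nrm x / sqrt \<kappa>"
  using real_sqrt_le_mono[OF coercive, of x] kappa_pos
  by (simp add: nrm_def real_sqrt_mult field_simps)

lemma nrm_le_norm: obtains K where "K > 0" "\<And>x. nrm x \<le> K * norm x"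
proof -
  obtain K where K: "K > 0" "\<And>x y. norm (ip x y) \<le> norm x * norm y * K"
    using ip.pos_bounded by blast
  have "nrm x \<le> sqrt K * norm x" for x
  proof -
    have "ip x x \<le> (norm x)\<^sup>2 * K"
      using K(2)[of x x] by (simp add: power2_eq_square)
    then have "sqrt (ip x x) \<le> sqrt ((norm x)\<^sup>2 * K)" by (rule real_sqrt_le_mono)
    then show ?thesis by (simp add: nrm_def real_sqrt_mult mult.commute)
  qed
  with K show ?thesis by (intro that[of "sqrt K"]) auto
qed

section \<open>Completeness of the carrier, orthogonal projection and the Riesz theorem\<close>

lemma tendsto_nrm: "(f \<longlongrightarrow> x) F \<Longrightarrow> ((\<lambda>a. nrm (f a)) \<longlongrightarrow> nrm x) F"
  unfolding nrm_def by (intro tendsto_intros ip.tendsto)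

lemma X_limit: "(\<And>n. f n \<in> X) \<Longrightarrow> f \<longlonglongrightarrow> x \<Longrightarrow> x \<in> X"
  using closed_X closed_sequentially by blast

text \<open>A bound by the smaller index alone is what minimising sequences and tails of orthogonal
  series provide; coercivity converts it to the norm of the type.\<close>

lemma Cauchy_from_ip:
  fixes f :: "nat \<Rightarrow> 'h"
  assumes f: "\<And>n. f n \<in> X" and r: "r \<longlonglongrightarrow> 0"
    and le: "\<And>m n. m \<le> n \<Longrightarrow> ip (f n - f m) (f n - f m) \<le> r m"
  shows "Cauchy f"
proof (rule metric_CauchyI)
  fix e :: real assume e: "e > 0"
  have "\<forall>\<^sub>F n in sequentially. r n < \<kappa> * e\<^sup>2"
    using e kappa_pos by (intro order_tendstoD[OF r]) auto
  then obtain N where N: "\<And>n. n \<ge> N \<Longrightarrow> r n < \<kappa> * e\<^sup>2"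
    by (auto simp: eventually_sequentially)
  have *: "dist (f m) (f n) < e" if "N \<le> m" "m \<le> n" for m n
  proof -
    have "\<kappa> * (norm (f n - f m))\<^sup>2 \<le> r m"
      using coercive[of "f n - f m"] le[OF \<open>m \<le> n\<close>] by (simp add: X_intros f)
    also have "\<dots> < \<kappa> * e\<^sup>2" using N that by blast
    finally have "(norm (f n - f m))\<^sup>2 < e\<^sup>2" using kappa_pos by simp
    then have "norm (f n - f m) < e" using e by (simp add: power2_less_imp_less)
    then show ?thesis by (simp add: dist_norm norm_minus_commute)
  qed
  show "\<exists>M. \<forall>m\<ge>M. \<forall>n\<ge>M. dist (f m) (f n) < e"
    by (rule exI[of _ N]) (metis * dist_commute nle_le)
qed

text \<open>The distance from \<open>x\<close> is minimised over \<open>V\<close>. A minimising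
  sequence is Cauchy by the parallelogram identity, and \<open>x - p\<close> is orthogonal to
  \<open>V\<close> because moving \<open>p\<close> along \<open>v\<close> cannot decrease the
  distance.\<close>

lemma projection:
  assumes V: "subspace V" "closed V" "V \<subseteq> X" and x: "x \<in> X"
  obtains p where "p \<in> V" "\<And>v. v \<in> V \<Longrightarrow> ip (x - p) v = 0"
proof -
  define q where "q v = ip (x - v) (x - v)" for v
  define d where "d = Inf (q ` V)"
  have q0: "0 \<le> q v" if "v \<in> V" for v
    unfolding q_def using that V x by (intro ip_nonneg X_intros) auto
  have bdd: "bdd_below (q ` V)" using q0 by (auto intro!: bdd_belowI[of _ 0])
  have ne: "q ` V \<noteq> {}" using V(1) subspace_0 by auto
  have d_le: "d \<le> q v" if "v \<in> V" for v
    unfolding d_def using bdd that by (intro cInf_lower) auto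
  have "\<exists>v\<in>V. q v < d + 1 / real (Suc n)" for n
  proof -
    have "Inf (q ` V) < d + 1 / real (Suc n)" by (simp add: d_def)
    then show ?thesis using cInf_lessD[OF ne] by blast
  qed
  then obtain f where f: "\<And>n. f n \<in> V" "\<And>n. q (f n) < d + 1 / real (Suc n)" by metis
  have fX: "f n \<in> X" for n using f V by auto
  \<comment> \<open>The midpoint lies in \<open>V\<close>, so its \<open>q\<close> is at least
    \<open>d\<close>; the parallelogram identity then leaves twice the two excesses
    \<open>1 / real (Suc n)\<close> and \<open>1 / real (Suc m)\<close>.\<close>
  have par: "ip (f n - f m) (f n - f m) \<le> 4 / real (Suc m)" if "m \<le> n" for m n
  proof -
    have "(1/2) *\<^sub>R (f n + f m) \<in> V" using f V(1) by (intro subspace_scale subspace_add) auto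
    then have "d \<le> q ((1/2) *\<^sub>R (f n + f m))" by (rule d_le)
    moreover have "ip (f n - f m) (f n - f m) = 2 * q (f n) + 2 * q (f m) - 4 * q ((1/2) *\<^sub>R (f n + f m))"
      unfolding q_def by (simp add: ip_simps sym[of "f m" x] sym[of "f n" x] sym[of "f m" "f n"] algebra_simps)
    moreover have "1 / real (Suc n) \<le> 1 / real (Suc m)"
      using that by (intro divide_left_mono) auto
    moreover have "4 / real (Suc m) = 4 * (1 / real (Suc m))" by simp
    ultimately show ?thesis using f(2)[of n] f(2)[of m] by linarith
  qed
  have lim: "(\<lambda>m. 1 / real (Suc m)) \<longlonglongrightarrow> 0"
    using LIMSEQ_inverse_real_of_nat by (simp add: inverse_eq_divide)
  have r: "(\<lambda>m. 4 / real (Suc m)) \<longlonglongrightarrow> 0"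
    using tendsto_mult_right_zero[OF lim, of 4] by simp
  have "Cauchy f" by (rule Cauchy_from_ip[OF fX r par])
  then obtain p where p: "f \<longlonglongrightarrow> p" by (auto simp: Cauchy_convergent_iff convergent_def)
  have pV: "p \<in> V" using V(2) f(1) p closed_sequentially by blast
  have "(\<lambda>n. q (f n)) \<longlonglongrightarrow> q p"
    unfolding q_def by (intro ip.tendsto tendsto_intros p)
  moreover have "(\<lambda>n. d + 1 / real (Suc n)) \<longlonglongrightarrow> d + 0"
    by (intro tendsto_intros lim)
  ultimately have qp: "q p \<le> d"
    using f(2) by (intro LIMSEQ_le[of "\<lambda>n. q (f n)" "q p" "\<lambda>n. d + 1 / real (Suc n)"]) (auto intro: less_imp_le)
  have "ip (x - p) v = 0" if v: "v \<in> V" for v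
  proof (cases "v = 0")
    case False
    then have pos: "0 < ip v v" using ip_pos v V by blast
    \<comment> \<open>The minimiser of the quadratic function \<open>q (p + t *\<^sub>R v)\<close>
      of \<open>t\<close>.\<close>
    define t where "t = ip (x - p) v / ip v v"
    have "p + t *\<^sub>R v \<in> V" using pV v V by (intro subspace_add subspace_scale) auto
    then have "q p \<le> q (p + t *\<^sub>R v)" using qp d_le by fastforce
    also have "q (p + t *\<^sub>R v) = q p - 2 * t * ip (x - p) v + t\<^sup>2 * ip v v"
      unfolding q_def by (simp add: ip_simps sym[of v x] sym[of v p] sym[of p x] algebra_simps power2_eq_square)
    also have "\<dots> = q p - (ip (x - p) v)\<^sup>2 / ip v v"
      using pos unfolding t_def by (simp add: field_simps power2_eq_square)
    finally have "(ip (x - p) v)\<^sup>2 \<le> 0" using pos by (simp add: field_simps)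
    then show ?thesis by simp
  qed (simp add: ip_simps)
  with pV show ?thesis by (rule that)
qed

text \<open>The kernel of \<open>f\<close> in \<open>X\<close> has codimension one: the part
  \<open>z\<close> of some \<open>x0\<close> that is orthogonal to the kernel spans the rest, since
  \<open>x - (f x / f z) *\<^sub>R z\<close> is always in the kernel.\<close>

lemma Riesz:
  assumes lin: "linear_on X f" and bd: "\<And>x. x \<in> X \<Longrightarrow> \<bar>f x\<bar> \<le> K * norm x"
  obtains a where "a \<in> X" "\<And>x. x \<in> X \<Longrightarrow> f x = ip x a"
proof (cases "\<forall>x\<in>X. f x = 0")
  case True
  then show ?thesis by (intro that[of 0]) (auto simp: ip_simps X_intros)
next
  case False
  then obtain x0 where x0: "x0 \<in> X" "f x0 \<noteq> 0" by blast
  have add: "f (x + y) = f x + f y" if "x \<in> X" "y \<in> X" for x y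
    using lin that by (auto simp: linear_on_def)
  have scale: "f (r *\<^sub>R x) = r * f x" if "x \<in> X" for r x
    using lin that by (auto simp: linear_on_def)
  have diff: "f (x - y) = f x - f y" if "x \<in> X" "y \<in> X" for x y
    using add[of x "(-1) *\<^sub>R y"] scale[of y "-1"] that by (simp add: X_intros)
  have f0: "f 0 = 0" using scale[of 0 0] by (simp add: X_intros)
  define V where "V = {x \<in> X. f x = 0}"
  have sV: "subspace V" unfolding subspace_def V_def
    using f0 by (auto simp: X_intros add scale)
  have cV: "closed V" unfolding closed_sequential_limits
  proof (intro allI impI, elim conjE)
    fix s l assume s: "\<forall>n. s n \<in> V" and l: "s \<longlonglongrightarrow> l"
    have lX: "l \<in> X" using s l X_limit by (auto simp: V_def)
    have "(\<lambda>n. K * norm (l - s n)) \<longlonglongrightarrow> K * norm (l - l)"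
      by (intro tendsto_intros l)
    moreover have "\<bar>f l\<bar> \<le> K * norm (l - s n)" for n
      using bd[of "l - s n"] s lX diff[of l "s n"] by (auto simp: V_def X_intros)
    ultimately have "\<bar>f l\<bar> \<le> 0"
      by (intro LIMSEQ_le_const[of "\<lambda>n. K * norm (l - s n)"]) auto
    with lX show "l \<in> V" by (simp add: V_def)
  qed
  obtain p where p: "p \<in> V" "\<And>v. v \<in> V \<Longrightarrow> ip (x0 - p) v = 0"
    using projection[OF sV cV _ x0(1)] by (auto simp: V_def)
  define z where "z = x0 - p"
  have pX: "p \<in> X" "f p = 0" using p by (auto simp: V_def)
  have z: "z \<in> X" "f z = f x0" using p x0 pX by (auto simp: z_def V_def X_intros diff)
  have zpos: "0 < ip z z" using z x0 f0 by (intro ip_pos) auto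
  show ?thesis
  proof (rule that[of "(f z / ip z z) *\<^sub>R z"])
    show "(f z / ip z z) *\<^sub>R z \<in> X" using z by (intro X_intros)
    fix x assume x: "x \<in> X"
    have "x - (f x / f z) *\<^sub>R z \<in> V"
      unfolding V_def using x z x0 by (auto simp: X_intros diff scale)
    from p(2)[OF this] have "ip z x = f x / f z * ip z z"
      by (simp add: z_def[symmetric] ip_simps)
    then show "f x = ip x ((f z / ip z z) *\<^sub>R z)"
      using zpos z x0 by (simp add: ip_simps sym[of x z])
  qed
qed

text \<open>Lax-Milgram for an unbounded operator: the range is closed by coercivity and closedness, and
  dense because the adjoint is injective.\<close>

lemma coercive_operator_surj:
  fixes Tm :: "'h \<Rightarrow> 'h"
  assumes DT: "subspace DT" "DT \<subseteq> X" and TX: "\<And>x. x \<in> DT \<Longrightarrow> Tm x \<in> X"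
    and lin: "linear_on DT Tm"
    and c: "c > 0" and coer: "\<And>x. x \<in> DT \<Longrightarrow> c * ip x x \<le> ip (Tm x) x"
    and clo: "\<And>f x y. (\<And>n. f n \<in> DT) \<Longrightarrow> f \<longlonglongrightarrow> x \<Longrightarrow> (\<lambda>n. Tm (f n)) \<longlonglongrightarrow> y \<Longrightarrow> x \<in> DT \<and> Tm x = y"
    and adj: "\<And>z. z \<in> X \<Longrightarrow> (\<And>x. x \<in> DT \<Longrightarrow> ip (Tm x) z = 0) \<Longrightarrow> z = 0"
    and y: "y \<in> X"
  obtains x where "x \<in> DT" "Tm x = y"
proof -
  have add: "Tm (x + y) = Tm x + Tm y" if "x \<in> DT" "y \<in> DT" for x y
    using lin that by (auto simp: linear_on_def)
  have scale: "Tm (r *\<^sub>R x) = r *\<^sub>R Tm x" if "x \<in> DT" for r x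
    using lin that by (auto simp: linear_on_def)
  have diff: "Tm (x - y) = Tm x - Tm y" if "x \<in> DT" "y \<in> DT" for x y
    using add[of x "(-1) *\<^sub>R y"] scale[of y "-1"] that DT(1) subspace_neg by fastforce
  have T0: "Tm 0 = 0" using scale[of 0 0] subspace_0[OF DT(1)] by simp
  have bound: "c * nrm x \<le> nrm (Tm x)" if x: "x \<in> DT" for x
  proof (cases "nrm x = 0")
    case False
    then have pos: "nrm x > 0" using nrm_nonneg x DT by force
    have xX: "x \<in> X" using x DT by auto
    have "c * (nrm x * nrm x) \<le> nrm (Tm x) * nrm x"
      using coer[OF x] Cauchy_Schwarz[OF TX[OF x] xX] nrm_square[OF xX]
      by (simp add: power2_eq_square)
    then show ?thesis using pos by simp
  qed (use nrm_nonneg TX x in auto)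
  define V where "V = Tm ` DT"
  have sV: "subspace V" unfolding subspace_def V_def
  proof (intro conjI ballI allI)
    show "0 \<in> Tm ` DT" using T0 subspace_0[OF DT(1)] by force
    show "x + y \<in> Tm ` DT" if "x \<in> Tm ` DT" "y \<in> Tm ` DT" for x y
      using that add subspace_add[OF DT(1)] by (metis (no_types, lifting) imageE imageI)
    show "r *\<^sub>R x \<in> Tm ` DT" if "x \<in> Tm ` DT" for r x
      using that scale subspace_scale[OF DT(1)] by (metis (no_types, lifting) imageE imageI)
  qed
  have VX: "V \<subseteq> X" using TX by (auto simp: V_def)
  have cV: "closed V" unfolding closed_sequential_limits
  proof (intro allI impI, elim conjE)
    fix s l assume s: "\<forall>n. s n \<in> V" and l: "s \<longlonglongrightarrow> l"
    then obtain f where f: "\<And>n. f n \<in> DT" "\<And>n. Tm (f n) = s n" unfolding V_def image_iff by metis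
    obtain K where K: "K > 0" "\<And>x. nrm x \<le> K * norm x" using nrm_le_norm by blast
    have "Cauchy f"
    proof (rule metric_CauchyI)
      fix e :: real assume e: "e > 0"
      \<comment> \<open>Chosen so that \<open>c * nrm x \<le> K * norm (Tm x)\<close>, which
        combines coercivity with the comparison of the two norms, turns a distance of images below
        \<open>e'\<close> into a distance of preimages below \<open>e\<close>.\<close>
      define e' where "e' = sqrt \<kappa> * c * e / K"
      have "e' > 0" using e c K kappa_pos by (simp add: e'_def)
      then obtain N where N: "\<And>m n. m \<ge> N \<Longrightarrow> n \<ge> N \<Longrightarrow> dist (s m) (s n) < e'"
        using LIMSEQ_imp_Cauchy[OF l] metric_CauchyD by blast
      have "dist (f m) (f n) < e" if "m \<ge> N" "n \<ge> N" for m n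
      proof -
        have fd: "f m - f n \<in> DT" using f DT subspace_diff by blast
        have "c * nrm (f m - f n) \<le> K * norm (s m - s n)"
          using bound[OF fd] K(2)[of "s m - s n"] f by (simp add: diff)
        also have "\<dots> < K * e'" using N[OF that] K(1) by (simp add: dist_norm)
        finally have "c * nrm (f m - f n) < sqrt \<kappa> * c * e" using K(1) by (simp add: e'_def)
        then have "nrm (f m - f n) < sqrt \<kappa> * e" using c by (simp add: field_simps)
        then have "nrm (f m - f n) / sqrt \<kappa> < e" using kappa_pos by (simp add: field_simps)
        then show ?thesis using norm_le_nrm[of "f m - f n"] fd DT by (auto simp: dist_norm)
      qed
      then show "\<exists>M. \<forall>m\<ge>M. \<forall>n\<ge>M. dist (f m) (f n) < e" by blast
    qed
    then obtain x where "f \<longlonglongrightarrow> x" by (auto simp: Cauchy_convergent_iff convergent_def)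
    from clo[OF f(1) this, of l] l f(2) show "l \<in> V" by (auto simp: V_def)
  qed
  obtain p where p: "p \<in> V" "\<And>v. v \<in> V \<Longrightarrow> ip (y - p) v = 0"
    using projection[OF sV cV VX y] by blast
  have "y - p = 0"
  proof (rule adj)
    show "y - p \<in> X" using y p VX by (intro X_intros) auto
    show "ip (Tm x) (y - p) = 0" if "x \<in> DT" for x
      using p(2)[of "Tm x"] that sym[of "Tm x" "y - p"] by (auto simp: V_def)
  qed
  then show ?thesis using p(1) that by (auto simp: V_def)
qed

subsection \<open>Orthonormal sequences\<close>

text \<open>Zero entries are allowed, so that finite-dimensional spaces and linearly dependent systems need
  no special treatment.\<close>

definition onseq :: "(nat \<Rightarrow> 'h) \<Rightarrow> bool" where
  "onseq g \<longleftrightarrow> (\<forall>k. g k \<in> X) \<and> (\<forall>i j. i \<noteq> j \<longrightarrow> ip (g i) (g j) = 0) \<and>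
     (\<forall>k. g k = 0 \<or> ip (g k) (g k) = 1) \<and> (\<forall>x\<in>X. (\<forall>k. ip x (g k) = 0) \<longrightarrow> x = 0)"

lemma onseq_X: "onseq g \<Longrightarrow> g k \<in> X"
  by (simp add: onseq_def)

lemma onseq_partial_sum:
  assumes "onseq g" "finite A"
  shows "ip (\<Sum>k\<in>A. c k *\<^sub>R g k) (g j) = (if j \<in> A then c j * ip (g j) (g j) else 0)"
proof -
  have "ip (\<Sum>k\<in>A. c k *\<^sub>R g k) (g j) = (\<Sum>k\<in>A. if k = j then c j * ip (g j) (g j) else 0)"
    using assms unfolding ip_simps by (intro sum.cong) (auto simp: onseq_def)
  then show ?thesis using assms(2) by simp
qed

text \<open>Where \<open>g\<close> is zero the left side cannot see the coefficient, hence the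
  condition on \<open>c\<close>.\<close>

lemma onseq_partial_square:
  assumes g: "onseq g" and A: "finite A" and c: "\<And>k. g k = 0 \<Longrightarrow> c k = 0"
  shows "ip (\<Sum>k\<in>A. c k *\<^sub>R g k) (\<Sum>k\<in>A. c k *\<^sub>R g k) = (\<Sum>k\<in>A. (c k)\<^sup>2)"
proof -
  have "ip (\<Sum>k\<in>A. c k *\<^sub>R g k) (\<Sum>k\<in>A. c k *\<^sub>R g k)
      = (\<Sum>j\<in>A. c j * ip (\<Sum>k\<in>A. c k *\<^sub>R g k) (g j))"
    unfolding ip.sum_right ip.scaleR_right by simp
  also have "\<dots> = (\<Sum>j\<in>A. (c j)\<^sup>2)"
    unfolding onseq_partial_sum[OF g A]
  proof (intro sum.cong refl)
    fix j assume "j \<in> A"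
    have "g j = 0 \<or> ip (g j) (g j) = 1" using g by (simp add: onseq_def)
    then show "c j * (if j \<in> A then c j * ip (g j) (g j) else 0) = (c j)\<^sup>2"
      using \<open>j \<in> A\<close> c[of j] by (auto simp: power2_eq_square)
  qed
  finally show ?thesis .
qed

text \<open>Riesz-Fischer: distances of partial sums are blocks of the square sum, bounded by its
  tail.\<close>

lemma onseq_series:
  assumes g: "onseq g" and c: "\<And>k. g k = 0 \<Longrightarrow> c k = 0" and s: "summable (\<lambda>k. (c k)\<^sup>2)"
  obtains z where "z \<in> X" "(\<lambda>n. \<Sum>k<n. c k *\<^sub>R g k) \<longlonglongrightarrow> z" "\<And>k. ip z (g k) = c k"
proof -
  define P where "P n = (\<Sum>k<n. c k *\<^sub>R g k)" for n
  have PX: "P n \<in> X" for n unfolding P_def using g by (intro X_intros) (auto simp: onseq_def)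
  define r where "r n = (\<Sum>k. (c k)\<^sup>2) - (\<Sum>k<n. (c k)\<^sup>2)" for n
  have "r \<longlonglongrightarrow> (\<Sum>k. (c k)\<^sup>2) - (\<Sum>k. (c k)\<^sup>2)"
    unfolding r_def by (intro tendsto_intros summable_LIMSEQ s)
  then have r: "r \<longlonglongrightarrow> 0" by simp
  have "ip (P n - P m) (P n - P m) \<le> r m" if "m \<le> n" for m n
  proof -
    have "P n - P m = (\<Sum>k\<in>{m..<n}. c k *\<^sub>R g k)"
      using that unfolding P_def by (simp add: sum_diff_nat_ivl lessThan_atLeast0)
    then have "ip (P n - P m) (P n - P m) = (\<Sum>k\<in>{m..<n}. (c k)\<^sup>2)"
      using onseq_partial_square[OF g _ c] by simp
    also have "\<dots> = (\<Sum>k<n. (c k)\<^sup>2) - (\<Sum>k<m. (c k)\<^sup>2)"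
      using that by (simp add: sum_diff_nat_ivl lessThan_atLeast0)
    also have "\<dots> \<le> r m" unfolding r_def using sum_le_suminf[OF s, of "{..<n}"] by simp
    finally show ?thesis .
  qed
  from Cauchy_from_ip[OF PX r this] obtain z where z: "P \<longlonglongrightarrow> z"
    by (auto simp: Cauchy_convergent_iff convergent_def)
  have "ip z (g k) = c k" for k
  proof (rule LIMSEQ_unique)
    show "(\<lambda>n. ip (P n) (g k)) \<longlonglongrightarrow> ip z (g k)" by (intro ip.tendsto z tendsto_const)
    have "ip (P n) (g k) = c k" if "n > k" for n
      using g c[of k] that unfolding P_def onseq_partial_sum[OF g finite_lessThan]
      by (cases "g k = 0") (auto simp: onseq_def ip_simps)
    then show "(\<lambda>n. ip (P n) (g k)) \<longlonglongrightarrow> c k"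
      by (intro tendsto_eventually) (auto simp: eventually_sequentially intro!: exI[of _ "Suc k"])
  qed
  moreover have "(\<lambda>n. \<Sum>k<n. c k *\<^sub>R g k) \<longlonglongrightarrow> z" using z by (simp add: P_def[abs_def])
  ultimately show ?thesis using X_limit[OF PX z] by (intro that[of z])
qed

text \<open>Bessel's inequality makes the coefficients square summable, so their series has a sum
  \<open>z\<close>; as \<open>x - z\<close> has no coefficients left, totality gives
  \<open>z = x\<close>. The second claim follows by continuity of \<open>ip\<close>.\<close>

lemma onseq_expand:
  assumes g: "onseq g" and x: "x \<in> X"
  shows "(\<lambda>n. \<Sum>k<n. ip x (g k) *\<^sub>R g k) \<longlonglongrightarrow> x" (is ?lim)
    and "(\<lambda>k. ip x (g k) * ip y (g k)) sums ip x y" (is ?sums)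
proof -
  have c0: "ip x (g k) = 0" if "g k = 0" for k using that by (simp add: ip_simps)
  have "summable (\<lambda>k. (ip x (g k))\<^sup>2)"
  proof (rule summableI_nonneg_bounded)
    fix n
    define P where "P = (\<Sum>k<n. ip x (g k) *\<^sub>R g k)"
    have PP: "ip P P = (\<Sum>k<n. (ip x (g k))\<^sup>2)" unfolding P_def
      by (rule onseq_partial_square[OF g _ c0]) auto
    have xP: "ip x P = (\<Sum>k<n. (ip x (g k))\<^sup>2)" unfolding P_def by (simp add: ip_simps power2_eq_square)
    have "0 \<le> ip (x - P) (x - P)"
      using x g unfolding P_def by (intro ip_nonneg X_intros) (auto simp: onseq_def)
    then show "(\<Sum>k<n. (ip x (g k))\<^sup>2) \<le> ip x x"
      by (simp add: ip_simps sym[of P x] PP xP)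
  qed simp
  then obtain z where z: "z \<in> X" "(\<lambda>n. \<Sum>k<n. ip x (g k) *\<^sub>R g k) \<longlonglongrightarrow> z" "\<And>k. ip z (g k) = ip x (g k)"
    using onseq_series[OF g c0, of "\<lambda>k. k"] by blast
  have "x - z \<in> X" "\<forall>k. ip (x - z) (g k) = 0" using z x by (auto simp: ip_simps X_intros)
  then have "x - z = 0" using g unfolding onseq_def by blast
  then have "z = x" by simp
  with z(2) show L: ?lim by (simp only:)
  have "(\<lambda>n. ip (\<Sum>k<n. ip x (g k) *\<^sub>R g k) y) \<longlonglongrightarrow> ip x y"
    by (intro ip.tendsto L tendsto_const)
  moreover have "ip (\<Sum>k<n. ip x (g k) *\<^sub>R g k) y = (\<Sum>k<n. ip x (g k) * ip y (g k))" for n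
    unfolding ip.sum_left ip.scaleR_left by (intro sum.cong refl) (simp add: sym[of y])
  ultimately show ?sums unfolding sums_def by simp
qed

lemma Parseval:
  assumes "onseq g" "x \<in> X"
  shows "(\<lambda>k. (ip x (g k))\<^sup>2) sums ip x x"
  using onseq_expand(2)[OF assms, of x] by (simp add: power2_eq_square)

lemma Parseval_ennreal:
  assumes "onseq g" "x \<in> X"
  shows "(\<Sum>k. ennreal ((ip x (g k))\<^sup>2)) = ennreal (ip x x)"
  using Parseval[OF assms] by (intro suminf_ennreal_eq) auto

end

text \<open>For a vector that depends on its predecessors \<open>h\<close> is zero, and
  \<open>inverse 0 = 0\<close> makes the entry zero, which \<open>onseq\<close> admits.\<close>

fun gram_schmidt :: "('h::banach \<Rightarrow> 'h \<Rightarrow> real) \<Rightarrow> (nat \<Rightarrow> 'h) \<Rightarrow> nat \<Rightarrow> 'h" where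
  "gram_schmidt ip d n = (let h = d n - (\<Sum>k<n. ip (d n) (gram_schmidt ip d k) *\<^sub>R gram_schmidt ip d k)
     in inverse (sqrt (ip h h)) *\<^sub>R h)"

declare gram_schmidt.simps [simp del]

context hilbert_form begin

text \<open>Only finite combinations of the \<open>d n\<close> occur, so the system stays in
  \<open>V\<close> even if \<open>V\<close> is a mere dense domain. That is how systems inside the
  domain of \<open>M\<close> arise later.\<close>

lemma onseq_exists_dense:
  fixes d :: "nat \<Rightarrow> 'h"
  assumes V: "subspace V" "V \<subseteq> X" and d: "\<And>n. d n \<in> V"
    and dense: "\<And>x. x \<in> X \<Longrightarrow> (\<And>n. ip x (d n) = 0) \<Longrightarrow> x = 0"
  obtains g where "onseq g" "\<And>k. g k \<in> V"
proof
  let ?g = "gram_schmidt ip d"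
  define h where "h n = d n - (\<Sum>k<n. ip (d n) (?g k) *\<^sub>R ?g k)" for n
  have g: "?g n = inverse (nrm (h n)) *\<^sub>R h n" for n
    by (subst gram_schmidt.simps) (simp add: h_def nrm_def Let_def)
  show gV: "?g n \<in> V" for n
  proof (induction n rule: less_induct)
    case (less n)
    then have "h n \<in> V" unfolding h_def
      by (intro subspace_diff subspace_sum subspace_scale V d) auto
    then show ?case unfolding g by (intro subspace_scale V)
  qed
  have gX: "?g n \<in> X" for n using gV V by auto
  have hX: "h n \<in> X" for n unfolding h_def using d V gX by (intro X_intros) auto
  have unit: "?g n = 0 \<or> ip (?g n) (?g n) = 1" for n
  proof (cases "h n = 0")
    case False
    then have "ip (h n) (h n) > 0" using ip_pos hX by blast
    then have "ip (?g n) (?g n) = 1"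
      unfolding g by (simp add: ip_simps nrm_def field_simps flip: power2_eq_square)
    then show ?thesis ..
  qed (simp add: g)
  have orth': "ip (?g n) (?g j) = 0" if "j < n" for n j
    using that
  proof (induction n arbitrary: j rule: less_induct)
    case (less n)
    have "ip (h n) (?g j) = ip (d n) (?g j) - (\<Sum>k<n. ip (d n) (?g k) * ip (?g k) (?g j))"
      unfolding h_def by (simp add: ip_simps)
    also have "(\<Sum>k<n. ip (d n) (?g k) * ip (?g k) (?g j))
        = (\<Sum>k<n. if k = j then ip (d n) (?g j) * ip (?g j) (?g j) else 0)"
    proof (intro sum.cong refl)
      fix k assume "k \<in> {..<n}"
      then show "ip (d n) (?g k) * ip (?g k) (?g j)
          = (if k = j then ip (d n) (?g j) * ip (?g j) (?g j) else 0)"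
        using less.IH[of k j] less.IH[of j k] less.prems sym[of "?g k" "?g j"]
        by (cases k j rule: linorder_cases) auto
    qed
    also have "\<dots> = ip (d n) (?g j) * ip (?g j) (?g j)" using less.prems by simp
    finally have "ip (h n) (?g j) = ip (d n) (?g j) * (1 - ip (?g j) (?g j))"
      by (simp add: algebra_simps)
    also have "\<dots> = 0" using unit[of j] by (auto simp: ip_simps)
    finally show ?case by (subst g) (simp add: ip_simps)
  qed
  have orth: "ip (?g i) (?g j) = 0" if "i \<noteq> j" for i j
    using orth'[of i j] orth'[of j i] that sym[of "?g i" "?g j"] by (cases i j rule: linorder_cases) auto
  \<comment> \<open>Each \<open>d n\<close> is a combination of the entries of \<open>?g\<close> up
    to index \<open>n\<close>, so a vector orthogonal to the system is orthogonal to all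
    \<open>d n\<close>.\<close>
  have total: "x = 0" if x: "x \<in> X" and 0: "\<forall>k. ip x (?g k) = 0" for x
  proof (rule dense[OF x])
    fix n
    have "h n = nrm (h n) *\<^sub>R ?g n"
    proof (cases "h n = 0")
      case False
      then have "nrm (h n) \<noteq> 0" using ip_pos[OF hX[of n]] by (simp add: nrm_def)
      then show ?thesis by (simp add: g)
    qed simp
    then have "d n = nrm (h n) *\<^sub>R ?g n + (\<Sum>k<n. ip (d n) (?g k) *\<^sub>R ?g k)"
      unfolding h_def by (simp add: algebra_simps)
    then have "ip x (d n) = ip x (nrm (h n) *\<^sub>R ?g n + (\<Sum>k<n. ip (d n) (?g k) *\<^sub>R ?g k))" by simp
    also have "\<dots> = 0" using 0 by (simp add: ip_simps)
    finally show "ip x (d n) = 0" .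
  qed
  show "onseq ?g" unfolding onseq_def using gX orth unit total by blast
qed

end

text \<open>Tonelli's theorem for the counting measure.\<close>

lemma suminf_ennreal_swap:
  fixes f :: "nat \<Rightarrow> nat \<Rightarrow> ennreal"
  shows "(\<Sum>i. \<Sum>j. f i j) = (\<Sum>j. \<Sum>i. f i j)"
  using nn_integral_suminf[of "\<lambda>j i. f i j" "count_space UNIV"]
  by (simp add: nn_integral_count_space_nat)

locale separable_hilbert_form = hilbert_form ip X \<kappa>
  for ip :: "'h::{banach,second_countable_topology} \<Rightarrow> 'h \<Rightarrow> real" and X \<kappa>
begin

text \<open>A countable dense subset of \<open>V\<close> supplies the sequence; by continuity of
  \<open>ip\<close> it is as total as \<open>V\<close> itself.\<close>

lemma onseq_exists:
  assumes V: "subspace V" "V \<subseteq> X" and dense: "\<And>x. x \<in> X \<Longrightarrow> (\<And>v. v \<in> V \<Longrightarrow> ip x v = 0) \<Longrightarrow> x = 0"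
  obtains g where "onseq g" "\<And>k. g k \<in> V"
proof -
  obtain C where C: "countable C" "C \<subseteq> V" "V \<subseteq> closure C" using separable by blast
  have "C \<noteq> {}" using C V(1) subspace_0 by fastforce
  define d where "d = from_nat_into C"
  have d: "range d = C" unfolding d_def by (rule range_from_nat_into[OF \<open>C \<noteq> {}\<close> C(1)])
  show ?thesis
  proof (rule onseq_exists_dense[OF V, of d])
    show "d n \<in> V" for n using d C by auto
    show "x = 0" if x: "x \<in> X" "\<And>n. ip x (d n) = 0" for x
    proof (rule dense[OF x(1)])
      fix v assume "v \<in> V"
      then obtain s where s: "\<And>n. s n \<in> C" "s \<longlonglongrightarrow> v" using C closure_sequential by blast
      have "(\<lambda>n. ip x (s n)) \<longlonglongrightarrow> ip x v" by (intro ip.tendsto tendsto_const s)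
      moreover have "ip x (s n) = 0" for n using s(1)[of n] d x(2) by auto
      ultimately show "ip x v = 0" using LIMSEQ_unique[OF _ tendsto_const] by fastforce
    qed
  qed (use that in auto)
qed

lemma onseq_exists': obtains g where "onseq g"
  using onseq_exists[OF subspace_X order_refl] ip_self_eq_0 by metis

text \<open>Balls of a fixed radius around the basis elements are disjoint, and a second countable
  space has only countably many disjoint nonempty open sets.\<close>

lemma orthonormal_basis_countable:
  assumes E: "orthonormal_basis_on X ip E"
  shows "countable E"
proof -
  obtain K where K: "K > 0" "\<And>x y. norm (ip x y) \<le> norm x * norm y * K"
    using ip.pos_bounded by blast
  \<comment> \<open>Distinct elements satisfy \<open>ip (e - f) (e - f) = 2\<close>, so boundedness
    of \<open>ip\<close> keeps them at least \<open>sqrt (1 / K) = 2 * r\<close> apart.\<close>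
  define r where "r = sqrt (1 / K) / 2"
  have r: "r > 0" using K by (simp add: r_def)
  have far: "2 * r \<le> norm (e - f)" if "e \<in> E" "f \<in> E" "e \<noteq> f" for e f
  proof -
    have "ip (e - f) (e - f) = 2"
      using that E sym[of f e] unfolding orthonormal_basis_on_def by (simp add: ip_simps)
    then have "2 \<le> (norm (e - f))\<^sup>2 * K" using K(2)[of "e - f" "e - f"] by (simp add: power2_eq_square)
    then have "1 / K \<le> (norm (e - f))\<^sup>2" using K(1) by (simp add: field_simps)
    then have "sqrt (1 / K) \<le> sqrt ((norm (e - f))\<^sup>2)" by (rule real_sqrt_le_mono)
    then have "sqrt (1 / K) \<le> norm (e - f)" unfolding real_sqrt_abs abs_norm_cancel .
    then show ?thesis by (simp add: r_def)
  qed
  have "pairwise disjnt ((\<lambda>e. ball e r) ` E)"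
  proof (intro pairwise_imageI)
    fix e f assume ef: "e \<in> E" "f \<in> E" "e \<noteq> f"
    show "disjnt (ball e r) (ball f r)"
      unfolding disjnt_iff
    proof (intro allI notI, elim conjE)
      fix x assume "x \<in> ball e r" "x \<in> ball f r"
      then show False using dist_triangle[of e f x] far[OF ef]
        by (auto simp: dist_commute dist_norm)
    qed
  qed
  then have "countable ((\<lambda>e. ball e r) ` E)"
    by (rule countable_disjoint_open_subsets[rotated]) auto
  moreover have "inj_on (\<lambda>e. ball e r) E"
  proof (rule inj_onI, rule ccontr)
    fix e f assume ef: "e \<in> E" "f \<in> E" "ball e r = ball f r" "e \<noteq> f"
    then have "e \<in> ball f r" using r by auto
    then show False using far[of e f] ef r by (auto simp: dist_norm norm_minus_commute)
  qed
  ultimately show ?thesis using countable_image_inj_on by blast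
qed

text \<open>Translates the unordered sums over arbitrary bases, by which Hilbert-Schmidt operators
  and traces are defined, to series over an \<open>onseq\<close>. Indices outside the enumeration
  get the entry zero, which \<open>\<phi> 0 = 0\<close> makes harmless.\<close>

lemma orthonormal_basis_onseq:
  assumes E: "orthonormal_basis_on X ip E"
  obtains g where "onseq g"
    "\<And>\<phi> :: 'h \<Rightarrow> real. \<phi> 0 = 0 \<Longrightarrow> (\<And>x. \<phi> x \<ge> 0) \<Longrightarrow>
       \<phi> summable_on E \<longleftrightarrow> summable (\<lambda>k. \<phi> (g k))"
    "\<And>\<phi> :: 'h \<Rightarrow> real. \<phi> 0 = 0 \<Longrightarrow> (\<And>x. \<phi> x \<ge> 0) \<Longrightarrow> \<phi> summable_on E \<Longrightarrow>
       infsum \<phi> E = (\<Sum>k. \<phi> (g k))"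
proof -
  have cE: "countable E" using orthonormal_basis_countable[OF E] .
  define I where "I = to_nat_on E ` E"
  define g where "g k = (if k \<in> I then from_nat_into E k else 0)" for k
  have bij: "bij_betw (to_nat_on E) E I"
    unfolding I_def by (intro inj_on_imp_bij_betw inj_on_to_nat_on cE)
  have gE: "g (to_nat_on E e) = e" if "e \<in> E" for e using that cE by (simp add: g_def I_def)
  have gI: "g k \<in> E" if "k \<in> I" for k using that gE by (auto simp: I_def)
  have ginj: "i = j" if "i \<in> I" "j \<in> I" "g i = g j" for i j
    using that gE by (auto simp: I_def)
  have ip: "ip e f = (if e = f then 1 else 0)" if "e \<in> E" "f \<in> E" for e f
    using that E by (auto simp: orthonormal_basis_on_def)
  have "onseq g" unfolding onseq_def
  proof (intro conjI allI ballI impI)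
    show "g k \<in> X" for k using gI E by (cases "k \<in> I") (auto simp: g_def orthonormal_basis_on_def X_intros)
    show "ip (g i) (g j) = 0" if "i \<noteq> j" for i j
    proof (cases "i \<in> I \<and> j \<in> I")
      case True then show ?thesis using ip gI ginj that by metis
    qed (auto simp: g_def ip_simps)
    show "g k = 0 \<or> ip (g k) (g k) = 1" for k
      using ip gI by (cases "k \<in> I") (auto simp: g_def)
    show "x = 0" if "x \<in> X" "\<forall>k. ip x (g k) = 0" for x
      using E that gE unfolding orthonormal_basis_on_def by metis
  qed
  have hs: "(\<phi> has_sum a) E \<longleftrightarrow> ((\<lambda>k. \<phi> (g k)) has_sum a) UNIV" if "\<phi> 0 = 0" for \<phi> :: "'h \<Rightarrow> real" and a
  proof -
    have "(\<phi> has_sum a) E \<longleftrightarrow> ((\<lambda>e. \<phi> (g (to_nat_on E e))) has_sum a) E"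
      by (intro has_sum_cong) (simp add: gE)
    also have "\<dots> \<longleftrightarrow> ((\<lambda>k. \<phi> (g k)) has_sum a) I"
      by (rule has_sum_reindex_bij_betw[OF bij, of "\<lambda>k. \<phi> (g k)"])
    also have "\<dots> \<longleftrightarrow> ((\<lambda>k. \<phi> (g k)) has_sum a) UNIV"
      using that by (intro has_sum_cong_neutral) (auto simp: g_def)
    finally show ?thesis .
  qed
  show ?thesis
  proof (rule that[OF \<open>onseq g\<close>])
    fix \<phi> :: "'h \<Rightarrow> real" assume \<phi>: "\<phi> 0 = 0" "\<And>x. \<phi> x \<ge> 0"
    show s: "\<phi> summable_on E \<longleftrightarrow> summable (\<lambda>k. \<phi> (g k))"
      using hs[of \<phi>] \<phi> summable_on_UNIV_nonneg_real_iff[of "\<lambda>k. \<phi> (g k)"]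
      by (simp add: summable_on_def)
    assume "\<phi> summable_on E"
    then have "(\<phi> has_sum infsum \<phi> E) E" by simp
    then have "(\<lambda>k. \<phi> (g k)) sums infsum \<phi> E" using hs[of \<phi>] \<phi>(1) has_sum_imp_sums by blast
    then show "infsum \<phi> E = (\<Sum>k. \<phi> (g k))" by (simp add: sums_iff)
  qed
qed

end

text \<open>\<open>\<parallel>f\<parallel>\<^sub>H\<^sub>S = \<parallel>f\<^sup>*\<parallel>\<^sub>H\<^sub>S\<close>, with \<open>a j = f\<^sup>* (h j)\<close>.\<close>

lemma hilbert_schmidt_adjoint:
  assumes "hilbert_form ip1 X1 \<kappa>1" "hilbert_form ip2 X2 \<kappa>2"
    and g: "hilbert_form.onseq ip1 X1 g" and h: "hilbert_form.onseq ip2 X2 h"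
    and f: "\<And>x. x \<in> X1 \<Longrightarrow> f x \<in> X2"
    and a: "\<And>j. a j \<in> X1" "\<And>x j. x \<in> X1 \<Longrightarrow> ip2 (f x) (h j) = ip1 x (a j)"
  shows "(\<Sum>k. ennreal (ip2 (f (g k)) (f (g k)))) = (\<Sum>j. ennreal (ip1 (a j) (a j)))"
proof -
  interpret A: hilbert_form ip1 X1 \<kappa>1 by fact
  interpret B: hilbert_form ip2 X2 \<kappa>2 by fact
  have gX: "g k \<in> X1" for k using A.onseq_X[OF g] .
  have "(\<Sum>k. ennreal (ip2 (f (g k)) (f (g k)))) = (\<Sum>k. \<Sum>j. ennreal ((ip2 (f (g k)) (h j))\<^sup>2))"
    by (subst B.Parseval_ennreal[OF h]) (auto simp: f gX)
  also have "\<dots> = (\<Sum>k. \<Sum>j. ennreal ((ip1 (a j) (g k))\<^sup>2))"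
    using a gX by (simp add: A.sym)
  also have "\<dots> = (\<Sum>j. \<Sum>k. ennreal ((ip1 (a j) (g k))\<^sup>2))"
    by (rule suminf_ennreal_swap)
  also have "\<dots> = (\<Sum>j. ennreal (ip1 (a j) (a j)))"
    by (subst A.Parseval_ennreal[OF g]) (auto simp: a)
  finally show ?thesis .
qed

section \<open>The space \<open>L\<^sup>2\<close>\<close>

subsection \<open>Representatives\<close>

lemma l2_rel_rep: "l2_rel (rep_l2 u) (rep_l2 u)"
  by (rule Quotient3_rep_reflp[OF Quotient3_l2])

lemma square_integrable_rep: "square_integrable (rep_l2 u)"
  using l2_rel_rep by (auto simp: l2_rel_def)

lemma rep_l2_measurable [measurable]: "rep_l2 u \<in> borel_measurable lebesgue"
  using square_integrable_rep[of u] by (simp add: square_integrable_def)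

lemma abs_rep_l2: "abs_l2 (rep_l2 u) = u"
  by (rule Quotient3_abs_rep[OF Quotient3_l2])

lemma AE_rep_abs_l2:
  assumes "square_integrable f"
  shows "AE x in lebesgue. rep_l2 (abs_l2 f) x = f x"
  using Quotient3_rep_abs[OF Quotient3_l2, of f] assms by (auto simp: l2_rel_def)

lemma l2_eqI: "AE x in lebesgue. rep_l2 u x = rep_l2 v x \<Longrightarrow> u = v"
  using Quotient3_rel_rep[OF Quotient3_l2, of u v] square_integrable_rep by (auto simp: l2_rel_def)

lemma AE_rep_add: "AE x in lebesgue. rep_l2 (u + v) x = rep_l2 u x + rep_l2 v x"
proof -
  have "abs_l2 (\<lambda>x. rep_l2 u x + rep_l2 v x) = u + v"
    using plus_l2.abs_eq[OF l2_rel_rep[of u] l2_rel_rep[of v]] by (simp add: abs_rep_l2)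
  with AE_rep_abs_l2[OF square_integrable_add[OF square_integrable_rep square_integrable_rep], of u v]
  show ?thesis by simp
qed

lemma AE_rep_scaleR: "AE x in lebesgue. rep_l2 (r *\<^sub>R u) x = r *\<^sub>R rep_l2 u x"
proof -
  have "abs_l2 (\<lambda>x. r *\<^sub>R rep_l2 u x) = r *\<^sub>R u"
    using scaleR_l2.abs_eq[OF l2_rel_rep[of u]] by (simp add: abs_rep_l2)
  with AE_rep_abs_l2[OF square_integrable_scaleR[OF square_integrable_rep], of r u]
  show ?thesis by simp
qed

lemma AE_rep_zero: "AE x in lebesgue. rep_l2 0 x = 0"
  using AE_rep_abs_l2[OF square_integrable_zero] by (simp add: zero_l2_def)

lemma AE_rep_uminus: "AE x in lebesgue. rep_l2 (- u) x = - rep_l2 u x"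
  using AE_rep_scaleR[of "-1" u] by simp

lemma AE_rep_diff: "AE x in lebesgue. rep_l2 (u - v) x = rep_l2 u x - rep_l2 v x"
  using AE_rep_add[of u "-v"] AE_rep_uminus[of v] by (auto elim: eventually_elim2)

lemma inner_l2_rep: "inner u v = (LINT x|lebesgue. inner (rep_l2 u x) (rep_l2 v x))"
  using inner_l2.abs_eq[OF l2_rel_rep[of u] l2_rel_rep[of v]] by (simp add: abs_rep_l2)

lemma integrable_inner_rep: "integrable lebesgue (\<lambda>x. inner (rep_l2 u x) (rep_l2 v x))"
  by (intro square_integrable_inner square_integrable_rep)

lemma integrable_norm_rep: "integrable lebesgue (\<lambda>x. (norm (rep_l2 u x))\<^sup>2)"
  using square_integrable_rep[of u] by (simp add: square_integrable_def)

lemma norm_l2_square: "(norm u)\<^sup>2 = (LINT x|lebesgue. (norm (rep_l2 u x))\<^sup>2)"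
  by (simp add: power2_norm_eq_inner inner_l2_rep)

lemma nn_integral_norm_rep: "(\<integral>\<^sup>+x. ennreal ((norm (rep_l2 u x))\<^sup>2) \<partial>lebesgue) = ennreal ((norm u)\<^sup>2)"
  unfolding norm_l2_square by (rule nn_integral_eq_integral[OF integrable_norm_rep]) auto

lemma square_integrable_iff_nn:
  "square_integrable f \<longleftrightarrow> f \<in> borel_measurable lebesgue \<and>
     (\<integral>\<^sup>+x. ennreal ((norm (f x))\<^sup>2) \<partial>lebesgue) < \<infinity>"
  by (auto simp: square_integrable_def integrable_iff_bounded)

lemma square_integrable_bound:
  assumes "f \<in> borel_measurable lebesgue" "square_integrable g"
    "AE x in lebesgue. norm (f x) \<le> K * norm (g x)"
  shows "square_integrable f"
  unfolding square_integrable_def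
proof
  have "integrable lebesgue (\<lambda>x. K\<^sup>2 * (norm (g x))\<^sup>2)"
    using assms(2) by (auto simp: square_integrable_def)
  then show "integrable lebesgue (\<lambda>x. (norm (f x))\<^sup>2)"
  proof (rule Bochner_Integration.integrable_bound)
    show "AE x in lebesgue. norm ((norm (f x))\<^sup>2) \<le> norm (K\<^sup>2 * (norm (g x))\<^sup>2)"
      using assms(3)
    proof eventually_elim
      case (elim x)
      then have "(norm (f x))\<^sup>2 \<le> (K * norm (g x))\<^sup>2" by (intro power_mono) auto
      then show ?case by (simp add: power_mult_distrib)
    qed
  qed (use assms(1) in measurable)
qed (rule assms(1))

lemma norm_l2_le:
  assumes K: "0 \<le> K" and le: "AE x in lebesgue. norm (rep_l2 u x) \<le> K * norm (rep_l2 v x)"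
  shows "norm u \<le> K * norm v"
proof -
  have "(norm u)\<^sup>2 \<le> (LINT x|lebesgue. K\<^sup>2 * (norm (rep_l2 v x))\<^sup>2)"
    unfolding norm_l2_square
  proof (rule integral_mono_AE)
    show "AE x in lebesgue. (norm (rep_l2 u x))\<^sup>2 \<le> K\<^sup>2 * (norm (rep_l2 v x))\<^sup>2"
      using le by eventually_elim (metis norm_ge_zero power_mono power_mult_distrib)
  qed (auto simp: integrable_norm_rep)
  also have "\<dots> = (K * norm v)\<^sup>2" by (simp add: norm_l2_square power_mult_distrib)
  finally show ?thesis by (rule power2_le_imp_le) (use K in auto)
qed

subsection \<open>Completeness\<close>

text \<open>The squared increments have integrals at most \<open>(1/4) ^ k\<close>, so even with
  weights \<open>2 ^ k\<close> their sum is integrable and hence finite almost everywhere. By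
  \<open>2 * a * b \<le> a\<^sup>2 + b\<^sup>2\<close> this makes the increments themselves
  absolutely summable.\<close>

lemma AE_convergent_of_fast_Cauchy:
  fixes u :: "nat \<Rightarrow> ('a::euclidean_space, 'b::euclidean_space) l2"
  assumes fast: "\<And>k. norm (u (Suc k) - u k) \<le> (1/2) ^ k"
  shows "AE x in lebesgue. convergent (\<lambda>k. rep_l2 (u k) x)"
proof -
  define d where "d k x = rep_l2 (u (Suc k)) x - rep_l2 (u k) x" for k x
  have [measurable]: "d k \<in> borel_measurable lebesgue" for k unfolding d_def by measurable
  have d2: "(\<integral>\<^sup>+x. ennreal ((norm (d k x))\<^sup>2) \<partial>lebesgue) \<le> ennreal ((1/4) ^ k)" for k
  proof -
    have "(\<integral>\<^sup>+x. ennreal ((norm (d k x))\<^sup>2) \<partial>lebesgue)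
        = (\<integral>\<^sup>+x. ennreal ((norm (rep_l2 (u (Suc k) - u k) x))\<^sup>2) \<partial>lebesgue)"
      by (rule nn_integral_cong_AE)
        (use AE_rep_diff[of "u (Suc k)" "u k"] in \<open>auto simp: d_def elim: eventually_mono\<close>)
    also have "\<dots> = ennreal ((norm (u (Suc k) - u k))\<^sup>2)" by (rule nn_integral_norm_rep)
    also have "(norm (u (Suc k) - u k))\<^sup>2 \<le> ((1/2) ^ k)\<^sup>2"
      using fast[of k] by (intro power_mono) auto
    also have "((1/2) ^ k)\<^sup>2 = (1/4 :: real) ^ k"
      by (simp add: power_mult_distrib[symmetric] power2_eq_square)
    finally show ?thesis by (simp add: ennreal_leI)
  qed
  have "(\<integral>\<^sup>+x. (\<Sum>k. ennreal (2 ^ k * (norm (d k x))\<^sup>2)) \<partial>lebesgue)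
      = (\<Sum>k. \<integral>\<^sup>+x. ennreal (2 ^ k * (norm (d k x))\<^sup>2) \<partial>lebesgue)"
    by (rule nn_integral_suminf) measurable
  also have "\<dots> = (\<Sum>k. ennreal (2 ^ k) * (\<integral>\<^sup>+x. ennreal ((norm (d k x))\<^sup>2) \<partial>lebesgue))"
    by (subst nn_integral_cmult[symmetric]) (auto simp: ennreal_mult)
  also have "\<dots> \<le> (\<Sum>k. ennreal (2 ^ k) * ennreal ((1/4) ^ k))"
    by (intro suminf_le mult_left_mono d2) auto
  also have "\<dots> = (\<Sum>k. ennreal ((1/2) ^ k))"
    by (intro arg_cong[where f=suminf] ext) (simp add: ennreal_mult[symmetric] power_mult_distrib[symmetric])
  also have "\<dots> < \<infinity>"
  proof -
    have "(\<Sum>k. ennreal ((1/2) ^ k)) \<noteq> \<top>"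
      by (rule ennreal_suminf_neq_top) (auto intro!: summable_geometric)
    then show ?thesis by (simp only: infinity_ennreal_def less_top)
  qed
  finally have "AE x in lebesgue. (\<Sum>k. ennreal (2 ^ k * (norm (d k x))\<^sup>2)) \<noteq> \<infinity>"
    by (intro nn_integral_noteq_infinite) auto
  then show ?thesis
  proof eventually_elim
    case (elim x)
    have s: "summable (\<lambda>k. 2 ^ k * (norm (d k x))\<^sup>2)"
      by (rule summable_suminf_not_top) (use elim in auto)
    have "summable (\<lambda>k. norm (d k x))"
    proof (rule summable_comparison_test')
      show "summable (\<lambda>k. (1/2) ^ k + 2 ^ k * (norm (d k x))\<^sup>2)"
        by (intro summable_add s summable_geometric) auto
      fix k :: nat
      have "2 * (sqrt ((1/2)^k)) * (sqrt (2^k) * norm (d k x))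
          \<le> (sqrt ((1/2)^k))\<^sup>2 + (sqrt (2^k) * norm (d k x))\<^sup>2" by (rule sum_squares_bound)
      moreover have "sqrt ((1/2)^k) * sqrt (2^k) = 1"
        by (simp add: real_sqrt_mult[symmetric] power_mult_distrib[symmetric])
      then have "2 * (sqrt ((1/2)^k)) * (sqrt (2^k) * norm (d k x)) = 2 * norm (d k x)"
        by (metis mult.assoc mult.right_neutral)
      ultimately have "2 * norm (d k x) \<le> (1/2)^k + 2^k * (norm (d k x))\<^sup>2"
        by (simp add: power_mult_distrib)
      moreover have "0 \<le> norm (d k x)" by simp
      ultimately have "norm (d k x) \<le> (1/2)^k + 2^k * (norm (d k x))\<^sup>2" by linarith
      then show "norm (norm (d k x)) \<le> (1/2) ^ k + 2 ^ k * (norm (d k x))\<^sup>2" by simp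
    qed
    then have "summable (\<lambda>k. d k x)" by (rule summable_norm_cancel)
    then have "convergent (\<lambda>n. \<Sum>k<n. d k x)" by (simp add: summable_iff_convergent)
    moreover have "(\<Sum>k<n. d k x) = rep_l2 (u n) x - rep_l2 (u 0) x" for n
      unfolding d_def by (rule sum_lessThan_telescope)
    ultimately have "convergent (\<lambda>n. rep_l2 (u n) x - rep_l2 (u 0) x)" by simp
    then obtain l where "(\<lambda>n. rep_l2 (u n) x - rep_l2 (u 0) x) \<longlonglongrightarrow> l" by (auto simp: convergent_def)
    from tendsto_add[OF this tendsto_const[of "rep_l2 (u 0) x"]]
    have "(\<lambda>n. rep_l2 (u n) x) \<longlonglongrightarrow> l + rep_l2 (u 0) x" by simp
    then show ?case by (auto simp: convergent_def)
  qed
qed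

text \<open>A fast subsequence converges almost everywhere; Fatou's lemma shows that the pointwise
  limit is square integrable and that the subsequence approaches its class. A Cauchy sequence with a
  convergent subsequence converges.\<close>

instance l2 :: (euclidean_space, euclidean_space) complete_space
proof
  fix X :: "nat \<Rightarrow> ('a, 'b) l2" assume X: "Cauchy X"
  have "\<exists>M. \<forall>m\<ge>M. \<forall>n\<ge>M. dist (X m) (X n) < (1/2) ^ k" for k
    by (rule metric_CauchyD[OF X]) simp
  then obtain M where M: "\<And>k m n. m \<ge> M k \<Longrightarrow> n \<ge> M k \<Longrightarrow> dist (X m) (X n) < (1/2) ^ k" by metis
  \<comment> \<open>Summation with \<open>+ 1\<close> makes the indices strictly increasing while
    keeping them above \<open>M k\<close>.\<close>
  define r where "r k = (\<Sum>i\<le>k. M i + 1)" for k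
  have r: "strict_mono r" unfolding strict_mono_Suc_iff r_def by simp
  have rM: "M k \<le> r k" for k
    unfolding r_def using member_le_sum[of k "{..k}" "\<lambda>i. M i + 1"] by simp
  define u where "u k = X (r k)" for k
  have fast: "norm (u (Suc k) - u k) \<le> (1/2) ^ k" for k
    using M[of k "r (Suc k)" "r k"] rM[of k] strict_monoD[OF r, of k "Suc k"]
    by (auto simp: u_def dist_norm intro!: less_imp_le)
  define f where "f x = lim (\<lambda>k. rep_l2 (u k) x)" for x
  have [measurable]: "f \<in> borel_measurable lebesgue" unfolding f_def by measurable
  have lim: "AE x in lebesgue. (\<lambda>k. rep_l2 (u k) x) \<longlonglongrightarrow> f x"
    using AE_convergent_of_fast_Cauchy[OF fast] by eventually_elim (simp add: f_def convergent_LIMSEQ_iff)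
  \<comment> \<open>Stated for the function \<open>f\<close> and not for its class, because it has
    to give the square integrability of \<open>f\<close> as well.\<close>
  have Fatou: "(\<integral>\<^sup>+x. ennreal ((norm (rep_l2 v x - f x))\<^sup>2) \<partial>lebesgue) \<le> ennreal (e\<^sup>2)"
    if "\<forall>\<^sub>F k in sequentially. norm (v - u k) \<le> e" for e v
  proof -
    have "(\<integral>\<^sup>+x. ennreal ((norm (rep_l2 v x - f x))\<^sup>2) \<partial>lebesgue)
        = (\<integral>\<^sup>+x. liminf (\<lambda>k. ennreal ((norm (rep_l2 v x - rep_l2 (u k) x))\<^sup>2)) \<partial>lebesgue)"
    proof (rule nn_integral_cong_AE)
      show "AE x in lebesgue. ennreal ((norm (rep_l2 v x - f x))\<^sup>2)
          = liminf (\<lambda>k. ennreal ((norm (rep_l2 v x - rep_l2 (u k) x))\<^sup>2))"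
        using lim
      proof eventually_elim
        case (elim x)
        have "(\<lambda>k. ennreal ((norm (rep_l2 v x - rep_l2 (u k) x))\<^sup>2)) \<longlonglongrightarrow> ennreal ((norm (rep_l2 v x - f x))\<^sup>2)"
          by (intro tendsto_ennrealI tendsto_intros elim)
        from lim_imp_Liminf[OF _ this] show ?case by simp
      qed
    qed
    also have "\<dots> \<le> liminf (\<lambda>k. \<integral>\<^sup>+x. ennreal ((norm (rep_l2 v x - rep_l2 (u k) x))\<^sup>2) \<partial>lebesgue)"
      by (rule nn_integral_liminf) measurable
    also have "\<dots> = liminf (\<lambda>k. ennreal ((norm (v - u k))\<^sup>2))"
    proof -
      have "(\<integral>\<^sup>+x. ennreal ((norm (rep_l2 v x - rep_l2 (u k) x))\<^sup>2) \<partial>lebesgue) = ennreal ((norm (v - u k))\<^sup>2)" for k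
        unfolding nn_integral_norm_rep[symmetric]
        by (rule nn_integral_cong_AE) (use AE_rep_diff[of v "u k"] in \<open>auto elim: eventually_mono\<close>)
      then show ?thesis by simp
    qed
    also have "\<dots> \<le> limsup (\<lambda>k. ennreal ((norm (v - u k))\<^sup>2))"
      by (rule Liminf_le_Limsup) simp
    also have "\<dots> \<le> ennreal (e\<^sup>2)"
      using that by (intro Limsup_bounded) (auto elim!: eventually_mono intro!: ennreal_leI power_mono)
    finally show ?thesis .
  qed
  have near: "\<forall>\<^sub>F k in sequentially. norm (u m - u k) \<le> (1/2) ^ m" for m
  proof -
    have "norm (u m - u k) \<le> (1/2) ^ m" if "k \<ge> m" for k
      using M[of m "r m" "r k"] rM[of m] strict_mono_mono[OF r] that
      by (fastforce simp: u_def dist_norm mono_def)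
    then show ?thesis by (auto simp: eventually_sequentially)
  qed
  have sq: "square_integrable f"
  proof -
    have "square_integrable (\<lambda>x. rep_l2 (u 0) x - f x)"
      unfolding square_integrable_iff_nn using Fatou[OF near[of 0]] by (auto intro: le_less_trans)
    from square_integrable_add[OF square_integrable_rep[of "u 0"] square_integrable_scaleR[OF this, of "-1"]]
    show ?thesis by simp
  qed
  have dist_u: "norm (u m - abs_l2 f) \<le> (1/2) ^ m" for m
  proof -
    have "ennreal ((norm (u m - abs_l2 f))\<^sup>2) = (\<integral>\<^sup>+x. ennreal ((norm (rep_l2 (u m) x - f x))\<^sup>2) \<partial>lebesgue)"
      unfolding nn_integral_norm_rep[symmetric]
      by (rule nn_integral_cong_AE)
        (use AE_rep_diff[of "u m" "abs_l2 f"] AE_rep_abs_l2[OF sq] in \<open>auto elim: eventually_elim2\<close>)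
    also have "\<dots> \<le> ennreal (((1/2) ^ m)\<^sup>2)" by (rule Fatou[OF near])
    finally have "(norm (u m - abs_l2 f))\<^sup>2 \<le> ((1/2) ^ m)\<^sup>2" by (subst (asm) ennreal_le_iff) auto
    then show ?thesis by (rule power2_le_imp_le) simp
  qed
  have "(\<lambda>m. (1/2::real) ^ m) \<longlonglongrightarrow> 0" by (rule LIMSEQ_realpow_zero) auto
  then have "(\<lambda>m. norm (u m - abs_l2 f)) \<longlonglongrightarrow> 0"
    by (rule Lim_null_comparison[rotated]) (auto simp: dist_u)
  then have "u \<longlonglongrightarrow> abs_l2 f" using LIM_zero_iff tendsto_norm_zero_iff by blast
  then have "(X \<circ> r) \<longlonglongrightarrow> abs_l2 f" by (simp add: u_def[abs_def] comp_def)
  then show "convergent X" using Cauchy_converges_subseq[OF X r] by (auto simp: convergent_def)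
qed

instance l2 :: (euclidean_space, euclidean_space) banach ..

subsection \<open>Functions are determined by their integrals over boxes\<close>

definition rational_vec :: "'a::euclidean_space \<Rightarrow> bool" where
  "rational_vec a \<longleftrightarrow> (\<forall>i\<in>Basis. a \<bullet> i \<in> \<rat>)"

text \<open>Countable and stable under intersection: null sets found box by box can be united, and
  Dynkin's theorem applies.\<close>

definition rational_boxes :: "'a::euclidean_space set set" where
  "rational_boxes = {box a b |a b. rational_vec a \<and> rational_vec b}"

lemma countable_rational_vec: "countable {a::'a::euclidean_space. rational_vec a}"
proof -
  have "countable (Pi\<^sub>E (Basis::'a set) (\<lambda>_. \<rat>::real set))"
    by (intro countable_PiE) (auto simp: countable_rat)
  moreover have "{a::'a. rational_vec a} \<subseteq> (\<lambda>f. \<Sum>i\<in>Basis. f i *\<^sub>R i) ` Pi\<^sub>E (Basis::'a set) (\<lambda>_. \<rat>)"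
  proof
    fix a :: 'a assume "a \<in> {a. rational_vec a}"
    then show "a \<in> (\<lambda>f. \<Sum>i\<in>Basis. f i *\<^sub>R i) ` Pi\<^sub>E (Basis::'a set) (\<lambda>_. \<rat>)"
      by (intro image_eqI[where x="\<lambda>i\<in>Basis. a \<bullet> i"]) (auto simp: rational_vec_def euclidean_representation)
  qed
  ultimately show ?thesis by (meson countable_image countable_subset)
qed

lemma countable_rational_boxes: "countable (rational_boxes :: 'a::euclidean_space set set)"
proof -
  have "rational_boxes \<subseteq> (\<lambda>(a, b). box a b) ` ({a::'a. rational_vec a} \<times> {b. rational_vec b})"
    by (auto simp: rational_boxes_def)
  moreover have "countable ((\<lambda>(a, b). box a b) ` ({a::'a. rational_vec a} \<times> {b. rational_vec b}))"
    by (intro countable_image countable_SIGMA countable_rational_vec)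
  ultimately show ?thesis by (rule countable_subset)
qed

lemma sets_borel_rational_boxes: "sets borel = sigma_sets UNIV (rational_boxes :: 'a::euclidean_space set set)"
proof
  show "sigma_sets UNIV rational_boxes \<subseteq> sets (borel :: 'a measure)"
    by (rule sets.sigma_sets_subset') (auto simp: rational_boxes_def)
  have "M \<in> sigma_sets UNIV rational_boxes" if M: "open M" for M :: "'a set"
  proof -
    define \<B> where "\<B> = {B \<in> rational_boxes. B \<subseteq> M}"
    have "M \<subseteq> \<Union>\<B>"
    proof
      fix x assume "x \<in> M"
      with open_UNION_box[OF M] obtain f where
        f: "f \<in> Basis \<rightarrow>\<^sub>E \<rat> \<times> \<rat>" "x \<in> box (\<Sum>i\<in>Basis. fst (f i) *\<^sub>R i) (\<Sum>i\<in>Basis. snd (f i) *\<^sub>R i)"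
          "box (\<Sum>i\<in>Basis. fst (f i) *\<^sub>R i) (\<Sum>i\<in>Basis. snd (f i) *\<^sub>R i) \<subseteq> M"
        by (smt (verit) UN_E mem_Collect_eq)
      have "f i \<in> \<rat> \<times> \<rat>" if "i \<in> Basis" for i using f(1) that by auto
      then have "fst (f i) \<in> \<rat> \<and> snd (f i) \<in> \<rat>" if "i \<in> Basis" for i
        using that by (metis mem_Times_iff)
      then have "box (\<Sum>i\<in>Basis. fst (f i) *\<^sub>R i) (\<Sum>i\<in>Basis. snd (f i) *\<^sub>R i) \<in> rational_boxes"
        unfolding rational_boxes_def rational_vec_def mem_Collect_eq
        by (intro exI[of _ "\<Sum>i\<in>Basis. fst (f i) *\<^sub>R i"] exI[of _ "\<Sum>i\<in>Basis. snd (f i) *\<^sub>R i"]) simp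
      with f show "x \<in> \<Union>\<B>" by (auto simp: \<B>_def)
    qed
    then have "M = \<Union>\<B>" by (auto simp: \<B>_def)
    moreover have "countable \<B>" using countable_rational_boxes by (rule countable_subset[rotated]) (auto simp: \<B>_def)
    moreover have "\<B> \<subseteq> sigma_sets UNIV rational_boxes" by (auto simp: \<B>_def)
    ultimately show ?thesis using sigma_sets_UNION[of \<B> UNIV rational_boxes] by blast
  qed
  then show "sets borel \<subseteq> sigma_sets UNIV (rational_boxes :: 'a set set)"
    unfolding borel_def by (subst sets_measure_of) (auto intro!: sigma_sets_mono)
qed

lemma Int_stable_rational_boxes: "Int_stable (rational_boxes :: 'a::euclidean_space set set)"
proof (rule Int_stableI)
  fix A B :: "'a set" assume "A \<in> rational_boxes" "B \<in> rational_boxes"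
  then obtain a b c d where *: "A = box a b" "B = box c d" "rational_vec a" "rational_vec b" "rational_vec c" "rational_vec d"
    by (auto simp: rational_boxes_def)
  have "rational_vec (\<Sum>i\<in>Basis. max (a\<bullet>i) (c\<bullet>i) *\<^sub>R i)" "rational_vec (\<Sum>i\<in>Basis. min (b\<bullet>i) (d\<bullet>i) *\<^sub>R i)"
    using * by (auto simp: rational_vec_def max_def min_def)
  then show "A \<inter> B \<in> rational_boxes" unfolding * box_Int_box rational_boxes_def by blast
qed

lemma rational_boxes_Pow: "rational_boxes \<subseteq> Pow UNIV"
  by simp

text \<open>By Dynkin's theorem the integral vanishes over every Borel set, in particular over the
  sets where \<open>g\<close> is positive or negative. Complements need the integral over the whole
  space, which is the limit over the growing boxes \<open>Bx n\<close>.\<close>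

lemma AE_zero_lborel:
  fixes g :: "'a::euclidean_space \<Rightarrow> real"
  assumes g: "integrable lborel g" and 0: "\<And>B. B \<in> rational_boxes \<Longrightarrow> (LINT x:B|lborel. g x) = 0"
  shows "AE x in lborel. g x = 0"
proof -
  have si: "set_integrable lborel A g" if "A \<in> sets borel" for A
    unfolding set_integrable_def using integrable_mult_indicator[OF _ g] that by simp
  define Bx where "Bx n = box (- (real n *\<^sub>R One)) (real n *\<^sub>R (One::'a))" for n
  have Bxr: "Bx n \<in> rational_boxes" for n
    unfolding rational_boxes_def mem_Collect_eq Bx_def
    by (rule exI[of _ "- (real n *\<^sub>R One)"], rule exI[of _ "real n *\<^sub>R One"]) (auto simp: rational_vec_def)
  have UBx: "(\<Union>n. Bx n) = UNIV" unfolding Bx_def using UN_box_eq_UNIV by simp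
  have tot: "(LINT x:UNIV|lborel. g x) = 0"
  proof -
    have "(\<lambda>n. LINT x:Bx n|lborel. g x) \<longlonglongrightarrow> (LINT x:(\<Union>n. Bx n)|lborel. g x)"
    proof (rule set_integral_cont_up)
      show "incseq Bx" unfolding incseq_def Bx_def by (auto simp: mem_box)
        (smt (verit, ccfv_SIG) mult_right_mono of_nat_mono inner_Basis)+
      show "set_integrable lborel (\<Union>n. Bx n) g" unfolding UBx by (rule si) simp
    qed (auto simp: Bx_def)
    then show ?thesis using 0[OF Bxr] by (simp add: UBx LIMSEQ_const_iff)
  qed
  have all: "(LINT x:A|lborel. g x) = 0" if A: "A \<in> sets borel" for A
  proof -
    have "A \<in> sigma_sets UNIV (rational_boxes :: 'a set set)" using A unfolding sets_borel_rational_boxes .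
    then show ?thesis
    proof (induction rule: sigma_sets_induct_disjoint[OF Int_stable_rational_boxes rational_boxes_Pow, consumes 1, case_names basic empty compl union])
      case (basic A) then show ?case by (rule 0)
    next
      case empty show ?case by (simp add: set_lebesgue_integral_def)
    next
      case (compl A)
      then have A: "A \<in> sets borel" using sets_borel_rational_boxes by blast
      have "(LINT x:A \<union> (UNIV - A)|lborel. g x) = (LINT x:A|lborel. g x) + (LINT x:UNIV - A|lborel. g x)"
        using A by (intro set_integral_Un si) auto
      then show ?case using compl tot by simp
    next
      case (union A)
      then have A: "A i \<in> sets borel" for i using sets_borel_rational_boxes by blast
      have "(LINT x:(\<Union>i. A i)|lborel. g x) = (\<Sum>i. LINT x:A i|lborel. g x)"
      proof (rule lebesgue_integral_countable_add)
        show "A i \<inter> A j = {}" if "i \<noteq> j" for i j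
          using union(1) that by (auto simp: disjoint_family_on_def)
        show "set_integrable lborel (\<Union>i. A i) g" using A by (intro si) auto
      qed (use A in auto)
      then show ?case using union by simp
    qed
  qed
  have half: "AE x in lborel. h x \<le> 0"
    if h: "integrable lborel h" and hz: "\<And>A. A \<in> sets borel \<Longrightarrow> (LINT x:A|lborel. h x) = 0" for h :: "'a \<Rightarrow> real"
  proof -
    have [measurable]: "h \<in> borel_measurable borel" using h by auto
    define A where "A = {x. h x > 0}"
    have A: "A \<in> sets borel" unfolding A_def by measurable
    have int: "integrable lborel (\<lambda>x. indicator A x *\<^sub>R h x)"
      using integrable_mult_indicator[OF _ h] A by simp
    have "(LINT x|lborel. indicator A x *\<^sub>R h x) = 0"
      using hz[OF A] by (simp add: set_lebesgue_integral_def)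
    then have "AE x in lborel. indicator A x *\<^sub>R h x = 0"
      by (subst integral_nonneg_eq_0_iff_AE[OF int, symmetric]) (auto simp: A_def indicator_def)
    then show ?thesis by eventually_elim (auto simp: A_def indicator_def split: if_splits)
  qed
  have "AE x in lborel. g x \<le> 0" by (rule half[OF g all])
  moreover have "AE x in lborel. - g x \<le> 0"
    by (rule half) (use g all in \<open>auto simp: set_lebesgue_integral_def\<close>)
  ultimately show ?thesis by eventually_elim auto
qed

text \<open>A Lebesgue measurable function agrees almost everywhere with a Borel function, which
  reduces the claim to \<open>AE_zero_lborel\<close>.\<close>

lemma AE_zero_lebesgue:
  fixes f :: "'a::euclidean_space \<Rightarrow> real"
  assumes f: "integrable lebesgue f" and 0: "\<And>B. B \<in> rational_boxes \<Longrightarrow> (LINT x:B|lebesgue. f x) = 0"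
  shows "AE x in lebesgue. f x = 0"
proof -
  have fm: "f \<in> borel_measurable lebesgue" using f by auto
  then obtain g where g: "g \<in> borel_measurable lborel" "AE x in lborel. f x = g x"
    using completion_ex_borel_measurable_real[of f lborel] by auto
  have [measurable]: "g \<in> borel_measurable borel" using g by simp
  have fg: "AE x in lebesgue. f x = g x" using g(2) by (rule AE_completion)
  have gm: "g \<in> borel_measurable lebesgue" using g(1) by (rule measurable_completion)
  have "integrable lebesgue g" using f fg by (rule integrable_cong_AE_imp[OF _ gm])
  then have gi: "integrable lborel g" using g(1) by (simp add: integrable_completion)
  have "AE x in lborel. g x = 0"
  proof (rule AE_zero_lborel[OF gi])
    fix B :: "'a set" assume B: "B \<in> rational_boxes"
    then have Bm: "B \<in> sets borel" by (auto simp: rational_boxes_def)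
    have "(LINT x:B|lborel. g x) = (LINT x|lebesgue. indicator B x *\<^sub>R g x)"
      unfolding set_lebesgue_integral_def using Bm by (subst integral_completion) auto
    also have "\<dots> = (LINT x:B|lebesgue. f x)"
      unfolding set_lebesgue_integral_def
    proof (rule integral_cong_AE)
      show "(\<lambda>x. indicator B x *\<^sub>R g x) \<in> borel_measurable lebesgue"
        using Bm gm by (intro borel_measurable_scaleR borel_measurable_indicator) auto
      show "(\<lambda>x. indicator B x *\<^sub>R f x) \<in> borel_measurable lebesgue"
        using Bm fm by (intro borel_measurable_scaleR borel_measurable_indicator) auto
      show "AE x in lebesgue. indicator B x *\<^sub>R g x = indicator B x *\<^sub>R f x"
        using fg by eventually_elim simp
    qed
    finally show "(LINT x:B|lborel. g x) = 0" using 0[OF B] by simp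
  qed
  then have "AE x in lebesgue. g x = 0" by (rule AE_completion)
  with fg show ?thesis by eventually_elim simp
qed

text \<open>Boxes whose closure lies in \<open>D\<close> are those that compactly supported test
  functions reach; countably many of them cover \<open>D\<close>. Cut off by the indicator of one
  such box, the function falls under \<open>AE_zero_lebesgue\<close>.\<close>

lemma AE_zero_on_open:
  fixes f :: "'a::euclidean_space \<Rightarrow> real"
  assumes D: "open D"
    and int: "\<And>B. B \<in> rational_boxes \<Longrightarrow> closure B \<subseteq> D \<Longrightarrow> set_integrable lebesgue B f"
    and 0: "\<And>B. B \<in> rational_boxes \<Longrightarrow> closure B \<subseteq> D \<Longrightarrow> (LINT x:B|lebesgue. f x) = 0"
  shows "AE x in lebesgue. x \<in> D \<longrightarrow> f x = 0"
proof -
  define \<B> where "\<B> = {B \<in> rational_boxes. closure B \<subseteq> D}"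
  have "D \<subseteq> \<Union>\<B>"
  proof
    fix x assume "x \<in> D"
    then obtain e where e: "e > 0" "cball x e \<subseteq> D" using D open_contains_cball by blast
    have "ball x e \<in> sigma_sets UNIV (rational_boxes :: 'a set set)"
      unfolding sets_borel_rational_boxes[symmetric] by simp
    from open_UNION_box[of "ball x e"] e obtain f where
      f: "f \<in> Basis \<rightarrow>\<^sub>E \<rat> \<times> \<rat>" "x \<in> box (\<Sum>i\<in>Basis. fst (f i) *\<^sub>R i) (\<Sum>i\<in>Basis. snd (f i) *\<^sub>R i)"
        "box (\<Sum>i\<in>Basis. fst (f i) *\<^sub>R i) (\<Sum>i\<in>Basis. snd (f i) *\<^sub>R i) \<subseteq> ball x e"
      by (smt (verit) UN_E mem_Collect_eq centre_in_ball open_ball)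
    define B where "B = box (\<Sum>i\<in>Basis. fst (f i) *\<^sub>R i) (\<Sum>i\<in>Basis. snd (f i) *\<^sub>R i)"
    have "f i \<in> \<rat> \<times> \<rat>" if "i \<in> Basis" for i using f(1) that by auto
    then have "fst (f i) \<in> \<rat> \<and> snd (f i) \<in> \<rat>" if "i \<in> Basis" for i
      using that by (metis mem_Times_iff)
    then have "B \<in> rational_boxes"
      unfolding rational_boxes_def rational_vec_def mem_Collect_eq B_def
      by (intro exI[of _ "\<Sum>i\<in>Basis. fst (f i) *\<^sub>R i"] exI[of _ "\<Sum>i\<in>Basis. snd (f i) *\<^sub>R i"]) simp
    moreover have "closure B \<subseteq> D"
      using closure_mono[of B "ball x e"] f(3) e by (auto simp: B_def)
    ultimately show "x \<in> \<Union>\<B>" using f(2) by (auto simp: \<B>_def B_def)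
  qed
  moreover have "AE x in lebesgue. \<forall>B\<in>\<B>. x \<in> B \<longrightarrow> f x = 0"
  proof (subst AE_ball_countable)
    show "countable \<B>" using countable_rational_boxes by (rule countable_subset[rotated]) (auto simp: \<B>_def)
    show "\<forall>B\<in>\<B>. AE x in lebesgue. x \<in> B \<longrightarrow> f x = 0"
    proof
      fix B assume "B \<in> \<B>"
      then have B: "B \<in> rational_boxes" "closure B \<subseteq> D" by (auto simp: \<B>_def)
      have "AE x in lebesgue. indicator B x *\<^sub>R f x = 0"
      proof (rule AE_zero_lebesgue)
        show "integrable lebesgue (\<lambda>x. indicator B x *\<^sub>R f x)"
          using int[OF B] by (simp add: set_integrable_def)
        fix B' :: "'a set" assume B': "B' \<in> rational_boxes"
        have "B' \<inter> B \<in> rational_boxes" using Int_stable_rational_boxes B B' by (auto simp: Int_stable_def)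
        moreover have "closure (B' \<inter> B) \<subseteq> D" using B closure_mono[of "B' \<inter> B" B] by auto
        ultimately have "(LINT x:B' \<inter> B|lebesgue. f x) = 0" by (rule 0)
        then show "(LINT x:B'|lebesgue. indicator B x *\<^sub>R f x) = 0"
          by (simp add: set_lebesgue_integral_def indicator_inter_arith mult.assoc)
      qed
      then show "AE x in lebesgue. x \<in> B \<longrightarrow> f x = 0" by eventually_elim auto
    qed
  qed
  ultimately show ?thesis by (auto elim!: eventually_mono)
qed

subsection \<open>Separability\<close>

interpretation l2_form: hilbert_form inner "UNIV :: ('a::euclidean_space, 'b::euclidean_space) l2 set" 1
  by (intro hilbert_form.intro) (auto simp: bounded_bilinear_inner inner_commute power2_norm_eq_inner)

lemma square_integrable_indicator_box:
  "square_integrable (\<lambda>x. indicator (box a b) x *\<^sub>R c)"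
  unfolding square_integrable_def
proof
  have "integrable lebesgue (\<lambda>x. indicat_real (box a b) x * (norm c)\<^sup>2)"
    by (intro integrable_mult_left integrable_real_indicator) (auto simp: emeasure_lborel_box_eq)
  moreover have "(\<lambda>x. indicat_real (box a b) x * (norm c)\<^sup>2) = (\<lambda>x. (norm (indicat_real (box a b) x *\<^sub>R c))\<^sup>2)"
    by (auto simp: indicator_def)
  ultimately show "integrable lebesgue (\<lambda>x. (norm (indicat_real (box a b) x *\<^sub>R c))\<^sup>2)" by simp
qed (intro borel_measurable_scaleR borel_measurable_indicator borel_measurable_const, auto)

lemma set_integrable_rep_box:
  "set_integrable lebesgue (box a b) (\<lambda>x. rep_l2 u x \<bullet> c)"
  using square_integrable_inner[OF square_integrable_rep[of u] square_integrable_indicator_box[of a b c]]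
  by (simp add: set_integrable_def)

lemma l2_orthogonal_boxes_imp_zero:
  fixes u :: "('a::euclidean_space, 'b::euclidean_space) l2"
  assumes 0: "\<And>B b. B \<in> rational_boxes \<Longrightarrow> b \<in> Basis \<Longrightarrow> inner u (abs_l2 (\<lambda>x. indicator B x *\<^sub>R b)) = 0"
  shows "u = 0"
proof -
  have "AE x in lebesgue. \<forall>b\<in>Basis. rep_l2 u x \<bullet> b = 0"
  proof (subst AE_ball_countable)
    show "countable (Basis :: 'b set)" by (simp add: countable_finite)
    show "\<forall>b\<in>Basis. AE x in lebesgue. rep_l2 u x \<bullet> b = 0"
    proof
      fix b :: 'b assume b: "b \<in> Basis"
      have "AE x in lebesgue. x \<in> UNIV \<longrightarrow> rep_l2 u x \<bullet> b = 0"
      proof (rule AE_zero_on_open[OF open_UNIV])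
        fix B :: "'a set" assume B: "B \<in> rational_boxes"
        then obtain a c where Bb: "B = box a c" by (auto simp: rational_boxes_def)
        show "set_integrable lebesgue B (\<lambda>x. rep_l2 u x \<bullet> b)" unfolding Bb by (rule set_integrable_rep_box)
        have sq: "square_integrable (\<lambda>x. indicator B x *\<^sub>R b)" unfolding Bb by (rule square_integrable_indicator_box)
        have "inner u (abs_l2 (\<lambda>x. indicator B x *\<^sub>R b)) = (LINT x|lebesgue. rep_l2 u x \<bullet> (indicator B x *\<^sub>R b))"
          unfolding inner_l2_rep
        proof (rule integral_cong_AE)
          show "AE x in lebesgue. rep_l2 u x \<bullet> rep_l2 (abs_l2 (\<lambda>x. indicator B x *\<^sub>R b)) x = rep_l2 u x \<bullet> (indicator B x *\<^sub>R b)"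
            using AE_rep_abs_l2[OF sq] by eventually_elim simp
          show "(\<lambda>x. rep_l2 u x \<bullet> indicat_real B x *\<^sub>R b) \<in> borel_measurable lebesgue"
            using sq by (intro borel_measurable_inner rep_l2_measurable) (simp add: square_integrable_def)
        qed measurable
        then show "(LINT x:B|lebesgue. rep_l2 u x \<bullet> b) = 0"
          using 0[OF B b] by (simp add: set_lebesgue_integral_def)
      qed
      then show "AE x in lebesgue. rep_l2 u x \<bullet> b = 0" by simp
    qed
  qed
  then have "AE x in lebesgue. rep_l2 u x = rep_l2 0 x"
    using AE_rep_zero by eventually_elim (simp add: euclidean_all_zero_iff)
  then show ?thesis by (rule l2_eqI)
qed

text \<open>Gram-Schmidt is applied to the countable total family of indicators of rational boxes,
  which presupposes no separability; finite rational combinations of the result are dense.\<close>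

lemma l2_separable: "\<exists>C :: ('a::euclidean_space, 'b::euclidean_space) l2 set. countable C \<and> closure C = UNIV"
proof -
  define S :: "('a, 'b) l2 set" where "S = (\<lambda>(B, b). abs_l2 (\<lambda>x. indicator B x *\<^sub>R b)) ` (rational_boxes \<times> Basis)"
  have "countable S" unfolding S_def
    by (intro countable_image countable_SIGMA countable_rational_boxes) (simp add: countable_finite)
  moreover have "S \<noteq> {}" unfolding S_def rational_boxes_def
    by (auto intro!: exI[of _ 0] simp: rational_vec_def)
  ultimately have d: "range (from_nat_into S) = S" by simp
  obtain g :: "nat \<Rightarrow> ('a, 'b) l2" where g: "l2_form.onseq g"
  proof (rule l2_form.onseq_exists_dense[of UNIV "from_nat_into S"])
    fix x :: "('a, 'b) l2" assume x: "\<And>n. inner x (from_nat_into S n) = 0"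
    show "x = 0"
    proof (rule l2_orthogonal_boxes_imp_zero)
      fix B :: "'a set" and b :: 'b assume "B \<in> rational_boxes" "b \<in> Basis"
      then have "abs_l2 (\<lambda>x. indicator B x *\<^sub>R b) \<in> range (from_nat_into S)"
        unfolding d by (force simp: S_def)
      with x show "inner x (abs_l2 (\<lambda>x. indicator B x *\<^sub>R b)) = 0" by auto
    qed
  qed auto
  have ng: "norm (g k) \<le> 1" for k
  proof -
    have "g k = 0 \<or> inner (g k) (g k) = 1" using g by (simp add: l2_form.onseq_def)
    then show ?thesis by (auto simp: norm_eq_sqrt_inner)
  qed
  define C where "C = (\<lambda>qs. \<Sum>k<length qs. of_rat (qs ! k) *\<^sub>R g k) ` UNIV"
  have "countable C" unfolding C_def by (intro countable_image) simp
  moreover have "x \<in> closure C" for x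
    unfolding closure_approachable
  proof (intro allI impI)
    fix e :: real assume e: "e > 0"
    have "(\<lambda>n. \<Sum>k<n. inner x (g k) *\<^sub>R g k) \<longlonglongrightarrow> x"
      by (rule l2_form.onseq_expand(1)[OF g]) simp
    then obtain n where n: "dist (\<Sum>k<n. inner x (g k) *\<^sub>R g k) x < e / 2"
      using metric_LIMSEQ_D[of _ x "e / 2"] e by (meson half_gt_zero order_refl)
    \<comment> \<open>The \<open>n\<close> rounding errors of size at most \<open>e'\<close> must
      sum to less than \<open>e / 2\<close>; the \<open>+ 1\<close> covers
      \<open>n = 0\<close>.\<close>
    define e' where "e' = e / (2 * (real n + 1))"
    have "e' > 0" using e by (simp add: e'_def)
    have "\<exists>q. \<bar>inner x (g k) - of_rat q\<bar> < e'" for k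
    proof -
      obtain q where "inner x (g k) - e' < of_rat q" "of_rat q < inner x (g k)"
        using of_rat_dense[of "inner x (g k) - e'" "inner x (g k)"] \<open>e' > 0\<close> by auto
      then show ?thesis by (intro exI[of _ q]) auto
    qed
    then obtain q where q: "\<And>k. \<bar>inner x (g k) - of_rat (q k)\<bar> < e'" by metis
    define qs where "qs = map q [0..<n]"
    define y where "y = (\<Sum>k<length qs. of_rat (qs ! k) *\<^sub>R g k)"
    have y: "y = (\<Sum>k<n. of_rat (q k) *\<^sub>R g k)" unfolding y_def qs_def by simp
    have "norm (y - (\<Sum>k<n. inner x (g k) *\<^sub>R g k)) = norm (\<Sum>k<n. (of_rat (q k) - inner x (g k)) *\<^sub>R g k)"
      unfolding y by (simp add: scaleR_diff_left sum_subtractf)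
    also have "\<dots> \<le> (\<Sum>k<n. e' * 1)"
    proof (rule sum_norm_le)
      fix k
      have "\<bar>of_rat (q k) - inner x (g k)\<bar> * norm (g k) \<le> e' * 1"
        using q[of k] ng[of k] by (intro mult_mono) (auto simp: abs_minus_commute less_imp_le)
      then show "norm ((of_rat (q k) - inner x (g k)) *\<^sub>R g k) \<le> e' * 1" by simp
    qed
    also have "\<dots> < e / 2" using e by (simp add: e'_def field_simps)
    finally have "dist y x < e"
      using n dist_triangle[of y x "\<Sum>k<n. inner x (g k) *\<^sub>R g k"] by (simp add: dist_norm)
    then show "\<exists>y\<in>C. dist y x < e" unfolding C_def y_def by blast
  qed
  ultimately show ?thesis by blast
qed

text \<open>Serves the Borel measurability of sums and pairs of random fields and the existence of
  orthonormal sequences in subspaces.\<close>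

instance l2 :: (euclidean_space, euclidean_space) second_countable_topology
proof
  obtain C :: "('a, 'b) l2 set" where C: "countable C" "closure C = UNIV" using l2_separable by blast
  define \<B> where "\<B> = (\<lambda>(c, n). ball c (1 / real (Suc n))) ` (C \<times> UNIV)"
  have "countable \<B>" unfolding \<B>_def using C by (intro countable_image countable_SIGMA) auto
  moreover have "topological_basis \<B>"
  proof (rule topological_basisI)
    fix U :: "('a, 'b) l2 set" and x assume "open U" "x \<in> U"
    then obtain e where e: "e > 0" "ball x e \<subseteq> U" using openE by blast
    obtain n where n: "1 / real (Suc n) < e / 2" using nat_approx_posE[of "e/2"] e by auto
    obtain c where c: "c \<in> C" "dist c x < 1 / real (Suc n)"
      using C(2) closure_approachable[of x C] by (metis UNIV_I of_nat_0_less_iff zero_less_Suc zero_less_divide_1_iff)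
    have "ball c (1 / real (Suc n)) \<subseteq> ball x e"
    proof
      fix y assume "y \<in> ball c (1 / real (Suc n))"
      then show "y \<in> ball x e" using c n dist_triangle[of x y c] by (auto simp: dist_commute)
    qed
    then show "\<exists>B'\<in>\<B>. x \<in> B' \<and> B' \<subseteq> U"
      using c e(2) by (intro bexI[of _ "ball c (1 / real (Suc n))"]) (auto simp: \<B>_def)
  qed (auto simp: \<B>_def)
  ultimately show "\<exists>B :: ('a, 'b) l2 set set. countable B \<and> open = generate_topology B"
    using topological_basis_imp_subbasis by blast
qed

subsection \<open>Functions supported in a set\<close>

lemma subspace_L2_on: "subspace (L2_on D)"
  unfolding subspace_def
proof (intro conjI ballI allI)
  show "0 \<in> L2_on D" using AE_rep_zero by (auto simp: L2_on_def elim: eventually_mono)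
  show "u + v \<in> L2_on D" if "u \<in> L2_on D" "v \<in> L2_on D" for u v
  proof -
    have "AE x in lebesgue. x \<notin> D \<longrightarrow> rep_l2 u x = 0" "AE x in lebesgue. x \<notin> D \<longrightarrow> rep_l2 v x = 0"
      using that by (auto simp: L2_on_def)
    then have "AE x in lebesgue. x \<notin> D \<longrightarrow> rep_l2 (u + v) x = 0"
      using AE_rep_add[of u v] by eventually_elim auto
    then show ?thesis by (simp add: L2_on_def)
  qed
  show "r *\<^sub>R u \<in> L2_on D" if "u \<in> L2_on D" for u r
  proof -
    have "AE x in lebesgue. x \<notin> D \<longrightarrow> rep_l2 u x = 0"
      using that by (auto simp: L2_on_def)
    then have "AE x in lebesgue. x \<notin> D \<longrightarrow> rep_l2 (r *\<^sub>R u) x = 0"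
      using AE_rep_scaleR[of r u] by eventually_elim auto
    then show ?thesis by (simp add: L2_on_def)
  qed
qed

text \<open>The mass of the limit outside \<open>D\<close> is at most its squared distance to any
  element of \<open>L2_on D\<close>.\<close>

lemma closed_L2_on:
  assumes D: "D \<in> sets lebesgue"
  shows "closed (L2_on D)"
  unfolding closed_sequential_limits
proof (intro allI impI, elim conjE)
  fix s u assume s: "\<forall>n. s n \<in> L2_on D" and lim: "s \<longlonglongrightarrow> u"
  have int: "integrable lebesgue (\<lambda>x. indicator (- D) x *\<^sub>R (norm (rep_l2 u x))\<^sup>2)"
    by (intro integrable_mult_indicator integrable_norm_rep) (use D sets.compl_sets[of D lebesgue] in \<open>auto simp: Compl_eq_Diff_UNIV\<close>)
  define I where "I = (LINT x|lebesgue. indicator (- D) x *\<^sub>R (norm (rep_l2 u x))\<^sup>2)"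
  have le: "I \<le> (norm (u - s n))\<^sup>2" for n
    unfolding norm_l2_square I_def
  proof (rule integral_mono_AE[OF int integrable_norm_rep])
    have "AE x in lebesgue. x \<notin> D \<longrightarrow> rep_l2 (s n) x = 0" using s by (auto simp: L2_on_def)
    then show "AE x in lebesgue. indicator (- D) x *\<^sub>R (norm (rep_l2 u x))\<^sup>2 \<le> (norm (rep_l2 (u - s n) x))\<^sup>2"
      using AE_rep_diff[of u "s n"] by eventually_elim (auto simp: indicator_def)
  qed
  have "(\<lambda>n. (norm (u - s n))\<^sup>2) \<longlonglongrightarrow> (norm (u - u))\<^sup>2" by (intro tendsto_intros lim)
  then have "I \<le> 0" using le by (intro LIMSEQ_le_const[of "\<lambda>n. (norm (u - s n))\<^sup>2"]) auto
  moreover have "0 \<le> I" unfolding I_def by (rule integral_nonneg_AE) auto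
  ultimately have "I = 0" by simp
  then have "AE x in lebesgue. indicator (- D) x *\<^sub>R (norm (rep_l2 u x))\<^sup>2 = 0"
    unfolding I_def by (subst (asm) integral_nonneg_eq_0_iff_AE[OF int]) auto
  then show "u \<in> L2_on D" unfolding L2_on_def by (auto elim!: eventually_mono simp: indicator_def)
qed

abbreviation sq_on :: "'a::euclidean_space set \<Rightarrow> ('a \<Rightarrow> 'b::euclidean_space) \<Rightarrow> bool" where
  "sq_on D f \<equiv> square_integrable (\<lambda>x. if x \<in> D then f x else 0)"

lemma AE_rep_class_on:
  "sq_on D f \<Longrightarrow> AE x in lebesgue. rep_l2 (l2_class_on D f) x = (if x \<in> D then f x else 0)"
  unfolding l2_class_on_def by (rule AE_rep_abs_l2)

lemma class_on_in_L2_on: "sq_on D f \<Longrightarrow> l2_class_on D f \<in> L2_on D"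
  using AE_rep_class_on[of D f] by (auto simp: L2_on_def elim: eventually_mono)

lemma L2_on_eqI:
  assumes "u \<in> L2_on D" "v \<in> L2_on D" "AE x in lebesgue. x \<in> D \<longrightarrow> rep_l2 u x = rep_l2 v x"
  shows "u = v"
proof (rule l2_eqI)
  have "AE x in lebesgue. x \<notin> D \<longrightarrow> rep_l2 u x = 0" "AE x in lebesgue. x \<notin> D \<longrightarrow> rep_l2 v x = 0"
    using assms by (auto simp: L2_on_def)
  then show "AE x in lebesgue. rep_l2 u x = rep_l2 v x"
    using assms(3) by eventually_elim auto
qed

lemma AE_lebesgue_on: "D \<in> sets lebesgue \<Longrightarrow> (AE x in lebesgue_on D. P x) \<longleftrightarrow> (AE x in lebesgue. x \<in> D \<longrightarrow> P x)"
  by (subst AE_restrict_space_iff) auto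

lemma sq_on_bound:
  assumes D: "D \<in> sets lebesgue" and f: "f \<in> borel_measurable (lebesgue_on D)" and g: "square_integrable g"
    and le: "AE x in lebesgue. x \<in> D \<longrightarrow> norm (f x) \<le> K * norm (g x)"
  shows "sq_on D f"
proof (rule square_integrable_bound[OF _ g])
  show "(\<lambda>x. if x \<in> D then f x else 0) \<in> borel_measurable lebesgue"
    using D f by (rule borel_measurable_if_I[rotated])
  show "AE x in lebesgue. norm (if x \<in> D then f x else 0) \<le> \<bar>K\<bar> * norm (g x)"
    using le by eventually_elim (auto intro!: order_trans[OF _ mult_right_mono[of K "\<bar>K\<bar>"]])
qed

lemma rep_l2_measurable_on: "rep_l2 u \<in> borel_measurable (lebesgue_on D)"
  by (rule measurable_restrict_space1) measurable

lemma norm_class_on_le: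
  assumes K: "0 \<le> K" and sq: "sq_on D f"
    and le: "AE x in lebesgue. x \<in> D \<longrightarrow> norm (f x) \<le> K * norm (rep_l2 u x)"
  shows "norm (l2_class_on D f) \<le> K * norm u"
proof (rule norm_l2_le[OF K])
  show "AE x in lebesgue. norm (rep_l2 (l2_class_on D f) x) \<le> K * norm (rep_l2 u x)"
    using AE_rep_class_on[OF sq] le by eventually_elim (use K in auto)
qed

lemma set_integral_inner_L2_on:
  assumes D: "D \<in> sets lebesgue" and uv: "u \<in> L2_on D \<or> v \<in> L2_on D"
  shows "(LINT x:D|lebesgue. inner (rep_l2 u x) (rep_l2 v x)) = inner u v"
  unfolding inner_l2_rep set_lebesgue_integral_def
proof (rule integral_cong_AE)
  have "AE x in lebesgue. x \<notin> D \<longrightarrow> inner (rep_l2 u x) (rep_l2 v x) = 0"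
    using uv by (auto simp: L2_on_def elim: eventually_mono)
  then show "AE x in lebesgue. indicator D x *\<^sub>R inner (rep_l2 u x) (rep_l2 v x) = inner (rep_l2 u x) (rep_l2 v x)"
    by eventually_elim (auto simp: indicator_def)
  show "(\<lambda>x. indicator D x *\<^sub>R inner (rep_l2 u x) (rep_l2 v x)) \<in> borel_measurable lebesgue"
    using D by (intro borel_measurable_scaleR borel_measurable_indicator borel_measurable_inner rep_l2_measurable)
qed measurable

section \<open>Test fields\<close>

subsection \<open>Bump functions\<close>

text \<open>All derivatives of \<open>exp (- 1 / t)\<close> on the positive half-line are combinations of these functions.\<close>

definition bump :: "nat \<Rightarrow> real \<Rightarrow> real" where
  "bump k t = (if t > 0 then exp (- 1 / t) / t ^ k else 0)"

text \<open>\<open>(1 + y / n) ^ n \<le> exp y\<close> at \<open>y = 1 / t\<close> and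
  \<open>n = k + 2\<close> gives \<open>exp (- 1 / t) \<le> (n * t) ^ n\<close>. The two powers of
  \<open>t\<close> that survive the division by \<open>t ^ k\<close> give derivative zero at the
  origin.\<close>

lemma bump_le:
  assumes "t > 0"
  shows "bump k t \<le> real (k + 2) ^ (k + 2) * t\<^sup>2"
proof -
  let ?n = "k + 2"
  have "(1 / (real ?n * t)) ^ ?n \<le> (1 + (1 / t) / real ?n) ^ ?n"
    using assms by (intro power_mono) (auto simp: field_simps)
  also have "\<dots> \<le> exp (1 / t)"
    using assms by (intro exp_ge_one_plus_x_over_n_power_n) (auto intro: order_trans[of _ 0])
  finally have le: "1 / (real ?n * t) ^ ?n \<le> exp (1 / t)" by (simp only: power_one_over)
  define P where "P = (real ?n * t) ^ ?n"
  have "P > 0" using assms by (simp add: P_def)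
  have "exp (- 1 / t) = inverse (exp (1 / t))" by (simp add: exp_minus[symmetric])
  also have "\<dots> \<le> inverse (1 / P)"
    using le \<open>P > 0\<close> unfolding P_def[symmetric] by (intro le_imp_inverse_le) auto
  also have "\<dots> = real ?n ^ ?n * t\<^sup>2 * t ^ k"
    unfolding P_def by (simp add: power_mult_distrib power_add power2_eq_square)
  finally have "exp (- 1 / t) / t ^ k \<le> real ?n ^ ?n * t\<^sup>2"
    using assms by (simp add: pos_divide_le_eq)
  then show ?thesis using assms by (simp add: bump_def)
qed

lemma bump_nonneg: "0 \<le> bump k t"
  by (simp add: bump_def)

text \<open>Differentiation stays within the linear span of the family: for \<open>t > 0\<close> it
  only divides by further powers of \<open>t\<close>, and at the origin \<open>bump_le\<close> sends
  the difference quotients to zero.\<close>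

lemma DERIV_bump:
  "(bump k has_real_derivative (bump (k + 2) t - real k * bump (k + 1) t)) (at t)"
proof (cases t "0 :: real" rule: linorder_cases)
  case less
  have "((\<lambda>_. 0) has_real_derivative 0) (at t)" by simp
  then have "(bump k has_real_derivative 0) (at t)"
    by (rule has_field_derivative_transform_within_open[of _ _ _ "{..<0}"]) (use less in \<open>auto simp: bump_def\<close>)
  then show ?thesis using less by (simp add: bump_def)
next
  case equal
  define c where "c = real (k + 2) ^ (k + 2)"
  have c: "c \<ge> 0" "\<And>t. t > 0 \<Longrightarrow> bump k t \<le> c * t\<^sup>2" using bump_le[of _ k] by (auto simp: c_def)
  have "((\<lambda>h. (bump k h - bump k 0) / (h - 0)) \<longlongrightarrow> 0) (at 0)"
  proof (rule Lim_null_comparison)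
    show "\<forall>\<^sub>F h in at 0. norm ((bump k h - bump k 0) / (h - 0)) \<le> c * \<bar>h\<bar>"
    proof (rule always_eventually, rule allI)
      fix h :: real
      show "norm ((bump k h - bump k 0) / (h - 0)) \<le> c * \<bar>h\<bar>"
      proof (cases "h > 0")
        case True
        then show ?thesis using c(2)[OF True] bump_nonneg[of k h]
          by (simp add: bump_def[of k 0] field_simps power2_eq_square)
      qed (use c(1) in \<open>simp add: bump_def mult_nonneg_nonpos\<close>)
    qed
    have "((\<lambda>h. c * \<bar>h\<bar>) \<longlongrightarrow> c * \<bar>0\<bar>) (at 0)" by (intro tendsto_intros)
    then show "((\<lambda>h. c * \<bar>h\<bar>) \<longlongrightarrow> 0) (at 0)" by simp
  qed
  then have "(bump k has_real_derivative 0) (at 0)" by (simp add: has_field_derivative_iff)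
  then show ?thesis using equal by (simp add: bump_def)
next
  case greater
  have "((\<lambda>s. exp (- 1 / s) / s ^ k) has_real_derivative
      (exp (- 1 / t) * (1 / t\<^sup>2) * t ^ k - exp (- 1 / t) * (real k * t ^ (k - 1))) / (t ^ k * t ^ k)) (at t)"
    using greater by (auto intro!: derivative_eq_intros simp: power2_eq_square)
  then have "(bump k has_real_derivative
      (exp (- 1 / t) * (1 / t\<^sup>2) * t ^ k - exp (- 1 / t) * (real k * t ^ (k - 1))) / (t ^ k * t ^ k)) (at t)"
    by (rule has_field_derivative_transform_within_open[of _ _ _ "{0<..}"]) (use greater in \<open>auto simp: bump_def\<close>)
  moreover have "(exp (- 1 / t) * (1 / t\<^sup>2) * t ^ k - exp (- 1 / t) * (real k * t ^ (k - 1))) / (t ^ k * t ^ k)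
      = bump (k + 2) t - real k * bump (k + 1) t"
  proof (cases k)
    case 0 then show ?thesis using greater by (simp add: bump_def power2_eq_square)
  next
    case (Suc m)
    then show ?thesis using greater by (simp add: bump_def field_simps power_add power2_eq_square)
  qed
  ultimately show ?thesis by simp
qed

text \<open>Smoothness speaks of all iterated partial derivatives; a class that is closed under a
  single partial derivative settles them all by induction on the list of indices.\<close>

inductive_set bump_algebra :: "(real^'n::finite \<Rightarrow> real) set" where
  const: "(\<lambda>_. r) \<in> bump_algebra"
| coord: "(\<lambda>x. x $ i) \<in> bump_algebra"
| bump: "f \<in> bump_algebra \<Longrightarrow> (\<lambda>x. bump k (f x)) \<in> bump_algebra"
| add: "f \<in> bump_algebra \<Longrightarrow> g \<in> bump_algebra \<Longrightarrow> (\<lambda>x. f x + g x) \<in> bump_algebra"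
| mult: "f \<in> bump_algebra \<Longrightarrow> g \<in> bump_algebra \<Longrightarrow> (\<lambda>x. f x * g x) \<in> bump_algebra"

lemma bump_algebra_prod:
  "(\<And>i. i \<in> I \<Longrightarrow> f i \<in> bump_algebra) \<Longrightarrow> (\<lambda>x. \<Prod>i\<in>I. f i x) \<in> bump_algebra"
  by (induction I rule: infinite_finite_induct) (auto intro: bump_algebra.intros)

lemma bump_algebra_derivative:
  fixes f :: "real^'n::finite \<Rightarrow> real"
  assumes "f \<in> bump_algebra"
  shows "\<exists>D. (\<forall>x. (f has_derivative D x) (at x)) \<and> (\<forall>i. (\<lambda>x. D x (axis i 1)) \<in> bump_algebra)"
  using assms
proof induction
  case (const r)
  show ?case by (rule exI[of _ "\<lambda>_ _. 0"]) (auto intro: bump_algebra.const)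
next
  case (coord i)
  have "((\<lambda>x. x $ i) has_derivative (\<lambda>h. h $ i)) (at x)" for x :: "real^'n"
    by (intro bounded_linear_imp_has_derivative bounded_linear_vec_nth)
  then show ?case
    by (intro exI[of _ "\<lambda>_ h. h $ i"]) (auto intro: bump_algebra.const)
next
  case (bump f k)
  then obtain D where D: "\<And>x. (f has_derivative D x) (at x)" "\<And>i. (\<lambda>x. D x (axis i 1)) \<in> bump_algebra"
    by blast
  define E where "E x h = D x h * (bump (k + 2) (f x) - real k * bump (k + 1) (f x))" for x h
  have "((\<lambda>x. bump k (f x)) has_derivative E x) (at x)" for x
    unfolding E_def
    using has_derivative_compose[OF D(1) DERIV_bump[of k "f x", unfolded has_field_derivative_def]]
    by (simp add: mult.commute)
  moreover have "(\<lambda>x. E x (axis i 1)) \<in> bump_algebra" for i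
  proof -
    have "(\<lambda>x. D x (axis i 1) * (bump (k + 2) (f x) + (- real k) * bump (k + 1) (f x))) \<in> bump_algebra"
      using bump.hyps D(2) by (intro bump_algebra.intros)
    then show ?thesis by (simp add: E_def)
  qed
  ultimately show ?case by blast
next
  case (add f g)
  then obtain D E where D: "\<And>x. (f has_derivative D x) (at x)" "\<And>i. (\<lambda>x. D x (axis i 1)) \<in> bump_algebra"
    and E: "\<And>x. (g has_derivative E x) (at x)" "\<And>i. (\<lambda>x. E x (axis i 1)) \<in> bump_algebra" by blast
  show ?case
    by (rule exI[of _ "\<lambda>x h. D x h + E x h"]) (auto intro!: has_derivative_add D E bump_algebra.add)
next
  case (mult f g)
  then obtain D E where D: "\<And>x. (f has_derivative D x) (at x)" "\<And>i. (\<lambda>x. D x (axis i 1)) \<in> bump_algebra"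
    and E: "\<And>x. (g has_derivative E x) (at x)" "\<And>i. (\<lambda>x. E x (axis i 1)) \<in> bump_algebra" by blast
  show ?case
    by (rule exI[of _ "\<lambda>x h. f x * E x h + D x h * g x"])
      (auto intro!: has_derivative_mult D E bump_algebra.intros mult)
qed

lemma bump_algebra_smooth:
  fixes f :: "real^'n::finite \<Rightarrow> real"
  assumes "f \<in> bump_algebra"
  shows "smooth f"
proof -
  have pd: "partial_deriv i f \<in> bump_algebra" if f: "f \<in> bump_algebra" for i and f :: "real^'n \<Rightarrow> real"
  proof -
    obtain D where D: "\<And>x. (f has_derivative D x) (at x)" "\<And>i. (\<lambda>x. D x (axis i 1)) \<in> bump_algebra"
      using bump_algebra_derivative[OF f] by blast
    have "partial_deriv i f = (\<lambda>x. D x (axis i 1))"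
      by (rule ext) (simp add: partial_deriv_def frechet_derivative_at[OF D(1), symmetric])
    then show ?thesis using D(2) by simp
  qed
  have "foldr partial_deriv is f \<in> bump_algebra" for "is"
    by (induction "is") (auto intro: pd assms)
  then show ?thesis
    unfolding smooth_def differentiable_def using bump_algebra_derivative by blast
qed

text \<open>Inside the box the argument of each factor grows like \<open>Suc n\<close>, and
  \<open>exp (- 1 / t)\<close> tends to 1 for large \<open>t\<close>; outside some factor is zero.
  So these smooth functions converge to the indicator of the box.\<close>

definition box_bump :: "real^'n::finite \<Rightarrow> real^'n \<Rightarrow> nat \<Rightarrow> real^'n \<Rightarrow> real" where
  "box_bump a b n x = (\<Prod>i\<in>UNIV. bump 0 (real (Suc n) * ((x $ i - a $ i) * (b $ i - x $ i))))"

lemma box_bump_smooth: "smooth (box_bump a b n)"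
proof (rule bump_algebra_smooth)
  have "(\<lambda>x. \<Prod>i\<in>UNIV. bump 0 (real (Suc n) * ((x $ i + - a $ i) * (b $ i + (-1) * x $ i)))) \<in> bump_algebra"
    by (intro bump_algebra_prod bump_algebra.intros)
  then show "box_bump a b n \<in> bump_algebra" by (simp add: box_bump_def[abs_def])
qed

lemma box_bump_bounds: "0 \<le> box_bump a b n x" "box_bump a b n x \<le> 1"
proof -
  show "0 \<le> box_bump a b n x" unfolding box_bump_def by (intro prod_nonneg) (simp add: bump_nonneg)
  have "box_bump a b n x \<le> (\<Prod>i\<in>(UNIV::'a set). 1)" unfolding box_bump_def
    by (intro prod_mono) (auto simp: bump_def)
  then show "box_bump a b n x \<le> 1" by simp
qed

text \<open>With \<open>a $ i < b $ i\<close> the factors \<open>x $ i - a $ i\<close> and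
  \<open>b $ i - x $ i\<close> cannot both be negative.\<close>

lemma box_bump_outside:
  assumes "\<And>i. a $ i < b $ i" "x \<notin> box a b"
  shows "box_bump a b n x = 0"
proof -
  obtain i where i: "\<not> (a $ i < x $ i \<and> x $ i < b $ i)" using assms(2) by (auto simp: mem_box_cart)
  then have "\<not> 0 < (x $ i - a $ i) * (b $ i - x $ i)"
    using assms(1)[of i] by (auto simp: zero_less_mult_iff)
  then have "bump 0 (real (Suc n) * ((x $ i - a $ i) * (b $ i - x $ i))) = 0"
    unfolding bump_def by (auto simp: zero_less_mult_iff)
  then show ?thesis unfolding box_bump_def by (intro prod_zero) auto
qed

lemma box_bump_limit:
  assumes "x \<in> box a b"
  shows "(\<lambda>n. box_bump a b n x) \<longlonglongrightarrow> 1"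
proof -
  have "(\<lambda>n. bump 0 (real (Suc n) * t)) \<longlonglongrightarrow> 1" if t: "t > 0" for t
  proof -
    have "(\<lambda>n. (- 1 / t) * inverse (real (Suc n))) \<longlonglongrightarrow> (- 1 / t) * 0"
      by (intro tendsto_mult tendsto_const LIMSEQ_inverse_real_of_nat)
    then have "(\<lambda>n. exp ((- 1 / t) * inverse (real (Suc n)))) \<longlonglongrightarrow> exp 0"
      by (intro tendsto_exp) simp
    moreover have "bump 0 (real (Suc n) * t) = exp ((- 1 / t) * inverse (real (Suc n)))" for n
      using t by (simp add: bump_def field_simps del: of_nat_Suc)
    ultimately show ?thesis by simp
  qed
  moreover have "(x $ i - a $ i) * (b $ i - x $ i) > 0" for i
    using assms by (auto simp: mem_box_cart)
  ultimately have "(\<lambda>n. box_bump a b n x) \<longlonglongrightarrow> (\<Prod>i\<in>(UNIV::'a set). 1)"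
    unfolding box_bump_def by (intro tendsto_prod) auto
  then show ?thesis by simp
qed

lemma box_bump_test_field:
  fixes a b :: "real^3"
  assumes ab: "\<And>i. a $ i < b $ i" and D: "closure (box a b) \<subseteq> D"
  shows "(\<lambda>x. box_bump a b n x *\<^sub>R axis j 1) \<in> test_fields D"
proof -
  have "closure {x. box_bump a b n x *\<^sub>R axis j (1::real) \<noteq> 0} \<subseteq> closure (box a b)"
    using box_bump_outside[OF ab] by (intro closure_mono) auto
  moreover have "compact (closure {x. box_bump a b n x *\<^sub>R axis j (1::real) \<noteq> 0})"
    unfolding compact_closure using box_bump_outside[OF ab] by (intro bounded_subset[OF bounded_box[of a b]]) auto
  moreover have "smooth (\<lambda>x. (box_bump a b n x *\<^sub>R axis j (1::real)) $ i)" for i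
  proof (cases "i = j")
    case True
    then have "(\<lambda>x. (box_bump a b n x *\<^sub>R axis j (1::real)) $ i) = box_bump a b n"
      by (auto simp: axis_def)
    then show ?thesis using box_bump_smooth[of a b n] by simp
  next
    case False
    then have "(\<lambda>x. (box_bump a b n x *\<^sub>R axis j (1::real)) $ i) = (\<lambda>_. 0)"
      by (auto simp: axis_def)
    then show ?thesis using bump_algebra_smooth[OF bump_algebra.const[of 0]] by simp
  qed
  ultimately show ?thesis
    unfolding test_fields_def using D by auto
qed

subsection \<open>Regularity of test fields\<close>

lemma smooth_partial_deriv: "smooth f \<Longrightarrow> smooth (partial_deriv i f)"
  unfolding smooth_def
proof (intro allI)
  fix "is" x assume "\<forall>is x. foldr partial_deriv is f differentiable at x"
  then have "foldr partial_deriv (is @ [i]) f differentiable at x" by blast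
  then show "foldr partial_deriv is (partial_deriv i f) differentiable at x" by simp
qed

lemma smooth_has_derivative:
  assumes "smooth f"
  shows "(f has_derivative frechet_derivative f (at x)) (at x)"
proof -
  have "foldr partial_deriv [] f differentiable at x" using assms unfolding smooth_def by blast
  then show ?thesis by (simp add: frechet_derivative_works)
qed

lemma smooth_continuous: "smooth f \<Longrightarrow> continuous_on UNIV f"
  by (intro continuous_at_imp_continuous_on ballI has_derivative_continuous[OF smooth_has_derivative])

lemma test_field_component:
  assumes "\<phi> \<in> test_fields D"
  shows "smooth (\<lambda>x. \<phi> x $ i)" "continuous_on UNIV (\<lambda>x. \<phi> x $ i)"
    "continuous_on UNIV (partial_deriv k (\<lambda>x. \<phi> x $ i))"
proof -
  show s: "smooth (\<lambda>x. \<phi> x $ i)" using assms by (simp add: test_fields_def)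
  show "continuous_on UNIV (\<lambda>x. \<phi> x $ i)" by (rule smooth_continuous[OF s])
  show "continuous_on UNIV (partial_deriv k (\<lambda>x. \<phi> x $ i))"
    by (rule smooth_continuous[OF smooth_partial_deriv[OF s]])
qed

lemma has_derivative_zero_outside:
  assumes "closed K" "x \<notin> K" "\<And>x. x \<notin> K \<Longrightarrow> f x = 0" "(f has_derivative f') (at x)"
  shows "f' = (\<lambda>_. 0)"
proof -
  have "((\<lambda>_. 0) has_derivative (\<lambda>_. 0)) (at x)" by simp
  then have "(f has_derivative (\<lambda>_. 0)) (at x)"
    by (rule has_derivative_transform_within_open[of _ _ _ _ "- K"]) (use assms in auto)
  then show ?thesis using has_derivative_unique[OF assms(4)] by blast
qed

lemma continuous_on_component_wise:
  fixes f :: "'a::topological_space \<Rightarrow> real^'n::finite"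
  assumes "\<And>i. continuous_on S (\<lambda>x. f x $ i)"
  shows "continuous_on S f"
  using continuous_on_vec_lambda[of S "\<lambda>i x. f x $ i"] assms by simp

lemma test_field_support:
  assumes "\<phi> \<in> test_fields D"
  obtains K where "compact K" "K \<subseteq> D" "\<And>x. x \<notin> K \<Longrightarrow> \<phi> x = 0" "\<And>x i k. x \<notin> K \<Longrightarrow> partial_deriv k (\<lambda>x. \<phi> x $ i) x = 0"
    "\<And>x. x \<notin> K \<Longrightarrow> curl \<phi> x = 0"
proof -
  define K where "K = closure {x. \<phi> x \<noteq> 0}"
  have K: "compact K" "K \<subseteq> D" using assms by (auto simp: test_fields_def K_def)
  have out: "\<phi> x = 0" if "x \<notin> K" for x using that closure_subset[of "{x. \<phi> x \<noteq> 0}"] by (auto simp: K_def)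
  have pd: "partial_deriv k (\<lambda>x. \<phi> x $ i) x = 0" if "x \<notin> K" for x i k
  proof -
    have "frechet_derivative (\<lambda>x. \<phi> x $ i) (at x) = (\<lambda>_. 0)"
    proof (rule has_derivative_zero_outside)
      show "closed K" using K compact_imp_closed by blast
      show "((\<lambda>x. \<phi> x $ i) has_derivative frechet_derivative (\<lambda>x. \<phi> x $ i) (at x)) (at x)"
        by (rule smooth_has_derivative[OF test_field_component(1)[OF assms]])
    qed (use that out in auto)
    then show ?thesis by (simp add: partial_deriv_def)
  qed
  have "curl \<phi> x = 0" if "x \<notin> K" for x
    unfolding curl_def pd[OF that] by (simp add: vec_eq_iff forall_3)
  with K out pd show ?thesis by (rule that)
qed

lemma continuous_on_curl:
  assumes "\<phi> \<in> test_fields D"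
  shows "continuous_on UNIV (curl \<phi>)"
proof (rule continuous_on_component_wise)
  note c = test_field_component(3)[OF assms]
  have "\<forall>i. continuous_on UNIV (\<lambda>x. curl \<phi> x $ i)"
    unfolding forall_3 curl_def vector_3 by (intro conjI continuous_intros c)
  then show "continuous_on UNIV (\<lambda>x. curl \<phi> x $ i)" for i by blast
qed

lemma continuous_on_test_field: "\<phi> \<in> test_fields D \<Longrightarrow> continuous_on UNIV \<phi>"
  by (rule continuous_on_component_wise) (rule test_field_component(2))

lemma integrable_compact_support:
  fixes f :: "'a::euclidean_space \<Rightarrow> 'b::{banach,second_countable_topology}"
  assumes "continuous_on UNIV f" "compact K" "\<And>x. x \<notin> K \<Longrightarrow> f x = 0"
  shows "integrable lborel f" "integrable lebesgue f"
proof -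
  have "integrable lborel (\<lambda>x. indicator K x *\<^sub>R f x)"
    by (rule borel_integrable_compact[OF assms(2) continuous_on_subset[OF assms(1)]]) auto
  also have "(\<lambda>x. indicator K x *\<^sub>R f x) = f" using assms(3) by (auto simp: indicator_def)
  finally show i: "integrable lborel f" .
  have "f \<in> borel_measurable lborel" using i by auto
  with i show "integrable lebesgue f" by (simp add: integrable_completion)
qed

lemma square_integrable_compact_support:
  fixes f :: "'a::euclidean_space \<Rightarrow> 'b::euclidean_space"
  assumes f: "continuous_on UNIV f" "compact K" "\<And>x. x \<notin> K \<Longrightarrow> f x = 0"
  shows "square_integrable f"
  unfolding square_integrable_def
proof
  show "f \<in> borel_measurable lebesgue" using integrable_compact_support(2)[OF f] by auto
  show "integrable lebesgue (\<lambda>x. (norm (f x))\<^sup>2)"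
    by (rule integrable_compact_support(2)[of _ K]) (use f in \<open>auto intro!: continuous_intros\<close>)
qed

lemma square_integrable_test_field:
  assumes "\<phi> \<in> test_fields D"
  shows "square_integrable \<phi>" "square_integrable (curl \<phi>)"
proof -
  obtain K where K: "compact K" "K \<subseteq> D" "\<And>x. x \<notin> K \<Longrightarrow> \<phi> x = 0"
    "\<And>x i k. x \<notin> K \<Longrightarrow> partial_deriv k (\<lambda>x. \<phi> x $ i) x = 0" "\<And>x. x \<notin> K \<Longrightarrow> curl \<phi> x = 0"
    by (rule test_field_support[OF assms], rule that)
  show "square_integrable \<phi>" by (rule square_integrable_compact_support[OF continuous_on_test_field[OF assms] K(1,3)])
  show "square_integrable (curl \<phi>)" by (rule square_integrable_compact_support[OF continuous_on_curl[OF assms] K(1,5)])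
qed

lemma class_test_field_in:
  assumes "\<phi> \<in> test_fields D"
  shows "abs_l2 \<phi> \<in> L2_on D" "abs_l2 (curl \<phi>) \<in> L2_on D"
proof -
  obtain K where K: "compact K" "K \<subseteq> D" "\<And>x. x \<notin> K \<Longrightarrow> \<phi> x = 0"
    "\<And>x i k. x \<notin> K \<Longrightarrow> partial_deriv k (\<lambda>x. \<phi> x $ i) x = 0" "\<And>x. x \<notin> K \<Longrightarrow> curl \<phi> x = 0"
    by (rule test_field_support[OF assms], rule that)
  have out: "x \<notin> K" if "x \<notin> D" for x using that K(2) by blast
  show "abs_l2 \<phi> \<in> L2_on D"
    using AE_rep_abs_l2[OF square_integrable_test_field(1)[OF assms]] K(3)[OF out] unfolding L2_on_def
    by (auto elim!: eventually_mono)
  show "abs_l2 (curl \<phi>) \<in> L2_on D"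
    using AE_rep_abs_l2[OF square_integrable_test_field(2)[OF assms]] K(5)[OF out] unfolding L2_on_def
    by (auto elim!: eventually_mono)
qed

lemma set_integral_inner_abs_l2:
  assumes "D \<in> sets lebesgue" "u \<in> L2_on D" "square_integrable f"
  shows "(LINT x:D|lebesgue. inner (rep_l2 u x) (f x)) = inner u (abs_l2 f)"
proof -
  have [measurable]: "f \<in> borel_measurable lebesgue" using assms by (simp add: square_integrable_def)
  have "(LINT x:D|lebesgue. inner (rep_l2 u x) (f x)) = (LINT x:D|lebesgue. inner (rep_l2 u x) (rep_l2 (abs_l2 f) x))"
    unfolding set_lebesgue_integral_def
  proof (rule integral_cong_AE)
    show "(\<lambda>x. indicator D x *\<^sub>R inner (rep_l2 u x) (f x)) \<in> borel_measurable lebesgue"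
      using assms(1) by measurable
    show "(\<lambda>x. indicator D x *\<^sub>R inner (rep_l2 u x) (rep_l2 (abs_l2 f) x)) \<in> borel_measurable lebesgue"
      using assms(1) by measurable
    show "AE x in lebesgue. indicator D x *\<^sub>R inner (rep_l2 u x) (f x) = indicator D x *\<^sub>R inner (rep_l2 u x) (rep_l2 (abs_l2 f) x)"
      using AE_rep_abs_l2[OF assms(3)] by eventually_elim simp
  qed
  also have "\<dots> = inner u (abs_l2 f)" using assms by (intro set_integral_inner_L2_on) auto
  finally show ?thesis .
qed

text \<open>The fundamental lemma of the calculus of variations. Test fields that converge boundedly
  to the indicator of a box times a unit vector make the integral of each component over the box
  vanish.\<close>

lemma test_fields_dense:
  assumes D: "open D" and u: "u \<in> L2_on D" and 0: "\<And>\<phi>. \<phi> \<in> test_fields D \<Longrightarrow> inner u (abs_l2 \<phi>) = 0"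
  shows "u = 0"
proof (rule L2_on_eqI[OF u subspace_0[OF subspace_L2_on]])
  have Dm: "D \<in> sets lebesgue" using D by simp
  have "AE x in lebesgue. x \<in> D \<longrightarrow> rep_l2 u x \<bullet> axis j 1 = 0" for j
  proof (rule AE_zero_on_open[OF D])
    fix B :: "(real^3) set" assume B: "B \<in> rational_boxes" "closure B \<subseteq> D"
    then obtain a b where Bb: "B = box a b" by (auto simp: rational_boxes_def)
    show int: "set_integrable lebesgue B (\<lambda>x. rep_l2 u x \<bullet> axis j 1)" unfolding Bb by (rule set_integrable_rep_box)
    show "(LINT x:B|lebesgue. rep_l2 u x \<bullet> axis j 1) = 0"
    proof (cases "B = {}")
      case False
      then have ab: "a $ i < b $ i" for i using Bb by (auto simp: mem_box_cart) (meson less_trans)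
      define \<phi> where "\<phi> n x = box_bump a b n x *\<^sub>R axis j (1::real)" for n x
      have t: "\<phi> n \<in> test_fields D" for n
        unfolding \<phi>_def using box_bump_test_field[OF ab] B Bb by auto
      have z: "(LINT x|lebesgue. rep_l2 u x \<bullet> \<phi> n x) = 0" for n
      proof -
        obtain K where K: "compact K" "K \<subseteq> D" "\<And>x. x \<notin> K \<Longrightarrow> \<phi> n x = 0"
    "\<And>x i k. x \<notin> K \<Longrightarrow> partial_deriv k (\<lambda>x. \<phi> n x $ i) x = 0" "\<And>x. x \<notin> K \<Longrightarrow> curl (\<phi> n) x = 0"
    by (rule test_field_support[OF t[of n]], rule that)
        have "(LINT x|lebesgue. rep_l2 u x \<bullet> \<phi> n x) = (LINT x:D|lebesgue. rep_l2 u x \<bullet> \<phi> n x)"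
          unfolding set_lebesgue_integral_def
        proof (intro Bochner_Integration.integral_cong refl)
          fix x show "rep_l2 u x \<bullet> \<phi> n x = indicator D x *\<^sub>R (rep_l2 u x \<bullet> \<phi> n x)"
            using K(3)[of x] K(2) by (cases "x \<in> K") (auto simp: indicator_def)
        qed
        also have "\<dots> = 0"
          using set_integral_inner_abs_l2[OF Dm u square_integrable_test_field(1)[OF t]] 0[OF t] by simp
        finally show ?thesis .
      qed
      have "(\<lambda>n. LINT x|lebesgue. rep_l2 u x \<bullet> \<phi> n x) \<longlonglongrightarrow> (LINT x|lebesgue. indicator B x *\<^sub>R (rep_l2 u x \<bullet> axis j 1))"
      proof (rule integral_dominated_convergence)
        show "integrable lebesgue (\<lambda>x. norm (indicator B x *\<^sub>R (rep_l2 u x \<bullet> axis j 1)))"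
          using int unfolding set_integrable_def by (rule integrable_norm)
        show "AE x in lebesgue. (\<lambda>n. rep_l2 u x \<bullet> \<phi> n x) \<longlonglongrightarrow> indicator B x *\<^sub>R (rep_l2 u x \<bullet> axis j 1)"
        proof (rule AE_I2)
          fix x
          show "(\<lambda>n. rep_l2 u x \<bullet> \<phi> n x) \<longlonglongrightarrow> indicator B x *\<^sub>R (rep_l2 u x \<bullet> axis j 1)"
          proof (cases "x \<in> B")
            case True
            have "(\<lambda>n. rep_l2 u x \<bullet> \<phi> n x) \<longlonglongrightarrow> rep_l2 u x \<bullet> (1 *\<^sub>R axis j 1)"
              unfolding \<phi>_def using True Bb by (intro tendsto_intros box_bump_limit) auto
            then show ?thesis using True by simp
          next
            case False
            then show ?thesis using box_bump_outside[OF ab, of x] Bb by (simp add: \<phi>_def)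
          qed
        qed
        show "AE x in lebesgue. norm (rep_l2 u x \<bullet> \<phi> n x) \<le> norm (indicator B x *\<^sub>R (rep_l2 u x \<bullet> axis j 1))" for n
        proof (rule AE_I2)
          fix x
          have "box_bump a b n x * \<bar>rep_l2 u x \<bullet> axis j 1\<bar> \<le> indicator B x * \<bar>rep_l2 u x \<bullet> axis j 1\<bar>"
            using box_bump_bounds[of a b n x] box_bump_outside[OF ab, of x] Bb
            by (intro mult_right_mono) (auto simp: indicator_def)
          then show "norm (rep_l2 u x \<bullet> \<phi> n x) \<le> norm (indicator B x *\<^sub>R (rep_l2 u x \<bullet> axis j 1))"
            using box_bump_bounds[of a b n x] by (simp add: \<phi>_def abs_mult)
        qed
        show "(\<lambda>x. rep_l2 u x \<bullet> \<phi> n x) \<in> borel_measurable lebesgue" for n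
          using square_integrable_test_field(1)[OF t[of n]]
          by (intro borel_measurable_inner rep_l2_measurable) (simp add: square_integrable_def)
        show "(\<lambda>x. indicator B x *\<^sub>R (rep_l2 u x \<bullet> axis j 1)) \<in> borel_measurable lebesgue"
          using int by (auto simp: set_integrable_def)
      qed
      then show ?thesis unfolding z set_lebesgue_integral_def by (simp add: LIMSEQ_const_iff)
    qed (simp add: set_lebesgue_integral_def)
  qed
  then have "AE x in lebesgue. \<forall>j. x \<in> D \<longrightarrow> rep_l2 u x \<bullet> axis j 1 = 0" by (subst AE_all_countable) blast
  then show "AE x in lebesgue. x \<in> D \<longrightarrow> rep_l2 u x = rep_l2 0 x"
    using AE_rep_zero[where 'a="real^3" and 'b="real^3"] by eventually_elim (simp add: vec_eq_iff inner_axis)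
qed

subsection \<open>Integration by parts\<close>

text \<open>The integrals of the difference quotients of \<open>h\<close> vanish by translation invariance.\<close>

lemma integral_derivative_compact_support:
  fixes h :: "'a::euclidean_space \<Rightarrow> real"
  assumes h: "\<And>x. (h has_derivative D x) (at x)" and c: "continuous_on UNIV (\<lambda>x. D x e)"
    and K: "compact K" and out: "\<And>x. x \<notin> K \<Longrightarrow> h x = 0"
  shows "(LINT x|lebesgue. D x e) = 0"
proof -
  have hc: "continuous_on UNIV h" by (intro continuous_at_imp_continuous_on ballI has_derivative_continuous[OF h])
  have Dout: "D x e = 0" if "x \<notin> K" for x
    using has_derivative_zero_outside[OF compact_imp_closed[OF K] that out h] by simp
  have "compact ((\<lambda>x. D x e) ` K)" using K c by (intro compact_continuous_image) (auto intro: continuous_on_subset)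
  then obtain B where "\<And>x. x \<in> K \<Longrightarrow> \<bar>D x e\<bar> \<le> B" using compact_imp_bounded bounded_iff by (metis imageI real_norm_def)
  then have B: "\<bar>D x e\<bar> \<le> \<bar>B\<bar>" for x using Dout[of x] by (cases "x \<in> K") (force intro: order_trans)+
  define r where "r n = 1 / real (Suc n)" for n
  have r: "0 < r n" "r n \<le> 1" for n by (auto simp: r_def)
  define q where "q n x = (h (x + r n *\<^sub>R e) - h x) / r n" for n x
  \<comment> \<open>Contains the support of every \<open>q n\<close>, as the shifts
    \<open>r n\<close> are at most 1; its indicator then yields one integrable bound for all
    difference quotients.\<close>
  define K' where "K' = (\<lambda>(x, t). x - t *\<^sub>R e) ` (K \<times> {0..1})"
  have K': "compact K'" unfolding K'_def case_prod_unfold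
    using K by (intro compact_continuous_image compact_Times continuous_intros) auto
  have mvt: "\<bar>h (x + t *\<^sub>R e) - h x\<bar> \<le> \<bar>B\<bar> * t" if "t > 0" for x t
  proof -
    have "((\<lambda>s. h (x + s *\<^sub>R e)) has_real_derivative D (x + s *\<^sub>R e) e) (at s)" for s
    proof -
      have "((\<lambda>s. x + s *\<^sub>R e) has_derivative (\<lambda>u. u *\<^sub>R e)) (at s)" by (auto intro!: derivative_eq_intros)
      from has_derivative_compose[OF this h]
      have "((\<lambda>s. h (x + s *\<^sub>R e)) has_derivative (\<lambda>u. D (x + s *\<^sub>R e) (u *\<^sub>R e))) (at s)" .
      moreover have "D (x + s *\<^sub>R e) (u *\<^sub>R e) = D (x + s *\<^sub>R e) e * u" for u
        using has_derivative_linear[OF h] by (simp add: linear_cmul)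
      ultimately show ?thesis by (simp add: has_field_derivative_def)
    qed
    from MVT2[OF that this] obtain z where "h (x + t *\<^sub>R e) - h (x + 0 *\<^sub>R e) = (t - 0) * D (x + z *\<^sub>R e) e" by blast
    then show ?thesis using B[of "x + z *\<^sub>R e"] that by (simp add: abs_mult mult.commute)
  qed
  have qz: "q n x = 0" if "x \<notin> K'" for n x
  proof -
    have "x \<notin> K" using that by (force simp: K'_def)
    moreover have "x + r n *\<^sub>R e \<notin> K"
      using that r[of n] unfolding K'_def
      by (metis (mono_tags, lifting) add_diff_cancel_right' atLeastAtMost_iff case_prod_conv image_eqI less_imp_le mem_Sigma_iff)
    ultimately show ?thesis by (simp add: q_def out)
  qed
  have qB: "\<bar>q n x\<bar> \<le> \<bar>B\<bar> * indicator K' x" for n x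
    using mvt[OF r(1)[of n], of x] qz[of x n] r(1)[of n]
    by (cases "x \<in> K'") (auto simp: q_def field_simps)
  have hi: "integrable lborel h" by (rule integrable_compact_support(1)[OF hc K out])
  have shift: "integrable lborel (\<lambda>x. h (x + a)) \<and> (LINT x|lborel. h (x + a)) = (LINT x|lborel. h x)" for a
  proof -
    have eq: "distr lborel borel ((+) a) = lborel" by (rule lborel_distr_plus)
    have hb: "h \<in> borel_measurable borel" using hi by auto
    have "integrable (distr lborel borel ((+) a)) h" using hi eq by simp
    then have "integrable lborel (\<lambda>x. h (a + x))" by (subst (asm) integrable_distr_eq) (use hb in auto)
    moreover have "(LINT x|distr lborel borel ((+) a). h x) = (LINT x|lborel. h (a + x))"
      by (rule integral_distr) (use hb in auto)
    ultimately show ?thesis using eq by (simp add: add.commute)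
  qed
  have q0: "(LINT x|lborel. q n x) = 0" for n
    unfolding q_def using shift[of "r n *\<^sub>R e"] hi by (simp add: Bochner_Integration.integral_diff)
  have "(\<lambda>n. LINT x|lborel. q n x) \<longlonglongrightarrow> (LINT x|lborel. D x e)"
  proof (rule integral_dominated_convergence)
    show "integrable lborel (\<lambda>x. \<bar>B\<bar> * indicator K' x)"
      using K' by (intro integrable_mult_right integrable_real_indicator)
        (use emeasure_compact_finite[OF K'] in \<open>auto simp: compact_imp_closed\<close>)
    show "AE x in lborel. norm (q n x) \<le> \<bar>B\<bar> * indicator K' x" for n using qB by simp
    show "(\<lambda>x. D x e) \<in> borel_measurable lborel" using c by (simp add: borel_measurable_continuous_onI)
    have hb: "h \<in> borel_measurable borel" using hi by auto
    show "q n \<in> borel_measurable lborel" for n unfolding q_def using hb by measurable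
    show "AE x in lborel. (\<lambda>n. q n x) \<longlonglongrightarrow> D x e"
    proof (rule AE_I2)
      fix x
      have "((\<lambda>s. x + s *\<^sub>R e) has_derivative (\<lambda>u. u *\<^sub>R e)) (at 0)" by (auto intro!: derivative_eq_intros)
      moreover have "(h has_derivative D x) (at (x + 0 *\<^sub>R e))" using h by simp
      ultimately have "((\<lambda>s. h (x + s *\<^sub>R e)) has_derivative (\<lambda>u. D x (u *\<^sub>R e))) (at 0)"
        by (rule has_derivative_compose)
      moreover have "D x (u *\<^sub>R e) = D x e * u" for u
        using has_derivative_linear[OF h] by (simp add: linear_cmul)
      ultimately have "((\<lambda>s. h (x + s *\<^sub>R e)) has_real_derivative D x e) (at 0)"
        by (simp add: has_field_derivative_def)
      then have "((\<lambda>s. (h (x + s *\<^sub>R e) - h x) / s) \<longlongrightarrow> D x e) (at 0)"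
        by (simp add: has_field_derivative_iff)
      moreover have "filterlim r (at 0) sequentially"
        unfolding filterlim_at using LIMSEQ_inverse_real_of_nat r(1)
        by (auto simp: r_def[abs_def] inverse_eq_divide)
      ultimately show "(\<lambda>n. q n x) \<longlonglongrightarrow> D x e"
        unfolding q_def by (rule filterlim_compose)
    qed
  qed
  then have "(LINT x|lborel. D x e) = 0" by (simp add: q0 LIMSEQ_const_iff)
  moreover have "(\<lambda>x. D x e) \<in> borel_measurable lborel" using c by (simp add: borel_measurable_continuous_onI)
  ultimately show ?thesis by (simp add: integral_completion)
qed

text \<open>\<open>P i j k\<close> is the partial derivative in direction \<open>i\<close> of the
  compactly supported product of the components \<open>j\<close> and \<open>k\<close>.\<close>

lemma test_field_product_rule:
  assumes \<phi>: "\<phi> \<in> test_fields D" and \<psi>: "\<psi> \<in> test_fields D"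
  defines "P \<equiv> \<lambda>i j k x. \<phi> x $ j * partial_deriv i (\<lambda>x. \<psi> x $ k) x + partial_deriv i (\<lambda>x. \<phi> x $ j) x * \<psi> x $ k"
  shows "integrable lebesgue (P i j k)" "(LINT x|lebesgue. P i j k x) = 0"
proof -
  obtain K where K: "compact K" "K \<subseteq> D" "\<And>x. x \<notin> K \<Longrightarrow> \<phi> x = 0"
    "\<And>x i k. x \<notin> K \<Longrightarrow> partial_deriv k (\<lambda>x. \<phi> x $ i) x = 0" "\<And>x. x \<notin> K \<Longrightarrow> curl \<phi> x = 0"
    by (rule test_field_support[OF \<phi>], rule that)
  have c: "continuous_on UNIV (P i j k)"
    unfolding P_def by (intro continuous_intros test_field_component(2,3)[OF \<phi>] test_field_component(2,3)[OF \<psi>])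
  show "integrable lebesgue (P i j k)"
    by (rule integrable_compact_support(2)[OF c K(1)]) (simp add: P_def K)
  define D' where "D' x h = \<phi> x $ j * frechet_derivative (\<lambda>x. \<psi> x $ k) (at x) h
      + frechet_derivative (\<lambda>x. \<phi> x $ j) (at x) h * \<psi> x $ k" for x h
  have P: "P i j k = (\<lambda>x. D' x (axis i 1))" by (simp add: P_def D'_def partial_deriv_def)
  have "((\<lambda>x. \<phi> x $ j * \<psi> x $ k) has_derivative D' x) (at x)" for x
    unfolding D'_def
    by (intro has_derivative_mult smooth_has_derivative test_field_component(1)[OF \<phi>] test_field_component(1)[OF \<psi>])
  from integral_derivative_compact_support[OF this c[unfolded P] K(1)]
  show "(LINT x|lebesgue. P i j k x) = 0" unfolding P by (simp add: K)
qed

text \<open>The difference of the two integrands is the divergence of the vector product of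
  \<open>\<phi>\<close> and \<open>\<psi>\<close>: six product derivatives with the signs of the
  permutations of the indices.\<close>

lemma curl_integration_by_parts:
  assumes \<phi>: "\<phi> \<in> test_fields D" and \<psi>: "\<psi> \<in> test_fields D"
  shows "inner (abs_l2 (curl \<phi>)) (abs_l2 \<psi>) = inner (abs_l2 \<phi>) (abs_l2 (curl \<psi>))"
proof -
  define P where "P i j k x = \<phi> x $ j * partial_deriv i (\<lambda>x. \<psi> x $ k) x + partial_deriv i (\<lambda>x. \<phi> x $ j) x * \<psi> x $ k" for i j k x
  have P: "integrable lebesgue (P i j k)" "(LINT x|lebesgue. P i j k x) = 0" for i j k
    using test_field_product_rule[OF \<phi> \<psi>] unfolding P_def by auto
  have sq: "square_integrable \<phi>" "square_integrable (curl \<phi>)" "square_integrable \<psi>" "square_integrable (curl \<psi>)"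
    using \<phi> \<psi> square_integrable_test_field by auto
  have in_abs: "inner (abs_l2 f) (abs_l2 g) = (LINT x|lebesgue. inner (f x) (g x))"
    if "square_integrable f" "square_integrable g" for f g :: "real^3 \<Rightarrow> real^3"
    using that by (subst inner_l2.abs_eq) (auto simp: l2_rel_def)
  have "inner (abs_l2 (curl \<phi>)) (abs_l2 \<psi>) - inner (abs_l2 \<phi>) (abs_l2 (curl \<psi>))
      = (LINT x|lebesgue. inner (curl \<phi> x) (\<psi> x) - inner (\<phi> x) (curl \<psi> x))"
    by (simp add: in_abs sq square_integrable_inner Bochner_Integration.integral_diff)
  also have "(\<lambda>x. inner (curl \<phi> x) (\<psi> x) - inner (\<phi> x) (curl \<psi> x))
      = (\<lambda>x. (P 1 2 3 x - P 1 3 2 x) + (P 2 3 1 x - P 2 1 3 x) + (P 3 1 2 x - P 3 2 1 x))"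
    by (rule ext) (simp add: curl_def P_def inner_vec_def sum_3 algebra_simps)
  also have "(LINT x|lebesgue. (P 1 2 3 x - P 1 3 2 x) + (P 2 3 1 x - P 2 1 3 x) + (P 3 1 2 x - P 3 2 1 x)) = 0"
    by (simp add: P Bochner_Integration.integral_diff Bochner_Integration.integral_add)
  finally show ?thesis by simp
qed

section \<open>The Maxwell operator is skew-adjoint\<close>

text \<open>\<open>M_skew\<close> says that the adjoint extends \<open>- M\<close>,
  \<open>M_maximal\<close> that it has no larger domain; by \<open>DM_dense\<close> the adjoint is
  single-valued, so it equals \<open>- M\<close>.\<close>

locale skew_adjoint = separable_hilbert_form ip X \<kappa>
  for ip :: "'h::{banach,second_countable_topology} \<Rightarrow> 'h \<Rightarrow> real" and X \<kappa> +
  fixes DM :: "'h set" and M :: "'h \<Rightarrow> 'h"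
  assumes subspace_DM: "subspace DM" and DM_X: "DM \<subseteq> X"
    and M_X: "x \<in> DM \<Longrightarrow> M x \<in> X"
    and M_linear: "linear_on DM M"
    and M_skew: "x \<in> DM \<Longrightarrow> y \<in> DM \<Longrightarrow> ip (M x) y = - ip x (M y)"
    and M_maximal: "z \<in> X \<Longrightarrow> y \<in> X \<Longrightarrow> (\<And>x. x \<in> DM \<Longrightarrow> ip (M x) z = ip x y) \<Longrightarrow> z \<in> DM"
    and DM_dense: "z \<in> X \<Longrightarrow> (\<And>x. x \<in> DM \<Longrightarrow> ip x z = 0) \<Longrightarrow> z = 0"

subsection \<open>Weak curl\<close>

text \<open>After this, weak curls are a matter of inner products with the classes of test
  fields.\<close>

lemma has_weak_curl_iff:
  assumes "open D"
  shows "has_weak_curl D v w \<longleftrightarrow> v \<in> L2_on D \<and> w \<in> L2_on D \<and>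
    (\<forall>\<phi>\<in>test_fields D. inner v (abs_l2 (curl \<phi>)) = inner w (abs_l2 \<phi>))"
  using assms square_integrable_test_field
  by (auto simp: has_weak_curl_def set_integral_inner_abs_l2)

context
  fixes D :: "(real^3) set"
  assumes open_D: "open D"
begin

lemma lebesgue_D: "D \<in> sets lebesgue"
  using open_D by simp

lemma has_weak_curl_add:
  "has_weak_curl D v w \<Longrightarrow> has_weak_curl D v' w' \<Longrightarrow> has_weak_curl D (v + v') (w + w')"
  unfolding has_weak_curl_iff[OF open_D] by (auto simp: inner_add_left subspace_add[OF subspace_L2_on])

lemma has_weak_curl_scaleR: "has_weak_curl D v w \<Longrightarrow> has_weak_curl D (r *\<^sub>R v) (r *\<^sub>R w)"
  unfolding has_weak_curl_iff[OF open_D] by (auto simp: subspace_scale[OF subspace_L2_on])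

lemma has_weak_curl_unique:
  assumes "has_weak_curl D v w" "has_weak_curl D v w'"
  shows "w = w'"
proof -
  have "w - w' = 0"
    using assms unfolding has_weak_curl_iff[OF open_D]
    by (intro test_fields_dense[OF open_D]) (auto simp: inner_diff_left subspace_diff[OF subspace_L2_on])
  then show ?thesis by simp
qed

lemma weak_curl_eqI: "has_weak_curl D v w \<Longrightarrow> weak_curl D v = w"
  unfolding weak_curl_def using has_weak_curl_unique by blast

lemma has_weak_curl_weak_curl: "v \<in> Hcurl D \<Longrightarrow> has_weak_curl D v (weak_curl D v)"
  using weak_curl_eqI by (auto simp: Hcurl_def)

lemma Hcurl_L2_on:
  assumes "v \<in> Hcurl D"
  shows "v \<in> L2_on D" "weak_curl D v \<in> L2_on D"
  using has_weak_curl_weak_curl[OF assms] by (auto simp: has_weak_curl_def)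

lemma Hcurl_add:
  assumes "v \<in> Hcurl D" "w \<in> Hcurl D"
  shows "v + w \<in> Hcurl D" "weak_curl D (v + w) = weak_curl D v + weak_curl D w"
  using has_weak_curl_add[OF assms[THEN has_weak_curl_weak_curl]] weak_curl_eqI by (auto simp: Hcurl_def)

lemma Hcurl_scaleR:
  assumes "v \<in> Hcurl D"
  shows "r *\<^sub>R v \<in> Hcurl D" "weak_curl D (r *\<^sub>R v) = r *\<^sub>R weak_curl D v"
  using has_weak_curl_scaleR[OF assms[THEN has_weak_curl_weak_curl]] weak_curl_eqI by (auto simp: Hcurl_def)

lemma Hcurl_zero: "0 \<in> Hcurl D" "weak_curl D 0 = 0"
proof -
  have "has_weak_curl D 0 0" unfolding has_weak_curl_iff[OF open_D]
    using subspace_0[OF subspace_L2_on] by auto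
  then show "0 \<in> Hcurl D" "weak_curl D 0 = 0" using weak_curl_eqI by (auto simp: Hcurl_def)
qed

lemma test_field_Hcurl:
  assumes "\<phi> \<in> test_fields D"
  shows "abs_l2 \<phi> \<in> Hcurl D" "weak_curl D (abs_l2 \<phi>) = abs_l2 (curl \<phi>)"
proof -
  have "has_weak_curl D (abs_l2 \<phi>) (abs_l2 (curl \<phi>))"
    unfolding has_weak_curl_iff[OF open_D]
    using class_test_field_in[OF assms] curl_integration_by_parts[OF assms] by simp
  then show "abs_l2 \<phi> \<in> Hcurl D" "weak_curl D (abs_l2 \<phi>) = abs_l2 (curl \<phi>)"
    using weak_curl_eqI by (auto simp: Hcurl_def)
qed

lemma tangential_trace_eq:
  assumes "v \<in> Hcurl D" "w \<in> Hcurl D"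
  shows "tangential_trace D v w = inner (weak_curl D v) w - inner v (weak_curl D w)"
proof -
  have si: "set_integrable lebesgue D (\<lambda>x. inner (rep_l2 a x) (rep_l2 b x))" for a b :: field
    unfolding set_integrable_def using lebesgue_D by (intro integrable_mult_indicator integrable_inner_rep)
  show ?thesis
    unfolding tangential_trace_def
    using Hcurl_L2_on[OF assms(1)] Hcurl_L2_on[OF assms(2)]
    by (simp add: set_integral_diff(2)[OF si si] set_integral_inner_L2_on[OF lebesgue_D])
qed

text \<open>In this form \<open>H0curl D\<close> is the domain of the adjoint of the curl on
  \<open>Hcurl D\<close>, which is what maximality of the Maxwell operator will ask for.\<close>

lemma H0curl_iff:
  "v \<in> H0curl D \<longleftrightarrow> v \<in> Hcurl D \<and> (\<forall>w\<in>Hcurl D. inner (weak_curl D v) w = inner v (weak_curl D w))"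
  by (auto simp: H0curl_def tangential_trace_eq)

lemma subspace_Hcurl: "subspace (Hcurl D)"
  unfolding subspace_def using Hcurl_add(1) Hcurl_scaleR(1) Hcurl_zero(1) by blast

lemma subspace_H0curl: "subspace (H0curl D)"
  unfolding subspace_def by (auto simp: H0curl_iff Hcurl_add Hcurl_scaleR Hcurl_zero inner_add_left)

text \<open>The required symmetry is the definition of the weak curl of \<open>w\<close>.\<close>

lemma test_field_H0curl:
  assumes "\<phi> \<in> test_fields D"
  shows "abs_l2 \<phi> \<in> H0curl D"
  unfolding H0curl_iff
proof (intro conjI ballI test_field_Hcurl[OF assms])
  fix w assume "w \<in> Hcurl D"
  from has_weak_curl_weak_curl[OF this] assms
  show "inner (weak_curl D (abs_l2 \<phi>)) w = inner (abs_l2 \<phi>) (weak_curl D w)"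
    unfolding has_weak_curl_iff[OF open_D] test_field_Hcurl(2)[OF assms] by (simp add: inner_commute)
qed

end

subsection \<open>Multiplication by bounded functions\<close>

definition bounded_weight :: "'a::euclidean_space set \<Rightarrow> ('a \<Rightarrow> real) \<Rightarrow> bool" where
  "bounded_weight D a \<longleftrightarrow> a \<in> borel_measurable (lebesgue_on D) \<and>
     (\<exists>K. AE x in lebesgue. x \<in> D \<longrightarrow> \<bar>a x\<bar> \<le> K)"

text \<open>These bounded self-adjoint operators carry the weights of the energy form and the
  coefficients of the Maxwell operator, so that pointwise products turn into operator
  identities.\<close>

definition mul_on :: "'a::euclidean_space set \<Rightarrow> ('a \<Rightarrow> real) \<Rightarrow> ('a, 'b::euclidean_space) l2 \<Rightarrow> ('a, 'b) l2" where
  "mul_on D a u = l2_class_on D (\<lambda>x. a x *\<^sub>R rep_l2 u x)"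

context
  fixes D :: "'a::euclidean_space set" and a :: "'a \<Rightarrow> real"
  assumes D: "D \<in> sets lebesgue" and a: "bounded_weight D a"
begin

lemma bounded_weight_bound: obtains K where "0 \<le> K" "AE x in lebesgue. x \<in> D \<longrightarrow> \<bar>a x\<bar> \<le> K"
proof -
  obtain K where "AE x in lebesgue. x \<in> D \<longrightarrow> \<bar>a x\<bar> \<le> K" using a by (auto simp: bounded_weight_def)
  then have "AE x in lebesgue. x \<in> D \<longrightarrow> \<bar>a x\<bar> \<le> \<bar>K\<bar>" by eventually_elim (auto intro: order_trans)
  then show ?thesis using that[of "\<bar>K\<bar>"] by simp
qed

lemma sq_on_mul: "sq_on D (\<lambda>x. a x *\<^sub>R rep_l2 u x)"
proof -
  obtain K where K: "0 \<le> K" "AE x in lebesgue. x \<in> D \<longrightarrow> \<bar>a x\<bar> \<le> K" by (rule bounded_weight_bound)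
  show ?thesis
  proof (rule sq_on_bound[OF D _ square_integrable_rep])
    show "(\<lambda>x. a x *\<^sub>R rep_l2 u x) \<in> borel_measurable (lebesgue_on D)"
      using a by (intro borel_measurable_scaleR rep_l2_measurable_on) (simp add: bounded_weight_def)
    show "AE x in lebesgue. x \<in> D \<longrightarrow> norm (a x *\<^sub>R rep_l2 u x) \<le> K * norm (rep_l2 u x)"
      using K(2) by eventually_elim (auto intro: mult_right_mono)
  qed
qed

lemma AE_mul_on: "AE x in lebesgue. rep_l2 (mul_on D a u) x = (if x \<in> D then a x *\<^sub>R rep_l2 u x else 0)"
  unfolding mul_on_def by (rule AE_rep_class_on[OF sq_on_mul])

lemma mul_on_in: "mul_on D a u \<in> L2_on D"
  unfolding mul_on_def by (rule class_on_in_L2_on[OF sq_on_mul])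

lemma mul_on_add: "mul_on D a (u + v) = mul_on D a u + mul_on D a v"
proof (rule L2_on_eqI[of _ D])
  show "AE x in lebesgue. x \<in> D \<longrightarrow> rep_l2 (mul_on D a (u + v)) x = rep_l2 (mul_on D a u + mul_on D a v) x"
    using AE_mul_on[of "u + v"] AE_mul_on[of u] AE_mul_on[of v] AE_rep_add[of u v]
      AE_rep_add[of "mul_on D a u" "mul_on D a v"]
    by eventually_elim (simp add: scaleR_add_right)
qed (auto intro: mul_on_in subspace_add[OF subspace_L2_on])

lemma mul_on_scaleR: "mul_on D a (r *\<^sub>R u) = r *\<^sub>R mul_on D a u"
proof (rule L2_on_eqI[of _ D])
  show "AE x in lebesgue. x \<in> D \<longrightarrow> rep_l2 (mul_on D a (r *\<^sub>R u)) x = rep_l2 (r *\<^sub>R mul_on D a u) x"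
    using AE_mul_on[of "r *\<^sub>R u"] AE_mul_on[of u] AE_rep_scaleR[of r u]
      AE_rep_scaleR[of r "mul_on D a u"]
    by eventually_elim simp
qed (auto intro: mul_on_in subspace_scale[OF subspace_L2_on])

lemma mul_on_norm: obtains K where "0 \<le> K" "\<And>u :: ('a, 'b::euclidean_space) l2. norm (mul_on D a u) \<le> K * norm u"
proof -
  obtain K where K: "0 \<le> K" "AE x in lebesgue. x \<in> D \<longrightarrow> \<bar>a x\<bar> \<le> K" by (rule bounded_weight_bound)
  have "norm (mul_on D a u) \<le> K * norm u" for u :: "('a, 'b) l2"
    unfolding mul_on_def
  proof (rule norm_class_on_le[OF K(1) sq_on_mul])
    show "AE x in lebesgue. x \<in> D \<longrightarrow> norm (a x *\<^sub>R rep_l2 u x) \<le> K * norm (rep_l2 u x)"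
      using K(2) by eventually_elim (auto intro: mult_right_mono)
  qed
  with K(1) show ?thesis by (rule that)
qed

lemma bounded_linear_mul_on: "bounded_linear (mul_on D a :: ('a, 'b::euclidean_space) l2 \<Rightarrow> _)"
proof -
  obtain K where "\<And>u :: ('a, 'b) l2. norm (mul_on D a u) \<le> K * norm u" using mul_on_norm by blast
  then show ?thesis by (intro bounded_linear_intro[of _ K]) (auto simp: mul_on_add mul_on_scaleR mult.commute)
qed

lemma inner_mul_on:
  "integrable lebesgue (\<lambda>x. indicator D x *\<^sub>R (a x * inner (rep_l2 u x) (rep_l2 v x)))"
  "inner (mul_on D a u) v = (LINT x:D|lebesgue. a x * inner (rep_l2 u x) (rep_l2 v x))"
proof -
  have i: "integrable lebesgue (\<lambda>x. inner (rep_l2 (mul_on D a u) x) (rep_l2 v x))" by (rule integrable_inner_rep)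
  have m: "(\<lambda>x. indicator D x *\<^sub>R (a x * inner (rep_l2 u x) (rep_l2 v x))) \<in> borel_measurable lebesgue"
  proof -
    have "(\<lambda>x. a x * inner (rep_l2 u x) (rep_l2 v x)) \<in> borel_measurable (lebesgue_on D)"
      using a by (intro borel_measurable_times borel_measurable_inner rep_l2_measurable_on) (simp add: bounded_weight_def)
    then have "(\<lambda>x. if x \<in> D then a x * inner (rep_l2 u x) (rep_l2 v x) else 0) \<in> borel_measurable lebesgue"
      using D by (rule borel_measurable_if_I)
    also have "(\<lambda>x. if x \<in> D then a x * inner (rep_l2 u x) (rep_l2 v x) else 0)
        = (\<lambda>x. indicator D x *\<^sub>R (a x * inner (rep_l2 u x) (rep_l2 v x)))" by auto
    finally show ?thesis .
  qed
  have ae: "AE x in lebesgue. inner (rep_l2 (mul_on D a u) x) (rep_l2 v x)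
      = indicator D x *\<^sub>R (a x * inner (rep_l2 u x) (rep_l2 v x))"
    using AE_mul_on[of u] by eventually_elim auto
  show "integrable lebesgue (\<lambda>x. indicator D x *\<^sub>R (a x * inner (rep_l2 u x) (rep_l2 v x)))"
    by (rule integrable_cong_AE_imp[OF i m ae])
  show "inner (mul_on D a u) v = (LINT x:D|lebesgue. a x * inner (rep_l2 u x) (rep_l2 v x))"
    unfolding inner_l2_rep set_lebesgue_integral_def by (rule integral_cong_AE[OF _ m ae]) (use i in auto)
qed

lemma mul_on_selfadjoint: "inner (mul_on D a u) v = inner u (mul_on D a v)"
proof -
  have "inner (mul_on D a u) v = inner (mul_on D a v) u" unfolding inner_mul_on(2) by (simp add: inner_commute)
  then show ?thesis by (simp add: inner_commute)
qed

end

text \<open>Used with \<open>r = 1\<close> and \<open>r = -1\<close>: a weight of the energy form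
  cancels the inverse coefficient in the Maxwell operator.\<close>

lemma mul_on_mul_on:
  assumes D: "D \<in> sets lebesgue" and a: "bounded_weight D a" and b: "bounded_weight D b"
    and u: "u \<in> L2_on D" and ab: "AE x in lebesgue. x \<in> D \<longrightarrow> a x * b x = r"
  shows "mul_on D a (mul_on D b u) = r *\<^sub>R u"
proof (rule L2_on_eqI)
  show "AE x in lebesgue. x \<in> D \<longrightarrow> rep_l2 (mul_on D a (mul_on D b u)) x = rep_l2 (r *\<^sub>R u) x"
    using AE_mul_on[OF D a, of "mul_on D b u"] AE_mul_on[OF D b, of u] AE_rep_scaleR[of r u] ab
    by eventually_elim simp
qed (use u in \<open>auto intro: mul_on_in[OF D a] subspace_scale[OF subspace_L2_on]\<close>)

lemma bounded_bilinear_plus: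
  assumes "bounded_bilinear f" "bounded_bilinear g"
  shows "bounded_bilinear (\<lambda>x y. f x y + g x y)"
proof -
  interpret f: bounded_bilinear f by fact
  interpret g: bounded_bilinear g by fact
  obtain K L where K: "\<And>a b. norm (f a b) \<le> norm a * norm b * K" and L: "\<And>a b. norm (g a b) \<le> norm a * norm b * L"
    using f.bounded g.bounded by blast
  show ?thesis
  proof (unfold_locales, goal_cases)
    case 5
    have "norm (f a b + g a b) \<le> norm a * norm b * (K + L)" for a b
      using norm_triangle_ineq[of "f a b" "g a b"] K[of a b] L[of a b] by (simp add: algebra_simps)
    then show ?case by blast
  qed (simp_all add: f.add_left f.add_right g.add_left g.add_right f.scaleR_left f.scaleR_right
      g.scaleR_left g.scaleR_right scaleR_add_right)
qed

subsection \<open>The energy space\<close>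

locale maxwell_domain =
  fixes D :: "(real^3) set" and eps mu :: "real^3 \<Rightarrow> real" and \<delta> :: real
  assumes open_D: "open D" and delta: "\<delta> > 0"
    and eps: "material_coefficient D \<delta> eps" and mu: "material_coefficient D \<delta> mu"
begin

lemmas D_sets = lebesgue_D[OF open_D]

lemma material_weights:
  assumes "material_coefficient D \<delta> a"
  shows "bounded_weight D a" "bounded_weight D (\<lambda>x. inverse (a x))" "bounded_weight D (\<lambda>x. - inverse (a x))"
    "AE x in lebesgue. x \<in> D \<longrightarrow> \<delta> \<le> a x"
    "AE x in lebesgue. x \<in> D \<longrightarrow> \<bar>inverse (a x)\<bar> \<le> 1 / \<delta>"
proof -
  have m: "a \<in> borel_measurable (lebesgue_on D)" using assms by (simp add: material_coefficient_def)
  show ge: "AE x in lebesgue. x \<in> D \<longrightarrow> \<delta> \<le> a x"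
    using assms by (simp add: material_coefficient_def AE_lebesgue_on[OF D_sets])
  show "bounded_weight D a"
    using assms by (simp add: material_coefficient_def bounded_weight_def AE_lebesgue_on[OF D_sets])
  show inv: "AE x in lebesgue. x \<in> D \<longrightarrow> \<bar>inverse (a x)\<bar> \<le> 1 / \<delta>"
    using ge by eventually_elim (use delta in \<open>auto simp: field_simps\<close>)
  show "bounded_weight D (\<lambda>x. inverse (a x))" "bounded_weight D (\<lambda>x. - inverse (a x))"
    unfolding bounded_weight_def using inv m by auto
qed

lemmas weights = material_weights[OF eps] material_weights[OF mu]
lemmas weight = weights(1,2,3,6,7,8)[THEN mul_on_in[OF D_sets]]
lemmas mul_lin = weights(1,2,3,6,7,8)[THEN bounded_linear_mul_on[OF D_sets]]

lemma inner_HH_eq: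
  "inner_HH D eps mu u v = inner (mul_on D eps (fst u)) (fst v) + inner (mul_on D mu (snd u)) (snd v)"
  unfolding inner_HH_def inner_mul_on(2)[OF D_sets weights(1)] inner_mul_on(2)[OF D_sets weights(6)]
  by (rule set_integral_add(2); unfold set_integrable_def; rule inner_mul_on(1)[OF D_sets]; rule weights)

lemma maxwell_op_eq:
  "maxwell_op D eps mu u = (mul_on D (\<lambda>x. inverse (eps x)) (weak_curl D (snd u)),
     mul_on D (\<lambda>x. - inverse (mu x)) (weak_curl D (fst u)))"
  by (simp add: maxwell_op_def mul_on_def)

lemma inner_mul_on_ge:
  assumes "material_coefficient D \<delta> a" "u \<in> L2_on D"
  shows "\<delta> * (norm u)\<^sup>2 \<le> inner (mul_on D a u) u"
  unfolding norm_l2_square inner_mul_on(2)[OF D_sets material_weights(1)[OF assms(1)]] set_lebesgue_integral_def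
    integral_mult_right_zero[symmetric]
proof (rule integral_mono_AE)
  show "integrable lebesgue (\<lambda>x. \<delta> * (norm (rep_l2 u x))\<^sup>2)" by (simp add: integrable_norm_rep)
  show "integrable lebesgue (\<lambda>x. indicator D x *\<^sub>R (a x * inner (rep_l2 u x) (rep_l2 u x)))"
    by (rule inner_mul_on(1)[OF D_sets material_weights(1)[OF assms(1)]])
  have "AE x in lebesgue. x \<notin> D \<longrightarrow> rep_l2 u x = 0" using assms by (simp add: L2_on_def)
  then show "AE x in lebesgue. \<delta> * (norm (rep_l2 u x))\<^sup>2 \<le> indicator D x *\<^sub>R (a x * inner (rep_l2 u x) (rep_l2 u x))"
    using material_weights(4)[OF assms(1)]
  proof eventually_elim
    case (elim x)
    show ?case
    proof (cases "x \<in> D")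
      case True
      then have "\<delta> * inner (rep_l2 u x) (rep_l2 u x) \<le> a x * inner (rep_l2 u x) (rep_l2 u x)"
        using elim by (intro mult_right_mono) auto
      then show ?thesis using True by (simp add: power2_norm_eq_inner)
    qed (use elim in simp)
  qed
qed

lemma bounded_bilinear_inner_HH: "bounded_bilinear (inner_HH D eps mu)"
proof -
  have "bounded_bilinear (\<lambda>u v. inner (mul_on D eps (fst u)) (fst v))"
    using bounded_bilinear.comp[OF bounded_bilinear_inner
        bounded_linear_compose[OF mul_lin(1) bounded_linear_fst] bounded_linear_fst] .
  moreover have "bounded_bilinear (\<lambda>u v. inner (mul_on D mu (snd u)) (snd v))"
    using bounded_bilinear.comp[OF bounded_bilinear_inner
        bounded_linear_compose[OF mul_lin(4) bounded_linear_snd] bounded_linear_snd] .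
  ultimately show ?thesis
    unfolding inner_HH_eq[abs_def] by (rule bounded_bilinear_plus)
qed

sublocale energy: separable_hilbert_form "inner_HH D eps mu" "HH D" \<delta>
proof (intro separable_hilbert_form.intro hilbert_form.intro bounded_bilinear_inner_HH delta)
  show "inner_HH D eps mu x y = inner_HH D eps mu y x" for x y
    by (simp add: inner_HH_def inner_commute)
  show "subspace (HH D)" unfolding HH_def by (intro subspace_Times subspace_L2_on)
  show "closed (HH D)" unfolding HH_def by (intro closed_Times closed_L2_on D_sets)
  show "\<delta> * (norm x)\<^sup>2 \<le> inner_HH D eps mu x x" if "x \<in> HH D" for x
  proof -
    have "(norm x)\<^sup>2 = (norm (fst x))\<^sup>2 + (norm (snd x))\<^sup>2"
      by (simp add: norm_prod_def)
    then show ?thesis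
      using inner_mul_on_ge[OF eps, of "fst x"] inner_mul_on_ge[OF mu, of "snd x"] that
      by (auto simp: inner_HH_eq HH_def algebra_simps)
  qed
qed

lemma energy_nrm: "energy.nrm = norm_HH D eps mu"
  by (rule ext) (simp add: energy.nrm_def norm_HH_def)

text \<open>The energy weights cancel the coefficients of the operator, so skew-adjointness becomes
  a statement about the curl in unweighted \<open>L\<^sup>2\<close>.\<close>

lemma inner_maxwell:
  assumes "u \<in> dom_maxwell D" "v \<in> HH D"
  shows "inner_HH D eps mu (maxwell_op D eps mu u) v =
    inner (weak_curl D (snd u)) (fst v) - inner (weak_curl D (fst u)) (snd v)"
proof -
  have c: "weak_curl D (snd u) \<in> L2_on D" "weak_curl D (fst u) \<in> L2_on D"
    using assms(1) Hcurl_L2_on[OF open_D] by (auto simp: dom_maxwell_def H0curl_def)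
  have "AE x in lebesgue. x \<in> D \<longrightarrow> eps x * inverse (eps x) = 1"
    using weights(4) by eventually_elim (use delta in auto)
  from mul_on_mul_on[OF D_sets weights(1,2) c(1) this]
  have 1: "mul_on D eps (mul_on D (\<lambda>x. inverse (eps x)) (weak_curl D (snd u))) = weak_curl D (snd u)" by simp
  have "AE x in lebesgue. x \<in> D \<longrightarrow> mu x * - inverse (mu x) = -1"
    using weights(9) by eventually_elim (use delta in auto)
  from mul_on_mul_on[OF D_sets weights(6,8) c(2) this]
  have 2: "mul_on D mu (mul_on D (\<lambda>x. - inverse (mu x)) (weak_curl D (fst u))) = - weak_curl D (fst u)" by simp
  show ?thesis unfolding inner_HH_eq maxwell_op_eq by (simp add: 1 2)
qed

text \<open>Only the first component of a pair in the domain satisfies the boundary condition, but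
  every product in the skewness identity pairs a first with a second component, so the symmetry of
  the curl applies. Density holds because test fields give domain elements in either
  component.\<close>

sublocale maxwell: skew_adjoint "inner_HH D eps mu" "HH D" \<delta> "dom_maxwell D" "maxwell_op D eps mu"
proof (intro skew_adjoint.intro skew_adjoint_axioms.intro energy.separable_hilbert_form_axioms)
  show "subspace (dom_maxwell D)" unfolding dom_maxwell_def
    by (intro subspace_Times subspace_Hcurl subspace_H0curl open_D)
  show sub: "dom_maxwell D \<subseteq> HH D"
    using Hcurl_L2_on[OF open_D] by (auto simp: dom_maxwell_def HH_def H0curl_def)
  show MX: "maxwell_op D eps mu x \<in> HH D" for x
    unfolding maxwell_op_eq HH_def using weight by auto
  show "linear_on (dom_maxwell D) (maxwell_op D eps mu)"
    unfolding linear_on_def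
  proof (intro conjI ballI allI)
    fix x y assume "x \<in> dom_maxwell D" "y \<in> dom_maxwell D"
    then have c: "snd x \<in> Hcurl D" "fst x \<in> Hcurl D" "snd y \<in> Hcurl D" "fst y \<in> Hcurl D"
      by (auto simp: dom_maxwell_def H0curl_def)
    show "maxwell_op D eps mu (x + y) = maxwell_op D eps mu x + maxwell_op D eps mu y"
      using c by (simp add: maxwell_op_eq Hcurl_add[OF open_D] mul_lin[THEN bounded_linear.linear, THEN linear_add])
    show "maxwell_op D eps mu (r *\<^sub>R x) = r *\<^sub>R maxwell_op D eps mu x" for r
      using c by (simp add: maxwell_op_eq Hcurl_scaleR[OF open_D] mul_lin[THEN bounded_linear.linear, THEN linear_cmul])
  qed
  show "inner_HH D eps mu (maxwell_op D eps mu x) y = - inner_HH D eps mu x (maxwell_op D eps mu y)"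
    if x: "x \<in> dom_maxwell D" and y: "y \<in> dom_maxwell D" for x y
  proof -
    have X: "x \<in> HH D" "y \<in> HH D" using x y sub by auto
    have "inner_HH D eps mu x (maxwell_op D eps mu y) = inner (weak_curl D (snd y)) (fst x) - inner (weak_curl D (fst y)) (snd x)"
      by (subst energy.sym) (rule inner_maxwell[OF y X(1)])
    moreover have "inner (weak_curl D (fst x)) (snd y) = inner (fst x) (weak_curl D (snd y))"
      "inner (weak_curl D (fst y)) (snd x) = inner (fst y) (weak_curl D (snd x))"
      using x y by (auto simp: dom_maxwell_def H0curl_iff[OF open_D])
    ultimately show ?thesis using inner_maxwell[OF x X(2)] by (simp add: inner_commute)
  qed
  show "z \<in> dom_maxwell D" if z: "z \<in> HH D" and y: "y \<in> HH D"
    and adj: "\<And>x. x \<in> dom_maxwell D \<Longrightarrow> inner_HH D eps mu (maxwell_op D eps mu x) z = inner_HH D eps mu x y" for z y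
  proof -
    \<comment> \<open>Test with \<open>(0, w)\<close>. For test fields this is the weak curl of
      \<open>fst z\<close>; for all \<open>w \<in> Hcurl D\<close> it is the boundary
      condition.\<close>
    have adj1: "inner (weak_curl D w) (fst z) = inner (mul_on D mu (snd y)) w" if w: "w \<in> Hcurl D" for w
    proof -
      have d: "(0, w) \<in> dom_maxwell D" using w subspace_0[OF subspace_H0curl[OF open_D]] by (simp add: dom_maxwell_def)
      have "inner_HH D eps mu (0, w) y = inner (mul_on D mu w) (snd y)"
        by (simp add: inner_HH_eq mul_lin[THEN bounded_linear.linear, THEN linear_0])
      also have "\<dots> = inner (mul_on D mu (snd y)) w"
        by (metis mul_on_selfadjoint[OF D_sets weights(6)] inner_commute)
      finally show ?thesis
        using adj[OF d] inner_maxwell[OF d z] by (simp add: Hcurl_zero[OF open_D])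
    qed
    \<comment> \<open>Test with \<open>(w, 0)\<close>. Here only \<open>w \<in> H0curl D\<close> is
      available; as this contains the test fields, \<open>snd z\<close> has a weak curl, and nothing
      more is asked of the second component.\<close>
    have adj2: "inner (weak_curl D w) (snd z) = - inner (mul_on D eps (fst y)) w" if w: "w \<in> H0curl D" for w
    proof -
      have d: "(w, 0) \<in> dom_maxwell D" using w Hcurl_zero[OF open_D] by (simp add: dom_maxwell_def)
      have "inner_HH D eps mu (w, 0) y = inner (mul_on D eps w) (fst y)"
        by (simp add: inner_HH_eq mul_lin[THEN bounded_linear.linear, THEN linear_0])
      also have "\<dots> = inner (mul_on D eps (fst y)) w"
        by (metis mul_on_selfadjoint[OF D_sets weights(1)] inner_commute)
      finally show ?thesis
        using adj[OF d] inner_maxwell[OF d z] by (simp add: Hcurl_zero[OF open_D])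
    qed
    have "has_weak_curl D (fst z) (mul_on D mu (snd y))"
      unfolding has_weak_curl_iff[OF open_D]
      using z weight(4) adj1[OF test_field_Hcurl(1)[OF open_D]]
      by (auto simp: HH_def test_field_Hcurl(2)[OF open_D] inner_commute)
    then have 1: "fst z \<in> Hcurl D" "weak_curl D (fst z) = mul_on D mu (snd y)"
      using weak_curl_eqI[OF open_D] by (auto simp: Hcurl_def)
    have z1: "fst z \<in> H0curl D"
      unfolding H0curl_iff[OF open_D] 1(2) using 1(1) adj1 by (simp add: inner_commute)
    have "has_weak_curl D (snd z) (- mul_on D eps (fst y))"
      unfolding has_weak_curl_iff[OF open_D]
      using z weight(1) adj2[OF test_field_H0curl[OF open_D]] subspace_neg[OF subspace_L2_on]
      by (auto simp: HH_def test_field_Hcurl(2)[OF open_D] inner_commute)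
    then have "snd z \<in> Hcurl D" by (auto simp: Hcurl_def)
    with z1 show ?thesis by (auto simp: dom_maxwell_def mem_Times_iff)
  qed
  show "z = 0" if z: "z \<in> HH D" and 0: "\<And>x. x \<in> dom_maxwell D \<Longrightarrow> inner_HH D eps mu x z = 0" for z
  proof -
    have zero: "(0::field) \<in> H0curl D" "(0::field) \<in> Hcurl D"
      using subspace_0 subspace_H0curl subspace_Hcurl open_D by auto
    have "mul_on D eps (fst z) = 0"
    proof (rule test_fields_dense[OF open_D weight(1)])
      fix \<phi> assume "\<phi> \<in> test_fields D"
      then have "(abs_l2 \<phi>, 0) \<in> dom_maxwell D" using test_field_H0curl[OF open_D] zero by (simp add: dom_maxwell_def)
      from 0[OF this] show "inner (mul_on D eps (fst z)) (abs_l2 \<phi>) = 0"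
        by (simp add: inner_HH_eq mul_lin[THEN bounded_linear.linear, THEN linear_0])
          (metis mul_on_selfadjoint[OF D_sets weights(1)] inner_commute)
    qed
    moreover have "mul_on D mu (snd z) = 0"
    proof (rule test_fields_dense[OF open_D weight(4)])
      fix \<phi> assume "\<phi> \<in> test_fields D"
      then have "(0, abs_l2 \<phi>) \<in> dom_maxwell D" using test_field_Hcurl[OF open_D] zero by (simp add: dom_maxwell_def)
      from 0[OF this] show "inner (mul_on D mu (snd z)) (abs_l2 \<phi>) = 0"
        by (simp add: inner_HH_eq mul_lin[THEN bounded_linear.linear, THEN linear_0])
          (metis mul_on_selfadjoint[OF D_sets weights(6)] inner_commute)
    qed
    ultimately have "inner_HH D eps mu z z = 0" by (simp add: inner_HH_eq)
    then show "z = 0" using energy.ip_self_eq_0[OF z] by simp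
  qed
qed

end

section \<open>Square roots of positive operators\<close>

lemma linear_onD:
  assumes "linear_on S f"
  shows "x \<in> S \<Longrightarrow> y \<in> S \<Longrightarrow> f (x + y) = f x + f y" "x \<in> S \<Longrightarrow> f (r *\<^sub>R x) = r *\<^sub>R f x"
  using assms by (auto simp: linear_on_def)

lemma linear_on_zero: "linear_on S f \<Longrightarrow> subspace S \<Longrightarrow> f 0 = 0"
  using linear_onD(2)[of S f 0 0] subspace_0 by fastforce

lemma linear_on_diff:
  assumes "linear_on S f" "subspace S" "x \<in> S" "y \<in> S"
  shows "f (x - y) = f x - f y"
  using linear_onD(1)[OF assms(1), of x "(-1) *\<^sub>R y"] linear_onD(2)[OF assms(1), of y "-1"]
    subspace_neg[OF assms(2)] assms(3,4) by simp

lemma linear_on_sum: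
  assumes "linear_on S f" "subspace S" "\<And>i. i \<in> I \<Longrightarrow> x i \<in> S"
  shows "f (\<Sum>i\<in>I. x i) = (\<Sum>i\<in>I. f (x i))"
  using assms(3)
proof (induction I rule: infinite_finite_induct)
  case (insert i I)
  then have "f (x i + (\<Sum>i\<in>I. x i)) = f (x i) + f (\<Sum>i\<in>I. x i)"
    by (intro linear_onD(1)[OF assms(1)] subspace_sum[OF assms(2)]) auto
  with insert show ?case by simp
qed (auto simp: linear_on_zero[OF assms(1,2)])

text \<open>Polynomials in \<open>A\<close> with nonnegative coefficients and without constant term, paired with their
  value at \<open>1\<close>. If \<open>A\<close> is a symmetric contraction, that value bounds the operator norm.\<close>

inductive pos_poly :: "'a::real_inner set \<Rightarrow> ('a \<Rightarrow> 'a) \<Rightarrow> ('a \<Rightarrow> 'a) \<Rightarrow> real \<Rightarrow> bool" for S A where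
  base: "pos_poly S A A 1"
| zero: "pos_poly S A (\<lambda>_. 0) 0"
| add: "pos_poly S A f r \<Longrightarrow> pos_poly S A g s \<Longrightarrow> pos_poly S A (\<lambda>x. f x + g x) (r + s)"
| comp: "pos_poly S A f r \<Longrightarrow> pos_poly S A g s \<Longrightarrow> pos_poly S A (\<lambda>x. f (g x)) (r * s)"
| scale: "pos_poly S A f r \<Longrightarrow> c \<ge> 0 \<Longrightarrow> pos_poly S A (\<lambda>x. c *\<^sub>R f x) (c * r)"
| cong: "pos_poly S A f r \<Longrightarrow> (\<And>x. x \<in> S \<Longrightarrow> g x = f x) \<Longrightarrow> pos_poly S A g r"

lemma pos_poly_props:
  assumes "pos_poly S A f r" and S: "subspace S" and A: "symmetric_op_on S A" and c: "\<And>x. x \<in> S \<Longrightarrow> norm (A x) \<le> norm x"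
  shows "r \<ge> 0 \<and> linear_on S f \<and> f ` S \<subseteq> S \<and> (\<forall>x\<in>S. norm (f x) \<le> r * norm x)"
  using assms(1)
proof induction
  case base
  then show ?case using A c by (auto simp: symmetric_op_on_def)
next
  case zero
  then show ?case using subspace_0[OF S] by (auto simp: linear_on_def)
next
  case (add f r g s)
  have "norm (f x + g x) \<le> (r + s) * norm x" if "x \<in> S" for x
  proof -
    have "norm (f x) \<le> r * norm x" "norm (g x) \<le> s * norm x" using add that by auto
    then show ?thesis using norm_triangle_ineq[of "f x" "g x"] by (simp add: algebra_simps)
  qed
  then show ?case using add subspace_add[OF S]
    by (auto simp: linear_on_def inner_add_left inner_add_right scaleR_add_right image_subset_iff)
next
  case (comp f r g s)
  have "norm (f (g x)) \<le> r * s * norm x" if "x \<in> S" for x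
  proof -
    have "norm (f (g x)) \<le> r * norm (g x)" using comp that by auto
    also have "\<dots> \<le> r * (s * norm x)" using comp that by (intro mult_left_mono) auto
    finally show ?thesis by (simp add: mult.assoc)
  qed
  then show ?case using comp by (auto simp: linear_on_def image_subset_iff)
next
  case (scale f r c)
  have "norm (c *\<^sub>R f x) \<le> c * r * norm x" if "x \<in> S" for x
    using scale that by (auto simp: mult.assoc intro: mult_left_mono)
  then show ?case using scale subspace_scale[OF S]
    by (auto simp: linear_on_def scaleR_add_right image_subset_iff mult.commute)
next
  case (cong f r g)
  then show ?case using subspace_add[OF S] subspace_scale[OF S] by (auto simp: linear_on_def image_subset_iff)
qed

text \<open>The iteration \<open>Y \<mapsto> (A + Y\<^sup>2) / 2\<close> converges to \<open>I - (I - A)\<^sup>1\<^sup>/\<^sup>2\<close>.\<close>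

fun sqrt_iter :: "('a::real_vector \<Rightarrow> 'a) \<Rightarrow> nat \<Rightarrow> 'a \<Rightarrow> 'a" where
  "sqrt_iter A 0 x = 0"
| "sqrt_iter A (Suc n) x = (1/2) *\<^sub>R (A x + sqrt_iter A n (sqrt_iter A n x))"

text \<open>The same iteration for the scalar 1. It increases and stays below 1, and its increments
  majorise those of the operator iteration.\<close>

fun sqrt_iter_bound :: "nat \<Rightarrow> real" where
  "sqrt_iter_bound 0 = 0"
| "sqrt_iter_bound (Suc n) = (1/2) * (1 + sqrt_iter_bound n * sqrt_iter_bound n)"

lemma sqrt_iter_bound_range: "0 \<le> sqrt_iter_bound n \<and> sqrt_iter_bound n \<le> 1"
proof (induction n)
  case (Suc n)
  then have "sqrt_iter_bound n * sqrt_iter_bound n \<le> 1 * 1" by (intro mult_mono) auto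
  then show ?case by simp
qed simp

lemma pos_poly_sqrt_iter: "pos_poly S A (sqrt_iter A n) (sqrt_iter_bound n)"
proof (induction n)
  case 0
  have "sqrt_iter A 0 = (\<lambda>_. 0)" by auto
  then show ?case using pos_poly.zero by simp
next
  case (Suc n)
  have "pos_poly S A (\<lambda>x. (1/2) *\<^sub>R (A x + sqrt_iter A n (sqrt_iter A n x))) ((1/2) * (1 + sqrt_iter_bound n * sqrt_iter_bound n))"
    by (intro pos_poly.scale pos_poly.add pos_poly.base pos_poly.comp Suc) simp
  then show ?case using pos_poly.cong by fastforce
qed

text \<open>\<open>A = I - Q / K\<close> lies between \<open>0\<close> and \<open>I\<close>. The
  increments of the iteration are polynomials in \<open>A\<close> with nonnegative coefficients, so
  their norms are at most the scalar increments, which are summable. This replaces the usual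
  arguments with monotone sequences of commuting operators.\<close>

lemma sqrt_op_exists:
  fixes S :: "'a::{real_inner,banach} set"
  assumes S: "subspace S" "closed S" and Q: "symmetric_op_on S Q" and pos: "\<And>x. x \<in> S \<Longrightarrow> 0 \<le> inner (Q x) x"
  obtains R where "symmetric_op_on S R" "\<And>x. x \<in> S \<Longrightarrow> 0 \<le> inner (R x) x" "\<And>x. x \<in> S \<Longrightarrow> R (R x) = Q x"
proof -
  obtain K0 where "\<forall>x\<in>S. norm (Q x) \<le> K0 * norm x" using Q unfolding symmetric_op_on_def by blast
  then have K0: "\<And>x. x \<in> S \<Longrightarrow> norm (Q x) \<le> K0 * norm x" by blast
  define K where "K = max K0 1"
  have K: "K > 0" "\<And>x. x \<in> S \<Longrightarrow> norm (Q x) \<le> K * norm x"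
    using K0 by (auto simp: K_def intro: order_trans[OF K0 mult_right_mono])
  define A where "A x = x - (1 / K) *\<^sub>R Q x" for x
  have QS: "Q x \<in> S" if "x \<in> S" for x using Q that by (auto simp: symmetric_op_on_def)
  have Qlin: "linear_on S Q" using Q by (simp add: symmetric_op_on_def)
  have Qsym: "inner (Q x) y = inner x (Q y)" if "x \<in> S" "y \<in> S" for x y
    using Q that by (simp add: symmetric_op_on_def)
  have AS: "A x \<in> S" if "x \<in> S" for x
    unfolding A_def using that QS S(1) by (intro subspace_diff subspace_scale)
  have Alin: "linear_on S A"
    unfolding linear_on_def A_def using linear_onD[OF Qlin] by (auto simp: algebra_simps)
  have Asym: "inner (A x) y = inner x (A y)" if "x \<in> S" "y \<in> S" for x y
    unfolding A_def using Qsym[OF that] by (simp add: inner_diff_left inner_diff_right)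
  have A_le: "inner (A x) x \<le> (norm x)\<^sup>2" if "x \<in> S" for x
    unfolding A_def using pos[OF that] K(1) by (simp add: inner_diff_left power2_norm_eq_inner)
  have A_ge: "0 \<le> inner (A x) x" if "x \<in> S" for x
  proof -
    have "inner (Q x) x \<le> norm (Q x) * norm x" by (rule norm_cauchy_schwarz)
    also have "\<dots> \<le> K * norm x * norm x" using K(2)[OF that] by (intro mult_right_mono) auto
    finally have "inner (Q x) x / K \<le> (norm x)\<^sup>2" using K(1) by (simp add: field_simps power2_eq_square)
    then show ?thesis unfolding A_def by (simp add: inner_diff_left power2_norm_eq_inner)
  qed
  \<comment> \<open>Nonnegativity of the form of \<open>A\<close> at \<open>x - A x\<close>,
    together with \<open>A \<le> I\<close> at \<open>x\<close> and at \<open>A x\<close>, bounds the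
    norm.\<close>
  have A1: "norm (A x) \<le> norm x" if x: "x \<in> S" for x
  proof (rule power2_le_imp_le)
    have "0 \<le> inner (A (x - A x)) (x - A x)" using x AS S(1) by (intro A_ge subspace_diff)
    also have "\<dots> = inner (A x) x - 2 * (norm (A x))\<^sup>2 + inner (A (A x)) (A x)"
      unfolding linear_on_diff[OF Alin S(1) x AS[OF x]]
      using Asym[OF AS[OF x] x] by (simp add: inner_diff_left inner_diff_right power2_norm_eq_inner)
    also have "\<dots> \<le> (norm x)\<^sup>2 - 2 * (norm (A x))\<^sup>2 + (norm (A x))\<^sup>2"
      using A_le[OF x] A_le[OF AS[OF x]] by linarith
    finally show "(norm (A x))\<^sup>2 \<le> (norm x)\<^sup>2" by simp
  qed simp
  have Aop: "symmetric_op_on S A"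
    unfolding symmetric_op_on_def using Alin AS Asym A1 by (auto intro!: exI[of _ 1])
  let ?Y = "sqrt_iter A" and ?y = sqrt_iter_bound
  note props = pos_poly_props[OF _ S(1) Aop A1]
  note Y = props[OF pos_poly_sqrt_iter]
  have YS: "?Y n x \<in> S" if "x \<in> S" for n x using Y that by (auto simp: image_subset_iff)
  have Yb: "norm (?Y n x) \<le> ?y n * norm x" if "x \<in> S" for n x using Y that by blast
  have Ylin: "linear_on S (?Y n)" for n using Y by blast
  \<comment> \<open>With \<open>?D\<close> the previous increment, the next one is half of
    \<open>?Y (Suc n)\<close> after \<open>?D\<close> plus \<open>?D\<close> after
    \<open>?Y n\<close>: a telescoping that introduces no negative coefficient.\<close>
  have step: "pos_poly S A (\<lambda>x. ?Y (Suc n) x - ?Y n x) (?y (Suc n) - ?y n)" for n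
  proof (induction n)
    case 0
    have "pos_poly S A (\<lambda>x. (1/2) *\<^sub>R A x) ((1/2) * 1)" by (intro pos_poly.scale pos_poly.base) simp
    then show ?case by simp
  next
    case (Suc n)
    let ?D = "\<lambda>x. ?Y (Suc n) x - ?Y n x" and ?d = "?y (Suc n) - ?y n"
    have h1: "pos_poly S A (\<lambda>x. (1/2) *\<^sub>R (?Y (Suc n) (?D x) + ?D (?Y n x))) ((1/2) * (?y (Suc n) * ?d + ?d * ?y n))"
      by (intro pos_poly.scale pos_poly.add pos_poly.comp[of S A "?Y (Suc n)" _ ?D] pos_poly.comp[of S A ?D _ "?Y n"]
          pos_poly_sqrt_iter Suc) simp
    have h2: "(1/2) * (?y (Suc n) * ?d + ?d * ?y n) = ?y (Suc (Suc n)) - ?y (Suc n)"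
      by (simp only: sqrt_iter_bound.simps(2)[of "Suc n"] sqrt_iter_bound.simps(2)[of n]) (simp add: algebra_simps)
    have h3: "?Y (Suc (Suc n)) x - ?Y (Suc n) x = (1/2) *\<^sub>R (?Y (Suc n) (?D x) + ?D (?Y n x))" if "x \<in> S" for x
    proof -
      have "?Y (Suc n) (?Y (Suc n) x - ?Y n x) = ?Y (Suc n) (?Y (Suc n) x) - ?Y (Suc n) (?Y n x)"
        by (rule linear_on_diff[OF Ylin S(1) YS[OF that] YS[OF that]])
      moreover have "?Y (Suc (Suc n)) x = (1/2) *\<^sub>R (A x + ?Y (Suc n) (?Y (Suc n) x))" by (rule sqrt_iter.simps)
      moreover have "?Y (Suc n) x = (1/2) *\<^sub>R (A x + ?Y n (?Y n x))" by (rule sqrt_iter.simps)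
      ultimately show ?thesis by (simp add: algebra_simps del: sqrt_iter.simps)
    qed
    show ?case by (rule pos_poly.cong[OF h1[unfolded h2] h3])
  qed
  have ymono: "?y n \<le> ?y (Suc n)" for n using props[OF step[of n]] by simp
  have Ydiff: "norm (?Y n x - ?Y m x) \<le> (?y n - ?y m) * norm x" if "m \<le> n" "x \<in> S" for m n x
    using that(1)
  proof (induction n rule: dec_induct)
    case (step n)
    have "norm (?Y (Suc n) x - ?Y n x) \<le> (?y (Suc n) - ?y n) * norm x"
      using props[OF \<open>\<And>n. pos_poly S A (\<lambda>x. ?Y (Suc n) x - ?Y n x) (?y (Suc n) - ?y n)\<close>[of n]] that(2) by blast
    moreover have "norm (?Y (Suc n) x - ?Y m x) \<le> norm (?Y (Suc n) x - ?Y n x) + norm (?Y n x - ?Y m x)"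
      using norm_triangle_ineq[of "?Y (Suc n) x - ?Y n x" "?Y n x - ?Y m x"] by (simp del: sqrt_iter.simps)
    ultimately show ?case using step.IH by (simp add: left_diff_distrib del: sqrt_iter.simps sqrt_iter_bound.simps)
  qed simp
  obtain yl where yl: "?y \<longlonglongrightarrow> yl"
    using incseq_convergent[of ?y 1] sqrt_iter_bound_range ymono by (metis incseq_SucI)
  have "Cauchy (\<lambda>n. ?Y n x)" if x: "x \<in> S" for x
  proof (rule metric_CauchyI)
    fix e :: real assume e: "e > 0"
    define e' where "e' = e / (norm x + 1)"
    have "e' > 0" using e by (simp add: e'_def add_nonneg_pos)
    then obtain N where N: "\<And>m n. m \<ge> N \<Longrightarrow> n \<ge> N \<Longrightarrow> dist (?y m) (?y n) < e'"
      using LIMSEQ_imp_Cauchy[OF yl] metric_CauchyD by blast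
    have *: "dist (?Y n x) (?Y m x) < e" if "N \<le> m" "m \<le> n" for m n
    proof -
      have "(?y n - ?y m) * norm x \<le> e' * norm x"
        using N[of n m] that by (intro mult_right_mono) (auto simp: dist_real_def)
      also have "\<dots> < e' * (norm x + 1)" using \<open>e' > 0\<close> by simp
      also have "\<dots> = e" unfolding e'_def using norm_ge_zero[of x] by (simp del: norm_ge_zero)
      finally show ?thesis using Ydiff[OF that(2) x] by (simp add: dist_norm)
    qed
    show "\<exists>M. \<forall>m\<ge>M. \<forall>n\<ge>M. dist (?Y m x) (?Y n x) < e"
      by (rule exI[of _ N]) (metis * dist_commute nle_le)
  qed
  then have "\<exists>l. (\<lambda>n. ?Y n x) \<longlonglongrightarrow> l" if "x \<in> S" for x
    using that by (auto simp: Cauchy_convergent_iff convergent_def)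
  then obtain Z where Z: "\<And>x. x \<in> S \<Longrightarrow> (\<lambda>n. ?Y n x) \<longlonglongrightarrow> Z x" by metis
  have ZS: "Z x \<in> S" if "x \<in> S" for x
    by (rule closed_sequentially[OF S(2) _ Z[OF that]]) (rule YS[OF that])
  have Zlin: "linear_on S Z" unfolding linear_on_def
  proof (intro conjI ballI allI)
    fix x y assume xy: "x \<in> S" "y \<in> S"
    have "(\<lambda>n. ?Y n (x + y)) \<longlonglongrightarrow> Z x + Z y"
      unfolding linear_onD(1)[OF Ylin xy] by (intro tendsto_add Z xy)
    then show "Z (x + y) = Z x + Z y" using Z[OF subspace_add[OF S(1) xy]] LIMSEQ_unique by blast
  next
    fix r x assume x: "x \<in> S"
    have "(\<lambda>n. ?Y n (r *\<^sub>R x)) \<longlonglongrightarrow> r *\<^sub>R Z x"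
      unfolding linear_onD(2)[OF Ylin x] by (intro tendsto_scaleR tendsto_const Z x)
    then show "Z (r *\<^sub>R x) = r *\<^sub>R Z x" using Z[OF subspace_scale[OF S(1) x]] LIMSEQ_unique by blast
  qed
  have Ysym: "inner (?Y n x) y = inner x (?Y n y)" if "x \<in> S" "y \<in> S" for n x y
    using that
  proof (induction n arbitrary: x y)
    case (Suc n)
    then have "inner (?Y n (?Y n x)) y = inner x (?Y n (?Y n y))" using YS by simp
    then show ?case using Asym Suc.prems by (simp add: inner_add_left inner_add_right)
  qed simp
  have Zsym: "inner (Z x) y = inner x (Z y)" if "x \<in> S" "y \<in> S" for x y
  proof (rule LIMSEQ_unique)
    show "(\<lambda>n. inner (?Y n x) y) \<longlonglongrightarrow> inner (Z x) y" by (intro tendsto_inner Z tendsto_const that)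
    have "inner (?Y n x) y = inner x (?Y n y)" for n using Ysym that by blast
    then show "(\<lambda>n. inner (?Y n x) y) \<longlonglongrightarrow> inner x (Z y)"
      using tendsto_inner[OF tendsto_const Z[OF that(2)]] by (simp del: sqrt_iter.simps)
  qed
  have Yle: "norm (?Y n x) \<le> norm x" if "x \<in> S" for n x
  proof -
    have "?y n * norm x \<le> 1 * norm x" using sqrt_iter_bound_range by (intro mult_right_mono) auto
    then show ?thesis using Yb[OF that, of n] by simp
  qed
  have Zb: "norm (Z x) \<le> norm x" if "x \<in> S" for x
    using LIMSEQ_le_const2[OF tendsto_norm[OF Z[OF that]]] Yle[OF that] by blast
  have ZZ: "Z x = (1/2) *\<^sub>R (A x + Z (Z x))" if x: "x \<in> S" for x
  proof (rule LIMSEQ_unique)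
    show "(\<lambda>n. ?Y (Suc n) x) \<longlonglongrightarrow> Z x" by (rule LIMSEQ_Suc[OF Z[OF x]])
    have "(\<lambda>n. ?Y n (?Y n x) - Z (Z x)) \<longlonglongrightarrow> 0"
    proof (rule Lim_null_comparison)
      show "(\<lambda>n. norm (?Y n x - Z x) + norm (?Y n (Z x) - Z (Z x))) \<longlonglongrightarrow> 0"
        using tendsto_add[OF tendsto_norm_zero[OF LIM_zero[OF Z[OF x]]] tendsto_norm_zero[OF LIM_zero[OF Z[OF ZS[OF x]]]]]
        by (simp del: sqrt_iter.simps)
      show "\<forall>\<^sub>F n in sequentially. norm (?Y n (?Y n x) - Z (Z x)) \<le> norm (?Y n x - Z x) + norm (?Y n (Z x) - Z (Z x))"
      proof (rule always_eventually, rule allI)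
        fix n
        have d: "?Y n (?Y n x - Z x) = ?Y n (?Y n x) - ?Y n (Z x)"
          by (rule linear_on_diff[OF Ylin S(1) YS[OF x] ZS[OF x]])
        have "norm (?Y n (?Y n x) - Z (Z x)) \<le> norm (?Y n (?Y n x - Z x)) + norm (?Y n (Z x) - Z (Z x))"
          unfolding d using norm_triangle_ineq[of "?Y n (?Y n x) - ?Y n (Z x)" "?Y n (Z x) - Z (Z x)"] by (simp del: sqrt_iter.simps)
        also have "norm (?Y n (?Y n x - Z x)) \<le> norm (?Y n x - Z x)"
          by (intro Yle subspace_diff S YS ZS x)
        finally show "norm (?Y n (?Y n x) - Z (Z x)) \<le> norm (?Y n x - Z x) + norm (?Y n (Z x) - Z (Z x))" by simp
      qed
    qed
    then have "(\<lambda>n. ?Y n (?Y n x)) \<longlonglongrightarrow> Z (Z x)" by (rule LIM_zero_cancel)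
    then show "(\<lambda>n. ?Y (Suc n) x) \<longlonglongrightarrow> (1/2) *\<^sub>R (A x + Z (Z x))"
      unfolding sqrt_iter.simps by (intro tendsto_intros)
  qed
  \<comment> \<open>By the fixed point equation \<open>ZZ\<close> the square of \<open>I - Z\<close>
    is \<open>I - A\<close>, that is \<open>Q / K\<close>.\<close>
  define R where "R x = sqrt K *\<^sub>R (x - Z x)" for x
  have RS: "R x \<in> S" if "x \<in> S" for x
    unfolding R_def using that ZS S(1) by (intro subspace_scale subspace_diff)
  have RR: "R (R x) = Q x" if x: "x \<in> S" for x
  proof -
    have xZ: "x - Z x \<in> S" using x ZS S(1) by (intro subspace_diff)
    have "R (R x) = K *\<^sub>R ((x - Z x) - Z (x - Z x))"
      unfolding R_def[of "R x"] unfolding R_def linear_onD(2)[OF Zlin xZ]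
      using K(1) by (simp add: scaleR_diff_right[symmetric])
    also have "\<dots> = K *\<^sub>R (x - 2 *\<^sub>R Z x + Z (Z x))"
      unfolding linear_on_diff[OF Zlin S(1) x ZS[OF x]] by (simp add: algebra_simps scaleR_2)
    also have "2 *\<^sub>R Z x = A x + Z (Z x)" using arg_cong[OF ZZ[OF x], of "\<lambda>y. 2 *\<^sub>R y"] by simp
    also have "K *\<^sub>R (x - (A x + Z (Z x)) + Z (Z x)) = Q x" unfolding A_def using K(1) by (simp add: algebra_simps)
    finally show ?thesis .
  qed
  have Rpos: "0 \<le> inner (R x) x" if "x \<in> S" for x
  proof -
    have "inner (Z x) x \<le> norm (Z x) * norm x" by (rule norm_cauchy_schwarz)
    also have "\<dots> \<le> norm x * norm x" using Zb[OF that] by (intro mult_right_mono) auto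
    finally have "0 \<le> inner (x - Z x) x" by (simp add: inner_diff_left power2_norm_eq_inner[symmetric] power2_eq_square)
    then show ?thesis unfolding R_def using K(1) by simp
  qed
  have "symmetric_op_on S R" unfolding symmetric_op_on_def
  proof (intro conjI)
    show "linear_on S R" unfolding linear_on_def R_def
      using linear_onD[OF Zlin] by (auto simp: algebra_simps)
    show "R ` S \<subseteq> S" using RS by auto
    have "norm (R x) \<le> (sqrt K * 2) * norm x" if "x \<in> S" for x
    proof -
      have "norm (x - Z x) \<le> 2 * norm x" using norm_triangle_ineq4[of x "Z x"] Zb[OF that] by simp
      then show ?thesis unfolding R_def using K(1) by simp
    qed
    then show "\<exists>K. \<forall>x\<in>S. norm (R x) \<le> K * norm x" by blast
    show "\<forall>x\<in>S. \<forall>y\<in>S. inner (R x) y = inner x (R y)"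
      unfolding R_def using Zsym by (simp add: inner_diff_left inner_diff_right)
  qed
  with Rpos RR show ?thesis by (intro that[of R]) auto
qed

text \<open>Injectivity, which turns \<open>inv_into\<close> in \<open>inner_cm\<close> into a
  genuine inverse, comes from the strict positivity of \<open>Q\<close>: a zero of the root is a
  zero of \<open>Q\<close>.\<close>

lemma sqrt_op_on_props:
  fixes S :: "'a::{real_inner,banach} set"
  assumes S: "subspace S" "closed S" and Q: "covariance_op_on S Q"
  shows "symmetric_op_on S (sqrt_op_on S Q)" "\<And>x. x \<in> S \<Longrightarrow> sqrt_op_on S Q (sqrt_op_on S Q x) = Q x"
    "inj_on (sqrt_op_on S Q) S"
proof -
  have sQ: "symmetric_op_on S Q" using Q by (simp add: covariance_op_on_def)
  have pos: "0 < inner (Q x) x" if "x \<in> S" "x \<noteq> 0" for x using Q that by (simp add: covariance_op_on_def)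
  then have "0 \<le> inner (Q x) x" if "x \<in> S" for x using that by (cases "x = 0") (auto intro: less_imp_le)
  from sqrt_op_exists[OF S sQ this]
  have "\<exists>R. symmetric_op_on S R \<and> (\<forall>x\<in>S. inner (R x) x \<ge> 0) \<and> (\<forall>x\<in>S. R (R x) = Q x)" by metis
  from someI_ex[OF this, folded sqrt_op_on_def]
  show R: "symmetric_op_on S (sqrt_op_on S Q)"
    and RR: "\<And>x. x \<in> S \<Longrightarrow> sqrt_op_on S Q (sqrt_op_on S Q x) = Q x" by auto
  show "inj_on (sqrt_op_on S Q) S"
  proof (rule inj_onI)
    fix x y assume xy: "x \<in> S" "y \<in> S" "sqrt_op_on S Q x = sqrt_op_on S Q y"
    have lin: "linear_on S (sqrt_op_on S Q)" using R by (simp add: symmetric_op_on_def)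
    have d: "x - y \<in> S" using xy S(1) by (intro subspace_diff)
    have "sqrt_op_on S Q (x - y) = 0" using linear_on_diff[OF lin S(1)] xy by simp
    then have "Q (x - y) = 0" using RR[OF d] linear_on_zero[OF lin S(1)] by simp
    then show "x = y" using pos[OF d] by force
  qed
qed

section \<open>Hilbert-Schmidt operators on the Cameron-Martin space\<close>

context
  fixes S :: "'u::{real_inner,banach,second_countable_topology} set" and Q :: "'u \<Rightarrow> 'u"
  assumes S: "subspace S" "closed S" and Q: "covariance_op_on S Q"
begin

abbreviation "rootQ \<equiv> sqrt_op_on S Q"

lemma form_S: "separable_hilbert_form inner S 1"
  using S by (intro separable_hilbert_form.intro hilbert_form.intro)
    (auto simp: bounded_bilinear_inner inner_commute power2_norm_eq_inner)

interpretation SF: separable_hilbert_form inner S 1 by (rule form_S)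

lemma R_S: "x \<in> S \<Longrightarrow> rootQ x \<in> S"
  using sqrt_op_on_props(1)[OF S Q] by (auto simp: symmetric_op_on_def)

lemma R_linear: "linear_on S rootQ"
  using sqrt_op_on_props(1)[OF S Q] by (auto simp: symmetric_op_on_def)

lemma R_sym: "x \<in> S \<Longrightarrow> y \<in> S \<Longrightarrow> inner (rootQ x) y = inner x (rootQ y)"
  using sqrt_op_on_props(1)[OF S Q] by (auto simp: symmetric_op_on_def)

lemma inner_Q: "x \<in> S \<Longrightarrow> inner (Q x) x = (norm (rootQ x))\<^sup>2"
  using sqrt_op_on_props(2)[OF S Q, of x] R_sym[of "rootQ x" x] R_S by (simp add: power2_norm_eq_inner)

lemma inner_cm_R:
  assumes "x \<in> S" "y \<in> S"
  shows "inner_cm S Q (rootQ x) (rootQ y) = inner x y"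
  unfolding inner_cm_def using assms sqrt_op_on_props(3)[OF S Q] by (simp add: inv_into_f_f)

text \<open>By \<open>inner_cm_R\<close> the root is an isometry of \<open>S\<close> onto the
  Cameron-Martin space, so the bases correspond.\<close>

lemma cameron_martin_basis:
  assumes E: "orthonormal_basis_on (cameron_martin S Q) (inner_cm S Q) E"
  obtains E' where "orthonormal_basis_on S inner E'" "bij_betw rootQ E' E"
proof
  define E' where "E' = {x \<in> S. rootQ x \<in> E}"
  have ES: "E \<subseteq> rootQ ` S" using E by (simp add: orthonormal_basis_on_def cameron_martin_def)
  have R0: "rootQ 0 = 0" by (rule linear_on_zero[OF R_linear S(1)])
  show "bij_betw rootQ E' E"
    using ES inj_on_subset[OF sqrt_op_on_props(3)[OF S Q], of E'] by (auto simp: bij_betw_def E'_def)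
  show "orthonormal_basis_on S inner E'"
    unfolding orthonormal_basis_on_def
  proof (intro conjI ballI impI)
    show "E' \<subseteq> S" by (auto simp: E'_def)
    fix e f assume "e \<in> E'" "f \<in> E'"
    then have ef: "e \<in> S" "f \<in> S" "rootQ e \<in> E" "rootQ f \<in> E" by (auto simp: E'_def)
    have "inner e f = inner_cm S Q (rootQ e) (rootQ f)" using inner_cm_R[OF ef(1,2)] by simp
    also have "\<dots> = (if rootQ e = rootQ f then 1 else 0)" using E ef by (simp add: orthonormal_basis_on_def)
    also have "(rootQ e = rootQ f) = (e = f)" using sqrt_op_on_props(3)[OF S Q] ef by (auto dest: inj_onD)
    finally show "inner e f = (if e = f then 1 else 0)" .
  next
    fix x assume x: "x \<in> S" "\<forall>e\<in>E'. inner x e = 0"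
    have "inner_cm S Q (rootQ x) e = 0" if e: "e \<in> E" for e
    proof -
      obtain y where "y \<in> S" "e = rootQ y" using ES e by auto
      then show ?thesis using inner_cm_R[OF x(1), of y] x(2) e by (auto simp: E'_def)
    qed
    then have "rootQ x = 0" using E x(1) by (simp add: orthonormal_basis_on_def cameron_martin_def)
    then show "x = 0" using inj_onD[OF sqrt_op_on_props(3)[OF S Q] _ x(1), of 0] R0 subspace_0[OF S(1)] by simp
  qed
qed

text \<open>\<open>a k\<close> and \<open>m k\<close> are the adjoints of \<open>B rootQ\<close> and
  \<open>M B rootQ\<close> at \<open>g k\<close>. Sums over them mention no basis of the
  Cameron-Martin space, so the value is independent of the basis chosen in \<open>hs_norm\<close>;
  up to the factor \<open>\<tau>\<close> the squared norms are the variances of the noise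
  coordinates.\<close>

lemma hilbert_schmidt_cm_sums:
  assumes sk: "skew_adjoint ip X \<kappa> DM M"
  defines "nrmD \<equiv> \<lambda>x. sqrt (ip x x + ip (M x) (M x))"
  assumes HS: "hilbert_schmidt (cameron_martin S Q) (inner_cm S Q) DM nrmD B"
    and g: "hilbert_form.onseq ip X g"
    and a: "\<And>k. a k \<in> S" "\<And>x k. x \<in> S \<Longrightarrow> ip (B (rootQ x)) (g k) = inner x (a k)"
    and m: "\<And>k. m k \<in> S" "\<And>x k. x \<in> S \<Longrightarrow> ip (M (B (rootQ x))) (g k) = inner x (m k)"
  shows "(\<Sum>k. ennreal ((norm (a k))\<^sup>2)) + (\<Sum>k. ennreal ((norm (m k))\<^sup>2))
    = ennreal ((hs_norm (cameron_martin S Q) (inner_cm S Q) nrmD B)\<^sup>2)"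
proof -
  interpret skew_adjoint ip X \<kappa> DM M by (rule sk)
  let ?U = "cameron_martin S Q" and ?i = "inner_cm S Q"
  let ?tot = "(\<Sum>k. ennreal ((norm (a k))\<^sup>2)) + (\<Sum>k. ennreal ((norm (m k))\<^sup>2))"
  define \<phi> where "\<phi> x = (nrmD (B (rootQ x)))\<^sup>2" for x
  have RU: "rootQ x \<in> ?U" if "x \<in> S" for x using that by (simp add: cameron_martin_def)
  have BD: "B (rootQ x) \<in> DM" if "x \<in> S" for x using HS RU[OF that] by (auto simp: hilbert_schmidt_def)
  have BX: "B (rootQ x) \<in> X" "M (B (rootQ x)) \<in> X" if "x \<in> S" for x using BD[OF that] DM_X M_X by auto
  have \<phi>_eq: "\<phi> x = ip (B (rootQ x)) (B (rootQ x)) + ip (M (B (rootQ x))) (M (B (rootQ x)))" if "x \<in> S" for x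
    using BX[OF that] by (simp add: \<phi>_def nrmD_def ip_nonneg)
  have U0: "0 \<in> ?U" using RU[OF subspace_0[OF S(1)]] linear_on_zero[OF R_linear S(1)] by simp
  have B0: "B 0 = 0" using HS linear_onD(2)[of ?U B 0 0] U0 by (simp add: hilbert_schmidt_def)
  have \<phi>0: "\<phi> 0 = 0" "\<And>x. \<phi> x \<ge> 0"
    using linear_on_zero[OF R_linear S(1)] linear_on_zero[OF M_linear subspace_DM]
    by (auto simp: \<phi>_def B0 nrmD_def ip_simps)
  have hf: "hilbert_form inner S 1" "hilbert_form ip X \<kappa>"
    using SF.hilbert_form_axioms hilbert_form_axioms by auto
  have sums: "(\<lambda>e. (nrmD (B e))\<^sup>2) summable_on E \<longleftrightarrow> ?tot \<noteq> \<infinity>"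
    "(\<lambda>e. (nrmD (B e))\<^sup>2) summable_on E \<Longrightarrow> ennreal (infsum (\<lambda>e. (nrmD (B e))\<^sup>2) E) = ?tot"
    if E: "orthonormal_basis_on ?U ?i E" for E
  proof -
    obtain E' where E': "orthonormal_basis_on S inner E'" "bij_betw rootQ E' E"
      using cameron_martin_basis[OF E] by blast
    obtain e where e: "SF.onseq e"
      and se: "\<phi> summable_on E' \<longleftrightarrow> summable (\<lambda>k. \<phi> (e k))"
      and ie: "\<phi> summable_on E' \<Longrightarrow> infsum \<phi> E' = (\<Sum>k. \<phi> (e k))"
      using SF.orthonormal_basis_onseq[OF E'(1)] \<phi>0 by metis
    have re: "(\<lambda>e. (nrmD (B e))\<^sup>2) summable_on E \<longleftrightarrow> \<phi> summable_on E'"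
      "infsum (\<lambda>e. (nrmD (B e))\<^sup>2) E = infsum \<phi> E'"
      using summable_on_reindex_bij_betw[OF E'(2), of "\<lambda>e. (nrmD (B e))\<^sup>2"]
        infsum_reindex_bij_betw[OF E'(2), of "\<lambda>e. (nrmD (B e))\<^sup>2"] unfolding \<phi>_def by simp_all
    have eS: "e k \<in> S" for k by (rule SF.onseq_X[OF e])
    have "(\<Sum>k. ennreal (\<phi> (e k))) = (\<Sum>k. ennreal (ip (B (rootQ (e k))) (B (rootQ (e k)))) + ennreal (ip (M (B (rootQ (e k)))) (M (B (rootQ (e k))))))"
      using BX[OF eS] by (simp add: \<phi>_eq[OF eS] ip_nonneg)
    also have "\<dots> = (\<Sum>k. ennreal (ip (B (rootQ (e k))) (B (rootQ (e k))))) + (\<Sum>k. ennreal (ip (M (B (rootQ (e k)))) (M (B (rootQ (e k))))))"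
      by (rule suminf_add[symmetric]) auto
    also have "(\<Sum>k. ennreal (ip (B (rootQ (e k))) (B (rootQ (e k))))) = (\<Sum>k. ennreal (inner (a k) (a k)))"
      by (rule hilbert_schmidt_adjoint[OF hf e g]) (auto simp: BX a)
    also have "(\<Sum>k. ennreal (ip (M (B (rootQ (e k)))) (M (B (rootQ (e k)))))) = (\<Sum>k. ennreal (inner (m k) (m k)))"
      by (rule hilbert_schmidt_adjoint[OF hf e g]) (auto simp: BX m)
    finally have tot: "(\<Sum>k. ennreal (\<phi> (e k))) = ?tot" by (simp add: power2_norm_eq_inner)
    show "(\<lambda>e. (nrmD (B e))\<^sup>2) summable_on E \<longleftrightarrow> ?tot \<noteq> \<infinity>"
      unfolding re se tot[symmetric] infinity_ennreal_def
    proof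
      show "(\<Sum>k. ennreal (\<phi> (e k))) \<noteq> \<top>" if "summable (\<lambda>k. \<phi> (e k))"
        by (rule ennreal_suminf_neq_top[OF that \<phi>0(2)])
      show "summable (\<lambda>k. \<phi> (e k))" if "(\<Sum>k. ennreal (\<phi> (e k))) \<noteq> \<top>"
        by (rule summable_suminf_not_top[OF \<phi>0(2) that])
    qed
    assume "(\<lambda>e. (nrmD (B e))\<^sup>2) summable_on E"
    then have "summable (\<lambda>k. \<phi> (e k))" "infsum \<phi> E' = (\<Sum>k. \<phi> (e k))" using re se ie by auto
    then show "ennreal (infsum (\<lambda>e. (nrmD (B e))\<^sup>2) E) = ?tot"
      unfolding re tot[symmetric] using suminf_ennreal2[OF \<phi>0(2)] by simp
  qed
  obtain E where E: "orthonormal_basis_on ?U ?i E" "(\<lambda>e. (nrmD (B e))\<^sup>2) summable_on E"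
    using HS by (auto simp: hilbert_schmidt_def)
  \<comment> \<open>Summability is known for some basis, the norm is defined with a chosen one;
    \<open>sums\<close> carries it over.\<close>
  define E1 where "E1 = (SOME E. orthonormal_basis_on ?U ?i E)"
  have E1: "orthonormal_basis_on ?U ?i E1" unfolding E1_def using E(1) by (rule someI)
  have "(\<lambda>e. (nrmD (B e))\<^sup>2) summable_on E1" using sums(1)[OF E(1)] sums(1)[OF E1] E(2) by simp
  then have "ennreal (infsum (\<lambda>e. (nrmD (B e))\<^sup>2) E1) = ?tot" by (rule sums(2)[OF E1])
  moreover have "0 \<le> infsum (\<lambda>e. (nrmD (B e))\<^sup>2) E1" by (rule infsum_nonneg) simp
  ultimately show ?thesis by (simp add: hs_norm_def E1_def)
qed

end

section \<open>Gaussian random variables in Hilbert spaces\<close>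

subsection \<open>Moments\<close>

text \<open>If one argument is 0, where the power is 0, the claim reduces to
  \<open>s powr q \<le> s\<close> for a weight \<open>s\<close> below 1; otherwise it is convexity
  on the positive half-line.\<close>

lemma powr_convex_nonneg:
  assumes "q \<ge> 1"
  shows "convex_on {0..} (\<lambda>x::real. x powr q)"
proof (rule convex_onI)
  fix t x y :: real assume t: "0 < t" "t < 1" and x: "x \<in> {0..}" and y: "y \<in> {0..}"
  have le: "s powr q \<le> s" if "0 < s" "s < 1" for s :: real
    using powr_mono'[of 1 q s] assms that by simp
  consider "x = 0" | "y = 0" | "x > 0" "y > 0" using x y by fastforce
  then show "((1 - t) *\<^sub>R x + t *\<^sub>R y) powr q \<le> (1 - t) * x powr q + t * y powr q"
  proof cases
    case 1
    then show ?thesis using t y le[of t] by (simp add: powr_mult mult_right_mono)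
  next
    case 2
    then show ?thesis using t x le[of "1 - t"] by (simp add: powr_mult mult_right_mono)
  next
    case 3
    then show ?thesis using convex_onD[OF powr_convex[OF assms], of t x y] t by simp
  qed
qed (simp add: convex_real_interval)

definition gauss_moment :: "real \<Rightarrow> real" where
  "gauss_moment p = (LINT x|lborel. std_normal_density x * \<bar>x\<bar> powr p)"

text \<open>Dominated by 1 plus an even power of order at least \<open>p\<close>, whose normal
  moment is finite.\<close>

lemma integrable_gauss_moment:
  assumes "p \<ge> 0"
  shows "integrable lborel (\<lambda>x. std_normal_density x * \<bar>x\<bar> powr p)"
proof -
  define m where "m = nat \<lceil>p\<rceil>"
  have m: "p \<le> real (2 * m)" using assms by (simp add: m_def) linarith
  have int: "integrable lborel (\<lambda>x. std_normal_density x + std_normal_density x * x ^ (2 * m))"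
    using std_normal_moment_even[of m] std_normal_moment_even[of 0]
    by (intro Bochner_Integration.integrable_add) (auto simp: has_bochner_integral_iff)
  show ?thesis
  proof (rule Bochner_Integration.integrable_bound[OF int])
    show "AE x in lborel. norm (std_normal_density x * \<bar>x\<bar> powr p) \<le> norm (std_normal_density x + std_normal_density x * x ^ (2 * m))"
    proof (rule AE_I2)
      fix x :: real
      have "\<bar>x\<bar> powr p \<le> 1 + x ^ (2 * m)"
      proof (cases "\<bar>x\<bar> \<le> 1")
        case True
        then have "\<bar>x\<bar> powr p \<le> 1" using assms by (intro powr_le1) auto
        then show ?thesis by (simp add: add_increasing2)
      next
        case False
        then have "\<bar>x\<bar> powr p \<le> \<bar>x\<bar> powr real (2 * m)" using m by (intro powr_mono) auto
        also have "\<dots> = \<bar>x\<bar> ^ (2 * m)" using False by (subst powr_realpow) auto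
        also have "\<dots> = x ^ (2 * m)" by (simp add: power_mult)
        finally show ?thesis by simp
      qed
      then have "std_normal_density x * \<bar>x\<bar> powr p \<le> std_normal_density x * (1 + x ^ (2 * m))"
        by (intro mult_left_mono) auto
      then show "norm (std_normal_density x * \<bar>x\<bar> powr p) \<le> norm (std_normal_density x + std_normal_density x * x ^ (2 * m))"
        by (simp add: algebra_simps)
    qed
  qed measurable
qed

lemma gauss_moment_nonneg: "0 \<le> gauss_moment p"
  unfolding gauss_moment_def by (rule integral_nonneg_AE) simp

lemma normal_abs_moment:
  assumes P: "prob_space P" and X: "distributed P lborel X (normal_density 0 \<sigma>)" and \<sigma>: "\<sigma> > 0" and p: "p \<ge> 0"
  shows "(\<integral>\<^sup>+\<omega>. ennreal (\<bar>X \<omega>\<bar> powr p) \<partial>P) = ennreal (gauss_moment p * \<sigma> powr p)"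
proof -
  have Y: "distributed P lborel (\<lambda>x. (X x - 0) / \<sigma>) std_normal_density"
    using prob_space.normal_standard_normal_convert[OF P \<sigma>, of X 0] X by simp
  have [measurable]: "X \<in> borel_measurable P" using X by (simp add: distributed_def)
  have "(\<integral>\<^sup>+\<omega>. ennreal (\<bar>X \<omega>\<bar> powr p) \<partial>P) = (\<integral>\<^sup>+\<omega>. ennreal (\<sigma> powr p) * ennreal (\<bar>X \<omega> / \<sigma>\<bar> powr p) \<partial>P)"
  proof (rule nn_integral_cong)
    fix \<omega>
    have "\<bar>X \<omega>\<bar> powr p = (\<sigma> * \<bar>X \<omega> / \<sigma>\<bar>) powr p" using \<sigma> by (simp add: abs_divide)
    also have "\<dots> = \<sigma> powr p * \<bar>X \<omega> / \<sigma>\<bar> powr p" using \<sigma> by (subst powr_mult) auto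
    finally show "ennreal (\<bar>X \<omega>\<bar> powr p) = ennreal (\<sigma> powr p) * ennreal (\<bar>X \<omega> / \<sigma>\<bar> powr p)"
      by (simp add: ennreal_mult)
  qed
  also have "\<dots> = ennreal (\<sigma> powr p) * (\<integral>\<^sup>+\<omega>. ennreal (\<bar>X \<omega> / \<sigma>\<bar> powr p) \<partial>P)"
    by (rule nn_integral_cmult) measurable
  also have "(\<integral>\<^sup>+\<omega>. ennreal (\<bar>X \<omega> / \<sigma>\<bar> powr p) \<partial>P) = (\<integral>\<^sup>+x. ennreal (std_normal_density x) * ennreal (\<bar>x\<bar> powr p) \<partial>lborel)"
    using distributed_nn_integral[OF Y, of "\<lambda>x. ennreal (\<bar>x\<bar> powr p)"] by simp
  also have "\<dots> = (\<integral>\<^sup>+x. ennreal (std_normal_density x * \<bar>x\<bar> powr p) \<partial>lborel)"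
    by (simp add: ennreal_mult)
  also have "\<dots> = ennreal (gauss_moment p)"
    unfolding gauss_moment_def by (rule nn_integral_eq_integral[OF integrable_gauss_moment[OF p]]) simp
  finally show ?thesis by (simp add: ennreal_mult gauss_moment_nonneg mult.commute)
qed

text \<open>Jensen's inequality with the weights \<open>\<sigma>\<^sub>k\<^sup>2 / \<Sum>\<sigma>\<^sub>j\<^sup>2\<close>.\<close>

lemma nn_integral_partial_sum_squares:
  fixes \<xi> :: "nat \<Rightarrow> 'w \<Rightarrow> real"
  assumes [measurable]: "\<And>k. \<xi> k \<in> borel_measurable P" and q: "q \<ge> 1" and c: "c \<ge> 0" and \<sigma>: "\<And>k. 0 \<le> \<sigma> k"
    and bd: "\<And>k. (\<integral>\<^sup>+\<omega>. ennreal (\<bar>\<xi> k \<omega>\<bar> powr (2 * q)) \<partial>P) \<le> ennreal (c * \<sigma> k powr (2 * q))"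
    and V: "V \<ge> 0" "(\<Sum>k<n. (\<sigma> k)\<^sup>2) \<le> V\<^sup>2"
  shows "(\<integral>\<^sup>+\<omega>. ennreal ((\<Sum>k<n. (\<xi> k \<omega>)\<^sup>2) powr q) \<partial>P) \<le> ennreal (c * V powr (2 * q))"
proof -
  \<comment> \<open>Indices with \<open>\<sigma> k = 0\<close> carry variables that vanish almost
    surely; they must go before dividing by \<open>\<sigma> k\<close>.\<close>
  define I where "I = {k. k < n \<and> \<sigma> k > 0}"
  have I: "finite I" "I \<subseteq> {..<n}" by (auto simp: I_def)
  have null: "AE \<omega> in P. \<forall>k\<in>{..<n} - I. \<xi> k \<omega> = 0"
  proof (subst AE_ball_countable)
    show "\<forall>k\<in>{..<n} - I. AE \<omega> in P. \<xi> k \<omega> = 0"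
    proof
      fix k assume "k \<in> {..<n} - I"
      then have "\<sigma> k = 0" using \<sigma>[of k] by (auto simp: I_def)
      then have "(\<integral>\<^sup>+\<omega>. ennreal (\<bar>\<xi> k \<omega>\<bar> powr (2 * q)) \<partial>P) = 0" using bd[of k] by simp
      then have "AE \<omega> in P. ennreal (\<bar>\<xi> k \<omega>\<bar> powr (2 * q)) = 0" by (subst (asm) nn_integral_0_iff_AE) auto
      then show "AE \<omega> in P. \<xi> k \<omega> = 0" by eventually_elim (auto simp: ennreal_eq_0_iff)
    qed
  qed (auto intro: countable_finite)
  have sumI: "AE \<omega> in P. (\<Sum>k<n. (\<xi> k \<omega>)\<^sup>2) = (\<Sum>k\<in>I. (\<xi> k \<omega>)\<^sup>2)"
    using null
  proof eventually_elim
    case (elim \<omega>)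
    show ?case by (rule sum.mono_neutral_right) (use I elim in auto)
  qed
  show ?thesis
  proof (cases "I = {}")
    case True
    then have "(\<integral>\<^sup>+\<omega>. ennreal ((\<Sum>k<n. (\<xi> k \<omega>)\<^sup>2) powr q) \<partial>P) = (\<integral>\<^sup>+\<omega>. 0 \<partial>P)"
      using sumI by (intro nn_integral_cong_AE) (auto elim: eventually_mono)
    then show ?thesis by simp
  next
    case False
    define S where "S = (\<Sum>k\<in>I. (\<sigma> k)\<^sup>2)"
    have pos: "\<sigma> k > 0" if "k \<in> I" for k using that by (simp add: I_def)
    have S: "S > 0" unfolding S_def by (intro sum_pos I False zero_less_power pos)
    have SV: "S \<le> V\<^sup>2" unfolding S_def by (rule order_trans[OF sum_mono2 V(2)]) (use I in auto)
    have "(\<integral>\<^sup>+\<omega>. ennreal ((\<Sum>k<n. (\<xi> k \<omega>)\<^sup>2) powr q) \<partial>P)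
        \<le> (\<integral>\<^sup>+\<omega>. (\<Sum>k\<in>I. ennreal ((\<sigma> k)\<^sup>2 / S * (S powr q / \<sigma> k powr (2 * q))) * ennreal (\<bar>\<xi> k \<omega>\<bar> powr (2 * q))) \<partial>P)"
    proof (rule nn_integral_mono_AE)
      show "AE \<omega> in P. ennreal ((\<Sum>k<n. (\<xi> k \<omega>)\<^sup>2) powr q)
        \<le> (\<Sum>k\<in>I. ennreal ((\<sigma> k)\<^sup>2 / S * (S powr q / \<sigma> k powr (2 * q))) * ennreal (\<bar>\<xi> k \<omega>\<bar> powr (2 * q)))"
        using sumI
      proof eventually_elim
        case (elim \<omega>)
        \<comment> \<open>Scaled so that the average of the \<open>y k\<close> with the weights
          \<open>(\<sigma> k)\<^sup>2 / S\<close> is the sum of squares.\<close>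
        define y where "y k = S * (\<xi> k \<omega>)\<^sup>2 / (\<sigma> k)\<^sup>2" for k
        have "(\<Sum>k\<in>I. (\<xi> k \<omega>)\<^sup>2) = (\<Sum>k\<in>I. ((\<sigma> k)\<^sup>2 / S) *\<^sub>R y k)"
        proof (intro sum.cong refl)
          fix k assume "k \<in> I"
          then show "(\<xi> k \<omega>)\<^sup>2 = ((\<sigma> k)\<^sup>2 / S) *\<^sub>R y k" using pos[of k] S by (simp add: y_def)
        qed
        also have "\<dots> powr q \<le> (\<Sum>k\<in>I. (\<sigma> k)\<^sup>2 / S * y k powr q)"
        proof (rule convex_on_sum[OF I(1) False powr_convex_nonneg[OF q]])
          show "(\<Sum>k\<in>I. (\<sigma> k)\<^sup>2 / S) = 1" using S by (simp add: S_def sum_divide_distrib[symmetric])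
        qed (use S in \<open>auto simp: y_def\<close>)
        also have "\<dots> = (\<Sum>k\<in>I. (\<sigma> k)\<^sup>2 / S * (S powr q / \<sigma> k powr (2 * q)) * \<bar>\<xi> k \<omega>\<bar> powr (2 * q))"
        proof (intro sum.cong refl)
          fix k assume "k \<in> I"
          then have k: "\<sigma> k > 0" by (rule pos)
          have sq: "(z\<^sup>2) powr q = z powr (2 * q)" if "z \<ge> 0" for z :: real
            using that by (cases "z = 0") (auto simp: powr_powr[symmetric])
          have "y k powr q = S powr q * ((\<xi> k \<omega>)\<^sup>2) powr q / ((\<sigma> k)\<^sup>2) powr q"
            unfolding y_def using S by (subst powr_divide) (auto simp: powr_mult)
          also have "((\<xi> k \<omega>)\<^sup>2) powr q = \<bar>\<xi> k \<omega>\<bar> powr (2 * q)" using sq[of "\<bar>\<xi> k \<omega>\<bar>"] by simp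
          also have "((\<sigma> k)\<^sup>2) powr q = \<sigma> k powr (2 * q)" using sq[of "\<sigma> k"] k by simp
          finally show "(\<sigma> k)\<^sup>2 / S * y k powr q = (\<sigma> k)\<^sup>2 / S * (S powr q / \<sigma> k powr (2 * q)) * \<bar>\<xi> k \<omega>\<bar> powr (2 * q)" by simp
        qed
        finally have "(\<Sum>k<n. (\<xi> k \<omega>)\<^sup>2) powr q \<le> (\<Sum>k\<in>I. (\<sigma> k)\<^sup>2 / S * (S powr q / \<sigma> k powr (2 * q)) * \<bar>\<xi> k \<omega>\<bar> powr (2 * q))"
          using elim by simp
        then have "ennreal ((\<Sum>k<n. (\<xi> k \<omega>)\<^sup>2) powr q) \<le> ennreal (\<Sum>k\<in>I. (\<sigma> k)\<^sup>2 / S * (S powr q / \<sigma> k powr (2 * q)) * \<bar>\<xi> k \<omega>\<bar> powr (2 * q))"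
          by (rule ennreal_leI)
        also have "\<dots> = (\<Sum>k\<in>I. ennreal ((\<sigma> k)\<^sup>2 / S * (S powr q / \<sigma> k powr (2 * q)) * \<bar>\<xi> k \<omega>\<bar> powr (2 * q)))"
          using S by (intro sum_ennreal[symmetric]) auto
        also have "\<dots> = (\<Sum>k\<in>I. ennreal ((\<sigma> k)\<^sup>2 / S * (S powr q / \<sigma> k powr (2 * q))) * ennreal (\<bar>\<xi> k \<omega>\<bar> powr (2 * q)))"
          using S by (intro sum.cong refl ennreal_mult) auto
        finally show ?case .
      qed
    qed
    also have "\<dots> = (\<Sum>k\<in>I. ennreal ((\<sigma> k)\<^sup>2 / S * (S powr q / \<sigma> k powr (2 * q))) * (\<integral>\<^sup>+\<omega>. ennreal (\<bar>\<xi> k \<omega>\<bar> powr (2 * q)) \<partial>P))"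
      by (subst nn_integral_sum) (auto simp: nn_integral_cmult)
    also have "\<dots> \<le> (\<Sum>k\<in>I. ennreal ((\<sigma> k)\<^sup>2 / S * (S powr q / \<sigma> k powr (2 * q))) * ennreal (c * \<sigma> k powr (2 * q)))"
      by (intro sum_mono mult_left_mono bd) auto
    also have "\<dots> = (\<Sum>k\<in>I. ennreal ((\<sigma> k)\<^sup>2 / S * (c * S powr q)))"
    proof (intro sum.cong refl)
      fix k assume "k \<in> I"
      then have k: "\<sigma> k > 0" by (rule pos)
      have "ennreal ((\<sigma> k)\<^sup>2 / S * (S powr q / \<sigma> k powr (2 * q))) * ennreal (c * \<sigma> k powr (2 * q))
          = ennreal (((\<sigma> k)\<^sup>2 / S * (S powr q / \<sigma> k powr (2 * q))) * (c * \<sigma> k powr (2 * q)))"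
        using S c by (intro ennreal_mult[symmetric]) auto
      also have "((\<sigma> k)\<^sup>2 / S * (S powr q / \<sigma> k powr (2 * q))) * (c * \<sigma> k powr (2 * q)) = (\<sigma> k)\<^sup>2 / S * (c * S powr q)"
        using k by simp
      finally show "ennreal ((\<sigma> k)\<^sup>2 / S * (S powr q / \<sigma> k powr (2 * q))) * ennreal (c * \<sigma> k powr (2 * q)) = ennreal ((\<sigma> k)\<^sup>2 / S * (c * S powr q))" .
    qed
    also have "\<dots> = ennreal (\<Sum>k\<in>I. (\<sigma> k)\<^sup>2 / S * (c * S powr q))" using S c by (intro sum_ennreal) auto
    also have "(\<Sum>k\<in>I. (\<sigma> k)\<^sup>2 / S * (c * S powr q)) = c * S powr q"
      using S by (simp add: sum_distrib_right[symmetric] sum_divide_distrib[symmetric] S_def[symmetric])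
    also have "\<dots> \<le> c * V powr (2 * q)"
    proof (rule mult_left_mono[OF _ c])
      have "S powr q \<le> (V\<^sup>2) powr q" using S SV q by (intro powr_mono2) auto
      also have "\<dots> = V powr (2 * q)" using V(1) by (cases "V = 0") (auto simp: powr_powr[symmetric])
      finally show "S powr q \<le> V powr (2 * q)" .
    qed
    finally show ?thesis by (simp add: ennreal_leI)
  qed
qed

text \<open>Monotone convergence carries the bound on partial sums to the series, and the finite
  mean of the supremum gives convergence almost surely. The bound tolerates dependence among the
  \<open>\<xi> k\<close>, as coordinates of the noise may be correlated.\<close>

lemma nn_integral_sum_squares:
  fixes \<xi> :: "nat \<Rightarrow> 'w \<Rightarrow> real"
  assumes meas [measurable]: "\<And>k. \<xi> k \<in> borel_measurable P" and q: "q \<ge> 1" and c: "c \<ge> 0" and \<sigma>: "\<And>k. 0 \<le> \<sigma> k"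
    and bd: "\<And>k. (\<integral>\<^sup>+\<omega>. ennreal (\<bar>\<xi> k \<omega>\<bar> powr (2 * q)) \<partial>P) \<le> ennreal (c * \<sigma> k powr (2 * q))"
    and V: "V \<ge> 0" "(\<Sum>k. ennreal ((\<sigma> k)\<^sup>2)) \<le> ennreal (V\<^sup>2)"
  obtains \<zeta> where "\<zeta> \<in> borel_measurable P" "\<And>\<omega>. 0 \<le> \<zeta> \<omega>"
    "AE \<omega> in P. (\<lambda>k. (\<xi> k \<omega>)\<^sup>2) sums (\<zeta> \<omega>)\<^sup>2"
    "(\<integral>\<^sup>+\<omega>. ennreal (\<zeta> \<omega> powr (2 * q)) \<partial>P) \<le> ennreal (c * V powr (2 * q))"
proof -
  define F where "F n \<omega> = (\<Sum>k<n. (\<xi> k \<omega>)\<^sup>2)" for n \<omega>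
  define G where "G \<omega> = (SUP n. ennreal (F n \<omega> powr q))" for \<omega>
  have [measurable]: "F n \<in> borel_measurable P" for n unfolding F_def by measurable
  have F0: "0 \<le> F n \<omega>" for n \<omega> unfolding F_def by (rule sum_nonneg) simp
  have Fmono: "F m \<omega> \<le> F n \<omega>" if "m \<le> n" for m n \<omega> unfolding F_def using that by (intro sum_mono2) auto
  have Vn: "(\<Sum>k<n. (\<sigma> k)\<^sup>2) \<le> V\<^sup>2" for n
  proof -
    have "ennreal (\<Sum>k<n. (\<sigma> k)\<^sup>2) = (\<Sum>k<n. ennreal ((\<sigma> k)\<^sup>2))" by (rule sum_ennreal[symmetric]) simp
    also have "\<dots> \<le> (\<Sum>k. ennreal ((\<sigma> k)\<^sup>2))" by (rule sum_le_suminf) auto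
    also note V(2)
    finally show ?thesis by (simp add: ennreal_le_iff)
  qed
  have "(\<integral>\<^sup>+\<omega>. G \<omega> \<partial>P) = (SUP n. \<integral>\<^sup>+\<omega>. ennreal (F n \<omega> powr q) \<partial>P)"
    unfolding G_def
  proof (rule nn_integral_monotone_convergence_SUP)
    show "incseq (\<lambda>n \<omega>. ennreal (F n \<omega> powr q))"
      unfolding incseq_def le_fun_def using F0 Fmono q by (auto intro!: ennreal_leI powr_mono2)
  qed measurable
  also have "\<dots> \<le> ennreal (c * V powr (2 * q))"
    unfolding F_def by (intro SUP_least nn_integral_partial_sum_squares[OF meas q c \<sigma> bd V(1) Vn])
  finally have G: "(\<integral>\<^sup>+\<omega>. G \<omega> \<partial>P) \<le> ennreal (c * V powr (2 * q))" .
  have [measurable]: "G \<in> borel_measurable P" unfolding G_def by measurable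
  have "AE \<omega> in P. G \<omega> \<noteq> \<infinity>"
    using G by (intro nn_integral_noteq_infinite) (auto simp: less_top[symmetric] top_unique)
  then have summ: "AE \<omega> in P. summable (\<lambda>k. (\<xi> k \<omega>)\<^sup>2)"
  proof eventually_elim
    case (elim \<omega>)
    define r where "r = enn2real (G \<omega>)"
    have r: "F n \<omega> powr q \<le> r" for n
    proof -
      have "ennreal (F n \<omega> powr q) \<le> G \<omega>" unfolding G_def by (rule SUP_upper) simp
      also have "\<dots> = ennreal r" using elim by (simp add: r_def less_top)
      finally show ?thesis by (subst (asm) ennreal_le_iff) (simp add: r_def)
    qed
    show ?case
    proof (rule summableI_nonneg_bounded)
      fix n
      have "F n \<omega> = (F n \<omega> powr q) powr (1 / q)" using q F0[of n \<omega>] by (simp add: powr_powr)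
      also have "\<dots> \<le> r powr (1 / q)" using r[of n] q by (intro powr_mono2) auto
      finally show "(\<Sum>k<n. (\<xi> k \<omega>)\<^sup>2) \<le> r powr (1 / q)" by (simp add: F_def)
    qed simp
  qed
  define \<zeta> where "\<zeta> \<omega> = sqrt \<bar>\<Sum>k. (\<xi> k \<omega>)\<^sup>2\<bar>" for \<omega>
  have lim: "AE \<omega> in P. (\<lambda>k. (\<xi> k \<omega>)\<^sup>2) sums (\<zeta> \<omega>)\<^sup>2"
    using summ by eventually_elim (simp add: \<zeta>_def suminf_nonneg summable_sums)
  show ?thesis
  proof (rule that[OF _ _ lim])
    show "\<zeta> \<in> borel_measurable P" unfolding \<zeta>_def by measurable
    show "0 \<le> \<zeta> \<omega>" for \<omega> by (simp add: \<zeta>_def)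
    have "(\<integral>\<^sup>+\<omega>. ennreal (\<zeta> \<omega> powr (2 * q)) \<partial>P) \<le> (\<integral>\<^sup>+\<omega>. G \<omega> \<partial>P)"
    proof (rule nn_integral_mono_AE)
      show "AE \<omega> in P. ennreal (\<zeta> \<omega> powr (2 * q)) \<le> G \<omega>" using lim
      proof eventually_elim
        case (elim \<omega>)
        have z: "\<zeta> \<omega> powr (2 * q) = (\<zeta> \<omega>)\<^sup>2 powr q"
          using q by (cases "\<zeta> \<omega> = 0") (auto simp: \<zeta>_def powr_powr[symmetric])
        have "(\<lambda>n. F n \<omega> powr q) \<longlonglongrightarrow> (\<zeta> \<omega>)\<^sup>2 powr q"
          using elim q F0 unfolding sums_def F_def[symmetric] by (intro tendsto_powr2) auto
        then have "(\<lambda>n. ennreal (F n \<omega> powr q)) \<longlonglongrightarrow> ennreal (\<zeta> \<omega> powr (2 * q))"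
          unfolding z by (rule tendsto_ennrealI)
        then show ?case
          by (rule LIMSEQ_le_const2) (auto simp: G_def intro!: exI[of _ 0] SUP_upper)
      qed
    qed
    also note G
    finally show "(\<integral>\<^sup>+\<omega>. ennreal (\<zeta> \<omega> powr (2 * q)) \<partial>P) \<le> ennreal (c * V powr (2 * q))" .
  qed
qed

subsection \<open>Gaussian vectors\<close>

definition gaussian_on :: "'u::real_inner set \<Rightarrow> ('u \<Rightarrow> 'u) \<Rightarrow> 'w measure \<Rightarrow> real \<Rightarrow> ('w \<Rightarrow> 'u) \<Rightarrow> bool" where
  "gaussian_on S Q P \<tau> G \<longleftrightarrow> G \<in> borel_measurable P \<and> (\<forall>\<omega>\<in>space P. G \<omega> \<in> S) \<and>
     (\<forall>h\<in>S. h \<noteq> 0 \<longrightarrow> distributed P lborel (\<lambda>\<omega>. inner (G \<omega>) h)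
        (\<lambda>x. ennreal (normal_density 0 (sqrt (\<tau> * inner (Q h) h)) x)))"

locale gaussian_vector = prob_space P for P :: "'w measure" +
  fixes S :: "'u::{real_inner,banach,second_countable_topology} set" and Q :: "'u \<Rightarrow> 'u"
    and \<tau> :: real and G :: "'w \<Rightarrow> 'u"
  assumes S: "subspace S" "closed S" and Q: "covariance_op_on S Q" and tau: "\<tau> > 0"
    and G: "gaussian_on S Q P \<tau> G"
begin

sublocale SF: separable_hilbert_form inner S 1
  by (rule form_S[OF S Q])

abbreviation "R \<equiv> sqrt_op_on S Q"

lemmas R_props = R_S[OF S Q] R_linear[OF S Q] R_sym[OF S Q]

lemma G_measurable [measurable]: "G \<in> borel_measurable P"
  and G_S: "\<omega> \<in> space P \<Longrightarrow> G \<omega> \<in> S"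
  using G by (auto simp: gaussian_on_def)

lemma Q_pos: "h \<in> S \<Longrightarrow> h \<noteq> 0 \<Longrightarrow> 0 < inner (Q h) h"
  using Q by (simp add: covariance_op_on_def)

text \<open>The standard deviation of \<open>inner (G \<omega>) h\<close> is
  \<open>sqrt \<tau> * norm (R h)\<close>, since \<open>inner (Q h) h\<close> is the square of
  \<open>norm (R h)\<close>. The inequality also covers \<open>h = 0\<close>.\<close>

lemma G_moment:
  assumes h: "h \<in> S" and p: "p \<ge> 0"
  shows "(\<integral>\<^sup>+\<omega>. ennreal (\<bar>inner (G \<omega>) h\<bar> powr p) \<partial>P) \<le> ennreal (gauss_moment p * (sqrt \<tau> * norm (R h)) powr p)"
proof (cases "h = 0")
  case False
  have "distributed P lborel (\<lambda>\<omega>. inner (G \<omega>) h) (normal_density 0 (sqrt (\<tau> * inner (Q h) h)))"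
    using G h False by (simp add: gaussian_on_def)
  from normal_abs_moment[OF prob_space_axioms this _ p]
  show ?thesis using Q_pos[OF h False] tau by (simp add: inner_Q[OF S Q h] real_sqrt_mult)
qed simp

lemma G_expectation:
  assumes h: "h \<in> S"
  shows "integrable P (\<lambda>\<omega>. inner (G \<omega>) h)" "expectation (\<lambda>\<omega>. inner (G \<omega>) h) = 0"
proof -
  have "(\<integral>\<^sup>+\<omega>. ennreal (\<bar>inner (G \<omega>) h\<bar> powr 1) \<partial>P) < \<infinity>"
    using G_moment[OF h, of 1] by (auto intro: le_less_trans)
  then show "integrable P (\<lambda>\<omega>. inner (G \<omega>) h)"
    by (auto simp: integrable_iff_bounded)
  show "expectation (\<lambda>\<omega>. inner (G \<omega>) h) = 0"
  proof (cases "h = 0")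
    case False
    have "distributed P lborel (\<lambda>\<omega>. inner (G \<omega>) h) (normal_density 0 (sqrt (\<tau> * inner (Q h) h)))"
      using G h False by (simp add: gaussian_on_def)
    then show ?thesis using normal_distributed_expectation[of "sqrt (\<tau> * inner (Q h) h)"] Q_pos[OF h False] tau by simp
  qed simp
qed

text \<open>The finite trace of \<open>Q\<close> is the sum of the squared norms of
  \<open>R (e k)\<close>, so the coordinates of \<open>G\<close> fall under
  \<open>nn_integral_sum_squares\<close>. Only finiteness is recorded: it serves to integrate
  products with the increment.\<close>

lemma G_norm_moment:
  assumes p: "p \<ge> 2"
  shows "(\<integral>\<^sup>+\<omega>. ennreal (norm (G \<omega>) powr p) \<partial>P) < \<infinity>"
proof -
  obtain E where E: "orthonormal_basis_on S inner E" "(\<lambda>e. inner (Q e) e) summable_on E"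
    using Q by (auto simp: covariance_op_on_def)
  define \<phi> where "\<phi> x = (norm (R x))\<^sup>2" for x
  have \<phi>: "\<phi> 0 = 0" "\<And>x. \<phi> x \<ge> 0" using linear_on_zero[OF R_props(2) S(1)] by (auto simp: \<phi>_def)
  have "\<phi> e = inner (Q e) e" if "e \<in> E" for e
    using E(1) that inner_Q[OF S Q, of e] by (auto simp: \<phi>_def orthonormal_basis_on_def)
  then have "\<phi> summable_on E" using E(2) summable_on_cong[of E \<phi> "\<lambda>e. inner (Q e) e"] by blast
  then obtain e where e: "SF.onseq e" "summable (\<lambda>k. \<phi> (e k))"
    using SF.orthonormal_basis_onseq[OF E(1)] \<phi> by metis
  have eS: "e k \<in> S" for k by (rule SF.onseq_X[OF e(1)])
  define V where "V = sqrt (\<Sum>k. \<tau> * \<phi> (e k))"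
  have s: "summable (\<lambda>k. \<tau> * \<phi> (e k))" using e(2) by (rule summable_mult)
  have V: "V \<ge> 0" "(\<Sum>k. ennreal ((sqrt \<tau> * norm (R (e k)))\<^sup>2)) \<le> ennreal (V\<^sup>2)"
  proof -
    show "V \<ge> 0" unfolding V_def using tau \<phi>(2) by (intro real_sqrt_ge_zero suminf_nonneg s) auto
    have "(\<Sum>k. ennreal (\<tau> * \<phi> (e k))) = ennreal (\<Sum>k. \<tau> * \<phi> (e k))"
      using tau \<phi>(2) by (intro suminf_ennreal2 s) auto
    moreover have "V\<^sup>2 = (\<Sum>k. \<tau> * \<phi> (e k))" unfolding V_def
      using tau \<phi>(2) by (intro real_sqrt_pow2 suminf_nonneg s) auto
    ultimately show "(\<Sum>k. ennreal ((sqrt \<tau> * norm (R (e k)))\<^sup>2)) \<le> ennreal (V\<^sup>2)"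
      using tau by (simp add: \<phi>_def power_mult_distrib)
  qed
  obtain \<zeta> where \<zeta>: "\<zeta> \<in> borel_measurable P" "\<And>\<omega>. 0 \<le> \<zeta> \<omega>"
    "AE \<omega> in P. (\<lambda>k. (inner (G \<omega>) (e k))\<^sup>2) sums (\<zeta> \<omega>)\<^sup>2"
    "(\<integral>\<^sup>+\<omega>. ennreal (\<zeta> \<omega> powr (2 * (p / 2))) \<partial>P) \<le> ennreal (gauss_moment p * V powr (2 * (p / 2)))"
  proof (rule nn_integral_sum_squares[of "\<lambda>k \<omega>. inner (G \<omega>) (e k)" P "p / 2" "gauss_moment p" "\<lambda>k. sqrt \<tau> * norm (R (e k))" V])
    show "(\<integral>\<^sup>+\<omega>. ennreal (\<bar>inner (G \<omega>) (e k)\<bar> powr (2 * (p / 2))) \<partial>P) \<le> ennreal (gauss_moment p * (sqrt \<tau> * norm (R (e k))) powr (2 * (p / 2)))" for k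
      using G_moment[OF eS, of p k] p by simp
  qed (use p V tau gauss_moment_nonneg in auto)
  have "(\<integral>\<^sup>+\<omega>. ennreal (norm (G \<omega>) powr p) \<partial>P) = (\<integral>\<^sup>+\<omega>. ennreal (\<zeta> \<omega> powr p) \<partial>P)"
  proof (rule nn_integral_cong_AE)
    show "AE \<omega> in P. ennreal (norm (G \<omega>) powr p) = ennreal (\<zeta> \<omega> powr p)"
      using \<zeta>(3) AE_space
    proof eventually_elim
      case (elim \<omega>)
      have "(norm (G \<omega>))\<^sup>2 = (\<zeta> \<omega>)\<^sup>2"
        using sums_unique2[OF SF.Parseval[OF e(1) G_S[OF elim(2)]] elim(1)] by (simp add: power2_norm_eq_inner)
      then show ?case using \<zeta>(2)[of \<omega>] by simp
    qed
  qed
  also have "\<dots> < \<infinity>" using \<zeta>(4) by (auto intro: le_less_trans)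
  finally show ?thesis .
qed

text \<open>Independence of \<open>F\<close> and the increment is inherited by the smaller
  sigma-algebras generated by \<open>X\<close> and by a function of \<open>G\<close>.\<close>

lemma indep_borel_var:
  fixes X Y :: "'w \<Rightarrow> real"
  assumes F: "subalgebra P F" and indep: "indep_set (sets F) (sets (vimage_algebra (space P) G borel))"
    and X: "X \<in> borel_measurable F" and h: "h \<in> borel_measurable borel"
  shows "indep_var borel X borel (\<lambda>\<omega>. h (G \<omega>))"
  unfolding indep_var_eq
proof (intro conjI)
  have Xm: "X \<in> borel_measurable P" using measurable_from_subalg[OF F X] .
  show "X \<in> borel_measurable P" by (rule Xm)
  show hm: "(\<lambda>\<omega>. h (G \<omega>)) \<in> borel_measurable P" by (rule measurable_compose[OF G_measurable h])
  have sF: "space F = space P" using F by (simp add: subalgebra_def)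
  have A: "sigma_sets (space P) {X -` A \<inter> space P |A. A \<in> sets borel} \<subseteq> sets F"
  proof -
    have "{X -` A \<inter> space P |A. A \<in> sets borel} \<subseteq> sets F"
      using measurable_sets[OF X] sF by auto
    from sets.sigma_sets_subset[OF this] show ?thesis unfolding sF .
  qed
  let ?V = "vimage_algebra (space P) G borel"
  have hV: "(\<lambda>\<omega>. h (G \<omega>)) \<in> borel_measurable ?V"
    by (rule measurable_compose[OF measurable_vimage_algebra1 h]) auto
  have B: "sigma_sets (space P) {(\<lambda>\<omega>. h (G \<omega>)) -` A \<inter> space P |A. A \<in> sets borel} \<subseteq> sets ?V"
  proof -
    have "{(\<lambda>\<omega>. h (G \<omega>)) -` A \<inter> space P |A. A \<in> sets borel} \<subseteq> sets ?V"
      using measurable_sets[OF hV] by auto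
    from sets.sigma_sets_subset[OF this] show ?thesis unfolding space_vimage_algebra .
  qed
  show "indep_set (sigma_sets (space P) {X -` A \<inter> space P |A. A \<in> sets borel})
     (sigma_sets (space P) {(\<lambda>\<omega>. h (G \<omega>)) -` A \<inter> space P |A. A \<in> sets borel})"
    using indep unfolding indep_set_def
    by (rule indep_sets_mono_sets) (use A B in \<open>auto split: bool.split\<close>)
qed

text \<open>The expectation vanishes term by term in the expansion of \<open>G\<close> in an orthonormal system.\<close>

lemma expectation_ip_zero:
  assumes X: "hilbert_form ip X \<kappa>"
    and F: "subalgebra P F" and indep: "indep_set (sets F) (sets (vimage_algebra (space P) G borel))"
    and w: "w \<in> borel_measurable F" and u: "\<And>y. y \<in> X \<Longrightarrow> (\<lambda>\<omega>. ip (u \<omega>) y) \<in> borel_measurable F"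
    and uX: "\<And>\<omega>. \<omega> \<in> space P \<Longrightarrow> u \<omega> \<in> X"
    and i1: "integrable P (\<lambda>\<omega>. \<bar>w \<omega>\<bar> * hilbert_form.nrm ip (u \<omega>))"
    and i2: "integrable P (\<lambda>\<omega>. \<bar>w \<omega>\<bar> * hilbert_form.nrm ip (u \<omega>) * norm (G \<omega>))"
    and B: "linear_on S B" "\<And>x. x \<in> S \<Longrightarrow> B x \<in> X" "\<And>x. x \<in> S \<Longrightarrow> hilbert_form.nrm ip (B x) \<le> K * norm x"
  shows "integrable P (\<lambda>\<omega>. w \<omega> * ip (u \<omega>) (B (G \<omega>)))" "expectation (\<lambda>\<omega>. w \<omega> * ip (u \<omega>) (B (G \<omega>))) = 0"
proof -
  interpret X: hilbert_form ip X \<kappa> by (rule X)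
  obtain e where e: "SF.onseq e" by (rule SF.onseq_exists')
  have eS: "e k \<in> S" for k by (rule SF.onseq_X[OF e])
  define Pn where "Pn n \<omega> = (\<Sum>k<n. inner (G \<omega>) (e k) *\<^sub>R e k)" for n \<omega>
  have PnS: "Pn n \<omega> \<in> S" for n \<omega> unfolding Pn_def using eS by (intro SF.X_intros)
  have BPn: "B (Pn n \<omega>) = (\<Sum>k<n. inner (G \<omega>) (e k) *\<^sub>R B (e k))" for n \<omega>
    unfolding Pn_def by (subst linear_on_sum[OF B(1) S(1)]) (auto simp: linear_onD(2)[OF B(1) eS] eS S(1) subspace_scale)
  define t where "t k \<omega> = w \<omega> * ip (u \<omega>) (B (e k)) * inner (G \<omega>) (e k)" for k \<omega>
  have t_sum: "(\<Sum>k<n. t k \<omega>) = w \<omega> * ip (u \<omega>) (B (Pn n \<omega>))" for n \<omega>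
    unfolding BPn t_def by (simp add: X.ip_simps sum_distrib_left mult_ac)
  have tz: "integrable P (t k) \<and> expectation (t k) = 0" for k
  proof -
    have Xm: "(\<lambda>\<omega>. w \<omega> * ip (u \<omega>) (B (e k))) \<in> borel_measurable F"
      using w u[OF B(2)[OF eS]] by (rule borel_measurable_times)
    have iX: "integrable P (\<lambda>\<omega>. w \<omega> * ip (u \<omega>) (B (e k)))"
    proof (rule Bochner_Integration.integrable_bound)
      show "integrable P (\<lambda>\<omega>. X.nrm (B (e k)) * (\<bar>w \<omega>\<bar> * X.nrm (u \<omega>)))" using i1 by (rule integrable_mult_right)
      show "AE \<omega> in P. norm (w \<omega> * ip (u \<omega>) (B (e k))) \<le> norm (X.nrm (B (e k)) * (\<bar>w \<omega>\<bar> * X.nrm (u \<omega>)))"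
      proof (rule AE_I2)
        fix \<omega> assume "\<omega> \<in> space P"
        then have "\<bar>ip (u \<omega>) (B (e k))\<bar> \<le> X.nrm (u \<omega>) * X.nrm (B (e k))"
          by (intro X.Cauchy_Schwarz uX B(2) eS)
        from mult_left_mono[OF this, of "\<bar>w \<omega>\<bar>"]
        show "norm (w \<omega> * ip (u \<omega>) (B (e k))) \<le> norm (X.nrm (B (e k)) * (\<bar>w \<omega>\<bar> * X.nrm (u \<omega>)))"
          using X.nrm_nonneg[OF uX[OF \<open>\<omega> \<in> space P\<close>]] X.nrm_nonneg[OF B(2)[OF eS[of k]]]
          by (simp add: abs_mult mult_ac)
      qed
    qed (rule measurable_from_subalg[OF F Xm])
    \<comment> \<open>Each term factors into a part measurable for \<open>F\<close> and a coordinate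
      of \<open>G\<close>, which has mean zero.\<close>
    have iv: "indep_var borel (\<lambda>\<omega>. w \<omega> * ip (u \<omega>) (B (e k))) borel (\<lambda>\<omega>. inner (G \<omega>) (e k))"
      by (rule indep_borel_var[OF F indep Xm, of "\<lambda>x. inner x (e k)"]) measurable
    show ?thesis
      using indep_var_integrable[OF iv iX G_expectation(1)[OF eS]] indep_var_lebesgue_integral[OF iv iX G_expectation(1)[OF eS]]
        G_expectation(2)[OF eS] by (simp add: t_def[abs_def])
  qed
  have K: "K' \<ge> 0 \<and> (\<forall>x\<in>S. X.nrm (B x) \<le> K' * norm x)" if "K' = \<bar>K\<bar>" for K'
    using B(3) that by (auto intro: order_trans[OF B(3) mult_right_mono])
  have nPn: "norm (Pn n \<omega>) \<le> norm (G \<omega>)" if "\<omega> \<in> space P" for n \<omega>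
  proof -
    have "(norm (Pn n \<omega>))\<^sup>2 = (\<Sum>k<n. (inner (G \<omega>) (e k))\<^sup>2)"
      unfolding Pn_def power2_norm_eq_inner by (rule SF.onseq_partial_square[OF e]) auto
    also have "\<dots> \<le> (norm (G \<omega>))\<^sup>2"
      using SF.Parseval[OF e G_S[OF that]] sum_le_suminf[of "\<lambda>k. (inner (G \<omega>) (e k))\<^sup>2" "{..<n}"]
      by (simp add: sums_iff power2_norm_eq_inner)
    finally show ?thesis by (rule power2_le_imp_le) simp
  qed
  have lim: "(\<lambda>n. w \<omega> * ip (u \<omega>) (B (Pn n \<omega>))) \<longlonglongrightarrow> w \<omega> * ip (u \<omega>) (B (G \<omega>))" if \<omega>: "\<omega> \<in> space P" for \<omega>
  proof -
    have c: "(\<lambda>n. norm (Pn n \<omega> - G \<omega>)) \<longlonglongrightarrow> 0"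
      using SF.onseq_expand(1)[OF e G_S[OF \<omega>]] unfolding Pn_def[symmetric] by (intro tendsto_norm_zero LIM_zero)
    have "(\<lambda>n. B (Pn n \<omega>) - B (G \<omega>)) \<longlonglongrightarrow> 0"
    proof (rule Lim_null_comparison)
      show "(\<lambda>n. \<bar>K\<bar> / sqrt \<kappa> * norm (Pn n \<omega> - G \<omega>)) \<longlonglongrightarrow> 0" by (rule tendsto_mult_right_zero[OF c])
      show "\<forall>\<^sub>F n in sequentially. norm (B (Pn n \<omega>) - B (G \<omega>)) \<le> \<bar>K\<bar> / sqrt \<kappa> * norm (Pn n \<omega> - G \<omega>)"
      proof (rule always_eventually, rule allI)
        fix n
        have d: "Pn n \<omega> - G \<omega> \<in> S" using PnS G_S[OF \<omega>] by (intro SF.X_intros)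
        have "norm (B (Pn n \<omega> - G \<omega>)) \<le> X.nrm (B (Pn n \<omega> - G \<omega>)) / sqrt \<kappa>" by (rule X.norm_le_nrm[OF B(2)[OF d]])
        also have "\<dots> \<le> \<bar>K\<bar> * norm (Pn n \<omega> - G \<omega>) / sqrt \<kappa>"
          using K[OF refl] d X.kappa_pos by (intro divide_right_mono) auto
        finally show "norm (B (Pn n \<omega>) - B (G \<omega>)) \<le> \<bar>K\<bar> / sqrt \<kappa> * norm (Pn n \<omega> - G \<omega>)"
          using linear_on_diff[OF B(1) S(1) PnS G_S[OF \<omega>]] by simp
      qed
    qed
    then have "(\<lambda>n. B (Pn n \<omega>)) \<longlonglongrightarrow> B (G \<omega>)" by (rule LIM_zero_cancel)
    then show ?thesis by (intro tendsto_mult tendsto_const X.ip.tendsto)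
  qed
  have dom: "norm (w \<omega> * ip (u \<omega>) (B (Pn n \<omega>))) \<le> \<bar>K\<bar> * (\<bar>w \<omega>\<bar> * X.nrm (u \<omega>) * norm (G \<omega>))" if \<omega>: "\<omega> \<in> space P" for n \<omega>
  proof -
    have "\<bar>ip (u \<omega>) (B (Pn n \<omega>))\<bar> \<le> X.nrm (u \<omega>) * X.nrm (B (Pn n \<omega>))"
      by (intro X.Cauchy_Schwarz uX \<omega> B(2) PnS)
    also have "\<dots> \<le> X.nrm (u \<omega>) * (\<bar>K\<bar> * norm (G \<omega>))"
    proof (rule mult_left_mono[OF _ X.nrm_nonneg[OF uX[OF \<omega>]]])
      have "X.nrm (B (Pn n \<omega>)) \<le> \<bar>K\<bar> * norm (Pn n \<omega>)" using K[OF refl] PnS by blast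
      also have "\<dots> \<le> \<bar>K\<bar> * norm (G \<omega>)" using nPn[OF \<omega>] by (intro mult_left_mono) auto
      finally show "X.nrm (B (Pn n \<omega>)) \<le> \<bar>K\<bar> * norm (G \<omega>)" .
    qed
    finally have "\<bar>w \<omega>\<bar> * \<bar>ip (u \<omega>) (B (Pn n \<omega>))\<bar> \<le> \<bar>w \<omega>\<bar> * (X.nrm (u \<omega>) * (\<bar>K\<bar> * norm (G \<omega>)))"
      by (rule mult_left_mono) simp
    then show ?thesis by (simp add: abs_mult mult_ac)
  qed
  have part: "integrable P (\<lambda>\<omega>. w \<omega> * ip (u \<omega>) (B (Pn n \<omega>)))" "expectation (\<lambda>\<omega>. w \<omega> * ip (u \<omega>) (B (Pn n \<omega>))) = 0" for n
    unfolding t_sum[symmetric] using tz by auto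
  \<comment> \<open>Gives measurability of the integrand, as a pointwise limit of the integrable
    partial sums.\<close>
  define f where "f \<omega> = lim (\<lambda>n. w \<omega> * ip (u \<omega>) (B (Pn n \<omega>)))" for \<omega>
  have f: "f \<omega> = w \<omega> * ip (u \<omega>) (B (G \<omega>))" if "\<omega> \<in> space P" for \<omega>
    unfolding f_def by (rule limI[OF lim[OF that]])
  have fm: "f \<in> borel_measurable P" unfolding f_def using part(1) by (intro borel_measurable_lim_metric) auto
  have m: "(\<lambda>\<omega>. w \<omega> * ip (u \<omega>) (B (G \<omega>))) \<in> borel_measurable P"
    using fm measurable_cong[of P f "\<lambda>\<omega>. w \<omega> * ip (u \<omega>) (B (G \<omega>))" borel] f by simp
  have i3: "integrable P (\<lambda>\<omega>. \<bar>K\<bar> * (\<bar>w \<omega>\<bar> * X.nrm (u \<omega>) * norm (G \<omega>)))" using i2 by (rule integrable_mult_right)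
  note dc = m _ i3 AE_I2[OF lim] AE_I2[OF dom]
  show "integrable P (\<lambda>\<omega>. w \<omega> * ip (u \<omega>) (B (G \<omega>)))"
    by (rule integrable_dominated_convergence[OF dc]) (use part in auto)
  have "(\<lambda>n. expectation (\<lambda>\<omega>. w \<omega> * ip (u \<omega>) (B (Pn n \<omega>)))) \<longlonglongrightarrow> expectation (\<lambda>\<omega>. w \<omega> * ip (u \<omega>) (B (G \<omega>)))"
    by (rule integral_dominated_convergence[OF dc]) (use part in auto)
  then show "expectation (\<lambda>\<omega>. w \<omega> * ip (u \<omega>) (B (G \<omega>))) = 0" by (simp add: part(2) LIMSEQ_const_iff)
qed

text \<open>\<open>B G\<close> lies in the domain of \<open>M\<close> although \<open>G\<close> itself only lies in \<open>S\<close>: \<open>M B G\<close> is obtained as the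
  random series \<open>- \<Sum> \<langle>B G, M g\<^sub>k\<rangle> g\<^sub>k\<close>, and \<open>\<langle>B G, M y\<rangle> = - \<langle>M B G, y\<rangle>\<close> is checked for countably many \<open>y\<close>
  that are dense in the graph norm.\<close>

lemma hilbert_schmidt_noise:
  assumes sk: "skew_adjoint ip X \<kappa> DM M" and p: "p \<ge> 2"
    and B: "linear_on S B" "\<And>x. x \<in> S \<Longrightarrow> B x \<in> X" "\<And>x. x \<in> S \<Longrightarrow> norm (B x) \<le> K * norm x"
    and HS: "hilbert_schmidt (cameron_martin S Q) (inner_cm S Q) DM (\<lambda>x. sqrt (ip x x + ip (M x) (M x))) B"
  defines "hs \<equiv> hs_norm (cameron_martin S Q) (inner_cm S Q) (\<lambda>x. sqrt (ip x x + ip (M x) (M x))) B"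
  obtains \<zeta> where "\<zeta> \<in> borel_measurable P" "\<And>\<omega>. 0 \<le> \<zeta> \<omega>"
    "AE \<omega> in P. B (G \<omega>) \<in> DM \<and> hilbert_form.nrm ip (B (G \<omega>)) \<le> \<zeta> \<omega> \<and> hilbert_form.nrm ip (M (B (G \<omega>))) \<le> \<zeta> \<omega>"
    "(\<integral>\<^sup>+\<omega>. ennreal (\<zeta> \<omega> powr p) \<partial>P) \<le> ennreal (2 * gauss_moment p * (sqrt \<tau> * hs) powr p)"
proof -
  interpret skew_adjoint ip X \<kappa> DM M by (rule sk)
  have hs0: "hs \<ge> 0" unfolding hs_def hs_norm_def by (intro real_sqrt_ge_zero infsum_nonneg) simp
  \<comment> \<open>A system inside the domain, so that \<open>M\<close> can be moved from
    \<open>B G\<close> to \<open>g k\<close>.\<close>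
  obtain g where g: "onseq g" "\<And>k. g k \<in> DM"
    using onseq_exists[OF subspace_DM DM_X, of thesis] DM_dense sym by (metis (no_types, lifting))
  have gX: "g k \<in> X" "M (g k) \<in> X" for k using g DM_X M_X by auto
  obtain K2 where K2: "K2 > 0" "\<And>x. nrm x \<le> K2 * norm x" using nrm_le_norm by blast
  have nB: "nrm (B x) \<le> K2 * \<bar>K\<bar> * norm x" if "x \<in> S" for x
  proof -
    have "nrm (B x) \<le> K2 * norm (B x)" by (rule K2)
    also have "\<dots> \<le> K2 * (\<bar>K\<bar> * norm x)"
      using K2(1) by (intro mult_left_mono order_trans[OF B(3)[OF that] mult_right_mono]) auto
    finally show ?thesis by simp
  qed
  have "\<exists>b\<in>S. \<forall>x\<in>S. ip (B x) y = inner x b" if y: "y \<in> X" for y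
  proof -
    have "linear_on S (\<lambda>x. ip (B x) y)"
      unfolding linear_on_def using linear_onD[OF B(1)] by (auto simp: ip_simps)
    moreover have "\<bar>ip (B x) y\<bar> \<le> (K2 * \<bar>K\<bar> * nrm y) * norm x" if "x \<in> S" for x
    proof -
      have "\<bar>ip (B x) y\<bar> \<le> nrm (B x) * nrm y" by (intro Cauchy_Schwarz B(2) that y)
      also have "\<dots> \<le> (K2 * \<bar>K\<bar> * norm x) * nrm y" by (intro mult_right_mono nB that nrm_nonneg y)
      finally show ?thesis by (simp add: mult_ac)
    qed
    ultimately show ?thesis using SF.Riesz[of "\<lambda>x. ip (B x) y"] by metis
  qed
  \<comment> \<open>\<open>b y\<close> is the adjoint of \<open>B\<close> applied to
    \<open>y\<close>.\<close>
  then obtain b where b: "\<And>y. y \<in> X \<Longrightarrow> b y \<in> S" "\<And>x y. x \<in> S \<Longrightarrow> y \<in> X \<Longrightarrow> ip (B x) y = inner x (b y)" by metis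
  have RS: "R x \<in> S" if "x \<in> S" for x using R_props(1) that by simp
  have BD: "B (R x) \<in> DM" if "x \<in> S" for x
    using HS that by (auto simp: hilbert_schmidt_def cameron_martin_def)
  have adjM: "ip (M (B (R x))) y = inner x (- R (b (M y)))" if x: "x \<in> S" and y: "y \<in> DM" for x y
  proof -
    have "ip (M (B (R x))) y = - ip (B (R x)) (M y)" by (rule M_skew[OF BD[OF x] y])
    also have "\<dots> = - inner (R x) (b (M y))" using b(2)[OF RS[OF x] M_X[OF y]] by simp
    also have "\<dots> = inner x (- R (b (M y)))" using R_props(3)[OF x b(1)[OF M_X[OF y]]] by simp
    finally show ?thesis .
  qed
  have sums: "(\<Sum>k. ennreal ((norm (R (b (g k))))\<^sup>2)) + (\<Sum>k. ennreal ((norm (- R (b (M (g k)))))\<^sup>2)) = ennreal (hs\<^sup>2)"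
    unfolding hs_def
  proof (rule hilbert_schmidt_cm_sums[OF S Q sk HS g(1)])
    show "ip (B (R x)) (g k) = inner x (R (b (g k)))" if "x \<in> S" for x k
      using b(2)[OF RS[OF that] gX(1)] R_props(3)[OF that b(1)[OF gX(1)]] by simp
    show "ip (M (B (R x))) (g k) = inner x (- R (b (M (g k))))" if "x \<in> S" for x k
      by (rule adjM[OF that g(2)])
  qed (auto intro!: RS b gX SF.X_intros)
  have series: "\<exists>\<zeta>. \<zeta> \<in> borel_measurable P \<and> (\<forall>\<omega>. 0 \<le> \<zeta> \<omega>) \<and>
      (AE \<omega> in P. (\<lambda>k. (inner (G \<omega>) (h k))\<^sup>2) sums (\<zeta> \<omega>)\<^sup>2) \<and>
      (\<integral>\<^sup>+\<omega>. ennreal (\<zeta> \<omega> powr p) \<partial>P) \<le> ennreal (gauss_moment p * (sqrt \<tau> * V) powr p)"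
    if h: "\<And>k. h k \<in> S" and V: "V \<ge> 0" "(\<Sum>k. ennreal ((norm (R (h k)))\<^sup>2)) = ennreal (V\<^sup>2)" for h V
  proof -
    have "(\<Sum>k. ennreal ((sqrt \<tau> * norm (R (h k)))\<^sup>2)) = (\<Sum>k. ennreal \<tau> * ennreal ((norm (R (h k)))\<^sup>2))"
      using tau by (simp add: power_mult_distrib ennreal_mult)
    also have "\<dots> = ennreal \<tau> * ennreal (V\<^sup>2)" using V(2) by simp
    also have "\<dots> = ennreal ((sqrt \<tau> * V)\<^sup>2)" using tau by (simp add: power_mult_distrib ennreal_mult)
    finally have V': "(\<Sum>k. ennreal ((sqrt \<tau> * norm (R (h k)))\<^sup>2)) \<le> ennreal ((sqrt \<tau> * V)\<^sup>2)" by simp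
    show ?thesis
    proof (rule nn_integral_sum_squares[of "\<lambda>k \<omega>. inner (G \<omega>) (h k)" P "p / 2" "gauss_moment p" "\<lambda>k. sqrt \<tau> * norm (R (h k))" "sqrt \<tau> * V"])
      show "(\<integral>\<^sup>+\<omega>. ennreal (\<bar>inner (G \<omega>) (h k)\<bar> powr (2 * (p / 2))) \<partial>P) \<le> ennreal (gauss_moment p * (sqrt \<tau> * norm (R (h k))) powr (2 * (p / 2)))" for k
        using G_moment[OF h, of p k] p by simp
    qed (use p V V' tau gauss_moment_nonneg in auto)
  qed
  have fin: "(\<Sum>k. ennreal ((norm (R (b (g k))))\<^sup>2)) < \<infinity>" "(\<Sum>k. ennreal ((norm (R (b (M (g k)))))\<^sup>2)) < \<infinity>"
  proof -
    have "(\<Sum>k. ennreal ((norm (R (b (g k))))\<^sup>2)) \<le> ennreal (hs\<^sup>2)" "(\<Sum>k. ennreal ((norm (R (b (M (g k)))))\<^sup>2)) \<le> ennreal (hs\<^sup>2)"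
      unfolding sums[symmetric] by (auto intro: add_increasing add_increasing2)
    then show "(\<Sum>k. ennreal ((norm (R (b (g k))))\<^sup>2)) < \<infinity>" "(\<Sum>k. ennreal ((norm (R (b (M (g k)))))\<^sup>2)) < \<infinity>"
      by (auto intro: le_less_trans)
  qed
  \<comment> \<open>The squares of \<open>V1\<close> and \<open>V2\<close> are the two parts of the
    squared Hilbert-Schmidt norm, from \<open>B\<close> and from \<open>M B\<close>.\<close>
  define V1 where "V1 = sqrt (enn2real (\<Sum>k. ennreal ((norm (R (b (g k))))\<^sup>2)))"
  define V2 where "V2 = sqrt (enn2real (\<Sum>k. ennreal ((norm (R (b (M (g k)))))\<^sup>2)))"
  have V1: "V1 \<ge> 0" "(\<Sum>k. ennreal ((norm (R (b (g k))))\<^sup>2)) = ennreal (V1\<^sup>2)"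
    using fin(1) by (simp_all add: V1_def)
  have V2: "V2 \<ge> 0" "(\<Sum>k. ennreal ((norm (R (b (M (g k)))))\<^sup>2)) = ennreal (V2\<^sup>2)"
    using fin(2) by (simp_all add: V2_def)
  have "ennreal (V1\<^sup>2 + V2\<^sup>2) = ennreal (hs\<^sup>2)" using sums V1 V2 by (simp add: ennreal_plus)
  then have V12: "V1\<^sup>2 + V2\<^sup>2 = hs\<^sup>2" by (subst (asm) ennreal_inj) auto
  obtain \<zeta>1 where z1: "\<zeta>1 \<in> borel_measurable P" "\<And>\<omega>. 0 \<le> \<zeta>1 \<omega>"
      "AE \<omega> in P. (\<lambda>k. (inner (G \<omega>) (b (g k)))\<^sup>2) sums (\<zeta>1 \<omega>)\<^sup>2"
      "(\<integral>\<^sup>+\<omega>. ennreal (\<zeta>1 \<omega> powr p) \<partial>P) \<le> ennreal (gauss_moment p * (sqrt \<tau> * V1) powr p)"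
    using series[OF b(1)[OF gX(1)] V1] by blast
  obtain \<zeta>2 where z2: "\<zeta>2 \<in> borel_measurable P" "\<And>\<omega>. 0 \<le> \<zeta>2 \<omega>"
      "AE \<omega> in P. (\<lambda>k. (inner (G \<omega>) (b (M (g k))))\<^sup>2) sums (\<zeta>2 \<omega>)\<^sup>2"
      "(\<integral>\<^sup>+\<omega>. ennreal (\<zeta>2 \<omega> powr p) \<partial>P) \<le> ennreal (gauss_moment p * (sqrt \<tau> * V2) powr p)"
    using series[OF b(1)[OF gX(2)] V2] by blast
  note z1(1)[measurable] z2(1)[measurable]
  define T where "T = (\<lambda>x. (x, M x)) ` DM"
  obtain C where C: "countable C" "C \<subseteq> T" "T \<subseteq> closure C" using separable by blast
  obtain K3 where K3: "\<And>x. x \<in> S \<Longrightarrow> nrm (M (B (R x))) \<le> K3 * norm x" "K3 \<ge> 0"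
  proof -
    obtain K4 where K4: "\<forall>x\<in>cameron_martin S Q. sqrt (ip (B x) (B x) + ip (M (B x)) (M (B x))) \<le> K4 * sqrt (inner_cm S Q x x)"
      using HS unfolding hilbert_schmidt_def by blast
    have "nrm (M (B (R x))) \<le> \<bar>K4\<bar> * norm x" if x: "x \<in> S" for x
    proof -
      have "nrm (M (B (R x))) \<le> sqrt (ip (B (R x)) (B (R x)) + ip (M (B (R x))) (M (B (R x))))"
        unfolding nrm_def using ip_nonneg[of "B (R x)"] BD[OF x] DM_X by auto
      also have "\<dots> \<le> K4 * sqrt (inner_cm S Q (R x) (R x))" using K4 x by (auto simp: cameron_martin_def)
      also have "\<dots> = K4 * norm x" using inner_cm_R[OF S Q x x] by (simp add: norm_eq_sqrt_inner)
      also have "\<dots> \<le> \<bar>K4\<bar> * norm x" by (intro mult_right_mono) auto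
      finally show ?thesis .
    qed
    then show ?thesis using that[of "\<bar>K4\<bar>"] by simp
  qed
  \<comment> \<open>Up to sign \<open>R (b (M y))\<close> is the adjoint of the bounded operator
    \<open>M B R\<close> at \<open>y\<close>: hence a bound by \<open>y\<close> alone, without
    \<open>M y\<close>.\<close>
  have Rb: "norm (R (b (M y))) \<le> K3 * nrm y" if y: "y \<in> DM" for y
  proof (cases "R (b (M y)) = 0")
    case False
    have yX: "y \<in> X" using y DM_X by auto
    define x where "x = R (b (M y))"
    have x: "x \<in> S" unfolding x_def by (intro RS b M_X y)
    have "(norm x)\<^sup>2 = - ip (M (B (R x))) y" using adjM[OF x y] by (simp add: x_def power2_norm_eq_inner)
    also have "\<dots> \<le> nrm (M (B (R x))) * nrm y"
      using Cauchy_Schwarz[OF M_X[OF BD[OF x]] yX] by linarith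
    also have "\<dots> \<le> K3 * norm x * nrm y" by (intro mult_right_mono K3 x nrm_nonneg yX)
    finally have "norm x * norm x \<le> norm x * (K3 * nrm y)" by (simp add: power2_eq_square mult_ac)
    then show ?thesis using False by (simp add: x_def)
  qed (use K3 nrm_nonneg y DM_X in auto)
  \<comment> \<open>For fixed \<open>y\<close> the remainder \<open>\<Delta> n\<close> tends to 0
    only in mean square, so its lower limit vanishes almost surely. That identifies the limit of the
    partial sums wherever there is one; convergence itself is supplied later, path by path, by
    square summable coefficients. Hence the disjunction.\<close>
  have pair: "AE \<omega> in P. (\<lambda>n. - (\<Sum>k<n. inner (G \<omega>) (b (M (g k))) * ip y (g k))) \<longlonglongrightarrow> - ip (B (G \<omega>)) (M y)
      \<or> \<not> convergent (\<lambda>n. \<Sum>k<n. inner (G \<omega>) (b (M (g k))) * ip y (g k))" if y: "y \<in> DM" for y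
  proof -
    have yX: "y \<in> X" using y DM_X by auto
    define yn where "yn n = (\<Sum>k<n. ip y (g k) *\<^sub>R g k)" for n
    have yn: "yn n \<in> DM" for n unfolding yn_def using g(2) subspace_DM by (intro subspace_sum subspace_scale)
    have d: "y - yn n \<in> DM" for n using y yn subspace_DM by (intro subspace_diff)
    define \<Delta> where "\<Delta> n \<omega> = inner (G \<omega>) (b (M (y - yn n)))" for n \<omega>
    have D_eq: "\<Delta> n \<omega> = ip (B (G \<omega>)) (M y) - (\<Sum>k<n. inner (G \<omega>) (b (M (g k))) * ip y (g k))" if w: "\<omega> \<in> space P" for n \<omega>
    proof -
      have "M (yn n) = (\<Sum>k<n. ip y (g k) *\<^sub>R M (g k))"
        unfolding yn_def by (subst linear_on_sum[OF M_linear subspace_DM])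
          (auto simp: linear_onD(2)[OF M_linear g(2)] g(2) subspace_DM subspace_scale)
      moreover have "\<Delta> n \<omega> = ip (B (G \<omega>)) (M (y - yn n))"
        unfolding \<Delta>_def by (rule b(2)[OF G_S[OF w] M_X[OF d], symmetric])
      ultimately have "\<Delta> n \<omega> = ip (B (G \<omega>)) (M y) - (\<Sum>k<n. ip y (g k) * ip (B (G \<omega>)) (M (g k)))"
        using linear_on_diff[OF M_linear subspace_DM y yn] by (simp add: ip_simps)
      then show ?thesis using b(2)[OF G_S[OF w] gX(2)] by (simp add: mult.commute)
    qed
    have [measurable]: "\<Delta> n \<in> borel_measurable P" for n unfolding \<Delta>_def by measurable
    have "(\<lambda>n. nrm (y - yn n)) \<longlonglongrightarrow> nrm (y - y)"
      unfolding yn_def by (intro tendsto_nrm tendsto_diff tendsto_const onseq_expand(1)[OF g(1) yX])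
    then have lim0: "(\<lambda>n. nrm (y - yn n)) \<longlonglongrightarrow> 0" by simp
    have "(\<integral>\<^sup>+\<omega>. ennreal (\<bar>\<Delta> n \<omega>\<bar> powr 2) \<partial>P) \<le> ennreal (gauss_moment 2 * (sqrt \<tau> * (K3 * nrm (y - yn n)))\<^sup>2)" for n
    proof -
      have "(\<integral>\<^sup>+\<omega>. ennreal (\<bar>\<Delta> n \<omega>\<bar> powr 2) \<partial>P) \<le> ennreal (gauss_moment 2 * (sqrt \<tau> * norm (R (b (M (y - yn n))))) powr 2)"
        unfolding \<Delta>_def by (rule G_moment[OF b(1)[OF M_X[OF d]]]) simp
      also have "\<dots> \<le> ennreal (gauss_moment 2 * (sqrt \<tau> * (K3 * nrm (y - yn n)))\<^sup>2)"
        using Rb[OF d, of n] tau gauss_moment_nonneg[of 2]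
        by (intro ennreal_leI mult_left_mono) (auto simp: powr_numeral intro!: power_mono)
      finally show ?thesis .
    qed
    moreover have "(\<lambda>n. ennreal (gauss_moment 2 * (sqrt \<tau> * (K3 * nrm (y - yn n)))\<^sup>2)) \<longlonglongrightarrow> ennreal (gauss_moment 2 * (sqrt \<tau> * (K3 * 0))\<^sup>2)"
      by (intro tendsto_ennrealI tendsto_intros lim0)
    ultimately have "liminf (\<lambda>n. \<integral>\<^sup>+\<omega>. ennreal (\<bar>\<Delta> n \<omega>\<bar> powr 2) \<partial>P) \<le> 0"
      using Liminf_mono[of "\<lambda>n. \<integral>\<^sup>+\<omega>. ennreal (\<bar>\<Delta> n \<omega>\<bar> powr 2) \<partial>P" "\<lambda>n. ennreal (gauss_moment 2 * (sqrt \<tau> * (K3 * nrm (y - yn n)))\<^sup>2)" sequentially]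
        lim_imp_Liminf[of sequentially "\<lambda>n. ennreal (gauss_moment 2 * (sqrt \<tau> * (K3 * nrm (y - yn n)))\<^sup>2)"]
      by simp
    moreover have "(\<integral>\<^sup>+\<omega>. liminf (\<lambda>n. ennreal (\<bar>\<Delta> n \<omega>\<bar> powr 2)) \<partial>P) \<le> liminf (\<lambda>n. \<integral>\<^sup>+\<omega>. ennreal (\<bar>\<Delta> n \<omega>\<bar> powr 2) \<partial>P)"
      by (rule nn_integral_liminf) measurable
    ultimately have "(\<integral>\<^sup>+\<omega>. liminf (\<lambda>n. ennreal (\<bar>\<Delta> n \<omega>\<bar> powr 2)) \<partial>P) = 0" by simp
    then have "AE \<omega> in P. liminf (\<lambda>n. ennreal (\<bar>\<Delta> n \<omega>\<bar> powr 2)) = 0" by (subst (asm) nn_integral_0_iff_AE) measurable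
    then show ?thesis using AE_space
    proof eventually_elim
      case (elim \<omega>)
      let ?s = "\<lambda>n. \<Sum>k<n. inner (G \<omega>) (b (M (g k))) * ip y (g k)"
      show ?case
      proof (cases "convergent ?s")
        case True
        then obtain l where l: "?s \<longlonglongrightarrow> l" by (auto simp: convergent_def)
        have "(\<lambda>n. \<Delta> n \<omega>) \<longlonglongrightarrow> ip (B (G \<omega>)) (M y) - l"
          unfolding D_eq[OF elim(2)] by (intro tendsto_intros l)
        then have "(\<lambda>n. ennreal (\<bar>\<Delta> n \<omega>\<bar> powr 2)) \<longlonglongrightarrow> ennreal (\<bar>ip (B (G \<omega>)) (M y) - l\<bar> powr 2)"
          by (intro tendsto_ennrealI tendsto_powr2 tendsto_rabs) auto
        from lim_imp_Liminf[OF _ this] have "ennreal (\<bar>ip (B (G \<omega>)) (M y) - l\<bar> powr 2) = 0" using elim(1) by simp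
        then have "l = ip (B (G \<omega>)) (M y)" by (simp add: ennreal_eq_0_iff)
        then show ?thesis using tendsto_minus[OF l] by simp
      qed simp
    qed
  qed
  have "AE \<omega> in P. \<forall>y\<in>C. (\<lambda>n. - (\<Sum>k<n. inner (G \<omega>) (b (M (g k))) * ip (fst y) (g k))) \<longlonglongrightarrow> - ip (B (G \<omega>)) (M (fst y))
      \<or> \<not> convergent (\<lambda>n. \<Sum>k<n. inner (G \<omega>) (b (M (g k))) * ip (fst y) (g k))"
    using C(2) by (subst AE_ball_countable[OF C(1)]) (auto simp: T_def intro!: pair)
  then have dom: "AE \<omega> in P. B (G \<omega>) \<in> DM \<and> nrm (M (B (G \<omega>))) = \<zeta>2 \<omega>"
    using z2(3) AE_space
  proof eventually_elim
    case (elim \<omega>)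
    have BX: "B (G \<omega>) \<in> X" by (rule B(2)[OF G_S[OF elim(3)]])
    define c where "c k = - inner (G \<omega>) (b (M (g k)))" for k
    have c0: "c k = 0" if "g k = 0" for k
    proof -
      have "M (g k) = 0" using that linear_on_zero[OF M_linear subspace_DM] by simp
      then show ?thesis using b(2)[OF G_S[OF elim(3)] gX(2), of k] by (simp add: c_def ip_simps)
    qed
    have "summable (\<lambda>k. (c k)\<^sup>2)" using elim(2) by (simp add: c_def sums_iff)
    \<comment> \<open>The candidate for \<open>M (B (G \<omega>))\<close>, assembled from its
      coefficients.\<close>
    then obtain Z where Z: "Z \<in> X" "\<And>k. ip Z (g k) = c k" using onseq_series[OF g(1) c0, of "\<lambda>k. k"] by blast
    have onC: "ip (B (G \<omega>)) (snd y) = - ip Z (fst y)" if y: "y \<in> C" for y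
    proof -
      have yD: "fst y \<in> DM" "snd y = M (fst y)" using y C(2) by (auto simp: T_def)
      have "(\<lambda>k. ip Z (g k) * ip (fst y) (g k)) sums ip Z (fst y)" by (rule onseq_expand(2)[OF g(1) Z(1)])
      then have l: "(\<lambda>n. - (\<Sum>k<n. inner (G \<omega>) (b (M (g k))) * ip (fst y) (g k))) \<longlonglongrightarrow> ip Z (fst y)"
        unfolding Z(2) c_def sums_def by (simp add: sum_negf)
      then have "convergent (\<lambda>n. \<Sum>k<n. inner (G \<omega>) (b (M (g k))) * ip (fst y) (g k))"
        using tendsto_minus[OF l] by (auto simp: convergent_def)
      then have "(\<lambda>n. - (\<Sum>k<n. inner (G \<omega>) (b (M (g k))) * ip (fst y) (g k))) \<longlonglongrightarrow> - ip (B (G \<omega>)) (M (fst y))"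
        using elim(1) y by blast
      from LIMSEQ_unique[OF l this] show ?thesis by (simp add: yD)
    qed
    have onDM: "ip (M x) (B (G \<omega>)) = ip x (- Z)" if x: "x \<in> DM" for x
    proof -
      have "(x, M x) \<in> closure C" using C(3) x by (auto simp: T_def)
      then obtain s where s: "\<And>n. s n \<in> C" "s \<longlonglongrightarrow> (x, M x)" using closure_sequential by blast
      have "(\<lambda>n. ip (B (G \<omega>)) (snd (s n))) \<longlonglongrightarrow> ip (B (G \<omega>)) (M x)"
        using tendsto_snd[OF s(2)] by (intro ip.tendsto tendsto_const) simp
      moreover have "(\<lambda>n. - ip Z (fst (s n))) \<longlonglongrightarrow> - ip Z x"
        using tendsto_fst[OF s(2)] by (intro tendsto_minus ip.tendsto tendsto_const) simp
      ultimately have "ip (B (G \<omega>)) (M x) = - ip Z x" using LIMSEQ_unique onC[OF s(1)] by simp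
      then show ?thesis using sym[of "M x"] sym[of x Z] by (simp add: ip_simps)
    qed
    \<comment> \<open>\<open>onDM\<close> presents \<open>- Z\<close> as the value of the adjoint of
      \<open>M\<close> at \<open>B (G \<omega>)\<close>; maximality then puts this vector into the
      domain.\<close>
    have D: "B (G \<omega>) \<in> DM" by (rule M_maximal[OF BX _ onDM]) (use Z(1) in \<open>auto intro: X_intros\<close>)
    have "M (B (G \<omega>)) - Z = 0"
    proof (rule DM_dense)
      show "M (B (G \<omega>)) - Z \<in> X" using M_X[OF D] Z(1) by (intro X_intros)
      show "ip x (M (B (G \<omega>)) - Z) = 0" if "x \<in> DM" for x
        using M_skew[OF that D] onDM[OF that] by (simp add: ip_simps)
    qed
    then have MZ: "M (B (G \<omega>)) = Z" by simp
    have "ip Z Z = (\<zeta>2 \<omega>)\<^sup>2"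
      using Parseval[OF g(1) Z(1)] elim(2) unfolding Z(2) c_def by (simp add: sums_unique2)
    then show ?case using D MZ z2(2)[of \<omega>] by (simp add: nrm_def)
  qed
  have n1: "AE \<omega> in P. nrm (B (G \<omega>)) = \<zeta>1 \<omega>"
    using z1(3) AE_space
  proof eventually_elim
    case (elim \<omega>)
    have "(\<lambda>k. (ip (B (G \<omega>)) (g k))\<^sup>2) sums ip (B (G \<omega>)) (B (G \<omega>))" by (rule Parseval[OF g(1) B(2)[OF G_S[OF elim(2)]]])
    then have "ip (B (G \<omega>)) (B (G \<omega>)) = (\<zeta>1 \<omega>)\<^sup>2"
      using elim(1) unfolding b(2)[OF G_S[OF elim(2)] gX(1)] by (rule sums_unique2)
    then show ?case using z1(2)[of \<omega>] by (simp add: nrm_def)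
  qed
  show ?thesis
  proof (rule that[of "\<lambda>\<omega>. max (\<zeta>1 \<omega>) (\<zeta>2 \<omega>)"])
    show "(\<lambda>\<omega>. max (\<zeta>1 \<omega>) (\<zeta>2 \<omega>)) \<in> borel_measurable P" by measurable
    show "0 \<le> max (\<zeta>1 \<omega>) (\<zeta>2 \<omega>)" for \<omega> using z1(2)[of \<omega>] by simp
    show "AE \<omega> in P. B (G \<omega>) \<in> DM \<and> nrm (B (G \<omega>)) \<le> max (\<zeta>1 \<omega>) (\<zeta>2 \<omega>) \<and> nrm (M (B (G \<omega>))) \<le> max (\<zeta>1 \<omega>) (\<zeta>2 \<omega>)"
      using dom n1 by eventually_elim simp
    have "(\<integral>\<^sup>+\<omega>. ennreal (max (\<zeta>1 \<omega>) (\<zeta>2 \<omega>) powr p) \<partial>P) \<le> (\<integral>\<^sup>+\<omega>. ennreal (\<zeta>1 \<omega> powr p) + ennreal (\<zeta>2 \<omega> powr p) \<partial>P)"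
      by (rule nn_integral_mono) (auto simp: max_def)
    also have "\<dots> = (\<integral>\<^sup>+\<omega>. ennreal (\<zeta>1 \<omega> powr p) \<partial>P) + (\<integral>\<^sup>+\<omega>. ennreal (\<zeta>2 \<omega> powr p) \<partial>P)"
      by (rule nn_integral_add) measurable
    also have "\<dots> \<le> ennreal (gauss_moment p * (sqrt \<tau> * hs) powr p) + ennreal (gauss_moment p * (sqrt \<tau> * hs) powr p)"
    proof (rule add_mono)
      have "V1 \<le> hs" "V2 \<le> hs" using V12 hs0
        by (auto intro!: power2_le_imp_le[of _ hs] simp flip: V12)
      then have "(sqrt \<tau> * V1) powr p \<le> (sqrt \<tau> * hs) powr p" "(sqrt \<tau> * V2) powr p \<le> (sqrt \<tau> * hs) powr p"
        using V1(1) V2(1) tau p by (auto intro!: powr_mono2 mult_left_mono)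
      then have "gauss_moment p * (sqrt \<tau> * V1) powr p \<le> gauss_moment p * (sqrt \<tau> * hs) powr p"
        "gauss_moment p * (sqrt \<tau> * V2) powr p \<le> gauss_moment p * (sqrt \<tau> * hs) powr p"
        using gauss_moment_nonneg by (auto intro: mult_left_mono)
      then show "(\<integral>\<^sup>+\<omega>. ennreal (\<zeta>1 \<omega> powr p) \<partial>P) \<le> ennreal (gauss_moment p * (sqrt \<tau> * hs) powr p)"
        "(\<integral>\<^sup>+\<omega>. ennreal (\<zeta>2 \<omega> powr p) \<partial>P) \<le> ennreal (gauss_moment p * (sqrt \<tau> * hs) powr p)"
        using z1(4) z2(4) by (auto intro: order_trans ennreal_leI)
    qed
    also have "\<dots> = ennreal (2 * gauss_moment p * (sqrt \<tau> * hs) powr p)"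
      using gauss_moment_nonneg[of p] by (simp add: ennreal_plus[symmetric])
    finally show "(\<integral>\<^sup>+\<omega>. ennreal (max (\<zeta>1 \<omega>) (\<zeta>2 \<omega>) powr p) \<partial>P) \<le> ennreal (2 * gauss_moment p * (sqrt \<tau> * hs) powr p)" .
  qed
qed

end

section \<open>Runge-Kutta stages\<close>

lemma bounded_bilinear_sum:
  fixes f :: "'i \<Rightarrow> 'a::real_normed_vector \<Rightarrow> 'b::real_normed_vector \<Rightarrow> 'c::real_normed_vector"
  assumes "\<And>i. i \<in> I \<Longrightarrow> bounded_bilinear (f i)"
  shows "bounded_bilinear (\<lambda>x y. \<Sum>i\<in>I. f i x y)"
proof -
  have zero: "bounded_bilinear (\<lambda>(x::'a) (y::'b). 0 :: 'c)"
    by (unfold_locales) (auto intro!: exI[of _ 0])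
  show ?thesis using assms
    by (induction I rule: infinite_finite_induct) (auto intro: zero bounded_bilinear_plus)
qed

lemma norm_vec_square: "(norm (x :: 'h::real_normed_vector^'s::finite))\<^sup>2 = (\<Sum>i\<in>UNIV. (norm (x $ i))\<^sup>2)"
  unfolding norm_vec_def L2_set_def by (simp add: sum_nonneg)

lemma norm_vec_le_scale:
  fixes x y :: "'h::real_normed_vector^'s::finite"
  assumes "\<And>i. norm (x $ i) \<le> c * norm (y $ i)" "c \<ge> 0"
  shows "norm x \<le> c * norm y"
proof (rule power2_le_imp_le)
  have "(norm x)\<^sup>2 \<le> (\<Sum>i\<in>UNIV. (c * norm (y $ i))\<^sup>2)"
    unfolding norm_vec_square by (intro sum_mono power_mono assms norm_ge_zero)
  also have "\<dots> = (c * norm y)\<^sup>2" by (simp add: power_mult_distrib norm_vec_square sum_distrib_left)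
  finally show "(norm x)\<^sup>2 \<le> (c * norm y)\<^sup>2" .
qed (use assms in auto)

lemma norm_vec_le_sum: "norm (x :: 'h::real_normed_vector^'s::finite) \<le> (\<Sum>i\<in>UNIV. norm (x $ i))"
  unfolding norm_vec_def by (rule L2_set_le_sum) simp

lemma (in hilbert_form) hilbert_form_vec:
  "hilbert_form (\<lambda>x y :: 'h^'s::finite. \<Sum>i\<in>UNIV. ip (x $ i) (y $ i)) {x. \<forall>i. x $ i \<in> X} \<kappa>"
proof (rule hilbert_form.intro)
  show "bounded_bilinear (\<lambda>x y :: 'h^'s. \<Sum>i\<in>UNIV. ip (x $ i) (y $ i))"
    by (intro bounded_bilinear_sum bounded_bilinear.comp[OF bilinear] bounded_linear_vec_nth)
  show "subspace {x :: 'h^'s. \<forall>i. x $ i \<in> X}" unfolding subspace_def by (auto intro: X_intros)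
  show "closed {x :: 'h^'s. \<forall>i. x $ i \<in> X}"
    unfolding closed_sequential_limits
  proof (intro allI impI, elim conjE)
    fix f :: "nat \<Rightarrow> 'h^'s" and l assume f: "\<forall>n. f n \<in> {x. \<forall>i. x $ i \<in> X}" "f \<longlonglongrightarrow> l"
    have "l $ i \<in> X" for i
      by (rule X_limit[of "\<lambda>n. f n $ i"]) (use f in \<open>auto intro: tendsto_vec_nth\<close>)
    then show "l \<in> {x. \<forall>i. x $ i \<in> X}" by simp
  qed
  show "\<kappa> * (norm x)\<^sup>2 \<le> (\<Sum>i\<in>UNIV. ip (x $ i) (x $ i))" if "x \<in> {x. \<forall>i. x $ i \<in> X}" for x :: "'h^'s"
    unfolding norm_vec_square sum_distrib_left using that by (intro sum_mono coercive) auto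
qed (simp_all add: sym kappa_pos)

lemma inner_matrix_vector: "inner v (G *v v) = (\<Sum>i\<in>UNIV. \<Sum>j\<in>UNIV. G $ i $ j * (v $ i * v $ j))"
  for G :: "real^'s::finite^'s"
  unfolding inner_vec_def matrix_vector_mult_def
  by (simp add: sum_distrib_left mult_ac)

context separable_hilbert_form
begin

text \<open>The coordinates in an orthonormal sequence split the form into real quadratic forms of
  \<open>G\<close>, one for each \<open>k\<close>.\<close>

lemma matrix_form_nonneg:
  fixes G :: "real^'s::finite^'s" and x :: "'s \<Rightarrow> 'h"
  assumes G: "\<And>v. 0 \<le> inner v (G *v v)" and x: "\<And>i. x i \<in> X"
  shows "0 \<le> (\<Sum>i\<in>UNIV. \<Sum>j\<in>UNIV. G $ i $ j * ip (x i) (x j))"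
proof -
  obtain g where g: "onseq g" by (rule onseq_exists')
  have "(\<lambda>k. \<Sum>i\<in>UNIV. \<Sum>j\<in>UNIV. G $ i $ j * (ip (x i) (g k) * ip (x j) (g k)))
      sums (\<Sum>i\<in>UNIV. \<Sum>j\<in>UNIV. G $ i $ j * ip (x i) (x j))"
    by (intro sums_sum sums_mult onseq_expand(2)[OF g x])
  from sums_le[OF _ sums_zero this] show ?thesis
    using G[of "\<chi> i. ip (x i) (g _)"] by (simp add: inner_matrix_vector)
qed

end

context skew_adjoint
begin

text \<open>Skewness survives the limit; maximality then gives \<open>x \<in> DM\<close>, and
  density the value.\<close>

lemma M_closed:
  assumes f: "\<And>n. f n \<in> DM" "f \<longlonglongrightarrow> x" "(\<lambda>n. M (f n)) \<longlonglongrightarrow> m"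
  shows "x \<in> DM \<and> M x = m"
proof -
  have x: "x \<in> X" using X_limit[OF _ f(2)] f(1) DM_X by auto
  have m: "m \<in> X" using X_limit[OF _ f(3)] M_X[OF f(1)] by auto
  have eq: "ip (M v) x = - ip v m" if v: "v \<in> DM" for v
  proof (rule LIMSEQ_unique)
    show "(\<lambda>n. ip (M v) (f n)) \<longlonglongrightarrow> ip (M v) x" by (intro ip.tendsto tendsto_const f)
    show "(\<lambda>n. ip (M v) (f n)) \<longlonglongrightarrow> - ip v m"
      unfolding M_skew[OF v f(1)] by (intro tendsto_minus ip.tendsto tendsto_const f)
  qed
  have D: "x \<in> DM"
    by (rule M_maximal[OF x, of "- m"]) (use m eq in \<open>auto simp: ip_simps intro: X_intros\<close>)
  have "M x - m = 0"
  proof (rule DM_dense)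
    show "M x - m \<in> X" using M_X[OF D] m by (intro X_intros)
    show "ip v (M x - m) = 0" if "v \<in> DM" for v
      using eq[OF that] M_skew[OF that D] by (simp add: ip_simps)
  qed
  with D show ?thesis by simp
qed

lemma M_add: "x \<in> DM \<Longrightarrow> y \<in> DM \<Longrightarrow> M (x + y) = M x + M y"
  and M_scaleR: "x \<in> DM \<Longrightarrow> M (r *\<^sub>R x) = r *\<^sub>R M x"
  using linear_onD[OF M_linear] by auto

lemma M_diff: "x \<in> DM \<Longrightarrow> y \<in> DM \<Longrightarrow> M (x - y) = M x - M y"
  by (rule linear_on_diff[OF M_linear subspace_DM])

lemma M_0: "M 0 = 0"
  by (rule linear_on_zero[OF M_linear subspace_DM])

lemma M_sum: "(\<And>i. i \<in> I \<Longrightarrow> x i \<in> DM) \<Longrightarrow> M (\<Sum>i\<in>I. c i *\<^sub>R x i) = (\<Sum>i\<in>I. c i *\<^sub>R M (x i))"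
  by (subst linear_on_sum[OF M_linear subspace_DM]) (auto simp: M_scaleR subspace_scale[OF subspace_DM])

lemma ip_M_self: "x \<in> DM \<Longrightarrow> ip (M x) x = 0"
  using M_skew[of x x] sym[of x "M x"] by simp

end

locale runge_kutta = skew_adjoint ip X \<kappa> DM M
  for ip :: "'h::{banach,second_countable_topology} \<Rightarrow> 'h \<Rightarrow> real" and X \<kappa> DM M +
  fixes A :: "real^'s::finite^'s" and b :: "real^'s"
  assumes coercivity: "coercivity_condition A" and stability: "algebraically_stable A b"
begin

section \<open>The stage system multiplied by the inverse matrix\<close>

abbreviation "Ai \<equiv> matrix_inv A"

lemma A_Ai: "A ** Ai = mat 1" "Ai ** A = mat 1"
proof -
  have "\<exists>A'. A ** A' = mat 1 \<and> A' ** A = mat 1"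
    using coercivity by (simp add: coercivity_condition_def invertible_def)
  from someI_ex[OF this] show "A ** Ai = mat 1" "Ai ** A = mat 1" by (auto simp: matrix_inv_def)
qed

lemma matrix_combination:
  fixes P N :: "real^'s^'s" and x :: "'s \<Rightarrow> 'h"
  assumes "P ** N = mat 1"
  shows "(\<Sum>j\<in>UNIV. P $ i $ j *\<^sub>R (\<Sum>k\<in>UNIV. N $ j $ k *\<^sub>R x k)) = x i"
proof -
  have "(\<Sum>j\<in>UNIV. P $ i $ j *\<^sub>R (\<Sum>k\<in>UNIV. N $ j $ k *\<^sub>R x k)) = (\<Sum>k\<in>UNIV. (\<Sum>j\<in>UNIV. P $ i $ j * N $ j $ k) *\<^sub>R x k)"
    unfolding scaleR_sum_right scaleR_scaleR by (subst sum.swap) (simp add: scaleR_sum_left)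
  also have "\<dots> = (\<Sum>k\<in>UNIV. (P ** N) $ i $ k *\<^sub>R x k)" by (simp add: matrix_matrix_mult_def)
  also have "\<dots> = (\<Sum>k\<in>UNIV. if k = i then x k else 0)"
    unfolding assms by (intro sum.cong) (auto simp: mat_def)
  finally show ?thesis by simp
qed

text \<open>The weights are the diagonal of the matrix in the coercivity condition; nonnegativity of
  the form of \<open>K ** Ai - \<alpha> *\<^sub>R K\<close> passes from real vectors to vectors with
  entries in \<open>X\<close>.\<close>

lemma coercivity_weights:
  "\<exists>(k :: 's \<Rightarrow> real) \<alpha>. (\<forall>i. k i > 0) \<and> \<alpha> > 0 \<and> (\<forall>x. (\<forall>i. x i \<in> X) \<longrightarrow>
     \<alpha> * (\<Sum>i\<in>UNIV. k i * ip (x i) (x i)) \<le> (\<Sum>i\<in>UNIV. \<Sum>j\<in>UNIV. k i * Ai $ i $ j * ip (x i) (x j)))"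
proof -
  obtain K \<alpha> where K: "\<And>i j. i \<noteq> j \<Longrightarrow> K $ i $ j = 0" "\<And>v. v \<noteq> 0 \<Longrightarrow> inner v (K *v v) > 0" "\<alpha> > 0"
    "\<And>v. inner v ((K ** Ai) *v v) \<ge> \<alpha> * inner v (K *v v)"
    using coercivity unfolding coercivity_condition_def by blast
  have Kv: "K *v v = (\<chi> i. K $ i $ i * v $ i)" for v
  proof -
    have "(\<Sum>j\<in>UNIV. K $ i $ j * v $ j) = (\<Sum>j\<in>UNIV. if j = i then K $ i $ i * v $ i else 0)" for i
      by (intro sum.cong) (use K(1)[of i] in auto)
    then show ?thesis by (simp add: matrix_vector_mult_def)
  qed
  have pos: "K $ i $ i > 0" for i
  proof -
    have "inner (axis i 1) (K *v axis i 1) > 0" by (rule K(2)) (simp add: axis_eq_0_iff)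
    also have "inner (axis i 1) (K *v axis i 1) = K $ i $ i" unfolding Kv inner_axis' by (simp add: axis_def)
    finally show ?thesis .
  qed
  have KA: "(K ** Ai) $ i $ j = K $ i $ i * Ai $ i $ j" for i j
  proof -
    have "(\<Sum>k\<in>UNIV. K $ i $ k * Ai $ k $ j) = (\<Sum>k\<in>UNIV. if k = i then K $ i $ i * Ai $ i $ j else 0)"
      by (intro sum.cong) (use K(1)[of i] in auto)
    then show ?thesis by (simp add: matrix_matrix_mult_def)
  qed
  have le: "\<alpha> * (\<Sum>i\<in>UNIV. K $ i $ i * ip (x i) (x i)) \<le> (\<Sum>i\<in>UNIV. \<Sum>j\<in>UNIV. K $ i $ i * Ai $ i $ j * ip (x i) (x j))"
    if x: "\<And>i. x i \<in> X" for x
  proof -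
    have "0 \<le> inner v ((K ** Ai - \<alpha> *\<^sub>R K) *v v)" for v
    proof -
      have "(K ** Ai - \<alpha> *\<^sub>R K) *v v = (K ** Ai) *v v - \<alpha> *\<^sub>R (K *v v)"
        by (simp add: matrix_vector_mult_diff_rdistrib scaleR_matrix_vector_assoc)
      then show ?thesis using K(4)[of v] by (simp add: inner_diff_right)
    qed
    from matrix_form_nonneg[OF this x]
    have "0 \<le> (\<Sum>i\<in>UNIV. \<Sum>j\<in>UNIV. (K $ i $ i * Ai $ i $ j - \<alpha> * K $ i $ j) * ip (x i) (x j))"
      by (simp add: KA)
    also have "\<dots> = (\<Sum>i\<in>UNIV. \<Sum>j\<in>UNIV. K $ i $ i * Ai $ i $ j * ip (x i) (x j)) - \<alpha> * (\<Sum>i\<in>UNIV. \<Sum>j\<in>UNIV. K $ i $ j * ip (x i) (x j))"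
      by (simp add: left_diff_distrib sum_subtractf sum_distrib_left mult.assoc)
    also have "(\<Sum>i\<in>UNIV. \<Sum>j\<in>UNIV. K $ i $ j * ip (x i) (x j)) = (\<Sum>i\<in>UNIV. K $ i $ i * ip (x i) (x i))"
    proof (intro sum.cong refl)
      fix i
      have "(\<Sum>j\<in>UNIV. K $ i $ j * ip (x i) (x j)) = (\<Sum>j\<in>UNIV. if j = i then K $ i $ i * ip (x i) (x i) else 0)"
        by (intro sum.cong) (use K(1)[of i] in auto)
      then show "(\<Sum>j\<in>UNIV. K $ i $ j * ip (x i) (x j)) = K $ i $ i * ip (x i) (x i)" by simp
    qed
    finally show ?thesis by simp
  qed
  show ?thesis by (rule exI[of _ "\<lambda>i. K $ i $ i"], rule exI[of _ \<alpha>]) (use pos K(3) le in blast)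
qed

text \<open>\<open>g\<close> collects the old value and the noise, \<open>p\<close> the drift
  values. Keeping \<open>p\<close> as data lets one predicate serve the linear problem and, with
  \<open>p = Fs s U\<close>, the stages themselves.\<close>

definition stage_eq :: "real \<Rightarrow> 'h^'s \<Rightarrow> 'h^'s \<Rightarrow> 'h^'s \<Rightarrow> bool" where
  "stage_eq \<tau> g p U \<longleftrightarrow>
     (\<forall>i. U $ i \<in> DM \<and> U $ i = g $ i + \<tau> *\<^sub>R (\<Sum>j\<in>UNIV. A $ i $ j *\<^sub>R (M (U $ j) + p $ j)))"

lemma stage_eqD:
  assumes "stage_eq \<tau> g p U"
  shows "U $ i \<in> DM" "U $ i = g $ i + \<tau> *\<^sub>R (\<Sum>j\<in>UNIV. A $ i $ j *\<^sub>R (M (U $ j) + p $ j))"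
  using assms unfolding stage_eq_def by blast+

text \<open>In this form row \<open>i\<close> contains \<open>M\<close> at its own stage only, where
  skewness removes it from the energy; and it expresses \<open>M (U $ i)\<close> through the stages
  without applying \<open>M\<close>.\<close>

lemma stage_eq_inverse:
  "stage_eq \<tau> g p U \<longleftrightarrow>
     (\<forall>i. U $ i \<in> DM) \<and> (\<forall>i. (\<Sum>j\<in>UNIV. Ai $ i $ j *\<^sub>R (U $ j - g $ j)) = \<tau> *\<^sub>R (M (U $ i) + p $ i))"
proof
  assume L: "stage_eq \<tau> g p U"
  have "U $ j - g $ j = (\<Sum>k\<in>UNIV. A $ j $ k *\<^sub>R (\<tau> *\<^sub>R (M (U $ k) + p $ k)))" for j
  proof -
    have "U $ j = g $ j + \<tau> *\<^sub>R (\<Sum>k\<in>UNIV. A $ j $ k *\<^sub>R (M (U $ k) + p $ k))" by (rule stage_eqD(2)[OF L])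
    then have "U $ j - g $ j = \<tau> *\<^sub>R (\<Sum>k\<in>UNIV. A $ j $ k *\<^sub>R (M (U $ k) + p $ k))" by (metis add_diff_cancel_left')
    then show ?thesis by (simp add: scaleR_sum_right mult.commute)
  qed
  then have "(\<Sum>j\<in>UNIV. Ai $ i $ j *\<^sub>R (U $ j - g $ j)) = \<tau> *\<^sub>R (M (U $ i) + p $ i)" for i
    by (simp only:) (rule matrix_combination[OF A_Ai(2)])
  then show "(\<forall>i. U $ i \<in> DM) \<and> (\<forall>i. (\<Sum>j\<in>UNIV. Ai $ i $ j *\<^sub>R (U $ j - g $ j)) = \<tau> *\<^sub>R (M (U $ i) + p $ i))"
    using stage_eqD(1)[OF L] by simp
next
  assume R: "(\<forall>i. U $ i \<in> DM) \<and> (\<forall>i. (\<Sum>j\<in>UNIV. Ai $ i $ j *\<^sub>R (U $ j - g $ j)) = \<tau> *\<^sub>R (M (U $ i) + p $ i))"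
  have "U $ i = g $ i + \<tau> *\<^sub>R (\<Sum>j\<in>UNIV. A $ i $ j *\<^sub>R (M (U $ j) + p $ j))" for i
  proof -
    have "(\<Sum>j\<in>UNIV. A $ i $ j *\<^sub>R (\<Sum>k\<in>UNIV. Ai $ j $ k *\<^sub>R (U $ k - g $ k))) = U $ i - g $ i"
      by (rule matrix_combination[OF A_Ai(1), of i "\<lambda>k. U $ k - g $ k"])
    then have "U $ i - g $ i = (\<Sum>j\<in>UNIV. A $ i $ j *\<^sub>R (\<tau> *\<^sub>R (M (U $ j) + p $ j)))" using R by simp
    also have "\<dots> = \<tau> *\<^sub>R (\<Sum>j\<in>UNIV. A $ i $ j *\<^sub>R (M (U $ j) + p $ j))"
      by (simp add: scaleR_sum_right mult.commute)
    finally show ?thesis by (metis diff_add_cancel add.commute)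
  qed
  with R show "stage_eq \<tau> g p U" unfolding stage_eq_def by blast
qed

abbreviation Xs :: "('h^'s) set" where "Xs \<equiv> {x. \<forall>i. x $ i \<in> X}"

sublocale vec: hilbert_form "\<lambda>x y :: 'h^'s. \<Sum>i\<in>UNIV. ip (x $ i) (y $ i)" Xs \<kappa>
  by (rule hilbert_form_vec)

text \<open>The rows are scaled by the coercivity weights \<open>k i\<close>. Then the matrix part
  of \<open>Tm\<close> is coercive, and the part with \<open>M\<close> adds nothing to the form as
  \<open>ip (M x) x = 0\<close>, so \<open>coercive_operator_surj\<close> applies on the product
  space.\<close>

lemma linear_stage_exists:
  assumes \<tau>: "\<tau> > 0" and g: "g \<in> Xs" and p: "p \<in> Xs"
  shows "\<exists>U. stage_eq \<tau> g p U"
proof -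
  obtain k \<alpha> where k': "\<forall>i. k i > 0" and \<alpha>: "\<alpha> > 0"
    and coer': "\<forall>x. (\<forall>i. x i \<in> X) \<longrightarrow> \<alpha> * (\<Sum>i\<in>UNIV. k i * ip (x i) (x i)) \<le> (\<Sum>i\<in>UNIV. \<Sum>j\<in>UNIV. k i * Ai $ i $ j * ip (x i) (x j))"
    using coercivity_weights by blast
  have k: "\<And>i. k i > 0" "\<alpha> > 0" using k' \<alpha> by auto
  have coer: "\<alpha> * (\<Sum>i\<in>UNIV. k i * ip (x i) (x i)) \<le> (\<Sum>i\<in>UNIV. \<Sum>j\<in>UNIV. k i * Ai $ i $ j * ip (x i) (x j))"
    if "\<And>i. x i \<in> X" for x using coer' that by blast
  define DT where "DT = {U :: 'h^'s. \<forall>i. U $ i \<in> DM}"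
  define Tm where "Tm U = (\<chi> i. (\<Sum>j\<in>UNIV. (k i * Ai $ i $ j) *\<^sub>R U $ j) - (\<tau> * k i) *\<^sub>R M (U $ i))" for U :: "'h^'s"
  define km where "km = Min (range k)"
  have km: "km > 0" "\<And>i. km \<le> k i" unfolding km_def using k(1) by auto
  have DTX: "DT \<subseteq> Xs" using DM_X by (auto simp: DT_def)
  have TmX: "Tm x \<in> Xs" if "x \<in> DT" for x
  proof -
    have "x $ i \<in> X" "M (x $ i) \<in> X" for i using that DM_X M_X by (auto simp: DT_def)
    then show ?thesis by (auto simp: Tm_def intro!: X_intros)
  qed
  obtain U where U: "U \<in> DT" "Tm U = (\<chi> i. k i *\<^sub>R ((\<Sum>j\<in>UNIV. Ai $ i $ j *\<^sub>R g $ j) + \<tau> *\<^sub>R p $ i))"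
  proof (rule vec.coercive_operator_surj[of DT Tm "\<alpha> * km" "\<chi> i. k i *\<^sub>R ((\<Sum>j\<in>UNIV. Ai $ i $ j *\<^sub>R g $ j) + \<tau> *\<^sub>R p $ i)"])
    show "subspace DT" unfolding DT_def subspace_def
      using subspace_0[OF subspace_DM] subspace_add[OF subspace_DM] subspace_scale[OF subspace_DM] by auto
    show "DT \<subseteq> Xs" by (rule DTX)
    show "Tm x \<in> Xs" if "x \<in> DT" for x by (rule TmX[OF that])
    show "linear_on DT Tm" unfolding linear_on_def
    proof (intro conjI ballI allI)
      fix x y assume "x \<in> DT" "y \<in> DT"
      then have "x $ i \<in> DM" "y $ i \<in> DM" for i by (auto simp: DT_def)
      then show "Tm (x + y) = Tm x + Tm y"
        by (simp add: vec_eq_iff Tm_def M_add scaleR_add_right sum.distrib)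
      show "Tm (r *\<^sub>R x) = r *\<^sub>R Tm x" for r
        using \<open>\<And>i. x $ i \<in> DM\<close>
        by (simp add: vec_eq_iff Tm_def M_scaleR scaleR_diff_right scaleR_sum_right mult_ac)
    qed
    show "\<alpha> * km > 0" using k km by simp
    show "\<alpha> * km * (\<Sum>i\<in>UNIV. ip (x $ i) (x $ i)) \<le> (\<Sum>i\<in>UNIV. ip (Tm x $ i) (x $ i))" if x: "x \<in> DT" for x
    proof -
      have xX: "x $ i \<in> X" and xD: "x $ i \<in> DM" for i using x DTX by (auto simp: DT_def)
      have "\<alpha> * km * (\<Sum>i\<in>UNIV. ip (x $ i) (x $ i)) = \<alpha> * (\<Sum>i\<in>UNIV. km * ip (x $ i) (x $ i))" by (simp add: sum_distrib_left mult.assoc)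
      also have "\<dots> \<le> \<alpha> * (\<Sum>i\<in>UNIV. k i * ip (x $ i) (x $ i))"
        using k(2) km(2) ip_nonneg[OF xX] by (intro mult_left_mono sum_mono mult_right_mono) auto
      also have "\<dots> \<le> (\<Sum>i\<in>UNIV. \<Sum>j\<in>UNIV. k i * Ai $ i $ j * ip (x $ i) (x $ j))" by (rule coer[OF xX])
      also have "\<dots> = (\<Sum>i\<in>UNIV. ip (Tm x $ i) (x $ i))"
        unfolding Tm_def by (simp add: ip_simps ip_M_self[OF xD] sym[of "x $ _" "x $ _"])
      finally show ?thesis .
    qed
    show "x \<in> DT \<and> Tm x = y"
      if f: "\<And>n. f n \<in> DT" "f \<longlonglongrightarrow> x" "(\<lambda>n. Tm (f n)) \<longlonglongrightarrow> y" for f x y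
    proof -
      \<comment> \<open>The limit of \<open>M (f n $ i)\<close>, found by solving row
        \<open>i\<close> of \<open>Tm\<close> for it; closedness of \<open>M\<close> does the
        rest.\<close>
      define m where "m i = (1 / (\<tau> * k i)) *\<^sub>R ((\<Sum>j\<in>UNIV. (k i * Ai $ i $ j) *\<^sub>R x $ j) - y $ i)" for i
      have fi: "(\<lambda>n. f n $ i) \<longlonglongrightarrow> x $ i" for i by (rule tendsto_vec_nth[OF f(2)])
      have "(\<lambda>n. M (f n $ i)) \<longlonglongrightarrow> m i" for i
      proof -
        have Meq: "M (f n $ i) = (1 / (\<tau> * k i)) *\<^sub>R ((\<Sum>j\<in>UNIV. (k i * Ai $ i $ j) *\<^sub>R f n $ j) - Tm (f n) $ i)" for n
          unfolding Tm_def using \<tau> k(1)[of i] by simp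
        show ?thesis unfolding m_def Meq
          by (intro tendsto_scaleR tendsto_diff tendsto_sum tendsto_const fi tendsto_vec_nth[OF f(3)])
      qed
      then have "x $ i \<in> DM \<and> M (x $ i) = m i" for i
        using M_closed[of "\<lambda>n. f n $ i", OF _ fi] f(1) by (auto simp: DT_def)
      then have "x \<in> DT" "\<And>i. M (x $ i) = m i" by (auto simp: DT_def)
      then show ?thesis using \<tau> k(1) by (simp add: Tm_def vec_eq_iff m_def less_imp_neq[THEN not_sym])
    qed
    show "z = 0" if z: "z \<in> Xs" and adj: "\<And>x. x \<in> DT \<Longrightarrow> (\<Sum>i\<in>UNIV. ip (Tm x $ i) (z $ i)) = 0" for z
    proof -
      have zX: "z $ i \<in> X" for i using z by simp
      \<comment> \<open>Testing with vectors supported in one stage shows that the adjoint of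
        \<open>M\<close> is defined at \<open>z $ j\<close> with value \<open>y j\<close>. Hence
        \<open>z\<close> lies in the domain, the identity may be used at \<open>z\<close> itself,
        and coercivity gives zero.\<close>
      define y where "y j = (1 / (\<tau> * k j)) *\<^sub>R (\<Sum>i\<in>UNIV. (k i * Ai $ i $ j) *\<^sub>R z $ i)" for j
      have yX: "y j \<in> X" for j unfolding y_def using zX by (intro X_intros)
      have eq: "ip (M u) (z $ j) = ip u (y j)" if u: "u \<in> DM" for u j
      proof -
        have D: "axis j u \<in> DT" using u subspace_0[OF subspace_DM] by (simp add: DT_def axis_def)
        have T: "Tm (axis j u) $ i = (k i * Ai $ i $ j) *\<^sub>R u - (if i = j then (\<tau> * k j) *\<^sub>R M u else 0)" for i
        proof -
          have "(\<Sum>l\<in>UNIV. (k i * Ai $ i $ l) *\<^sub>R axis j u $ l) = (\<Sum>l\<in>UNIV. if l = j then (k i * Ai $ i $ j) *\<^sub>R u else 0)"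
            by (intro sum.cong) (auto simp: axis_def)
          then show ?thesis by (auto simp: Tm_def axis_def M_0)
        qed
        have "0 = (\<Sum>i\<in>UNIV. ip (Tm (axis j u) $ i) (z $ i))" using adj[OF D] by simp
        also have "\<dots> = (\<Sum>i\<in>UNIV. k i * Ai $ i $ j * ip u (z $ i)) - (\<Sum>i\<in>UNIV. if i = j then \<tau> * k j * ip (M u) (z $ j) else 0)"
          unfolding T sum_subtractf[symmetric] by (intro sum.cong) (auto simp: ip_simps)
        finally have "\<tau> * k j * ip (M u) (z $ j) = (\<Sum>i\<in>UNIV. k i * Ai $ i $ j * ip u (z $ i))" by simp
        also have "\<dots> = \<tau> * k j * ip u (y j)" using \<tau> k(1)[of j] by (simp add: y_def ip_simps)
        finally show ?thesis using \<tau> k(1)[of j] by simp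
      qed
      have zD: "z $ j \<in> DM" for j by (rule M_maximal[OF zX yX eq])
      have "(\<Sum>i\<in>UNIV. k i * Ai $ i $ j * ip (z $ j) (z $ i)) = 0" for j
      proof -
        have "ip (z $ j) (y j) = 0" using eq[OF zD, of j] ip_M_self[OF zD] by metis
        then show ?thesis using \<tau> k(1)[of j] by (simp add: y_def ip_simps)
      qed
      then have "0 = (\<Sum>j\<in>UNIV. \<Sum>i\<in>UNIV. k i * Ai $ i $ j * ip (z $ j) (z $ i))" by simp
      also have "\<dots> = (\<Sum>i\<in>UNIV. \<Sum>j\<in>UNIV. k i * Ai $ i $ j * ip (z $ i) (z $ j))"
        by (subst sum.swap) (intro sum.cong refl, metis sym)
      also have "\<dots> \<ge> \<alpha> * (\<Sum>i\<in>UNIV. k i * ip (z $ i) (z $ i))" by (rule coer[OF zX])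
      finally have "(\<Sum>i\<in>UNIV. k i * ip (z $ i) (z $ i)) \<le> 0" using k(2) by (simp add: mult_le_0_iff)
      moreover have nn: "0 \<le> k i * ip (z $ i) (z $ i)" for i using k(1)[of i] ip_nonneg[OF zX] by simp
      ultimately have "(\<Sum>i\<in>UNIV. k i * ip (z $ i) (z $ i)) = 0" by (meson antisym sum_nonneg)
      then have kz: "k i * ip (z $ i) (z $ i) = 0" for i using nn by (subst (asm) sum_nonneg_eq_0_iff) auto
      have "z $ i = 0" for i using ip_self_eq_0[OF zX, of i] k(1)[of i] kz[of i] by auto
      then show "z = 0" by (simp add: vec_eq_iff)
    qed
    show "(\<chi> i. k i *\<^sub>R ((\<Sum>j\<in>UNIV. Ai $ i $ j *\<^sub>R g $ j) + \<tau> *\<^sub>R p $ i)) \<in> Xs"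
      using g p by (auto intro!: X_intros)
  qed auto
  have "(\<Sum>j\<in>UNIV. Ai $ i $ j *\<^sub>R (U $ j - g $ j)) = \<tau> *\<^sub>R (M (U $ i) + p $ i)" for i
  proof -
    have "k i *\<^sub>R (\<Sum>j\<in>UNIV. Ai $ i $ j *\<^sub>R U $ j) - k i *\<^sub>R (\<tau> *\<^sub>R M (U $ i))
        = k i *\<^sub>R ((\<Sum>j\<in>UNIV. Ai $ i $ j *\<^sub>R g $ j) + \<tau> *\<^sub>R p $ i)"
      using arg_cong[OF U(2), of "\<lambda>v. v $ i"] by (simp add: Tm_def scaleR_sum_right mult.commute)
    then have "k i *\<^sub>R ((\<Sum>j\<in>UNIV. Ai $ i $ j *\<^sub>R U $ j) - \<tau> *\<^sub>R M (U $ i))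
        = k i *\<^sub>R ((\<Sum>j\<in>UNIV. Ai $ i $ j *\<^sub>R g $ j) + \<tau> *\<^sub>R p $ i)" by (simp add: scaleR_diff_right)
    then have "(\<Sum>j\<in>UNIV. Ai $ i $ j *\<^sub>R U $ j) - \<tau> *\<^sub>R M (U $ i) = (\<Sum>j\<in>UNIV. Ai $ i $ j *\<^sub>R g $ j) + \<tau> *\<^sub>R p $ i"
      by (subst (asm) real_vector.scale_cancel_left) (use k(1)[of i] in auto)
    then show ?thesis by (simp add: scaleR_diff_right sum_subtractf scaleR_add_right algebra_simps)
  qed
  then have "stage_eq \<tau> g p U" unfolding stage_eq_inverse using U(1) by (simp add: DT_def)
  then show ?thesis ..
qed

text \<open>The constant does not depend on \<open>\<tau>\<close>, since the difference of the terms
  with \<open>M\<close> drops out of the energy; the step enters only in front of the drift. This is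
  what leaves a contraction for small steps.\<close>

lemma linear_stage_estimate:
  obtains C0 where "C0 > 0" "\<And>\<tau> g p U g' p' V. \<tau> \<ge> 0 \<Longrightarrow> g \<in> Xs \<Longrightarrow> p \<in> Xs \<Longrightarrow> g' \<in> Xs \<Longrightarrow> p' \<in> Xs \<Longrightarrow>
     stage_eq \<tau> g p U \<Longrightarrow> stage_eq \<tau> g' p' V \<Longrightarrow> norm (U - V) \<le> C0 * (norm (g - g') + \<tau> * norm (p - p'))"
proof -
  obtain k \<alpha> where k': "\<forall>i. k i > 0" and \<alpha>: "\<alpha> > 0"
    and coer': "\<forall>x. (\<forall>i. x i \<in> X) \<longrightarrow> \<alpha> * (\<Sum>i\<in>UNIV. k i * ip (x i) (x i)) \<le> (\<Sum>i\<in>UNIV. \<Sum>j\<in>UNIV. k i * Ai $ i $ j * ip (x i) (x j))"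
    using coercivity_weights by blast
  have k: "\<And>i. k i > 0" "\<alpha> > 0" using k' \<alpha> by auto
  have coer: "\<alpha> * (\<Sum>i\<in>UNIV. k i * ip (x i) (x i)) \<le> (\<Sum>i\<in>UNIV. \<Sum>j\<in>UNIV. k i * Ai $ i $ j * ip (x i) (x j))"
    if "\<And>i. x i \<in> X" for x using coer' that by blast
  obtain L where L: "L > 0" "\<And>x y. norm (ip x y) \<le> norm x * norm y * L" using ip.pos_bounded by blast
  define km where "km = Min (range k)"
  have km: "km > 0" "\<And>i. km \<le> k i" unfolding km_def using k(1) by auto
  \<comment> \<open>\<open>C\<close> gathers the bounds of all products of the difference with the
    data, \<open>c\<close> the coercivity constants in the norm of the type; the final quotient uses
    \<open>C + 1\<close> to be positive.\<close>
  define C where "C = (\<Sum>i\<in>UNIV. \<Sum>j\<in>UNIV. k i * \<bar>Ai $ i $ j\<bar> * L) + (\<Sum>i\<in>(UNIV::'s set). k i * L)"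
  have C: "(\<Sum>i\<in>UNIV. \<Sum>j\<in>UNIV. k i * \<bar>Ai $ i $ j\<bar> * L) \<le> C" "(\<Sum>i\<in>(UNIV::'s set). k i * L) \<le> C"
    unfolding C_def using k(1) L(1) by (auto intro!: sum_nonneg simp: less_imp_le)
  define c where "c = \<alpha> * km * \<kappa>"
  have c: "c > 0" unfolding c_def using k km kappa_pos by simp
  have Cpos: "C \<ge> 0" using C(2) order_trans[OF sum_nonneg[of UNIV "\<lambda>i. k i * L"]] k(1) L(1) by (simp add: less_imp_le)
  show ?thesis
  proof (rule that[of "(C + 1) / c"])
    show "(C + 1) / c > 0" using Cpos c by simp
    fix \<tau> :: real and g p U g' p' V
    assume \<tau>: "\<tau> \<ge> 0" and X: "g \<in> Xs" "p \<in> Xs" "g' \<in> Xs" "p' \<in> Xs" and U: "stage_eq \<tau> g p U" and V: "stage_eq \<tau> g' p' V"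
    define W where "W = U - V"
    define d where "d = g - g'"
    define r where "r = p - p'"
    have WD: "W $ i \<in> DM" for i using subspace_diff[OF subspace_DM stage_eqD(1)[OF U] stage_eqD(1)[OF V]] by (simp add: W_def)
    have WX: "W $ i \<in> X" for i using WD DM_X by auto
    have eq: "(\<Sum>j\<in>UNIV. Ai $ i $ j *\<^sub>R W $ j) = (\<Sum>j\<in>UNIV. Ai $ i $ j *\<^sub>R d $ j) + \<tau> *\<^sub>R M (W $ i) + \<tau> *\<^sub>R r $ i" for i
    proof -
      have "(\<Sum>j\<in>UNIV. Ai $ i $ j *\<^sub>R (U $ j - g $ j)) - (\<Sum>j\<in>UNIV. Ai $ i $ j *\<^sub>R (V $ j - g' $ j))
          = \<tau> *\<^sub>R (M (U $ i) + p $ i) - \<tau> *\<^sub>R (M (V $ i) + p' $ i)"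
        using U V unfolding stage_eq_inverse by (intro arg_cong2[where f="(-)"]) blast+
      moreover have MW: "M (U $ i - V $ i) = M (U $ i) - M (V $ i)" using stage_eqD(1)[OF U] stage_eqD(1)[OF V] by (simp add: W_def M_diff)
      ultimately show ?thesis
        unfolding W_def d_def r_def vector_minus_component MW
        by (simp add: scaleR_diff_right sum_subtractf scaleR_add_right algebra_simps)
    qed
    have quad: "(\<Sum>i\<in>UNIV. \<Sum>j\<in>UNIV. k i * Ai $ i $ j * ip (W $ i) (W $ j))
        = (\<Sum>i\<in>UNIV. \<Sum>j\<in>UNIV. k i * Ai $ i $ j * ip (W $ i) (d $ j)) + \<tau> * (\<Sum>i\<in>UNIV. k i * ip (W $ i) (r $ i))"
    proof -
      have "(\<Sum>j\<in>UNIV. k i * Ai $ i $ j * ip (W $ i) (W $ j))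
          = (\<Sum>j\<in>UNIV. k i * Ai $ i $ j * ip (W $ i) (d $ j)) + \<tau> * (k i * ip (W $ i) (r $ i))" for i
      proof -
        have "(\<Sum>j\<in>UNIV. k i * Ai $ i $ j * ip (W $ i) (W $ j)) = k i * ip (W $ i) (\<Sum>j\<in>UNIV. Ai $ i $ j *\<^sub>R W $ j)"
          by (simp add: ip_simps sum_distrib_left mult.assoc)
        also have "\<dots> = (\<Sum>j\<in>UNIV. k i * Ai $ i $ j * ip (W $ i) (d $ j)) + \<tau> * (k i * ip (W $ i) (r $ i))"
          unfolding eq using ip_M_self[OF WD[of i]] sym[of "W $ i" "M (W $ i)"]
          by (simp add: ip_simps sum_distrib_left mult.assoc algebra_simps)
        finally show ?thesis .
      qed
      then show ?thesis by (simp add: sum.distrib sum_distrib_left)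
    qed
    have "c * (norm W)\<^sup>2 = \<alpha> * (\<Sum>i\<in>UNIV. km * (\<kappa> * (norm (W $ i))\<^sup>2))"
      unfolding norm_vec_square c_def by (simp add: sum_distrib_left mult_ac)
    also have "\<dots> \<le> \<alpha> * (\<Sum>i\<in>UNIV. k i * ip (W $ i) (W $ i))"
      using k(2) km kappa_pos k(1) coercive[OF WX] by (intro mult_left_mono sum_mono mult_mono) (auto simp: less_imp_le)
    also have "\<dots> \<le> (\<Sum>i\<in>UNIV. \<Sum>j\<in>UNIV. k i * Ai $ i $ j * ip (W $ i) (d $ j)) + \<tau> * (\<Sum>i\<in>UNIV. k i * ip (W $ i) (r $ i))"
      unfolding quad[symmetric] by (rule coer[OF WX])
    also have "\<dots> \<le> (\<Sum>i\<in>UNIV. \<Sum>j\<in>UNIV. k i * \<bar>Ai $ i $ j\<bar> * L * (norm W * norm d)) + \<tau> * (\<Sum>i\<in>(UNIV::'s set). k i * L * (norm W * norm r))"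
    proof -
      have ipb: "\<bar>ip (x $ i) (y $ j)\<bar> \<le> L * (norm x * norm y)" for x y :: "'h^'s" and i j
      proof -
        have "\<bar>ip (x $ i) (y $ j)\<bar> \<le> norm (x $ i) * norm (y $ j) * L" using L(2) by simp
        also have "\<dots> \<le> norm x * norm y * L"
          using L(1) by (intro mult_right_mono mult_mono Finite_Cartesian_Product.norm_nth_le) auto
        finally show ?thesis by (simp add: mult_ac)
      qed
      have 1: "k i * Ai $ i $ j * ip (W $ i) (d $ j) \<le> k i * \<bar>Ai $ i $ j\<bar> * L * (norm W * norm d)" for i j
      proof -
        have "k i * Ai $ i $ j * ip (W $ i) (d $ j) \<le> \<bar>k i * Ai $ i $ j * ip (W $ i) (d $ j)\<bar>" by simp
        also have "\<dots> = k i * \<bar>Ai $ i $ j\<bar> * \<bar>ip (W $ i) (d $ j)\<bar>" using k(1)[of i] by (simp add: abs_mult)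
        also have "\<dots> \<le> k i * \<bar>Ai $ i $ j\<bar> * (L * (norm W * norm d))"
          using k(1)[of i] by (intro mult_left_mono ipb) auto
        finally show ?thesis by (simp add: mult_ac)
      qed
      have 2: "k i * ip (W $ i) (r $ i) \<le> k i * L * (norm W * norm r)" for i
      proof -
        have "ip (W $ i) (r $ i) \<le> L * (norm W * norm r)" using ipb[of W i r i] by simp
        from mult_left_mono[OF this, of "k i"] show ?thesis using k(1)[of i] by (simp add: mult_ac)
      qed
      show ?thesis using 1 2 \<tau> by (intro add_mono sum_mono mult_left_mono) auto
    qed
    also have "\<dots> = (\<Sum>i\<in>UNIV. \<Sum>j\<in>UNIV. k i * \<bar>Ai $ i $ j\<bar> * L) * (norm W * norm d) + \<tau> * ((\<Sum>i\<in>(UNIV::'s set). k i * L) * (norm W * norm r))"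
      by (simp add: sum_distrib_right)
    also have "\<dots> \<le> C * (norm W * norm d) + \<tau> * (C * (norm W * norm r))"
      using C \<tau> by (intro add_mono mult_right_mono mult_left_mono) auto
    also have "\<dots> = norm W * (C * (norm d + \<tau> * norm r))" by (simp add: algebra_simps)
    also have "\<dots> \<le> norm W * ((C + 1) * (norm d + \<tau> * norm r))" using \<tau> by (intro mult_left_mono mult_right_mono) auto
    finally have "norm W * (c * norm W) \<le> norm W * ((C + 1) * (norm d + \<tau> * norm r))" by (simp add: power2_eq_square mult_ac)
    then have "c * norm W \<le> (C + 1) * (norm d + \<tau> * norm r)"
      using \<tau> Cpos by (cases "norm W = 0") auto
    then show "norm (U - V) \<le> (C + 1) / c * (norm (g - g') + \<tau> * norm (p - p'))"
      using c by (simp add: W_def d_def r_def field_simps)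
  qed
qed

text \<open>Skew-adjointness moves \<open>M\<close> from the stages, where it is not controlled, to the noise.\<close>

lemma energy_inequality:
  assumes U: "stage_eq \<tau> (\<chi> i. u + \<eta> i) p U" and X: "u \<in> X" "\<And>i. p $ i \<in> X"
    and D: "\<And>i. \<eta> i \<in> DM" "\<xi> \<in> DM"
  defines "v \<equiv> u + \<tau> *\<^sub>R (\<Sum>i\<in>UNIV. b $ i *\<^sub>R (M (U $ i) + p $ i)) + \<xi>"
  shows "ip v v \<le> ip (u + \<xi>) (u + \<xi>) + \<tau> * (\<Sum>i\<in>UNIV. 2 * b $ i *
    (ip (U $ i) (p $ i) + ip (U $ i) (M (\<eta> i)) - ip (\<eta> i) (p $ i) - ip (U $ i) (M \<xi>) + ip (p $ i) \<xi>))"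
proof -
  define k where "k i = M (U $ i) + p $ i" for i
  have UD: "U $ i \<in> DM" for i by (rule stage_eqD(1)[OF U])
  have kX: "k i \<in> X" for i unfolding k_def using M_X[OF UD] X(2) by (intro X_intros)
  \<comment> \<open>The stage equation is solved for \<open>u\<close>: products of \<open>u\<close>
    with the slopes \<open>k i\<close> become products with \<open>U $ i\<close> and the noise, from
    which skewness removes \<open>M\<close> of the stages, plus terms quadratic in the
    slopes.\<close>
  have u: "u = U $ i - \<tau> *\<^sub>R (\<Sum>j\<in>UNIV. A $ i $ j *\<^sub>R k j) - \<eta> i" for i
  proof -
    have "U $ i = u + \<eta> i + \<tau> *\<^sub>R (\<Sum>j\<in>UNIV. A $ i $ j *\<^sub>R k j)" using stage_eqD(2)[OF U, of i] by (simp only: k_def vec_lambda_beta)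
    then show ?thesis by (simp add: algebra_simps)
  qed
  have uk: "ip u (k i) = ip (U $ i) (p $ i) + ip (U $ i) (M (\<eta> i)) - ip (\<eta> i) (p $ i) - \<tau> * (\<Sum>j\<in>UNIV. A $ i $ j * ip (k j) (k i))" for i
  proof -
    have "ip u (k i) = ip (U $ i) (k i) - \<tau> * (\<Sum>j\<in>UNIV. A $ i $ j * ip (k j) (k i)) - ip (\<eta> i) (k i)"
      by (subst u[of i]) (simp add: ip_simps)
    moreover have "ip (U $ i) (k i) = ip (U $ i) (p $ i)"
      using ip_M_self[OF UD[of i]] sym[of "U $ i" "M (U $ i)"] by (simp add: k_def ip_simps)
    moreover have "ip (\<eta> i) (k i) = - ip (U $ i) (M (\<eta> i)) + ip (\<eta> i) (p $ i)"
      using M_skew[OF D(1) UD, of i i] sym[of "U $ i" "M (\<eta> i)"] by (simp add: k_def ip_simps)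
    ultimately show ?thesis by simp
  qed
  have kxi: "ip (k i) \<xi> = - ip (U $ i) (M \<xi>) + ip (p $ i) \<xi>" for i
    using M_skew[OF UD D(2), of i] by (simp add: k_def ip_simps)
  define s where "s = (\<Sum>i\<in>UNIV. b $ i *\<^sub>R k i)"
  define Z where "Z i j = ip (k i) (k j)" for i j
  have Zsym: "Z i j = Z j i" for i j unfolding Z_def by (rule sym)
  \<comment> \<open>These are the terms of order \<open>\<tau>\<^sup>2\<close>: algebraic stability
    lets \<open>ip s s\<close> be absorbed by the quadratic terms that come from
    \<open>ip u s\<close>.\<close>
  have "0 \<le> (\<Sum>i\<in>UNIV. \<Sum>j\<in>UNIV. (b $ i * A $ i $ j + b $ j * A $ j $ i - b $ i * b $ j) * Z i j)"
  proof -
    have "0 \<le> inner v ((\<chi> i j. b $ i * A $ i $ j + b $ j * A $ j $ i - b $ i * b $ j) *v v)" for v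
      using stability unfolding algebraically_stable_def by blast
    from matrix_form_nonneg[OF this, of k, OF kX] show ?thesis by (simp add: Z_def)
  qed
  also have "\<dots> = 2 * (\<Sum>i\<in>UNIV. \<Sum>j\<in>UNIV. b $ i * A $ i $ j * Z j i) - (\<Sum>i\<in>UNIV. \<Sum>j\<in>UNIV. b $ i * b $ j * Z i j)"
  proof -
    have "(\<Sum>i\<in>UNIV. \<Sum>j\<in>UNIV. b $ j * A $ j $ i * Z i j) = (\<Sum>i\<in>UNIV. \<Sum>j\<in>UNIV. b $ i * A $ i $ j * Z j i)"
      by (rule sum.swap)
    moreover have "(\<Sum>i\<in>UNIV. \<Sum>j\<in>UNIV. b $ i * A $ i $ j * Z i j) = (\<Sum>i\<in>UNIV. \<Sum>j\<in>UNIV. b $ i * A $ i $ j * Z j i)"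
      by (intro sum.cong refl arg_cong2[where f="(*)"] Zsym)
    ultimately show ?thesis by (simp add: algebra_simps sum.distrib sum_subtractf)
  qed
  finally have stab: "(\<Sum>i\<in>UNIV. \<Sum>j\<in>UNIV. b $ i * b $ j * Z i j) \<le> 2 * (\<Sum>i\<in>UNIV. \<Sum>j\<in>UNIV. b $ i * A $ i $ j * Z j i)" by simp
  have ss: "ip s s = (\<Sum>i\<in>UNIV. \<Sum>j\<in>UNIV. b $ i * b $ j * Z i j)"
    unfolding s_def Z_def by (simp add: ip_simps sum_distrib_left mult_ac)
      (subst sum.swap, simp add: mult_ac)
  have us: "ip u s = (\<Sum>i\<in>UNIV. b $ i * (ip (U $ i) (p $ i) + ip (U $ i) (M (\<eta> i)) - ip (\<eta> i) (p $ i)))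
      - \<tau> * (\<Sum>i\<in>UNIV. \<Sum>j\<in>UNIV. b $ i * A $ i $ j * Z j i)"
    unfolding s_def Z_def ip.sum_right ip.scaleR_right real_scaleR_def uk
    by (simp add: right_diff_distrib sum_subtractf sum_distrib_left mult_ac)
  have sxi: "ip s \<xi> = (\<Sum>i\<in>UNIV. b $ i * (- ip (U $ i) (M \<xi>) + ip (p $ i) \<xi>))"
    unfolding s_def ip.sum_left ip.scaleR_left real_scaleR_def kxi ..
  have "v = (u + \<xi>) + \<tau> *\<^sub>R s" by (simp add: v_def s_def k_def)
  then have "ip v v = ip (u + \<xi>) (u + \<xi>) + 2 * \<tau> * (ip u s + ip s \<xi>) + \<tau>\<^sup>2 * ip s s"
    by (simp add: ip_simps sym[of s u] sym[of \<xi> s] power2_eq_square algebra_simps)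
  also have "\<tau>\<^sup>2 * ip s s \<le> \<tau>\<^sup>2 * (2 * (\<Sum>i\<in>UNIV. \<Sum>j\<in>UNIV. b $ i * A $ i $ j * Z j i))"
    unfolding ss by (intro mult_left_mono stab) simp
  also have "ip (u + \<xi>) (u + \<xi>) + 2 * \<tau> * (ip u s + ip s \<xi>) + \<tau>\<^sup>2 * (2 * (\<Sum>i\<in>UNIV. \<Sum>j\<in>UNIV. b $ i * A $ i $ j * Z j i))
      = ip (u + \<xi>) (u + \<xi>) + 2 * \<tau> * ((\<Sum>i\<in>UNIV. b $ i * (ip (U $ i) (p $ i) + ip (U $ i) (M (\<eta> i)) - ip (\<eta> i) (p $ i)))
        + (\<Sum>i\<in>UNIV. b $ i * (- ip (U $ i) (M \<xi>) + ip (p $ i) \<xi>)))"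
    unfolding us sxi by (simp add: power2_eq_square algebra_simps)
  also have "\<dots> = ip (u + \<xi>) (u + \<xi>) + \<tau> * (\<Sum>i\<in>UNIV. 2 * b $ i *
    (ip (U $ i) (p $ i) + ip (U $ i) (M (\<eta> i)) - ip (\<eta> i) (p $ i) - ip (U $ i) (M \<xi>) + ip (p $ i) \<xi>))"
    unfolding sum.distrib[symmetric] by (simp add: sum_distrib_left algebra_simps)
  finally show ?thesis by simp
qed

end

subsection \<open>Nonlinear stages\<close>

locale rk_drift = runge_kutta ip X \<kappa> DM M A b
  for ip :: "'h::{banach,second_countable_topology} \<Rightarrow> 'h \<Rightarrow> real" and X \<kappa> DM M
    and A :: "real^'s::finite^'s" and b :: "real^'s" +
  fixes At :: "real^'s^'s" and bt c :: "real^'s" and F :: "real \<Rightarrow> 'h \<Rightarrow> 'h" and T l f0 :: real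
  assumes T: "T > 0" and nodes: "\<And>i. c $ i \<in> {0..1}" and l: "l \<ge> 0"
    and F_X: "t \<in> {0..T} \<Longrightarrow> x \<in> X \<Longrightarrow> F t x \<in> X"
    and F_lipschitz: "t \<in> {0..T} \<Longrightarrow> x \<in> X \<Longrightarrow> y \<in> X \<Longrightarrow> norm (F t x - F t y) \<le> l * norm (x - y)"
    and F_0: "t \<in> {0..T} \<Longrightarrow> norm (F t 0) \<le> f0"
begin

lemma f0: "f0 \<ge> 0"
  using F_0[of 0] T by (auto intro: order_trans[OF norm_ge_zero])

definition Fs :: "('s \<Rightarrow> real) \<Rightarrow> 'h^'s \<Rightarrow> 'h^'s" where
  "Fs s U = (\<chi> i. F (s i) (U $ i))"

lemma Fs_X: "(\<And>i. s i \<in> {0..T}) \<Longrightarrow> U \<in> Xs \<Longrightarrow> Fs s U \<in> Xs"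
  by (simp add: Fs_def F_X)

lemma Fs_lipschitz:
  assumes "\<And>i. s i \<in> {0..T}" "U \<in> Xs" "V \<in> Xs"
  shows "norm (Fs s U - Fs s V) \<le> l * norm (U - V)"
  by (rule norm_vec_le_scale[OF _ l]) (use assms in \<open>simp add: Fs_def F_lipschitz\<close>)

lemma Fs_0:
  assumes "\<And>i. s i \<in> {0..T}"
  shows "norm (Fs s 0) \<le> real CARD('s) * f0"
proof -
  have "norm (Fs s 0) \<le> (\<Sum>i\<in>UNIV. norm (Fs s 0 $ i))" by (rule norm_vec_le_sum)
  also have "\<dots> \<le> (\<Sum>i\<in>(UNIV::'s set). f0)" using assms by (intro sum_mono) (auto simp: Fs_def intro!: F_0 simp del: atLeastAtMost_iff)
  finally show ?thesis by simp
qed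

lemma stage_X: "stage_eq \<tau> g p U \<Longrightarrow> U \<in> Xs"
  using stage_eqD(1) DM_X by blast

text \<open>The three clauses give solvability, Lipschitz dependence on the data (hence uniqueness
  and measurability) and linear growth. A predicate, so that both constants can be fixed once for
  all steps and all probability spaces.\<close>

definition stage_constants :: "real \<Rightarrow> real \<Rightarrow> bool" where
  "stage_constants \<tau>' C \<longleftrightarrow> \<tau>' > 0 \<and> C > 0 \<and>
     (\<forall>\<tau> s g. 0 < \<tau> \<and> \<tau> \<le> \<tau>' \<and> (\<forall>i. s i \<in> {0..T}) \<and> g \<in> Xs \<longrightarrow> (\<exists>U. stage_eq \<tau> g (Fs s U) U)) \<and>
     (\<forall>\<tau> s g g' U V. 0 < \<tau> \<and> \<tau> \<le> \<tau>' \<and> (\<forall>i. s i \<in> {0..T}) \<and> g \<in> Xs \<and> g' \<in> Xs \<and>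
        stage_eq \<tau> g (Fs s U) U \<and> stage_eq \<tau> g' (Fs s V) V \<longrightarrow> norm (U - V) \<le> C * norm (g - g')) \<and>
     (\<forall>\<tau> s g U. 0 < \<tau> \<and> \<tau> \<le> \<tau>' \<and> (\<forall>i. s i \<in> {0..T}) \<and> g \<in> Xs \<and> stage_eq \<tau> g (Fs s U) U \<longrightarrow>
        norm U \<le> C * (norm g + \<tau>))"

lemma stage_constantsD:
  assumes "stage_constants \<tau>' C"
  shows "\<tau>' > 0" "C > 0"
    "0 < \<tau> \<Longrightarrow> \<tau> \<le> \<tau>' \<Longrightarrow> (\<And>i. s i \<in> {0..T}) \<Longrightarrow> g \<in> Xs \<Longrightarrow> \<exists>U. stage_eq \<tau> g (Fs s U) U"
    "0 < \<tau> \<Longrightarrow> \<tau> \<le> \<tau>' \<Longrightarrow> (\<And>i. s i \<in> {0..T}) \<Longrightarrow> g \<in> Xs \<Longrightarrow> g' \<in> Xs \<Longrightarrow>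
       stage_eq \<tau> g (Fs s U) U \<Longrightarrow> stage_eq \<tau> g' (Fs s V) V \<Longrightarrow> norm (U - V) \<le> C * norm (g - g')"
    "0 < \<tau> \<Longrightarrow> \<tau> \<le> \<tau>' \<Longrightarrow> (\<And>i. s i \<in> {0..T}) \<Longrightarrow> g \<in> Xs \<Longrightarrow> stage_eq \<tau> g (Fs s U) U \<Longrightarrow>
       norm U \<le> C * (norm g + \<tau>)"
proof -
  note * = assms[unfolded stage_constants_def]
  show "\<tau>' > 0" "C > 0" using * by blast+
  show "\<exists>U. stage_eq \<tau> g (Fs s U) U" if "0 < \<tau>" "\<tau> \<le> \<tau>'" "\<And>i. s i \<in> {0..T}" "g \<in> Xs"
    using *[THEN conjunct2, THEN conjunct2, THEN conjunct1, rule_format, of \<tau> s g] that by blast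
  show "norm (U - V) \<le> C * norm (g - g')" if "0 < \<tau>" "\<tau> \<le> \<tau>'" "\<And>i. s i \<in> {0..T}" "g \<in> Xs" "g' \<in> Xs"
     "stage_eq \<tau> g (Fs s U) U" "stage_eq \<tau> g' (Fs s V) V"
    using *[THEN conjunct2, THEN conjunct2, THEN conjunct2, THEN conjunct1, rule_format, of \<tau> s g g' U V] that by blast
  show "norm U \<le> C * (norm g + \<tau>)" if "0 < \<tau>" "\<tau> \<le> \<tau>'" "\<And>i. s i \<in> {0..T}" "g \<in> Xs" "stage_eq \<tau> g (Fs s U) U"
    using *[THEN conjunct2, THEN conjunct2, THEN conjunct2, THEN conjunct2, rule_format, of \<tau> s g U] that by blast
qed

text \<open>The threshold makes \<open>C0 * (\<tau> * l) \<le> 1 / 2\<close>. Freezing the drift at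
  \<open>U\<close> and solving the linear problem is then a contraction with factor one half, and in
  both estimates the drift term is absorbed by the left side at the price of a factor 2. The rest of
  \<open>C\<close> pays for the drift at zero.\<close>

lemma stage_constants_exist: "\<exists>\<tau>' C. stage_constants \<tau>' C"
proof -
  obtain C0 where C0: "C0 > 0" "\<And>\<tau> g p U g' p' V. \<tau> \<ge> 0 \<Longrightarrow> g \<in> Xs \<Longrightarrow> p \<in> Xs \<Longrightarrow> g' \<in> Xs \<Longrightarrow> p' \<in> Xs \<Longrightarrow>
     stage_eq \<tau> g p U \<Longrightarrow> stage_eq \<tau> g' p' V \<Longrightarrow> norm (U - V) \<le> C0 * (norm (g - g') + \<tau> * norm (p - p'))"
    by (rule linear_stage_estimate, rule that)
  define \<tau>' where "\<tau>' = 1 / (2 * C0 * (l + 1))"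
  define C where "C = 2 * C0 * (1 + real CARD('s) * f0)"
  have \<tau>': "\<tau>' > 0" unfolding \<tau>'_def using C0 l by simp
  have C: "C > 0" "2 * C0 \<le> C" unfolding C_def using C0 f0
    by (auto simp: add_pos_nonneg mult_le_cancel_left1)
  have half: "C0 * (\<tau> * l) \<le> 1 / 2" if "0 < \<tau>" "\<tau> \<le> \<tau>'" for \<tau>
  proof -
    have "C0 * (\<tau> * l) \<le> C0 * (\<tau>' * (l + 1))" using that C0 l by (intro mult_left_mono mult_mono) auto
    also have "\<dots> = 1 / 2"       proof -
      have "C0 \<noteq> 0" "l + 1 \<noteq> 0" using C0(1) l by auto
      then show ?thesis unfolding \<tau>'_def by simp
    qed
    finally show ?thesis .
  qed
  have lip: "norm (U - V) \<le> 2 * C0 * norm (g - g')"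
    if "0 < \<tau>" "\<tau> \<le> \<tau>'" "\<forall>i. s i \<in> {0..T}" "g \<in> Xs" "g' \<in> Xs"
      "stage_eq \<tau> g (Fs s U) U" "stage_eq \<tau> g' (Fs s V) V" for \<tau> s g g' U V
  proof -
    have UV: "U \<in> Xs" "V \<in> Xs" using that stage_X by blast+
    have "norm (U - V) \<le> C0 * (norm (g - g') + \<tau> * norm (Fs s U - Fs s V))"
      by (rule C0(2)[OF _ that(4) Fs_X[OF that(3)[rule_format] UV(1)] that(5) Fs_X[OF that(3)[rule_format] UV(2)] that(6,7)])
        (use that(1) in simp)
    also have "\<dots> \<le> C0 * (norm (g - g') + \<tau> * (l * norm (U - V)))"
      using that(1) C0(1) Fs_lipschitz[OF that(3)[rule_format] UV] by (intro mult_left_mono add_left_mono) auto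
    also have "\<dots> = C0 * norm (g - g') + C0 * (\<tau> * l) * norm (U - V)" by (simp add: algebra_simps)
    also have "\<dots> \<le> C0 * norm (g - g') + 1 / 2 * norm (U - V)"
      using half[OF that(1,2)] by (intro add_left_mono mult_right_mono) auto
    finally show ?thesis by simp
  qed
  have ex: "\<exists>U. stage_eq \<tau> g (Fs s U) U" if that: "0 < \<tau>" "\<tau> \<le> \<tau>'" "\<forall>i. s i \<in> {0..T}" "g \<in> Xs" for \<tau> s g
  proof -
    have "\<forall>U\<in>Xs. \<exists>V. stage_eq \<tau> g (Fs s U) V"
    proof
      show "\<exists>V. stage_eq \<tau> g (Fs s U) V" if "U \<in> Xs" for U
        by (rule linear_stage_exists[OF \<open>0 < \<tau>\<close> \<open>g \<in> Xs\<close> Fs_X[OF \<open>\<forall>i. s i \<in> {0..T}\<close>[rule_format] that]])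
    qed
    note \<tau> = that(1,2) and s = that(3)[rule_format] and g = that(4)
    from \<open>\<forall>U\<in>Xs. _\<close> obtain \<Phi> where \<Phi>: "\<And>U. U \<in> Xs \<Longrightarrow> stage_eq \<tau> g (Fs s U) (\<Phi> U)" by metis
    have "\<exists>!U\<in>Xs. \<Phi> U = U"
    proof (rule Banach_fix)
      show "Topological_Spaces.complete Xs" using vec.closed_X by (simp add: complete_eq_closed)
      show "Xs \<noteq> {}" using vec.subspace_X subspace_0 by blast
      show "\<Phi> ` Xs \<subseteq> Xs" using \<Phi> stage_X by blast
      show "dist (\<Phi> U) (\<Phi> V) \<le> 1 / 2 * dist U V" if UV: "U \<in> Xs" "V \<in> Xs" for U V
      proof -
        have "norm (\<Phi> U - \<Phi> V) \<le> C0 * (norm (g - g) + \<tau> * norm (Fs s U - Fs s V))"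
          by (rule C0(2)[OF _ g Fs_X[OF s UV(1)] g Fs_X[OF s UV(2)] \<Phi>[OF UV(1)] \<Phi>[OF UV(2)]]) (use \<tau> in simp)
        also have "\<dots> \<le> C0 * (norm (g - g) + \<tau> * (l * norm (U - V)))"
          using C0(1) \<tau> Fs_lipschitz[OF s UV] by (intro mult_left_mono add_left_mono) auto
        also have "\<dots> = C0 * (\<tau> * l) * norm (U - V)" by simp
        also have "\<dots> \<le> 1 / 2 * norm (U - V)"
          using half[OF \<tau>] by (intro mult_right_mono) auto
        finally show ?thesis by (simp add: dist_norm)
      qed
    qed auto
    then show ?thesis using \<Phi> by metis
  qed
  have growth: "norm U \<le> C * (norm g + \<tau>)"
    if "0 < \<tau>" "\<tau> \<le> \<tau>'" "\<forall>i. s i \<in> {0..T}" "g \<in> Xs" "stage_eq \<tau> g (Fs s U) U" for \<tau> s g U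
  proof -
    have U: "U \<in> Xs" using that stage_X by blast
    have 0: "(0 :: 'h^'s) \<in> Xs" using subspace_0[OF subspace_X] by simp
    have s0: "stage_eq \<tau> 0 0 0" unfolding stage_eq_def using subspace_0[OF subspace_DM] by (simp add: M_0)
    have "norm (U - 0) \<le> C0 * (norm (g - 0) + \<tau> * norm (Fs s U - 0))"
      by (rule C0(2)[OF _ that(4) Fs_X[OF that(3)[rule_format] U] 0 0 that(5) s0]) (use that(1) in simp)
    also have "\<dots> \<le> C0 * (norm g + \<tau> * (l * norm U + real CARD('s) * f0))"
    proof -
      have "norm (Fs s U) \<le> norm (Fs s U - Fs s 0) + norm (Fs s 0)"
        using norm_triangle_ineq[of "Fs s U - Fs s 0" "Fs s 0"] by simp
      also have "\<dots> \<le> l * norm (U - 0) + real CARD('s) * f0"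
        by (intro add_mono Fs_lipschitz[OF that(3)[rule_format] U 0] Fs_0 that(3)[rule_format])
      finally show ?thesis using C0(1) that(1) by (intro mult_left_mono add_mono) auto
    qed
    also have "\<dots> = C0 * norm g + C0 * (\<tau> * l) * norm U + C0 * (\<tau> * (real CARD('s) * f0))" by (simp add: algebra_simps)
    also have "\<dots> \<le> C0 * norm g + 1 / 2 * norm U + C0 * (\<tau> * (real CARD('s) * f0))"
      using half[OF that(1,2)] by (intro add_right_mono add_left_mono mult_right_mono) auto
    finally have "norm U \<le> 2 * C0 * (norm g + \<tau> * (real CARD('s) * f0))" by (simp add: algebra_simps)
    also have "\<dots> \<le> 2 * C0 * ((1 + real CARD('s) * f0) * (norm g + \<tau>))"
      using C0(1) f0 that(1) by (intro mult_left_mono) (auto simp: algebra_simps)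
    finally show ?thesis by (simp add: C_def mult.assoc)
  qed
  have lip': "norm (U - V) \<le> C * norm (g - g')"
    if "0 < \<tau>" "\<tau> \<le> \<tau>'" "\<forall>i. s i \<in> {0..T}" "g \<in> Xs" "g' \<in> Xs"
      "stage_eq \<tau> g (Fs s U) U" "stage_eq \<tau> g' (Fs s V) V" for \<tau> s g g' U V
    using lip[OF that] mult_right_mono[OF C(2), of "norm (g - g')"] by simp
  have "stage_constants \<tau>' C"
    unfolding stage_constants_def using \<tau>' C(1) ex lip' growth by blast
  then show ?thesis by blast
qed

section \<open>Pathwise estimates of one step with noise\<close>

definition noise_stage :: "'h \<Rightarrow> ('s \<Rightarrow> 'h) \<Rightarrow> 'h^'s" where
  "noise_stage u \<beta> = (\<chi> i. u + (\<Sum>j\<in>UNIV. At $ i $ j *\<^sub>R \<beta> j))"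

lemma noise_stage_X: "u \<in> X \<Longrightarrow> (\<And>j. \<beta> j \<in> X) \<Longrightarrow> noise_stage u \<beta> \<in> Xs"
  by (auto simp: noise_stage_def intro!: X_intros)

lemma nrm_combination:
  assumes "\<And>j. \<beta> j \<in> X" "\<And>j. nrm (\<beta> j) \<le> z"
  shows "nrm (\<Sum>j\<in>UNIV. a j *\<^sub>R \<beta> j) \<le> (\<Sum>j\<in>(UNIV::'s set). \<bar>a j\<bar>) * z"
proof -
  have "nrm (\<Sum>j\<in>UNIV. a j *\<^sub>R \<beta> j) \<le> (\<Sum>j\<in>UNIV. nrm (a j *\<^sub>R \<beta> j))"
    using assms(1) by (intro nrm_sum X_intros)
  also have "\<dots> \<le> (\<Sum>j\<in>(UNIV::'s set). \<bar>a j\<bar> * z)"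
    unfolding nrm_scaleR by (intro sum_mono mult_left_mono assms) auto
  finally show ?thesis by (simp add: sum_distrib_right)
qed

definition noise_update :: "('s \<Rightarrow> 'h) \<Rightarrow> 'h" where
  "noise_update \<beta> = (\<Sum>i\<in>UNIV. bt $ i *\<^sub>R \<beta> i)"

definition update :: "real \<Rightarrow> ('s \<Rightarrow> real) \<Rightarrow> 'h \<Rightarrow> ('s \<Rightarrow> 'h) \<Rightarrow> 'h^'s \<Rightarrow> 'h" where
  "update \<tau> s u \<beta> U = u + \<tau> *\<^sub>R (\<Sum>i\<in>UNIV. b $ i *\<^sub>R (M (U $ i) + F (s i) (U $ i))) + noise_update \<beta>"

text \<open>All that a single path has to satisfy in one step; probability enters only in showing
  that this holds almost surely.\<close>

definition step_data :: "real \<Rightarrow> real \<Rightarrow> ('s \<Rightarrow> real) \<Rightarrow> 'h \<Rightarrow> ('s \<Rightarrow> 'h) \<Rightarrow> real \<Rightarrow> 'h^'s \<Rightarrow> bool" where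
  "step_data \<tau>' \<tau> s u \<beta> z U \<longleftrightarrow> 0 < \<tau> \<and> \<tau> \<le> \<tau>' \<and> \<tau> \<le> T \<and> (\<forall>i. s i \<in> {0..T}) \<and> u \<in> X \<and>
     (\<forall>j. \<beta> j \<in> DM \<and> nrm (\<beta> j) \<le> z \<and> nrm (M (\<beta> j)) \<le> z) \<and> stage_eq \<tau> (noise_stage u \<beta>) (Fs s U) U"

lemma step_dataD:
  assumes "step_data \<tau>' \<tau> s u \<beta> z U"
  shows "0 < \<tau>" "\<tau> \<le> \<tau>'" "\<tau> \<le> T" "s i \<in> {0..T}" "u \<in> X" "\<beta> j \<in> DM" "nrm (\<beta> j) \<le> z" "nrm (M (\<beta> j)) \<le> z"
    "stage_eq \<tau> (noise_stage u \<beta>) (Fs s U) U" "\<beta> j \<in> X" "0 \<le> z"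
proof -
  show 1: "0 < \<tau>" "\<tau> \<le> \<tau>'" "\<tau> \<le> T" "s i \<in> {0..T}" "u \<in> X" "\<beta> j \<in> DM" "nrm (\<beta> j) \<le> z" "nrm (M (\<beta> j)) \<le> z"
    "stage_eq \<tau> (noise_stage u \<beta>) (Fs s U) U" using assms unfolding step_data_def by blast+
  show 2: "\<beta> j \<in> X" using 1(6) DM_X by blast
  show "0 \<le> z" by (rule order_trans[OF nrm_nonneg[OF 2] 1(7)])
qed

text \<open>The first bound keeps \<open>\<tau>\<close> as its inhomogeneous term, because the
  moment bound for the stages allows an addition of order \<open>\<tau>\<close> and not a constant.
  The second is \<open>energy_inequality\<close> with every product estimated by
  Cauchy-Schwarz.\<close>

lemma step_estimates:
  assumes C: "stage_constants \<tau>' C"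
  obtains C2 where "C2 > 0"
    "\<And>\<tau> s u \<beta> z U i. step_data \<tau>' \<tau> s u \<beta> z U \<Longrightarrow> nrm (U $ i) \<le> C2 * (nrm u + z + \<tau>)"
    "\<And>\<tau> s u \<beta> z U. step_data \<tau>' \<tau> s u \<beta> z U \<Longrightarrow>
       (nrm (update \<tau> s u \<beta> U))\<^sup>2 \<le> (nrm (u + noise_update \<beta>))\<^sup>2 + \<tau> * (C2 * (1 + nrm u + z)\<^sup>2)"
proof -
  obtain Kb where Kb: "Kb > 0" "\<And>x. nrm x \<le> Kb * norm x" using nrm_le_norm by blast
  define kk where "kk = 1 / sqrt \<kappa>"
  have kk: "kk > 0" "\<And>x. x \<in> X \<Longrightarrow> norm x \<le> kk * nrm x" using norm_le_nrm kappa_pos by (auto simp: kk_def)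
  have Cpos: "C > 0" by (rule stage_constantsD(2)[OF C])
  define a where "a = (\<Sum>i\<in>UNIV. \<Sum>j\<in>UNIV. \<bar>At $ i $ j\<bar>)"
  define bb where "bb = (\<Sum>j\<in>UNIV. \<bar>bt $ j\<bar>)"
  have a: "a \<ge> 0" "\<And>i. (\<Sum>j\<in>UNIV. \<bar>At $ i $ j\<bar>) \<le> a"
    unfolding a_def by (auto intro!: sum_nonneg member_le_sum[of _ UNIV "\<lambda>i. \<Sum>j\<in>UNIV. \<bar>At $ i $ j\<bar>"])
  have bb: "bb \<ge> 0" unfolding bb_def by (auto intro!: sum_nonneg)
  define n where "n = real CARD('s)"
  have n: "n > 0" by (simp add: n_def)
  define c3 where "c3 = Kb * C * (kk * n * (1 + a) + 1)"
  have c3: "c3 > 0" unfolding c3_def using Kb Cpos kk n a by (simp add: add_nonneg_pos)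
  have \<eta>b: "nrm (\<Sum>j\<in>UNIV. At $ i $ j *\<^sub>R \<beta> j) \<le> a * z" if "\<And>j. \<beta> j \<in> X" "\<And>j. nrm (\<beta> j) \<le> z" for i \<beta> z
  proof -
    have "0 \<le> z" using that nrm_nonneg order_trans by blast
    have "nrm (\<Sum>j\<in>UNIV. At $ i $ j *\<^sub>R \<beta> j) \<le> (\<Sum>j\<in>UNIV. \<bar>At $ i $ j\<bar>) * z" by (rule nrm_combination[OF that])
    also have "\<dots> \<le> a * z" using a(2) \<open>0 \<le> z\<close> by (rule mult_right_mono)
    finally show ?thesis .
  qed
  have stage: "nrm (U $ i) \<le> c3 * (nrm u + z + \<tau>)"
    if d: "step_data \<tau>' \<tau> s u \<beta> z U" for \<tau> s u \<beta> z U i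
  proof -
    note t = step_dataD(1,2)[OF d] and s = step_dataD(4)[OF d] and u = step_dataD(5)[OF d]
      and \<beta> = step_dataD(10,7)[OF d] and U = step_dataD(9)[OF d] and z = step_dataD(11)[OF d]
    have nu: "0 \<le> nrm u" by (rule nrm_nonneg[OF u])
    have "norm (noise_stage u \<beta>) \<le> (\<Sum>i\<in>UNIV. norm (noise_stage u \<beta> $ i))" by (rule norm_vec_le_sum)
    also have "\<dots> \<le> (\<Sum>i\<in>(UNIV::'s set). kk * (nrm u + a * z))"
    proof (rule sum_mono)
      fix i
      have e: "(\<Sum>j\<in>UNIV. At $ i $ j *\<^sub>R \<beta> j) \<in> X" using \<beta>(1) by (intro X_intros)
      have "norm (noise_stage u \<beta> $ i) \<le> kk * nrm (u + (\<Sum>j\<in>UNIV. At $ i $ j *\<^sub>R \<beta> j))"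
        unfolding noise_stage_def using u e by (auto intro!: kk(2) X_intros)
      also have "\<dots> \<le> kk * (nrm u + a * z)"
        using kk(1) order_trans[OF nrm_triangle[OF u e] add_left_mono[OF \<eta>b[OF \<beta>]]] by (intro mult_left_mono) auto
      finally show "norm (noise_stage u \<beta> $ i) \<le> kk * (nrm u + a * z)" .
    qed
    also have "\<dots> = kk * n * (nrm u + a * z)" by (simp add: n_def)
    finally have g: "norm (noise_stage u \<beta>) \<le> kk * n * (nrm u + a * z)" .
    have "nrm (U $ i) \<le> Kb * norm (U $ i)" by (rule Kb)
    also have "\<dots> \<le> Kb * norm U" using Kb(1) by (intro mult_left_mono Finite_Cartesian_Product.norm_nth_le) auto
    also have "\<dots> \<le> Kb * (C * (norm (noise_stage u \<beta>) + \<tau>))"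
    proof -
      have "norm U \<le> C * (norm (noise_stage u \<beta>) + \<tau>)"
        by (rule stage_constantsD(5)[OF C t s noise_stage_X[OF u \<beta>(1)] U])
      then show ?thesis using Kb(1) by (intro mult_left_mono) auto
    qed
    also have "\<dots> \<le> Kb * (C * (kk * n * (nrm u + a * z) + \<tau>))"
      using Kb(1) Cpos g by (intro mult_left_mono add_right_mono) auto
    also have "\<dots> \<le> Kb * (C * ((kk * n * (1 + a) + 1) * (nrm u + z + \<tau>)))"
    proof -
      have "kk * n * (nrm u + a * z) \<le> kk * n * ((1 + a) * (nrm u + z + \<tau>))"
        using kk n a z nu t by (intro mult_left_mono) (auto simp: algebra_simps)
      then have "kk * n * (nrm u + a * z) + \<tau> \<le> (kk * n * (1 + a) + 1) * (nrm u + z + \<tau>)"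
        using nu z by (simp add: algebra_simps)
      then show ?thesis using Kb(1) Cpos by (intro mult_left_mono) auto
    qed
    finally show ?thesis by (simp add: c3_def mult.assoc)
  qed
  define c5 where "c5 = Kb * (l * kk * (c3 * (1 + T)) + f0)"
  define c6 where "c6 = c3 * (1 + T) + c5 + a + bb"
  have c5: "c5 \<ge> 0" unfolding c5_def using Kb l kk c3 T f0 by simp
  have c6: "c3 * (1 + T) \<le> c6" "c5 \<le> c6" "a \<le> c6" "bb \<le> c6" "c6 \<ge> 0"
    unfolding c6_def using c5 a bb c3 T by auto
  define c7 where "c7 = (\<Sum>i\<in>UNIV. 2 * b $ i * (5 * c6\<^sup>2))"
  have bpos: "b $ i \<ge> 0" for i using stability by (simp add: algebraically_stable_def)
  have c7: "c7 \<ge> 0" unfolding c7_def using bpos by (intro sum_nonneg) auto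
  have energy: "(nrm (update \<tau> s u \<beta> U))\<^sup>2 \<le> (nrm (u + noise_update \<beta>))\<^sup>2 + \<tau> * (c7 * (1 + nrm u + z)\<^sup>2)"
    if d: "step_data \<tau>' \<tau> s u \<beta> z U" for \<tau> s u \<beta> z U
  proof -
    note t = step_dataD(1-3)[OF d] and s = step_dataD(4)[OF d] and u = step_dataD(5)[OF d]
      and \<beta> = step_dataD(6-8)[OF d] and U = step_dataD(9)[OF d] and \<beta>X = step_dataD(10)[OF d]
    have \<beta>X: "\<beta> j \<in> X" "M (\<beta> j) \<in> X" for j using \<beta>(1) DM_X M_X by auto
    have z: "0 \<le> z" using \<beta>(2) nrm_nonneg[OF \<beta>X(1)] order_trans by blast
    have nu: "0 \<le> nrm u" by (rule nrm_nonneg[OF u])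
    \<comment> \<open>A common scale: stages, drift values, noise and \<open>M\<close> of the noise
      are all at most \<open>c6 * m\<close>, so each of the five products below is at most
      \<open>c6\<^sup>2 * m\<^sup>2\<close>.\<close>
    define m where "m = 1 + nrm u + z"
    have m: "m \<ge> 1" "z \<le> m" unfolding m_def using nu z by auto
    define \<eta> where "\<eta> i = (\<Sum>j\<in>UNIV. At $ i $ j *\<^sub>R \<beta> j)" for i
    define \<xi> where "\<xi> = (\<Sum>i\<in>UNIV. bt $ i *\<^sub>R \<beta> i)"
    have D: "\<eta> i \<in> DM" "\<xi> \<in> DM" for i unfolding \<eta>_def \<xi>_def
      by (intro subspace_sum[OF subspace_DM] subspace_scale[OF subspace_DM] \<beta>(1))+
    have UX: "U $ i \<in> X" for i using stage_X[OF U] by simp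
    have pX: "Fs s U $ i \<in> X" for i using Fs_X[OF s stage_X[OF U]] by simp
    have Me: "M (\<eta> i) = (\<Sum>j\<in>UNIV. At $ i $ j *\<^sub>R M (\<beta> j))" for i unfolding \<eta>_def by (rule M_sum) (rule \<beta>)
    have Mx: "M \<xi> = (\<Sum>i\<in>UNIV. bt $ i *\<^sub>R M (\<beta> i))" unfolding \<xi>_def by (rule M_sum) (rule \<beta>)
    have U': "stage_eq \<tau> (\<chi> i. u + \<eta> i) (Fs s U) U" using U by (simp add: noise_stage_def \<eta>_def)
    have b1: "nrm (U $ i) \<le> c3 * (1 + T) * m" for i
    proof -
      have "nrm (U $ i) \<le> c3 * (nrm u + z + \<tau>)" by (rule stage[OF d])
      also have "\<dots> \<le> c3 * ((1 + T) * m)"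
      proof -
        have "T * 1 \<le> T * m" using m(1) T by (intro mult_left_mono) auto
        then have "\<tau> \<le> T * m" using t(3) by simp
        then show ?thesis using c3 by (intro mult_left_mono) (auto simp: m_def algebra_simps)
      qed
      finally show ?thesis by simp
    qed
    have b2: "nrm (Fs s U $ i) \<le> c5 * m" for i
    proof -
      have "norm (Fs s U $ i) \<le> norm (F (s i) (U $ i) - F (s i) 0) + norm (F (s i) 0)"
        using norm_triangle_ineq[of "F (s i) (U $ i) - F (s i) 0" "F (s i) 0"] by (simp add: Fs_def)
      also have "\<dots> \<le> l * norm (U $ i - 0) + f0"
        using UX subspace_0[OF subspace_X] s by (intro add_mono F_lipschitz F_0) auto
      also have "\<dots> \<le> l * (kk * (c3 * (1 + T) * m)) + f0 * m"
      proof (rule add_mono)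
        have "norm (U $ i) \<le> kk * (c3 * (1 + T) * m)"
          by (rule order_trans[OF kk(2)[OF UX] mult_left_mono[OF b1[of i]]]) (use kk(1) in simp)
        then show "l * norm (U $ i - 0) \<le> l * (kk * (c3 * (1 + T) * m))" using l by (simp add: mult_left_mono)
        show "f0 \<le> f0 * m" using f0 m mult_left_mono[of 1 m f0] by simp
      qed
      finally have "Kb * norm (Fs s U $ i) \<le> Kb * (l * (kk * (c3 * (1 + T) * m)) + f0 * m)"
        using Kb(1) by (intro mult_left_mono) auto
      then show ?thesis using Kb(2)[of "Fs s U $ i"] by (simp add: c5_def algebra_simps)
    qed
    have up: "x \<le> c6 * m" if "x \<le> r * m" "r \<le> c6" for x r
      by (rule order_trans[OF that(1) mult_right_mono[OF that(2)]]) (use m in simp)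
    have b3: "nrm (\<eta> i) \<le> c6 * m" "nrm (M (\<eta> i)) \<le> c6 * m" "nrm \<xi> \<le> c6 * m" "nrm (M \<xi>) \<le> c6 * m" for i
    proof -
      have "nrm (\<eta> i) \<le> a * z" "nrm (M (\<eta> i)) \<le> a * z" unfolding Me unfolding \<eta>_def by (intro \<eta>b \<beta>X \<beta>)+
      moreover have "nrm \<xi> \<le> bb * z" "nrm (M \<xi>) \<le> bb * z"
        unfolding Mx unfolding \<xi>_def bb_def by (intro nrm_combination \<beta>X \<beta>)+
      moreover have "a * z \<le> a * m" "bb * z \<le> bb * m" using a bb m by (auto intro: mult_left_mono)
      ultimately show "nrm (\<eta> i) \<le> c6 * m" "nrm (M (\<eta> i)) \<le> c6 * m" "nrm \<xi> \<le> c6 * m" "nrm (M \<xi>) \<le> c6 * m"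
        using up c6 by (meson order_trans)+
    qed
    have b1': "nrm (U $ i) \<le> c6 * m" for i using up[OF b1 c6(1)] .
    have b2': "nrm (Fs s U $ i) \<le> c6 * m" for i using up[OF b2 c6(2)] .
    have ipb: "\<bar>ip x y\<bar> \<le> c6\<^sup>2 * m\<^sup>2" if "x \<in> X" "y \<in> X" "nrm x \<le> c6 * m" "nrm y \<le> c6 * m" for x y
    proof -
      have "\<bar>ip x y\<bar> \<le> nrm x * nrm y" by (rule Cauchy_Schwarz[OF that(1,2)])
      also have "\<dots> \<le> (c6 * m) * (c6 * m)" using that nrm_nonneg[OF that(2)] c6(5) m by (intro mult_mono) auto
      finally show ?thesis by (simp add: power2_eq_square mult_ac)
    qed
    have eX: "\<eta> i \<in> X" "M (\<eta> i) \<in> X" "\<xi> \<in> X" "M \<xi> \<in> X" for i using D DM_X M_X by auto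
    have summand: "2 * b $ i * (ip (U $ i) (Fs s U $ i) + ip (U $ i) (M (\<eta> i)) - ip (\<eta> i) (Fs s U $ i) - ip (U $ i) (M \<xi>) + ip (Fs s U $ i) \<xi>)
        \<le> 2 * b $ i * (5 * c6\<^sup>2) * m\<^sup>2" for i
    proof -
      have "ip (U $ i) (Fs s U $ i) + ip (U $ i) (M (\<eta> i)) - ip (\<eta> i) (Fs s U $ i) - ip (U $ i) (M \<xi>) + ip (Fs s U $ i) \<xi>
          \<le> 5 * (c6\<^sup>2 * m\<^sup>2)"
        using ipb[OF UX pX b1' b2', of i i] ipb[OF UX eX(2) b1' b3(2), of i i] ipb[OF eX(1) pX b3(1) b2', of i i]
          ipb[OF UX eX(4) b1' b3(4), of i] ipb[OF pX eX(3) b2' b3(3), of i] by linarith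
      from mult_left_mono[OF this, of "2 * b $ i"] show ?thesis using bpos[of i] by (simp add: mult_ac)
    qed
    define v where "v = u + \<tau> *\<^sub>R (\<Sum>i\<in>UNIV. b $ i *\<^sub>R (M (U $ i) + Fs s U $ i)) + \<xi>"
    have "ip v v \<le> ip (u + \<xi>) (u + \<xi>) + \<tau> * (\<Sum>i\<in>UNIV. 2 * b $ i *
        (ip (U $ i) (Fs s U $ i) + ip (U $ i) (M (\<eta> i)) - ip (\<eta> i) (Fs s U $ i) - ip (U $ i) (M \<xi>) + ip (Fs s U $ i) \<xi>))"
      unfolding v_def by (rule energy_inequality[OF U' u pX D])
    also have "\<dots> \<le> ip (u + \<xi>) (u + \<xi>) + \<tau> * (\<Sum>i\<in>UNIV. 2 * b $ i * (5 * c6\<^sup>2) * m\<^sup>2)"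
      using t(1) by (intro add_left_mono mult_left_mono sum_mono summand) auto
    also have "\<dots> = ip (u + \<xi>) (u + \<xi>) + \<tau> * (c7 * m\<^sup>2)" by (simp add: c7_def sum_distrib_right)
    finally have "ip v v \<le> ip (u + \<xi>) (u + \<xi>) + \<tau> * (c7 * m\<^sup>2)" .
    moreover have "v \<in> X" unfolding v_def
      using u pX M_X[OF stage_eqD(1)[OF U]] eX by (intro X_intros)
    moreover have "u + \<xi> \<in> X" using u eX by (intro X_intros)
    ultimately show ?thesis unfolding m_def v_def \<xi>_def update_def noise_update_def by (simp add: nrm_square Fs_def)
  qed
  show ?thesis
  proof (rule that[of "c3 + c7"])
    show "c3 + c7 > 0" using c3 c7 by simp
    fix \<tau> z :: real and s :: "'s \<Rightarrow> real" and u and \<beta> :: "'s \<Rightarrow> 'h" and U :: "'h^'s" and i :: 's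
    assume d: "step_data \<tau>' \<tau> s u \<beta> z U"
    note d' = step_dataD(1)[OF d] step_dataD(11)[OF d] nrm_nonneg[OF step_dataD(5)[OF d]]
    have "c3 * (nrm u + z + \<tau>) \<le> (c3 + c7) * (nrm u + z + \<tau>)" using c7 d' by (intro mult_right_mono) auto
    then show "nrm (U $ i) \<le> (c3 + c7) * (nrm u + z + \<tau>)" using stage[OF d, of i] by simp
    have "\<tau> * (c7 * (1 + nrm u + z)\<^sup>2) \<le> \<tau> * ((c3 + c7) * (1 + nrm u + z)\<^sup>2)"
      using d' c3 by (intro mult_left_mono mult_right_mono) auto
    then show "(nrm (update \<tau> s u \<beta> U))\<^sup>2 \<le> (nrm (u + noise_update \<beta>))\<^sup>2 + \<tau> * ((c3 + c7) * (1 + nrm u + z)\<^sup>2)"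
      using energy[OF d] by linarith
  qed
qed

end

section \<open>Moment estimates\<close>

lemma exp_le_quadratic: "exp y \<le> 1 + y + y\<^sup>2 / 2 * exp \<bar>y\<bar>" for y :: real
proof -
  obtain t where t: "\<bar>t\<bar> \<le> \<bar>y\<bar>" "exp y = (\<Sum>m<2. y ^ m / fact m) + exp t / fact 2 * y ^ 2"
    using Maclaurin_exp_le[of y 2] by blast
  have "exp t * y\<^sup>2 \<le> exp \<bar>y\<bar> * y\<^sup>2" using t(1) by (intro mult_right_mono) auto
  then show ?thesis using t(2) by (simp add: numeral_2_eq_2 mult.commute)
qed

context hilbert_form
begin

text \<open>For \<open>nrm u > 4 * nrm x\<close> this is \<open>1 + y \<le> exp y\<close> applied to
  \<open>y = ((nrm (u + x))\<^sup>2 - (nrm u)\<^sup>2) / (nrm u)\<^sup>2\<close>; otherwise the last term dominates.\<close>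

lemma nrm_add_powr:
  assumes p: "p \<ge> 2"
  obtains C where "C \<ge> 0" "\<And>u x. u \<in> X \<Longrightarrow> x \<in> X \<Longrightarrow>
    nrm (u + x) powr p \<le> nrm u powr p + p * (nrm u powr (p - 2) * ip u x) + C * (nrm u powr (p - 2) * (nrm x)\<^sup>2 + nrm x powr p)"
proof -
  define q where "q = p / 2"
  have q: "q \<ge> 1" "p = 2 * q" using p by (auto simp: q_def)
  \<comment> \<open>\<open>C1\<close> serves the case \<open>nrm u \<le> 4 * nrm x\<close>: the
    power is at most \<open>(5 * nrm x) powr p\<close>, and the other summand absorbs a negative
    linear term. In \<open>C2\<close>, \<open>q\<close> stems from the square of
    \<open>nrm x\<close> in \<open>y\<close>, and \<open>3 * q\<^sup>2 * exp q\<close> from the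
    quadratic remainder, as \<open>y\<^sup>2 \<le> 6 * (d\<^sup>2 / r\<^sup>2)\<close>.\<close>
  define C1 where "C1 = 5 powr p + p * 4 powr (p - 1)"
  define C2 where "C2 = q + 3 * q\<^sup>2 * exp q"
  have "1 \<le> 5 powr p" using p by (intro ge_one_powr_ge_zero) auto
  moreover have "0 \<le> p * 4 powr (p - 1)" using p by simp
  ultimately have C: "C1 \<ge> 1" "C2 \<ge> 0" using q unfolding C1_def C2_def by (linarith, simp)
  have "nrm (u + x) powr p \<le> nrm u powr p + p * (nrm u powr (p - 2) * ip u x) + (C1 + C2) * (nrm u powr (p - 2) * (nrm x)\<^sup>2 + nrm x powr p)"
    if u: "u \<in> X" and x: "x \<in> X" for u x
  proof -
    define r where "r = nrm u"
    define d where "d = nrm x"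
    have r: "r \<ge> 0" and d: "d \<ge> 0" using nrm_nonneg u x by (auto simp: r_def d_def)
    have cs: "\<bar>ip u x\<bar> \<le> r * d" using Cauchy_Schwarz[OF u x] by (simp add: r_def d_def)
    have tri: "nrm (u + x) \<le> r + d" using nrm_triangle[OF u x] by (simp add: r_def d_def)
    have ux: "u + x \<in> X" using u x by (intro X_intros)
    have nonneg: "0 \<le> r powr (p - 2) * d\<^sup>2" by simp
    consider "r = 0" | "r > 0" "r \<le> 4 * d" | "r > 0" "4 * d < r" using r by linarith
    then have "nrm (u + x) powr p \<le> r powr p + p * (r powr (p - 2) * ip u x) + (C1 + C2) * (r powr (p - 2) * d\<^sup>2 + d powr p)"
    proof cases
      case 1
      then have "nrm (u + x) powr p \<le> d powr p" using tri nrm_nonneg[OF ux] p by (intro powr_mono2) auto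
      also have "\<dots> \<le> (C1 + C2) * d powr p" using C mult_right_mono[of 1 "C1 + C2" "d powr p"] by simp
      finally show ?thesis using 1 by simp
    next
      case 2
      have "nrm (u + x) powr p \<le> (5 * d) powr p" using tri nrm_nonneg[OF ux] p 2 by (intro powr_mono2) auto
      also have "\<dots> = 5 powr p * d powr p" using d by (simp add: powr_mult)
      finally have 1: "nrm (u + x) powr p \<le> 5 powr p * d powr p" .
      have "r powr (p - 2) * - ip u x \<le> r powr (p - 2) * (r * d)" using cs by (intro mult_left_mono) auto
      also have "\<dots> = r powr (p - 1) * d"
      proof -
        have "r powr (p - 1) = r powr (p - 2) * r powr 1" unfolding powr_add[symmetric] by simp
        then show ?thesis using 2 by simp
      qed
      also have "\<dots> \<le> (4 * d) powr (p - 1) * d" using 2 d p by (intro mult_right_mono powr_mono2) auto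
      also have "\<dots> = 4 powr (p - 1) * d powr p"
      proof -
        have "d > 0" using 2 by linarith
        then have "d powr p = d powr (p - 1) * d powr 1" unfolding powr_add[symmetric] by simp
        then show ?thesis using \<open>d > 0\<close> by (simp add: powr_mult)
      qed
      finally have "p * (r powr (p - 2) * - ip u x) \<le> p * (4 powr (p - 1) * d powr p)" using p by (intro mult_left_mono) auto
      then have "C1 * d powr p + p * (r powr (p - 2) * ip u x) \<ge> 5 powr p * d powr p"
        unfolding C1_def by (simp add: algebra_simps)
      moreover have "C1 * d powr p \<le> (C1 + C2) * (r powr (p - 2) * d\<^sup>2 + d powr p)"
        using C nonneg by (intro mult_mono) auto
      moreover have "0 \<le> r powr p" by simp
      ultimately show ?thesis using 1 by linarith
    next
      case 3
      define y where "y = (2 * ip u x + d\<^sup>2) / r\<^sup>2"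
      have N: "(nrm (u + x))\<^sup>2 = r\<^sup>2 * (1 + y)"
    proof -
      have "r\<^sup>2 * y = 2 * ip u x + d\<^sup>2" using 3 by (simp add: y_def)
      then have "r\<^sup>2 * (1 + y) = r\<^sup>2 + (2 * ip u x + d\<^sup>2)" unfolding distrib_left by simp
      then show ?thesis unfolding nrm_square[OF ux] r_def d_def nrm_square[OF u] nrm_square[OF x]
        by (simp add: ip_simps sym[of x u])
    qed
      have h: "\<bar>2 * ip u x + d\<^sup>2\<bar> \<le> 9 / 4 * (r * d)"
      proof -
        have "d * d \<le> d * (r / 4)" using 3 d by (intro mult_left_mono) auto
        then have "4 * d\<^sup>2 \<le> r * d" by (simp add: power2_eq_square algebra_simps)
        then show ?thesis using cs zero_le_power2[of d] unfolding abs_le_iff by linarith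
      qed
      have y1: "\<bar>y\<bar> \<le> 9 / 4 * (d / r)"
      proof -
        have "\<bar>y\<bar> = \<bar>2 * ip u x + d\<^sup>2\<bar> / r\<^sup>2" unfolding y_def by (simp add: abs_divide)
        also have "\<dots> \<le> (9 / 4 * (r * d)) / r\<^sup>2" using h by (intro divide_right_mono) auto
        finally show ?thesis using 3 by (simp add: power2_eq_square)
      qed
      have "d / r \<le> 1 / 4" using 3 by (simp add: field_simps)
      then have y2: "\<bar>y\<bar> \<le> 1" using y1 by simp
      have y3: "y\<^sup>2 \<le> 6 * (d\<^sup>2 / r\<^sup>2)"
      proof -
        have "\<bar>y\<bar>\<^sup>2 \<le> (9 / 4 * (d / r))\<^sup>2" using y1 by (intro power_mono) auto
        also have "\<dots> = 81 / 16 * (d\<^sup>2 / r\<^sup>2)" by (simp add: power_mult_distrib power_divide)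
        also have "\<dots> \<le> 6 * (d\<^sup>2 / r\<^sup>2)" by (intro mult_right_mono) auto
        finally show ?thesis by simp
      qed
      have rq: "(z\<^sup>2) powr q = z powr p" if "z \<ge> 0" for z :: real
        using that q by (cases "z = 0") (auto simp: powr_powr[symmetric])
      have "nrm (u + x) powr p = (r\<^sup>2 * (1 + y)) powr q" using rq[OF nrm_nonneg[OF ux]] N by simp
      also have "\<dots> = r powr p * (1 + y) powr q" using y2 rq[OF r] by (subst powr_mult) auto
      also have "\<dots> \<le> r powr p * exp (q * y)"
      proof (rule mult_left_mono)
        have "(1 + y) powr q \<le> exp y powr q" using y2 q by (intro powr_mono2) auto
        then show "(1 + y) powr q \<le> exp (q * y)" by (simp add: powr_def)
      qed simp
      also have "\<dots> \<le> r powr p * (1 + q * y + 3 * q\<^sup>2 * exp q * (d\<^sup>2 / r\<^sup>2))"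
      proof (rule mult_left_mono)
        have "exp (q * y) \<le> 1 + q * y + (q * y)\<^sup>2 / 2 * exp \<bar>q * y\<bar>" by (rule exp_le_quadratic)
        also have "(q * y)\<^sup>2 / 2 * exp \<bar>q * y\<bar> \<le> (q\<^sup>2 * (6 * (d\<^sup>2 / r\<^sup>2))) / 2 * exp q"
        proof (intro mult_mono divide_right_mono)
          show "(q * y)\<^sup>2 \<le> q\<^sup>2 * (6 * (d\<^sup>2 / r\<^sup>2))" unfolding power_mult_distrib using y3 by (intro mult_left_mono) auto
          have "\<bar>q * y\<bar> \<le> q * 1" unfolding abs_mult using q y2 by (intro mult_mono) auto
          then show "exp \<bar>q * y\<bar> \<le> exp q" by simp
        qed auto
        finally show "exp (q * y) \<le> 1 + q * y + 3 * q\<^sup>2 * exp q * (d\<^sup>2 / r\<^sup>2)" by (simp add: algebra_simps)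
      qed simp
      also have "\<dots> = r powr p + p * (r powr (p - 2) * ip u x) + C2 * (r powr (p - 2) * d\<^sup>2)"
      proof -
        have r2: "r powr p = r powr (p - 2) * r\<^sup>2"
        proof -
          have "r powr p = r powr (p - 2) * r powr 2" unfolding powr_add[symmetric] by simp
          then show ?thesis using 3 by (simp add: powr_numeral)
        qed
        have "r powr p * (1 + q * y + 3 * q\<^sup>2 * exp q * (d\<^sup>2 / r\<^sup>2))
            = r powr p + r powr (p - 2) * (q * (r\<^sup>2 * y) + 3 * q\<^sup>2 * exp q * (r\<^sup>2 * (d\<^sup>2 / r\<^sup>2)))"
          unfolding r2 by (simp add: algebra_simps)
        also have "r\<^sup>2 * y = 2 * ip u x + d\<^sup>2" using 3 by (simp add: y_def)
        also have "r\<^sup>2 * (d\<^sup>2 / r\<^sup>2) = d\<^sup>2" using 3 by simp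
        finally show ?thesis unfolding C2_def q(2) by (simp add: algebra_simps)
      qed
      also have "\<dots> \<le> r powr p + p * (r powr (p - 2) * ip u x) + (C1 + C2) * (r powr (p - 2) * d\<^sup>2 + d powr p)"
        using C by (intro add_left_mono mult_mono) auto
      finally show ?thesis .
    qed
    then show ?thesis by (simp add: r_def d_def)
  qed
  then show ?thesis using C by (intro that[of "C1 + C2"]) auto
qed

end

section \<open>Elementary inequalities for real powers\<close>

lemma powr_sum_le:
  fixes z :: "'i \<Rightarrow> real"
  assumes "finite I" "\<And>i. i \<in> I \<Longrightarrow> 0 \<le> z i" "p \<ge> 0"
  shows "(\<Sum>i\<in>I. z i) powr p \<le> real (card I) powr p * (\<Sum>i\<in>I. z i powr p)"
proof (cases "I = {}")
  case False
  define m where "m = Max (z ` I)"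
  have m: "\<And>i. i \<in> I \<Longrightarrow> z i \<le> m" and "m \<in> z ` I"
    unfolding m_def using assms(1) False by (auto intro: Max_in)
  then obtain k where k: "k \<in> I" "m = z k" by blast
  have "(\<Sum>i\<in>I. z i) \<le> real (card I) * m" using m sum_bounded_above[of I z m] by simp
  then have "(\<Sum>i\<in>I. z i) powr p \<le> (real (card I) * m) powr p"
    using assms by (intro powr_mono2 sum_nonneg) auto
  also have "\<dots> = real (card I) powr p * m powr p" using k assms(2) by (subst powr_mult) auto
  also have "m powr p \<le> (\<Sum>i\<in>I. z i powr p)" unfolding k(2) by (rule member_le_sum[OF k(1)]) (use assms in auto)
  finally show ?thesis by (simp add: mult_left_mono)
qed simp

lemma powr_add3_le:
  fixes x y z :: real
  assumes "0 \<le> x" "0 \<le> y" "0 \<le> z" "p \<ge> 0"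
  shows "(x + y + z) powr p \<le> 3 powr p * (x powr p + y powr p + z powr p)"
  using powr_sum_le[of "{0,1,2::nat}" "\<lambda>i. if i = 0 then x else if i = 1 then y else z" p] assms
  by (simp add: add.assoc)

text \<open>Convexity with weights \<open>1 / (1 + \<tau>)\<close> and
  \<open>\<tau> / (1 + \<tau>)\<close>. The loss is
  \<open>(1 + \<tau>) powr q \<le> exp (q * \<tau>)\<close>, which over all steps multiplies up to
  \<open>exp (q * T)\<close>.\<close>

lemma powr_convex_combination:
  fixes x y \<tau> :: real
  assumes "0 \<le> x" "0 \<le> y" "0 < \<tau>" "q \<ge> 1"
  shows "(x + \<tau> * y) powr q \<le> exp (q * \<tau>) * (x powr q + \<tau> * y powr q)"
proof -
  define t where "t = \<tau> / (1 + \<tau>)"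
  have t: "0 \<le> t" "t \<le> 1" "1 - t = 1 / (1 + \<tau>)" using assms by (auto simp: t_def field_simps)
  have "(1 + \<tau>) * (1 - t) = 1" "(1 + \<tau>) * t = \<tau>" using assms t(3) by (auto simp: t_def)
  then have eq: "x + \<tau> * y = (1 + \<tau>) * ((1 - t) * x + t * y)"
    by (simp add: distrib_left mult.assoc[symmetric])
  have "((1 - t) * x + t * y) powr q \<le> (1 - t) * x powr q + t * y powr q"
    using convex_onD[OF powr_convex_nonneg[OF assms(4)], of t x y] t assms by simp
  then have "(1 + \<tau>) powr q * ((1 - t) * x + t * y) powr q \<le> (1 + \<tau>) powr q * ((1 - t) * x powr q + t * y powr q)"
    by (intro mult_left_mono) auto
  also have "(1 - t) * x powr q + t * y powr q = (x powr q + \<tau> * y powr q) / (1 + \<tau>)"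
    unfolding t(3) unfolding t_def by (simp add: add_divide_distrib)
  also have "\<dots> \<le> x powr q + \<tau> * y powr q"
  proof -
    have "(x powr q + \<tau> * y powr q) / (1 + \<tau>) \<le> (x powr q + \<tau> * y powr q) / 1"
      using assms by (intro divide_left_mono) auto
    then show ?thesis by simp
  qed
  also have "(1 + \<tau>) powr q * (x powr q + \<tau> * y powr q) \<le> exp (q * \<tau>) * (x powr q + \<tau> * y powr q)"
  proof (rule mult_right_mono)
    have "(1 + \<tau>) powr q \<le> exp \<tau> powr q" using assms by (intro powr_mono2) auto
    then show "(1 + \<tau>) powr q \<le> exp (q * \<tau>)" by (simp add: powr_def)
  qed (use assms in auto)
  finally have "(1 + \<tau>) powr q * ((1 - t) * x + t * y) powr q \<le> exp (q * \<tau>) * (x powr q + \<tau> * y powr q)"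
    by (simp add: mult_left_mono)
  then show ?thesis unfolding eq using t assms by (subst powr_mult) auto
qed

text \<open>The scale is \<open>sqrt \<tau>\<close>, the size of an increment: with
  \<open>e = d / sqrt \<tau>\<close> the left side is \<open>\<tau>\<close> times a product that the
  larger of \<open>r\<close> and \<open>e\<close> dominates.\<close>

lemma powr_young:
  fixes r d \<tau> :: real
  assumes "0 \<le> r" "0 \<le> d" "\<tau> > 0" "p \<ge> 2"
  shows "r powr (p - 2) * d\<^sup>2 \<le> \<tau> * r powr p + \<tau> * \<tau> powr (- (p / 2)) * d powr p"
proof -
  define e where "e = d / sqrt \<tau>"
  have e: "e \<ge> 0" "d\<^sup>2 = \<tau> * e\<^sup>2" using assms by (auto simp: e_def power_divide)
  have ep: "e powr p = \<tau> powr (- (p / 2)) * d powr p"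
  proof -
    have "sqrt \<tau> powr p = \<tau> powr (p / 2)" using assms by (simp add: powr_half_sqrt[symmetric] powr_powr)
    then show ?thesis using assms by (simp add: e_def powr_divide powr_minus field_simps)
  qed
  define w where "w = max r e"
  have w: "w \<ge> 0" "r \<le> w" "e \<le> w" "w powr p \<le> r powr p + e powr p"
    using assms e by (auto simp: w_def max_def)
  have "r powr (p - 2) * e\<^sup>2 \<le> w powr (p - 2) * w\<^sup>2"
    using assms e w by (intro mult_mono powr_mono2 power_mono) auto
  also have "\<dots> = w powr p"
  proof (cases "w = 0")
    case False
    then have "w\<^sup>2 = w powr 2" using w by (simp add: powr_numeral)
    then show ?thesis by (simp add: powr_add[symmetric])
  qed (use assms in auto)
  also note w(4)
  finally have "\<tau> * (r powr (p - 2) * e\<^sup>2) \<le> \<tau> * (r powr p + e powr p)" using assms by (intro mult_left_mono) auto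
  then show ?thesis unfolding e(2) ep by (simp add: algebra_simps)
qed

lemma (in hilbert_form) nrm_measurable: "nrm \<in> borel_measurable borel"
  unfolding nrm_def
  by (intro borel_measurable_continuous_onI continuous_intros ip.continuous_on)

text \<open>Supplies integrable majorants for the mixed term.\<close>

lemma powr_product_le:
  fixes r g :: real
  assumes "0 \<le> r" "0 \<le> g" "p \<ge> 2"
  shows "r powr (p - 2) * r * g \<le> r powr p + g powr p"
proof -
  define a where "a = max r g"
  have a: "0 \<le> a" "r \<le> a" "g \<le> a" "a powr p \<le> r powr p + g powr p" using assms by (auto simp: a_def max_def)
  have "r powr (p - 2) * r * g \<le> a powr (p - 2) * a * a" using assms a by (intro mult_mono powr_mono2) auto
  also have "\<dots> = a powr p"
  proof (cases "a = 0")
    case False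
    have "a powr p = a powr (p - 2) * a powr 2" unfolding powr_add[symmetric] by simp
    then show ?thesis using False a by (simp add: power2_eq_square)
  qed (use assms in auto)
  finally show ?thesis using a(4) by simp
qed

section \<open>One step of the moment recursion\<close>

context rk_drift
begin

text \<open>The mixed term with \<open>ip u (noise_update \<beta>)\<close> is carried along exactly,
  as only its expectation vanishes. One \<open>D\<close> serves all step data, hence all probability
  spaces.\<close>

definition step_bound :: "real \<Rightarrow> real \<Rightarrow> real \<Rightarrow> bool" where
  "step_bound p \<tau>' D \<longleftrightarrow> D > 0 \<and> (\<forall>\<tau> s u \<beta> z U. step_data \<tau>' \<tau> s u \<beta> z U \<longrightarrow>
     nrm (update \<tau> s u \<beta> U) powr p \<le> exp (p / 2 * \<tau>) * (nrm u powr p + p * (nrm u powr (p - 2) * ip u (noise_update \<beta>))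
       + D * \<tau> * (nrm u powr p + 1 + \<tau> powr - (p / 2) * z powr p)) \<and>
     (\<forall>i. nrm (U $ i) powr p \<le> D * (nrm u powr p + \<tau> + z powr p)))"

lemma step_bound_pos: "step_bound p \<tau>' D \<Longrightarrow> D > 0"
  by (simp add: step_bound_def)

text \<open>\<open>powr_convex_combination\<close> raises the energy estimate of
  \<open>step_estimates\<close> to the power \<open>p / 2\<close>; the leading term is then expanded
  by \<open>nrm_add_powr\<close>, and \<open>powr_young\<close> treats its second order
  part.\<close>

lemma step_bound_exists:
  assumes C: "stage_constants \<tau>' C" and p: "p \<ge> 2"
  shows "\<exists>D. step_bound p \<tau>' D"
proof -
  obtain C2 where C2: "C2 > 0"
    "\<And>\<tau> s u \<beta> z U i. step_data \<tau>' \<tau> s u \<beta> z U \<Longrightarrow> nrm (U $ i) \<le> C2 * (nrm u + z + \<tau>)"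
    "\<And>\<tau> s u \<beta> z U. step_data \<tau>' \<tau> s u \<beta> z U \<Longrightarrow>
       (nrm (update \<tau> s u \<beta> U))\<^sup>2 \<le> (nrm (u + noise_update \<beta>))\<^sup>2 + \<tau> * (C2 * (1 + nrm u + z)\<^sup>2)"
  proof (rule step_estimates[OF C], goal_cases)
    case (1 C2)
    show ?case by (rule 1(1)[OF 1(2-4)])
  qed
  obtain C3 where C3: "C3 \<ge> 0" "\<And>u x. u \<in> X \<Longrightarrow> x \<in> X \<Longrightarrow>
    nrm (u + x) powr p \<le> nrm u powr p + p * (nrm u powr (p - 2) * ip u x) + C3 * (nrm u powr (p - 2) * (nrm x)\<^sup>2 + nrm x powr p)"
    by (rule nrm_add_powr[OF p], rule that)
  define q where "q = p / 2"
  have q: "q \<ge> 1" "p = 2 * q" using p by (auto simp: q_def)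
  define bb where "bb = 1 + (\<Sum>j\<in>UNIV. \<bar>bt $ j\<bar>)"
  have bb: "bb \<ge> 1" unfolding bb_def by (auto intro!: sum_nonneg)
  define C4 where "C4 = C2 powr q * 3 powr p"
  have C4: "C4 \<ge> 0" by (simp add: C4_def)
  define c1 where "c1 = C3 + C4"
  define c2 where "c2 = C3 * bb powr p * (1 + T powr (q - 1)) + C4 * T powr q"
  have T0: "T > 0" by (rule T)
  have c2: "c2 \<ge> 0" unfolding c2_def using C3(1) C4 T0 by simp
  define c5 where "c5 = C2 powr p * 3 powr p * (1 + T powr (p - 1))"
  have c5: "c5 \<ge> 0" unfolding c5_def by simp
  define D where "D = 1 + c1 + c2 + c5"
  have D: "D > 0" "c1 \<le> D" "c2 \<le> D" "c5 \<le> D" unfolding D_def using C3(1) C4 c2 c5 by (auto simp: c1_def)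
  have main: "nrm (update \<tau> s u \<beta> U) powr p \<le> exp (p / 2 * \<tau>) * (nrm u powr p + p * (nrm u powr (p - 2) * ip u (noise_update \<beta>))
            + D * \<tau> * (nrm u powr p + 1 + \<tau> powr - (p / 2) * z powr p)) \<and>
        (\<forall>i. nrm (U $ i) powr p \<le> D * (nrm u powr p + \<tau> + z powr p))"
    if d: "step_data \<tau>' \<tau> s u \<beta> z U" for \<tau> s u \<beta> z U
  proof
    note t = step_dataD(1-3)[OF d] and s = step_dataD(4)[OF d] and u = step_dataD(5)[OF d]
      and \<beta> = step_dataD(6-8)[OF d] and U = step_dataD(9)[OF d] and \<beta>X = step_dataD(10)[OF d] and z = step_dataD(11)[OF d]
    define r where "r = nrm u"
    define \<xi> where "\<xi> = noise_update \<beta>"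
    define v where "v = update \<tau> s u \<beta> U"
    have r: "r \<ge> 0" unfolding r_def by (rule nrm_nonneg[OF u])
    have \<xi>: "\<xi> \<in> X" unfolding \<xi>_def noise_update_def by (intro X_intros \<beta>X)
    have n\<xi>: "nrm \<xi> \<le> bb * z"
    proof -
      have "nrm \<xi> \<le> (\<Sum>j\<in>UNIV. \<bar>bt $ j\<bar>) * z" unfolding \<xi>_def noise_update_def by (intro nrm_combination \<beta>X \<beta>)
      also have "\<dots> \<le> bb * z" unfolding bb_def using z by (intro mult_right_mono) auto
      finally show ?thesis .
    qed
    have UX: "U $ i \<in> X" for i using stage_X[OF U] by simp
    have FX: "F (s i) (U $ i) \<in> X" for i by (rule F_X[OF s UX])
    have vX: "v \<in> X" unfolding v_def update_def \<xi>_def[symmetric]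
      by (intro X_intros u \<xi> M_X[OF stage_eqD(1)[OF U]] FX)
    have rq: "(x\<^sup>2) powr q = x powr p" if "x \<ge> 0" for x :: real
      using that q by (cases "x = 0") (auto simp: powr_powr[symmetric])
    \<comment> \<open>The noise rescaled to order one in the mean: in the application
      \<open>z powr p\<close> has a mean of order \<open>\<tau> powr q\<close>.\<close>
    define h where "h = \<tau> powr - q * z powr p"
    have h: "h \<ge> 0" by (simp add: h_def)
    have zp: "z powr p = \<tau> powr q * h" unfolding h_def using t(1) by (simp add: powr_minus)
    \<comment> \<open>Since \<open>q \<ge> 1\<close>, one factor \<open>\<tau>\<close> can be split
      off, the remaining power being bounded through \<open>\<tau> \<le> T\<close>.\<close>
    have tq: "\<tau> powr q \<le> \<tau> * T powr (q - 1)"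
    proof -
      have "\<tau> powr q = \<tau> powr 1 * \<tau> powr (q - 1)" unfolding powr_add[symmetric] by simp
      also have "\<dots> \<le> \<tau> * T powr (q - 1)" using t q by (auto intro!: mult_left_mono powr_mono2)
      finally show ?thesis .
    qed
    have tq': "\<tau> powr q \<le> T powr q" using t q by (intro powr_mono2) auto
    have 1: "nrm v powr p \<le> exp (q * \<tau>) * (nrm (u + \<xi>) powr p + \<tau> * (C2 * (1 + r + z)\<^sup>2) powr q)"
    proof -
      have "(nrm v)\<^sup>2 \<le> (nrm (u + \<xi>))\<^sup>2 + \<tau> * (C2 * (1 + r + z)\<^sup>2)"
        unfolding v_def \<xi>_def r_def by (rule C2(3)[OF d])
      then have "((nrm v)\<^sup>2) powr q \<le> ((nrm (u + \<xi>))\<^sup>2 + \<tau> * (C2 * (1 + r + z)\<^sup>2)) powr q"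
        using q by (intro powr_mono2) auto
      also have "\<dots> \<le> exp (q * \<tau>) * (((nrm (u + \<xi>))\<^sup>2) powr q + \<tau> * (C2 * (1 + r + z)\<^sup>2) powr q)"
        using C2(1) t q by (intro powr_convex_combination) auto
      finally show ?thesis
        unfolding rq[OF nrm_nonneg[OF vX]] rq[OF nrm_nonneg[OF X_intros(1)[OF u \<xi>]]] .
    qed
    have 2: "(C2 * (1 + r + z)\<^sup>2) powr q \<le> C4 * (1 + r powr p + T powr q * h)"
    proof -
      have "(C2 * (1 + r + z)\<^sup>2) powr q = C2 powr q * (1 + r + z) powr p"
        using C2(1) r z rq[of "1 + r + z"] by (subst powr_mult) auto
      also have "\<dots> \<le> C2 powr q * (3 powr p * (1 powr p + r powr p + z powr p))"
        using r z p by (intro mult_left_mono powr_add3_le) auto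
      also have "\<dots> \<le> C2 powr q * (3 powr p * (1 + r powr p + T powr q * h))"
        unfolding zp using tq' h by (intro mult_left_mono add_mono mult_right_mono) auto
      finally show ?thesis by (simp add: C4_def mult.assoc)
    qed
    have 3: "nrm (u + \<xi>) powr p \<le> r powr p + p * (r powr (p - 2) * ip u \<xi>) + C3 * (\<tau> * r powr p + \<tau> * (bb powr p * (1 + T powr (q - 1)) * h))"
    proof -
      have b1: "(nrm \<xi>) powr p \<le> bb powr p * z powr p"
      proof -
        have "(nrm \<xi>) powr p \<le> (bb * z) powr p" using n\<xi> nrm_nonneg[OF \<xi>] p by (intro powr_mono2) auto
        then show ?thesis using bb z by (simp add: powr_mult)
      qed
      have "r powr (p - 2) * (nrm \<xi>)\<^sup>2 \<le> \<tau> * r powr p + \<tau> * \<tau> powr (- (p / 2)) * nrm \<xi> powr p"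
        by (rule powr_young[OF r nrm_nonneg[OF \<xi>] t(1) p])
      also have "\<dots> \<le> \<tau> * r powr p + \<tau> * \<tau> powr (- (p / 2)) * (bb powr p * z powr p)"
        using b1 t(1) by (intro add_left_mono mult_left_mono) auto
      also have "\<dots> = \<tau> * r powr p + \<tau> * (bb powr p * h)" by (simp add: h_def q_def)
      finally have b2: "r powr (p - 2) * (nrm \<xi>)\<^sup>2 \<le> \<tau> * r powr p + \<tau> * (bb powr p * h)" .
      have "bb powr p * z powr p \<le> bb powr p * (\<tau> * T powr (q - 1) * h)"
        unfolding zp using tq h by (intro mult_left_mono mult_right_mono) auto
      then have "r powr (p - 2) * (nrm \<xi>)\<^sup>2 + nrm \<xi> powr p \<le> \<tau> * r powr p + \<tau> * (bb powr p * h) + bb powr p * (\<tau> * T powr (q - 1) * h)"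
        using b1 b2 by linarith
      also have "\<dots> = \<tau> * r powr p + \<tau> * (bb powr p * (1 + T powr (q - 1)) * h)" by (simp add: algebra_simps)
      finally show ?thesis
        using C3(2)[OF u \<xi>] mult_left_mono[of _ _ C3] C3(1) unfolding r_def by (smt (verit))
    qed
    have "nrm (u + \<xi>) powr p + \<tau> * (C2 * (1 + r + z)\<^sup>2) powr q
        \<le> (r powr p + p * (r powr (p - 2) * ip u \<xi>) + C3 * (\<tau> * r powr p + \<tau> * (bb powr p * (1 + T powr (q - 1)) * h)))
          + \<tau> * (C4 * (1 + r powr p + T powr q * h))"
      using 2 3 t(1) by (intro add_mono mult_left_mono) auto
    also have "\<dots> = r powr p + p * (r powr (p - 2) * ip u \<xi>) + \<tau> * (c1 * r powr p + C4 * 1 + c2 * h)"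
      by (simp add: c1_def c2_def algebra_simps)
    also have "\<dots> \<le> r powr p + p * (r powr (p - 2) * ip u \<xi>) + \<tau> * (D * r powr p + D * 1 + D * h)"
    proof -
      have "C4 \<le> D" using D(2) C3(1) by (simp add: c1_def)
      then show ?thesis using t(1) D h by (intro add_left_mono mult_left_mono add_mono mult_right_mono) auto
    qed
    finally have "nrm (u + \<xi>) powr p + \<tau> * (C2 * (1 + r + z)\<^sup>2) powr q
        \<le> r powr p + p * (r powr (p - 2) * ip u \<xi>) + D * \<tau> * (r powr p + 1 + h)" by (simp add: algebra_simps)
    from order_trans[OF 1 mult_left_mono[OF this]]
    show "nrm (update \<tau> s u \<beta> U) powr p \<le> exp (p / 2 * \<tau>) * (nrm u powr p + p * (nrm u powr (p - 2) * ip u (noise_update \<beta>))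
            + D * \<tau> * (nrm u powr p + 1 + \<tau> powr - (p / 2) * z powr p))"
      unfolding v_def r_def \<xi>_def h_def q_def by simp
    show "\<forall>i. nrm (U $ i) powr p \<le> D * (nrm u powr p + \<tau> + z powr p)"
    proof
      fix i
      have "nrm (U $ i) powr p \<le> (C2 * (r + z + \<tau>)) powr p"
        unfolding r_def using C2(2)[OF d] nrm_nonneg[OF UX] p by (intro powr_mono2) auto
      also have "\<dots> = C2 powr p * (r + z + \<tau>) powr p" using C2(1) r z t(1) by (simp add: powr_mult)
      also have "\<dots> \<le> C2 powr p * (3 powr p * (r powr p + z powr p + \<tau> powr p))"
        using r z t p by (intro mult_left_mono powr_add3_le) auto
      also have "\<dots> \<le> C2 powr p * (3 powr p * ((1 + T powr (p - 1)) * (r powr p + \<tau> + z powr p)))"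
      proof (intro mult_left_mono)
        have "\<tau> powr p = \<tau> powr 1 * \<tau> powr (p - 1)" unfolding powr_add[symmetric] by simp
        also have "\<dots> \<le> \<tau> * T powr (p - 1)" using t p by (auto intro!: mult_left_mono powr_mono2)
        finally have "\<tau> powr p \<le> T powr (p - 1) * \<tau>" by (simp add: mult.commute)
        moreover have "0 \<le> T powr (p - 1) * (r powr p)" "0 \<le> T powr (p - 1) * (z powr p)" by simp_all
        ultimately show "r powr p + z powr p + \<tau> powr p \<le> (1 + T powr (p - 1)) * (r powr p + \<tau> + z powr p)"
          using t(1) unfolding distrib_left distrib_right by linarith
      qed auto
      also have "\<dots> = c5 * (r powr p + \<tau> + z powr p)" by (simp add: c5_def mult.assoc)
      also have "\<dots> \<le> D * (r powr p + \<tau> + z powr p)" using D(4) t(1) by (intro mult_right_mono) auto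
      finally show "nrm (U $ i) powr p \<le> D * (nrm u powr p + \<tau> + z powr p)" by (simp add: r_def)
    qed
  qed
  have "step_bound p \<tau>' D"
    unfolding step_bound_def by (intro conjI[OF D(1)] allI impI) (rule main)
  then show ?thesis by blast
qed

text \<open>Bounds the moment of the summed noise of all nodes after division by
  \<open>\<tau> powr (p / 2)\<close>: the factors with the number of stages come from
  \<open>powr_sum_le\<close> and from counting summands, the rest from
  \<open>hilbert_schmidt_noise\<close>.\<close>

definition noise_const :: "real \<Rightarrow> real \<Rightarrow> real" where
  "noise_const p K = real CARD('s) powr p * (real CARD('s) * (2 * gauss_moment p * K powr p))"

lemma noise_const_nonneg: "0 \<le> noise_const p K"
  by (simp add: noise_const_def gauss_moment_nonneg)

text \<open>Integration of \<open>step_bound\<close>. The mixed term has mean zero and the noise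
  moment cancels the weight \<open>\<tau> powr - (p / 2)\<close>, so one step costs a factor
  \<open>exp ((p / 2 + D) * \<tau>)\<close> and an addition of order \<open>\<tau>\<close>.\<close>

lemma moment_step:
  fixes P :: "'w measure" and S :: "'u::{real_inner,banach,second_countable_topology} set"
    and B :: "'s \<Rightarrow> 'u \<Rightarrow> 'h" and U :: "'w \<Rightarrow> 'h^'s"
  defines "hnorm \<equiv> (\<lambda>x. sqrt (ip x x + ip (M x) (M x)))"
  assumes D: "step_bound p \<tau>' D" and p: "p \<ge> 2" and t: "0 < \<tau>" "\<tau> \<le> \<tau>'" "\<tau> \<le> T" and s: "\<And>i. s i \<in> {0..T}"
    and gv: "gaussian_vector P S Q \<tau> G"
    and Fm: "subalgebra P Fm" "prob_space.indep_set P (sets Fm) (sets (vimage_algebra (space P) G borel))"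
    and B: "\<And>j. linear_on S (B j)" "\<And>j x. x \<in> S \<Longrightarrow> B j x \<in> X" "\<And>j x. x \<in> S \<Longrightarrow> norm (B j x) \<le> KB * norm x"
    and HS: "\<And>j. hilbert_schmidt (cameron_martin S Q) (inner_cm S Q) DM hnorm (B j)"
      "\<And>j. hs_norm (cameron_martin S Q) (inner_cm S Q) hnorm (B j) \<le> K"
    and u: "u \<in> borel_measurable Fm" "\<And>\<omega>. \<omega> \<in> space P \<Longrightarrow> u \<omega> \<in> X"
    and m: "(\<integral>\<^sup>+\<omega>. ennreal (nrm (u \<omega>) powr p) \<partial>P) = ennreal m" "m \<ge> 0"
    and U: "AE \<omega> in P. stage_eq \<tau> (noise_stage (u \<omega>) (\<lambda>j. B j (G \<omega>))) (Fs s (U \<omega>)) (U \<omega>)"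
    and v: "AE \<omega> in P. v \<omega> = update \<tau> s (u \<omega>) (\<lambda>j. B j (G \<omega>)) (U \<omega>)"
  shows "(\<integral>\<^sup>+\<omega>. ennreal (nrm (v \<omega>) powr p) \<partial>P) \<le> ennreal (exp ((p / 2 + D) * \<tau>) * (m + D * (1 + noise_const p K) * \<tau>))"
    and "(\<integral>\<^sup>+\<omega>. ennreal (nrm (U \<omega> $ i) powr p) \<partial>P) \<le> ennreal (D * (1 + noise_const p K * T powr (p / 2 - 1)) * (m + \<tau>))"
proof -
  interpret gv: gaussian_vector P S Q \<tau> G by (rule gv)
  note D0 = step_bound_pos[OF D]
  define n where "n = real CARD('s)"
  define N where "N = noise_const p K"
  have N: "N \<ge> 0" by (simp add: N_def noise_const_nonneg)
  have hs0: "0 \<le> hs_norm (cameron_martin S Q) (inner_cm S Q) hnorm (B j)" for j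
    unfolding hs_norm_def by (intro real_sqrt_ge_zero infsum_nonneg) simp
  have "\<exists>\<zeta>. \<zeta> \<in> borel_measurable P \<and> (\<forall>\<omega>. 0 \<le> \<zeta> \<omega>) \<and>
     (AE \<omega> in P. B j (G \<omega>) \<in> DM \<and> nrm (B j (G \<omega>)) \<le> \<zeta> \<omega> \<and> nrm (M (B j (G \<omega>))) \<le> \<zeta> \<omega>) \<and>
     (\<integral>\<^sup>+\<omega>. ennreal (\<zeta> \<omega> powr p) \<partial>P) \<le> ennreal (2 * gauss_moment p * (sqrt \<tau> * K) powr p)" for j
  proof (rule gv.hilbert_schmidt_noise[OF skew_adjoint_axioms p B(1)[of j] B(2)[of _ j] B(3)[of _ j] HS(1)[of j, unfolded hnorm_def]], goal_cases)
    case (3 \<zeta>)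
    have "ennreal (2 * gauss_moment p * (sqrt \<tau> * hs_norm (cameron_martin S Q) (inner_cm S Q) hnorm (B j)) powr p)
        \<le> ennreal (2 * gauss_moment p * (sqrt \<tau> * K) powr p)"
      using HS(2)[of j] hs0[of j] p t(1) gauss_moment_nonneg by (intro ennreal_leI mult_left_mono powr_mono2) auto
    with 3 show ?case by (intro exI[of _ \<zeta>]) (auto simp: hnorm_def)
  qed
  then have "\<forall>j. \<exists>\<zeta>. \<zeta> \<in> borel_measurable P \<and> (\<forall>\<omega>. 0 \<le> \<zeta> \<omega>) \<and>
     (AE \<omega> in P. B j (G \<omega>) \<in> DM \<and> nrm (B j (G \<omega>)) \<le> \<zeta> \<omega> \<and> nrm (M (B j (G \<omega>))) \<le> \<zeta> \<omega>) \<and>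
     (\<integral>\<^sup>+\<omega>. ennreal (\<zeta> \<omega> powr p) \<partial>P) \<le> ennreal (2 * gauss_moment p * (sqrt \<tau> * K) powr p)" by blast
  from choice[OF this] obtain \<zeta> where \<zeta>: "\<And>j. \<zeta> j \<in> borel_measurable P" "\<And>j \<omega>. 0 \<le> \<zeta> j \<omega>"
    "\<And>j. AE \<omega> in P. B j (G \<omega>) \<in> DM \<and> nrm (B j (G \<omega>)) \<le> \<zeta> j \<omega> \<and> nrm (M (B j (G \<omega>))) \<le> \<zeta> j \<omega>"
    "\<And>j. (\<integral>\<^sup>+\<omega>. ennreal (\<zeta> j \<omega> powr p) \<partial>P) \<le> ennreal (2 * gauss_moment p * (sqrt \<tau> * K) powr p)"
    by blast
  \<comment> \<open>The sum dominates the noise at every node and keeps a moment of order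
    \<open>\<tau> powr (p / 2)\<close>.\<close>
  define z where "z \<omega> = (\<Sum>j\<in>UNIV. \<zeta> j \<omega>)" for \<omega>
  have zm [measurable]: "z \<in> borel_measurable P" unfolding z_def using \<zeta>(1) by measurable
  have z0: "0 \<le> z \<omega>" for \<omega> unfolding z_def using \<zeta>(2) by (intro sum_nonneg) auto
  have \<zeta>z: "\<zeta> j \<omega> \<le> z \<omega>" for j \<omega> unfolding z_def using \<zeta>(2) by (intro member_le_sum) auto
  have "AE \<omega> in P. \<forall>j. B j (G \<omega>) \<in> DM \<and> nrm (B j (G \<omega>)) \<le> \<zeta> j \<omega> \<and> nrm (M (B j (G \<omega>))) \<le> \<zeta> j \<omega>"
    using \<zeta>(3) by (subst AE_all_countable) auto
  then have zAE: "AE \<omega> in P. \<forall>j. B j (G \<omega>) \<in> DM \<and> nrm (B j (G \<omega>)) \<le> z \<omega> \<and> nrm (M (B j (G \<omega>))) \<le> z \<omega>"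
    by eventually_elim (use \<zeta>z order_trans in blast)
  have zp: "(\<integral>\<^sup>+\<omega>. ennreal (z \<omega> powr p) \<partial>P) \<le> ennreal (\<tau> powr (p / 2) * N)"
  proof -
    have "(\<integral>\<^sup>+\<omega>. ennreal (z \<omega> powr p) \<partial>P) \<le> (\<integral>\<^sup>+\<omega>. ennreal (n powr p) * (\<Sum>j\<in>UNIV. ennreal (\<zeta> j \<omega> powr p)) \<partial>P)"
    proof (rule nn_integral_mono)
      fix \<omega>
      have "z \<omega> powr p \<le> n powr p * (\<Sum>j\<in>UNIV. \<zeta> j \<omega> powr p)"
        unfolding z_def n_def using powr_sum_le[of UNIV "\<lambda>j. \<zeta> j \<omega>" p] \<zeta>(2) p by simp
      then show "ennreal (z \<omega> powr p) \<le> ennreal (n powr p) * (\<Sum>j\<in>UNIV. ennreal (\<zeta> j \<omega> powr p))"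
        by (simp add: sum_ennreal ennreal_mult[symmetric] sum_nonneg ennreal_leI)
    qed
    also have "\<dots> = ennreal (n powr p) * (\<Sum>j\<in>UNIV. \<integral>\<^sup>+\<omega>. ennreal (\<zeta> j \<omega> powr p) \<partial>P)"
      using \<zeta>(1) by (subst nn_integral_cmult, simp del: sum_ennreal, subst nn_integral_sum) (auto simp del: sum_ennreal)
    also have "\<dots> \<le> ennreal (n powr p) * (\<Sum>j\<in>(UNIV::'s set). ennreal (2 * gauss_moment p * (sqrt \<tau> * K) powr p))"
      by (intro mult_left_mono sum_mono \<zeta>(4)) auto
    also have "\<dots> = ennreal (n powr p * (n * (2 * gauss_moment p * (sqrt \<tau> * K) powr p)))"
      using gauss_moment_nonneg[of p] by (simp add: n_def ennreal_mult ennreal_of_nat_eq_real_of_nat)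
    also have "(sqrt \<tau> * K) powr p = \<tau> powr (p / 2) * K powr p"
    proof -
      have "K \<ge> 0" using hs0 HS(2) order_trans by blast
      moreover have "sqrt \<tau> powr p = \<tau> powr (p / 2)" using t(1) by (simp add: powr_half_sqrt[symmetric] powr_powr)
      ultimately show ?thesis using t(1) by (simp add: powr_mult)
    qed
    finally show ?thesis by (simp add: N_def noise_const_def n_def mult_ac)
  qed
  have um [measurable]: "u \<in> borel_measurable P" by (rule measurable_from_subalg[OF Fm(1) u(1)])
  have nu [measurable]: "(\<lambda>\<omega>. nrm (u \<omega>)) \<in> borel_measurable P" "(\<lambda>\<omega>. nrm (u \<omega>)) \<in> borel_measurable Fm"
    using measurable_compose[OF um nrm_measurable] measurable_compose[OF u(1) nrm_measurable] by auto
  have r0: "0 \<le> nrm (u \<omega>)" if "\<omega> \<in> space P" for \<omega> by (rule nrm_nonneg[OF u(2)[OF that]])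
  have iu: "integrable P (\<lambda>\<omega>. nrm (u \<omega>) powr p)"
    by (rule integrableI_nn_integral_finite[OF _ _ m(1)]) auto
  have eu: "gv.expectation (\<lambda>\<omega>. nrm (u \<omega>) powr p) = m"
    by (subst integral_eq_nn_integral) (auto simp: m)
  have dAE: "AE \<omega> in P. step_data \<tau>' \<tau> s (u \<omega>) (\<lambda>j. B j (G \<omega>)) (z \<omega>) (U \<omega>)"
    using U zAE AE_space unfolding step_data_def by eventually_elim (intro conjI allI t s u(2); blast)
  note bound = D[unfolded step_bound_def, THEN conjunct2, rule_format]
  have stAE: "AE \<omega> in P. \<forall>i. nrm (U \<omega> $ i) powr p \<le> D * (nrm (u \<omega>) powr p + \<tau> + z \<omega> powr p)"
    using dAE by eventually_elim (rule bound[THEN conjunct2])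
  have vAE: "AE \<omega> in P. nrm (v \<omega>) powr p \<le> exp (p / 2 * \<tau>) * (nrm (u \<omega>) powr p
      + p * (nrm (u \<omega>) powr (p - 2) * ip (u \<omega>) (noise_update (\<lambda>j. B j (G \<omega>))))
      + D * \<tau> * (nrm (u \<omega>) powr p + 1 + \<tau> powr - (p / 2) * z \<omega> powr p))"
    using v dAE by eventually_elim (simp only:, rule bound[THEN conjunct1])
  show "(\<integral>\<^sup>+\<omega>. ennreal (nrm (U \<omega> $ i) powr p) \<partial>P) \<le> ennreal (D * (1 + noise_const p K * T powr (p / 2 - 1)) * (m + \<tau>))"
  proof -
    have "(\<integral>\<^sup>+\<omega>. ennreal (nrm (U \<omega> $ i) powr p) \<partial>P)
        \<le> (\<integral>\<^sup>+\<omega>. ennreal D * (ennreal (nrm (u \<omega>) powr p) + ennreal \<tau> + ennreal (z \<omega> powr p)) \<partial>P)"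
    proof (rule nn_integral_mono_AE)
      show "AE \<omega> in P. ennreal (nrm (U \<omega> $ i) powr p) \<le> ennreal D * (ennreal (nrm (u \<omega>) powr p) + ennreal \<tau> + ennreal (z \<omega> powr p))"
        using stAE
      proof eventually_elim
        case (elim \<omega>)
        then have "ennreal (nrm (U \<omega> $ i) powr p) \<le> ennreal (D * (nrm (u \<omega>) powr p + \<tau> + z \<omega> powr p))"
          by (intro ennreal_leI) blast
        then show ?case using D0 t(1) by (simp add: ennreal_mult)
      qed
    qed
    also have "\<dots> = ennreal D * (ennreal m + ennreal \<tau> + (\<integral>\<^sup>+\<omega>. ennreal (z \<omega> powr p) \<partial>P))"
      by (simp add: nn_integral_cmult nn_integral_add m gv.emeasure_space_1)
    also have "\<dots> \<le> ennreal D * (ennreal m + ennreal \<tau> + ennreal (\<tau> powr (p / 2) * N))"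
      by (intro mult_left_mono add_left_mono zp) auto
    also have "\<dots> = ennreal (D * (m + \<tau> + \<tau> powr (p / 2) * N))"
      using D0 m(2) t(1) N by (simp add: ennreal_mult)
    also have "\<dots> \<le> ennreal (D * ((1 + N * T powr (p / 2 - 1)) * (m + \<tau>)))"
    proof (intro ennreal_leI mult_left_mono)
      have "\<tau> powr (p / 2) = \<tau> powr 1 * \<tau> powr (p / 2 - 1)" unfolding powr_add[symmetric] by simp
      also have "\<dots> \<le> \<tau> * T powr (p / 2 - 1)" using t p by (auto intro!: mult_left_mono powr_mono2)
      finally have "\<tau> powr (p / 2) * N \<le> \<tau> * T powr (p / 2 - 1) * N" using N by (rule mult_right_mono)
      moreover have "0 \<le> N * T powr (p / 2 - 1) * m" using N m(2) by simp
      ultimately show "m + \<tau> + \<tau> powr (p / 2) * N \<le> (1 + N * T powr (p / 2 - 1)) * (m + \<tau>)"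
        by (simp add: algebra_simps)
    qed (use D0 in simp)
    finally show ?thesis by (simp add: N_def mult.assoc)
  qed
  show "(\<integral>\<^sup>+\<omega>. ennreal (nrm (v \<omega>) powr p) \<partial>P) \<le> ennreal (exp ((p / 2 + D) * \<tau>) * (m + D * (1 + noise_const p K) * \<tau>))"
  proof -
    \<comment> \<open>Measurable for the past, as the mean zero argument requires. For
      \<open>p = 2\<close> it is 0 where \<open>nrm (u \<omega>)\<close> vanishes, because
      \<open>0 powr 0 = 0\<close>; the product with \<open>ip (u \<omega>)\<close> does not
      notice.\<close>
    define w where "w \<omega> = nrm (u \<omega>) powr (p - 2)" for \<omega>
    have wm: "w \<in> borel_measurable Fm" unfolding w_def by measurable
    have wmP [measurable]: "w \<in> borel_measurable P" unfolding w_def by measurable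
    obtain Kn where Kn: "Kn > 0" "\<And>x. nrm x \<le> Kn * norm x" using nrm_le_norm by blast
    have cross: "integrable P (\<lambda>\<omega>. w \<omega> * ip (u \<omega>) (B j (G \<omega>))) \<and> gv.expectation (\<lambda>\<omega>. w \<omega> * ip (u \<omega>) (B j (G \<omega>))) = 0" for j
    proof -
      have ipm: "(\<lambda>\<omega>. ip (u \<omega>) y) \<in> borel_measurable Fm" for y
        by (rule measurable_compose[OF u(1)]) (intro borel_measurable_continuous_onI continuous_intros ip.continuous_on)
      have iG: "integrable P (\<lambda>\<omega>. norm (G \<omega>) powr p)"
        by (rule integrableI_bounded) (use gv.G_norm_moment[OF p] in auto)
      have i1: "integrable P (\<lambda>\<omega>. \<bar>w \<omega>\<bar> * nrm (u \<omega>))"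
      proof (rule Bochner_Integration.integrable_bound)
        show "integrable P (\<lambda>\<omega>. nrm (u \<omega>) powr p + 1)" using iu by simp
        show "AE \<omega> in P. norm (\<bar>w \<omega>\<bar> * nrm (u \<omega>)) \<le> norm (nrm (u \<omega>) powr p + 1)"
          using powr_product_le[OF r0 _ p, of _ 1] r0 by (intro AE_I2) (simp add: w_def)
      qed measurable
      have i2: "integrable P (\<lambda>\<omega>. \<bar>w \<omega>\<bar> * nrm (u \<omega>) * norm (G \<omega>))"
      proof (rule Bochner_Integration.integrable_bound)
        show "integrable P (\<lambda>\<omega>. nrm (u \<omega>) powr p + norm (G \<omega>) powr p)" using iu iG by simp
        show "AE \<omega> in P. norm (\<bar>w \<omega>\<bar> * nrm (u \<omega>) * norm (G \<omega>)) \<le> norm (nrm (u \<omega>) powr p + norm (G \<omega>) powr p)"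
          using powr_product_le[OF r0 norm_ge_zero p] r0 by (intro AE_I2) (simp add: w_def)
      qed measurable
      have Bn: "nrm (B j x) \<le> Kn * KB * norm x" if "x \<in> S" for x
        using order_trans[OF Kn(2) mult_left_mono[OF B(3)[OF that, of j]]] Kn(1) by (simp add: mult.assoc)
      show ?thesis
        using gv.expectation_ip_zero[OF hilbert_form_axioms Fm wm ipm u(2) i1 i2 B(1)[of j] B(2)[of _ j] Bn] by blast
    qed
    have nu_eq: "w \<omega> * ip (u \<omega>) (noise_update (\<lambda>j. B j (G \<omega>))) = (\<Sum>j\<in>UNIV. bt $ j * (w \<omega> * ip (u \<omega>) (B j (G \<omega>))))" for \<omega>
      by (simp add: noise_update_def ip_simps sum_distrib_left mult_ac)
    have ic: "integrable P (\<lambda>\<omega>. w \<omega> * ip (u \<omega>) (noise_update (\<lambda>j. B j (G \<omega>))))"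
      unfolding nu_eq using cross by (intro Bochner_Integration.integrable_sum integrable_mult_right) auto
    have ec: "gv.expectation (\<lambda>\<omega>. w \<omega> * ip (u \<omega>) (noise_update (\<lambda>j. B j (G \<omega>)))) = 0"
      unfolding nu_eq using cross by (subst Bochner_Integration.integral_sum) (auto intro: integrable_mult_right)
    have iz: "integrable P (\<lambda>\<omega>. z \<omega> powr p)"
      by (rule integrableI_bounded) (use zp in \<open>auto intro: le_less_trans\<close>)
    define ez where "ez = gv.expectation (\<lambda>\<omega>. z \<omega> powr p)"
    have ez: "ez \<le> \<tau> powr (p / 2) * N"
    proof -
      have "ennreal ez = (\<integral>\<^sup>+\<omega>. ennreal (z \<omega> powr p) \<partial>P)"
        unfolding ez_def by (rule nn_integral_eq_integral[OF iz, symmetric]) auto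
      then have "ennreal ez \<le> ennreal (\<tau> powr (p / 2) * N)" using zp by (simp only:)
      then show ?thesis using N by (subst (asm) ennreal_le_iff) auto
    qed
    define f where "f \<omega> = exp (p / 2 * \<tau>) * (nrm (u \<omega>) powr p
      + p * (w \<omega> * ip (u \<omega>) (noise_update (\<lambda>j. B j (G \<omega>))))
      + D * \<tau> * (nrm (u \<omega>) powr p + 1 + \<tau> powr - (p / 2) * z \<omega> powr p))" for \<omega>
    have f: "integrable P f" unfolding f_def using iu ic iz by simp
    have ef: "gv.expectation f = exp (p / 2 * \<tau>) * (m + D * \<tau> * (m + 1 + \<tau> powr - (p / 2) * ez))"
      unfolding f_def using iu ic iz eu ec by (simp add: ez_def gv.prob_space)
    have "(\<integral>\<^sup>+\<omega>. ennreal (nrm (v \<omega>) powr p) \<partial>P) \<le> (\<integral>\<^sup>+\<omega>. ennreal (f \<omega>) \<partial>P)"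
      using vAE unfolding f_def w_def by (intro nn_integral_mono_AE) (auto elim!: eventually_mono intro: ennreal_leI)
    also have "\<dots> = ennreal (gv.expectation f)"
    proof (rule nn_integral_eq_integral[OF f])
      \<comment> \<open>\<open>f\<close> contains the signed mixed term; it is nonnegative because
        it dominates a power.\<close>
      show "AE \<omega> in P. 0 \<le> f \<omega>" using vAE unfolding f_def w_def
        by eventually_elim (rule order_trans[OF powr_ge_zero])
    qed
    also have "\<dots> \<le> ennreal (exp ((p / 2 + D) * \<tau>) * (m + D * (1 + N) * \<tau>))"
    proof (rule ennreal_leI)
      have "\<tau> powr - (p / 2) * ez \<le> \<tau> powr - (p / 2) * (\<tau> powr (p / 2) * N)" using ez by (intro mult_left_mono) auto
      also have "\<dots> = N" using t(1) by (simp add: powr_minus)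
      finally have "m + D * \<tau> * (m + 1 + \<tau> powr - (p / 2) * ez) \<le> m + D * \<tau> * (m + 1 + N)"
        using D0 t(1) by (intro add_left_mono mult_left_mono) auto
      also have "\<dots> \<le> (1 + D * \<tau>) * (m + D * (1 + N) * \<tau>)"
        using D0 t(1) N by (simp add: algebra_simps)
      also have "\<dots> \<le> exp (D * \<tau>) * (m + D * (1 + N) * \<tau>)"
        using D0 t(1) N m(2) by (intro mult_right_mono) auto
      finally have "exp (p / 2 * \<tau>) * (m + D * \<tau> * (m + 1 + \<tau> powr - (p / 2) * ez)) \<le> exp (p / 2 * \<tau>) * (exp (D * \<tau>) * (m + D * (1 + N) * \<tau>))"
        by (intro mult_left_mono) auto
      then show "gv.expectation f \<le> exp ((p / 2 + D) * \<tau>) * (m + D * (1 + N) * \<tau>)"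
        unfolding ef by (simp add: distrib_right exp_add mult.assoc)
    qed
    finally show ?thesis by (simp add: N_def)
  qed
qed

end

section \<open>Solutions of the stochastic method\<close>

locale srk_data = rk_drift ip X \<kappa> DM M A b At bt c F T l f0
  for ip :: "'h::{banach,second_countable_topology} \<Rightarrow> 'h \<Rightarrow> real" and X \<kappa> DM M
    and A :: "real^'s::finite^'s" and b At bt c F T l f0 +
  fixes P :: "'w measure" and Fil :: "real \<Rightarrow> 'w measure"
    and S :: "'u::{real_inner,banach,second_countable_topology} set" and Q and W :: "real \<Rightarrow> 'w \<Rightarrow> 'u"
    and B :: "real \<Rightarrow> 'u \<Rightarrow> 'h" and KB :: real and N :: nat and \<tau>' C :: real
  assumes filtered: "filtered_prob_space P T Fil"
    and S: "subspace S" "closed S" and Q: "covariance_op_on S Q"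
    and W: "q_wiener_process S Q P T Fil W"
    and B: "t \<in> {0..T} \<Longrightarrow> linear_on S (B t)" "t \<in> {0..T} \<Longrightarrow> x \<in> S \<Longrightarrow> B t x \<in> X"
      "t \<in> {0..T} \<Longrightarrow> x \<in> S \<Longrightarrow> norm (B t x) \<le> KB * norm x"
    and C: "stage_constants \<tau>' C" and N: "N \<ge> 1" and step_size: "T / real N \<le> \<tau>'"
begin

sublocale P: prob_space P
  using filtered by (simp add: filtered_prob_space_def)

section \<open>Grid points, nodes and increments\<close>

definition \<tau> :: real where "\<tau> = T / real N"
definition grid :: "nat \<Rightarrow> real" where "grid n = real n * \<tau>"
definition node :: "nat \<Rightarrow> 's \<Rightarrow> real" where "node n j = grid n + c $ j * \<tau>"
definition dW :: "nat \<Rightarrow> 'w \<Rightarrow> 'u" where "dW n \<omega> = W (grid (Suc n)) \<omega> - W (grid n) \<omega>"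

lemma tau: "0 < \<tau>" "\<tau> \<le> \<tau>'" "\<tau> \<le> T"
  using T N step_size by (auto simp: \<tau>_def field_simps)

lemma grid_mem: "n \<le> N \<Longrightarrow> grid n \<in> {0..T}"
  using T N by (auto simp: grid_def \<tau>_def field_simps)

lemma grid_Suc: "grid (Suc n) = grid n + \<tau>"
  by (simp add: grid_def distrib_right)

lemma node_mem: "n < N \<Longrightarrow> node n j \<in> {0..T}"
proof -
  assume n: "n < N"
  have c: "0 \<le> c $ j" "c $ j \<le> 1" using nodes[of j] by auto
  have "c $ j * \<tau> \<le> 1 * \<tau>" using c tau(1) by (intro mult_right_mono) auto
  moreover have "0 \<le> c $ j * \<tau>" using c tau(1) by simp
  ultimately show ?thesis
    using grid_mem[of n] grid_mem[of "Suc n"] n by (auto simp: node_def grid_Suc)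
qed

lemma Fil_subalgebra: "t \<in> {0..T} \<Longrightarrow> subalgebra P (Fil t)"
  using filtered by (simp add: filtered_prob_space_def)

lemma Fil_space: "t \<in> {0..T} \<Longrightarrow> space (Fil t) = space P"
  using Fil_subalgebra by (auto simp: subalgebra_def)

lemma Fil_mono:
  assumes f: "f \<in> borel_measurable (Fil s)" and st: "0 \<le> s" "s \<le> t" "t \<le> T"
  shows "f \<in> borel_measurable (Fil t)"
proof (rule measurable_from_subalg[OF _ f])
  show "subalgebra (Fil t) (Fil s)"
    using filtered st Fil_space[of s] Fil_space[of t] by (auto simp: filtered_prob_space_def subalgebra_def)
qed

lemma W_measurable: "t \<in> {0..T} \<Longrightarrow> W t \<in> borel_measurable (Fil t)"
  and W_S: "t \<in> {0..T} \<Longrightarrow> \<omega> \<in> space P \<Longrightarrow> W t \<omega> \<in> S"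
  using W unfolding q_wiener_process_def by blast+

lemma dW_measurable: "n < N \<Longrightarrow> dW n \<in> borel_measurable (Fil (grid (Suc n)))"
  unfolding dW_def[abs_def]
  using grid_mem[of n] grid_mem[of "Suc n"] tau(1)
  by (intro borel_measurable_diff W_measurable Fil_mono[OF W_measurable]) (auto simp: grid_Suc)

lemma dW_S: "n < N \<Longrightarrow> \<omega> \<in> space P \<Longrightarrow> dW n \<omega> \<in> S"
  unfolding dW_def using S(1) by (intro subspace_diff W_S grid_mem) auto

lemma dW_gaussian: "n < N \<Longrightarrow> gaussian_vector P S Q \<tau> (dW n)"
  and dW_indep: "n < N \<Longrightarrow> P.indep_set (sets (Fil (grid n))) (sets (vimage_algebra (space P) (dW n) borel))"
proof -
  assume n: "n < N"
  then have g: "0 \<le> grid n" "grid n < grid (Suc n)" "grid (Suc n) \<le> T" "grid (Suc n) - grid n = \<tau>"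
    using grid_mem[of n] grid_mem[of "Suc n"] tau(1) by (auto simp: grid_Suc)
  note w = W[unfolded q_wiener_process_def, THEN conjunct2, THEN conjunct2, THEN conjunct2, rule_format,
      of "grid n" "grid (Suc n)", OF conjI[OF g(1) conjI[OF g(2,3)]]]
  show "P.indep_set (sets (Fil (grid n))) (sets (vimage_algebra (space P) (dW n) borel))"
    using w unfolding dW_def by blast
  have "dW n \<in> borel_measurable P"
    by (rule measurable_from_subalg[OF Fil_subalgebra[OF grid_mem[of "Suc n"]] dW_measurable[OF n]]) (use n in simp)
  moreover have "\<forall>h\<in>S. h \<noteq> 0 \<longrightarrow> distributed P lborel (\<lambda>\<omega>. inner (dW n \<omega>) h)
      (\<lambda>x. ennreal (normal_density 0 (sqrt (\<tau> * inner (Q h) h)) x))"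
    using w[THEN conjunct2] unfolding dW_def g(4) .
  ultimately have "gaussian_on S Q P \<tau> (dW n)" unfolding gaussian_on_def using ballI[OF dW_S[OF n], of "space P"]
    by (intro conjI)
  then show "gaussian_vector P S Q \<tau> (dW n)"
    by (intro gaussian_vector.intro gaussian_vector_axioms.intro P.prob_space_axioms S Q tau(1))
qed

abbreviation noise :: "nat \<Rightarrow> 'w \<Rightarrow> 's \<Rightarrow> 'h" where
  "noise n \<omega> \<equiv> \<lambda>j. B (node n j) (dW n \<omega>)"

lemma noise_X: "n < N \<Longrightarrow> \<omega> \<in> space P \<Longrightarrow> noise n \<omega> j \<in> X"
  by (intro B(2) node_mem dW_S)

text \<open>Reads a solution as a sequence of pathwise problems \<open>stage_eq\<close> and
  \<open>update\<close>, with the stages of one step gathered into a vector.\<close>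

lemma solution_iff:
  "srk_solution P Fil X DM M F B W A b At bt c T N u0 u U \<longleftrightarrow>
     (\<forall>n\<le>N. u n \<in> borel_measurable (Fil (grid n)) \<and> (\<forall>\<omega>\<in>space P. u n \<omega> \<in> X)) \<and>
     (\<forall>n<N. \<forall>i. U n i \<in> borel_measurable P \<and> (\<forall>\<omega>\<in>space P. U n i \<omega> \<in> X)) \<and>
     (AE \<omega> in P. u 0 \<omega> = u0 \<omega>) \<and>
     (\<forall>n<N. AE \<omega> in P.
        stage_eq \<tau> (noise_stage (u n \<omega>) (noise n \<omega>)) (Fs (node n) (\<chi> i. U n i \<omega>)) (\<chi> i. U n i \<omega>) \<and>
        u (Suc n) \<omega> = update \<tau> (node n) (u n \<omega>) (noise n \<omega>) (\<chi> i. U n i \<omega>))"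
proof -
  have "stage_eq \<tau> (noise_stage x \<beta>) (Fs s (\<chi> i. V i)) (\<chi> i. V i) \<longleftrightarrow>
      (\<forall>i. V i \<in> DM \<and> V i = x + \<tau> *\<^sub>R (\<Sum>j\<in>UNIV. A $ i $ j *\<^sub>R (M (V j) + F (s j) (V j))) + (\<Sum>j\<in>UNIV. At $ i $ j *\<^sub>R \<beta> j))"
    for x \<beta> s V
    unfolding stage_eq_def noise_stage_def Fs_def vec_lambda_beta by (simp only: add.assoc add.commute[of "\<tau> *\<^sub>R _"])
  then show ?thesis
    unfolding srk_solution_def Let_def update_def noise_update_def vec_lambda_beta
    unfolding node_def grid_def \<tau>_def dW_def by simp
qed

section \<open>One step as a continuous function of the old value and the increment\<close>

lemma continuous_on_B: "t \<in> {0..T} \<Longrightarrow> continuous_on S (B t)"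
proof (rule continuous_onI)
  fix x e assume t: "t \<in> {0..T}" and x: "x \<in> S" and e: "(e::real) > 0"
  have "dist (B t y) (B t x) \<le> e" if y: "y \<in> S" "dist y x < e / (\<bar>KB\<bar> + 1)" for y
  proof -
    have "dist (B t y) (B t x) = norm (B t (y - x))"
      using linear_on_diff[OF B(1)[OF t] S(1) y(1) x] by (simp add: dist_norm)
    also have "\<dots> \<le> KB * norm (y - x)" using subspace_diff[OF S(1) y(1) x] by (rule B(3)[OF t])
    also have "\<dots> \<le> (\<bar>KB\<bar> + 1) * norm (y - x)" by (intro mult_right_mono) auto
    also have "\<dots> \<le> e" using y(2) by (simp add: dist_norm field_simps)
    finally show ?thesis .
  qed
  then show "\<exists>d>0. \<forall>y\<in>S. dist y x < d \<longrightarrow> dist (B t y) (B t x) \<le> e"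
    using e by (intro exI[of _ "e / (\<bar>KB\<bar> + 1)"]) auto
qed

text \<open>For \<open>g \<in> Xs\<close> the choice is determined by \<open>solve_unique\<close>;
  continuity in \<open>g\<close> is the Lipschitz clause of \<open>stage_constants\<close>.\<close>

definition solve :: "nat \<Rightarrow> 'h^'s \<Rightarrow> 'h^'s" where
  "solve n g = (SOME U. stage_eq \<tau> g (Fs (node n) U) U)"

lemma solve:
  assumes n: "n < N" and g: "g \<in> Xs"
  shows "stage_eq \<tau> g (Fs (node n) (solve n g)) (solve n g)"
  unfolding solve_def by (rule someI_ex[OF stage_constantsD(3)[OF C tau(1,2) node_mem[OF n] g]])

lemma solve_unique:
  assumes n: "n < N" and g: "g \<in> Xs" and U: "stage_eq \<tau> g (Fs (node n) U) U" and V: "stage_eq \<tau> g (Fs (node n) V) V"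
  shows "U = V"
  using stage_constantsD(4)[OF C tau(1,2) node_mem[OF n] g g U V] by simp

lemma continuous_on_solve:
  assumes n: "n < N"
  shows "continuous_on Xs (solve n)"
proof (rule continuous_onI)
  fix g e assume g: "g \<in> Xs" and e: "(e::real) > 0"
  have C0: "C > 0" by (rule stage_constantsD(2)[OF C])
  have "dist (solve n g') (solve n g) \<le> e" if g': "g' \<in> Xs" "dist g' g < e / C" for g'
  proof -
    have "dist (solve n g') (solve n g) \<le> C * norm (g' - g)"
      unfolding dist_norm by (rule stage_constantsD(4)[OF C tau(1,2) node_mem[OF n] g'(1) g solve[OF n g'(1)] solve[OF n g]])
    also have "\<dots> \<le> e" using g'(2) C0 by (simp add: dist_norm field_simps)
    finally show ?thesis .
  qed
  then show "\<exists>d>0. \<forall>y\<in>Xs. dist y g < d \<longrightarrow> dist (solve n y) (solve n g) \<le> e"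
    using e C0 by (intro exI[of _ "e / C"]) auto
qed

definition stages :: "nat \<Rightarrow> 'h \<Rightarrow> 'u \<Rightarrow> 'h^'s" where
  "stages n u x = solve n (noise_stage u (\<lambda>j. B (node n j) x))"

text \<open>\<open>update\<close> applies the unbounded \<open>M\<close> to the stages, so its
  continuity is not visible. Here \<open>\<tau>\<close> times the slopes is replaced by the
  combination of the differences of stages and data with \<open>Ai\<close> from
  \<open>stage_eq_inverse\<close>, which is continuous.\<close>

definition successor :: "nat \<Rightarrow> 'h \<Rightarrow> 'u \<Rightarrow> 'h" where
  "successor n u x = u + (\<Sum>i\<in>UNIV. b $ i *\<^sub>R (\<Sum>j\<in>UNIV. Ai $ i $ j *\<^sub>R
     (stages n u x $ j - noise_stage u (\<lambda>j. B (node n j) x) $ j))) + noise_update (\<lambda>j. B (node n j) x)"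

lemma stages:
  assumes n: "n < N" and u: "u \<in> X" and x: "x \<in> S"
  shows "stage_eq \<tau> (noise_stage u (\<lambda>j. B (node n j) x)) (Fs (node n) (stages n u x)) (stages n u x)"
  unfolding stages_def by (intro solve[OF n] noise_stage_X u B(2) node_mem n x)

lemma successor_eq:
  assumes n: "n < N" and u: "u \<in> X" and x: "x \<in> S"
  shows "successor n u x = update \<tau> (node n) u (\<lambda>j. B (node n j) x) (stages n u x)"
proof -
  have "(\<Sum>j\<in>UNIV. Ai $ i $ j *\<^sub>R (stages n u x $ j - noise_stage u (\<lambda>j. B (node n j) x) $ j))
      = \<tau> *\<^sub>R (M (stages n u x $ i) + F (node n i) (stages n u x $ i))" for i
    using stages[OF assms] unfolding stage_eq_inverse by (simp add: Fs_def)
  then show ?thesis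
    unfolding successor_def update_def by (simp add: scaleR_sum_right mult.commute)
qed

lemma successor_X:
  assumes n: "n < N" and u: "u \<in> X" and x: "x \<in> S"
  shows "successor n u x \<in> X"
proof -
  have g: "noise_stage u (\<lambda>j. B (node n j) x) \<in> Xs" by (intro noise_stage_X u B(2) node_mem n x)
  have "stages n u x $ i \<in> X" for i using stage_X[OF stages[OF assms]] by simp
  then show ?thesis unfolding successor_def noise_update_def
    using g by (intro X_intros u B(2) node_mem n x) auto
qed

lemma continuous_on_noise:
  assumes n: "n < N"
  shows "continuous_on (X \<times> S) (\<lambda>z. B (node n j) (snd z))"
  by (rule continuous_on_compose2[OF continuous_on_B[OF node_mem[OF n]] continuous_on_snd[OF continuous_on_id]]) auto

lemma continuous_on_noise_stage:
  assumes n: "n < N"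
  shows "continuous_on (X \<times> S) (\<lambda>z. noise_stage (fst z) (\<lambda>j. B (node n j) (snd z)))"
  unfolding noise_stage_def
  by (intro continuous_on_vec_lambda continuous_intros continuous_on_noise[OF n])

lemma continuous_on_stages:
  assumes n: "n < N"
  shows "continuous_on (X \<times> S) (\<lambda>z. stages n (fst z) (snd z))"
  unfolding stages_def
  by (rule continuous_on_compose2[OF continuous_on_solve[OF n] continuous_on_noise_stage[OF n]])
    (intro image_subsetI noise_stage_X B(2)[OF node_mem[OF n]], auto)

lemma continuous_on_successor:
  assumes n: "n < N"
  shows "continuous_on (X \<times> S) (\<lambda>z. successor n (fst z) (snd z))"
  unfolding successor_def noise_update_def
  by (intro continuous_intros continuous_on_noise[OF n] continuous_on_component continuous_on_stages[OF n] continuous_on_noise_stage[OF n])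

text \<open>The maps are known to be continuous on \<open>X \<times> S\<close> only, so
  measurability is passed through the subspace in which the pair takes its values.\<close>

lemma measurable_on_pair:
  fixes f :: "'h \<times> 'u \<Rightarrow> 'h"
  assumes n: "n < N" and f: "continuous_on (X \<times> S) f"
    and u: "u \<in> borel_measurable (Fil (grid n))" "\<And>\<omega>. \<omega> \<in> space P \<Longrightarrow> u \<omega> \<in> X"
  shows "(\<lambda>\<omega>. f (u \<omega>, dW n \<omega>)) \<in> borel_measurable (Fil (grid (Suc n)))"
proof (rule measurable_compose[of "\<lambda>\<omega>. (u \<omega>, dW n \<omega>)" _ "restrict_space borel (X \<times> S)" f])
  have g: "0 \<le> grid n" "grid n \<le> grid (Suc n)" "grid (Suc n) \<le> T" "grid (Suc n) \<in> {0..T}"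
    using grid_mem[of n] grid_mem[of "Suc n"] tau(1) n by (auto simp: grid_Suc)
  show "f \<in> borel_measurable (restrict_space borel (X \<times> S))"
    by (rule borel_measurable_continuous_on_restrict[OF f])
  show "(\<lambda>\<omega>. (u \<omega>, dW n \<omega>)) \<in> Fil (grid (Suc n)) \<rightarrow>\<^sub>M restrict_space borel (X \<times> S)"
  proof (rule measurable_restrict_space2)
    show "(\<lambda>\<omega>. (u \<omega>, dW n \<omega>)) \<in> space (Fil (grid (Suc n))) \<rightarrow> X \<times> S"
      using u(2) dW_S[OF n] by (auto simp: Fil_space[OF g(4)])
    show "(\<lambda>\<omega>. (u \<omega>, dW n \<omega>)) \<in> borel_measurable (Fil (grid (Suc n)))"
      by (intro borel_measurable_Pair dW_measurable n Fil_mono[OF u(1) g(1,2,3)])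
  qed
qed

fun iterate :: "('w \<Rightarrow> 'h) \<Rightarrow> nat \<Rightarrow> 'w \<Rightarrow> 'h" where
  "iterate u0 0 = u0"
| "iterate u0 (Suc n) = (\<lambda>\<omega>. successor n (iterate u0 n \<omega>) (dW n \<omega>))"

text \<open>The iterates solve the equations for every outcome and not merely almost surely;
  adaptedness follows from \<open>measurable_on_pair\<close> by induction.\<close>

lemma solution_exists:
  assumes u0: "u0 \<in> borel_measurable (Fil 0)" "\<And>\<omega>. \<omega> \<in> space P \<Longrightarrow> u0 \<omega> \<in> X"
  shows "\<exists>u U. srk_solution P Fil X DM M F B W A b At bt c T N u0 u U"
proof -
  have u: "iterate u0 n \<in> borel_measurable (Fil (grid n)) \<and> (\<forall>\<omega>\<in>space P. iterate u0 n \<omega> \<in> X)" if "n \<le> N" for n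
    using that
  proof (induction n)
    case 0
    then show ?case using u0 by (simp add: grid_def)
  next
    case (Suc n)
    then have n: "n < N" and IH: "iterate u0 n \<in> borel_measurable (Fil (grid n))" "\<And>\<omega>. \<omega> \<in> space P \<Longrightarrow> iterate u0 n \<omega> \<in> X"
      by auto
    show ?case
      using measurable_on_pair[OF n continuous_on_successor[OF n] IH] successor_X[OF n IH(2) dW_S[OF n]] by simp
  qed
  have U: "(\<lambda>\<omega>. stages n (iterate u0 n \<omega>) (dW n \<omega>) $ i) \<in> borel_measurable P" if n: "n < N" for n i
  proof (rule measurable_from_subalg[OF Fil_subalgebra])
    show "grid (Suc n) \<in> {0..T}" using n by (intro grid_mem) simp
    show "(\<lambda>\<omega>. stages n (iterate u0 n \<omega>) (dW n \<omega>) $ i) \<in> borel_measurable (Fil (grid (Suc n)))"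
      using measurable_on_pair[OF n continuous_on_component[OF continuous_on_stages[OF n]], of "iterate u0 n" i] u[of n] n by simp
  qed
  have S: "stage_eq \<tau> (noise_stage (iterate u0 n \<omega>) (noise n \<omega>)) (Fs (node n) (stages n (iterate u0 n \<omega>) (dW n \<omega>))) (stages n (iterate u0 n \<omega>) (dW n \<omega>))
     \<and> iterate u0 (Suc n) \<omega> = update \<tau> (node n) (iterate u0 n \<omega>) (noise n \<omega>) (stages n (iterate u0 n \<omega>) (dW n \<omega>))"
    if n: "n < N" and \<omega>: "\<omega> \<in> space P" for n \<omega>
  proof -
    have x: "iterate u0 n \<omega> \<in> X" "dW n \<omega> \<in> S" using u[of n] n \<omega> dW_S by auto
    show ?thesis using stages[OF n x] successor_eq[OF n x] by simp
  qed
  have SX: "stages n (iterate u0 n \<omega>) (dW n \<omega>) $ i \<in> X" if "n < N" "\<omega> \<in> space P" for n \<omega> i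
    using stage_X[OF S[OF that, THEN conjunct1]] by simp
  have "srk_solution P Fil X DM M F B W A b At bt c T N u0 (iterate u0) (\<lambda>n i \<omega>. stages n (iterate u0 n \<omega>) (dW n \<omega>) $ i)"
    unfolding solution_iff vec_nth_inverse
  proof (intro conjI allI impI ballI)
    show "AE \<omega> in P. iterate u0 0 \<omega> = u0 \<omega>" by simp
    show "AE \<omega> in P. stage_eq \<tau> (noise_stage (iterate u0 n \<omega>) (noise n \<omega>)) (Fs (node n) (stages n (iterate u0 n \<omega>) (dW n \<omega>))) (stages n (iterate u0 n \<omega>) (dW n \<omega>))
        \<and> iterate u0 (Suc n) \<omega> = update \<tau> (node n) (iterate u0 n \<omega>) (noise n \<omega>) (stages n (iterate u0 n \<omega>) (dW n \<omega>))"
      if "n < N" for n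
      by (rule AE_I2) (rule S[OF that])
  qed (use u U SX in blast)+
  then show ?thesis by blast
qed

text \<open>Induction along the grid, outside the null sets of the finitely many equations of both
  solutions.\<close>

lemma solution_unique:
  assumes u: "srk_solution P Fil X DM M F B W A b At bt c T N u0 u U"
    and u': "srk_solution P Fil X DM M F B W A b At bt c T N u0 u' U'"
  shows "AE \<omega> in P. \<forall>n\<le>N. u n \<omega> = u' n \<omega>"
proof -
  define eqs where "eqs u U n \<omega> \<longleftrightarrow>
        stage_eq \<tau> (noise_stage (u n \<omega>) (noise n \<omega>)) (Fs (node n) (\<chi> i. U n i \<omega>)) (\<chi> i. U n i \<omega>) \<and>
        u (Suc n) \<omega> = update \<tau> (node n) (u n \<omega>) (noise n \<omega>) (\<chi> i. U n i \<omega>)"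
    for u :: "nat \<Rightarrow> 'w \<Rightarrow> 'h" and U :: "nat \<Rightarrow> 's \<Rightarrow> 'w \<Rightarrow> 'h" and n \<omega>
  have 1: "AE \<omega> in P. \<forall>n\<in>{..<N}. eqs u U n \<omega>" if "srk_solution P Fil X DM M F B W A b At bt c T N u0 u U" for u U
    using that unfolding solution_iff eqs_def[symmetric] by (intro AE_finite_allI) auto
  have 0: "AE \<omega> in P. u 0 \<omega> = u0 \<omega>" if "srk_solution P Fil X DM M F B W A b At bt c T N u0 u U" for u U
    using that unfolding solution_iff by blast
  show ?thesis
    using 1[OF u] 1[OF u'] 0[OF u] 0[OF u'] AE_space
  proof eventually_elim
    case (elim \<omega>)
    have uX: "u n \<omega> \<in> X" if "n \<le> N" for n using u elim(5) that unfolding solution_iff by blast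
    have "u n \<omega> = u' n \<omega>" if "n \<le> N" for n
      using that
    proof (induction n)
      case 0
      then show ?case using elim(3,4) by simp
    next
      case (Suc n)
      then have n: "n < N" "u' n \<omega> = u n \<omega>" by auto
      have e: "eqs u U n \<omega>" "eqs u' U' n \<omega>" using elim(1,2) n(1) by auto
      have "(\<chi> i. U n i \<omega>) = (\<chi> i. U' n i \<omega>)"
        using e uX[of n] n noise_X[OF n(1) elim(5)] unfolding eqs_def n(2)
        by (intro solve_unique[OF n(1) noise_stage_X, of "u n \<omega>" "noise n \<omega>"]) auto
      then show ?case using e unfolding eqs_def n(2) by simp
    qed
    then show ?case by blast
  qed
qed

text \<open>Discrete Gronwall: the bound
  \<open>exp (a * (real n * \<tau>)) * (m + d * (real n * \<tau>))\<close> reproduces itself in a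
  step, since the addition \<open>d * \<tau>\<close> may be multiplied by an exponential that is at
  least 1. At the end \<open>real n * \<tau> \<le> T\<close>.\<close>

lemma solution_moments:
  defines "hnorm \<equiv> (\<lambda>x. sqrt (ip x x + ip (M x) (M x)))"
  assumes u: "srk_solution P Fil X DM M F B W A b At bt c T N u0 u U"
    and D: "step_bound p \<tau>' D" and p: "p \<ge> 2"
    and HS: "\<And>t. t \<in> {0..T} \<Longrightarrow> hilbert_schmidt (cameron_martin S Q) (inner_cm S Q) DM hnorm (B t)"
      "\<And>t. t \<in> {0..T} \<Longrightarrow> hs_norm (cameron_martin S Q) (inner_cm S Q) hnorm (B t) \<le> K"
    and m: "moment P p nrm u0 = ennreal m" "m \<ge> 0"
  shows "n \<le> N \<Longrightarrow> moment P p nrm (u n) \<le> ennreal (exp ((p / 2 + D) * T) * (m + D * (1 + noise_const p K) * T))"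
    and "n < N \<Longrightarrow> moment P p nrm (U n i) \<le> ennreal (D * (1 + noise_const p K * T powr (p / 2 - 1))) * (moment P p nrm (u n) + ennreal \<tau>)"
proof -
  note D0 = step_bound_pos[OF D]
  define a where "a = p / 2 + D"
  define d where "d = D * (1 + noise_const p K)"
  have a: "a \<ge> 0" unfolding a_def using p D0 by simp
  have d: "d \<ge> 0" unfolding d_def using D0 noise_const_nonneg[of p K] by simp
  have step: "moment P p nrm (u (Suc n)) \<le> ennreal (exp (a * \<tau>) * (x + d * \<tau>)) \<and>
      moment P p nrm (U n i) \<le> ennreal (D * (1 + noise_const p K * T powr (p / 2 - 1)) * (x + \<tau>))"
    if n: "n < N" and x: "moment P p nrm (u n) = ennreal x" "x \<ge> 0" for n x i
  proof -
    have un: "u n \<in> borel_measurable (Fil (grid n))" "\<And>\<omega>. \<omega> \<in> space P \<Longrightarrow> u n \<omega> \<in> X"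
      using u n unfolding solution_iff by auto
    have ae: "AE \<omega> in P. stage_eq \<tau> (noise_stage (u n \<omega>) (noise n \<omega>)) (Fs (node n) (\<chi> i. U n i \<omega>)) (\<chi> i. U n i \<omega>) \<and>
        u (Suc n) \<omega> = update \<tau> (node n) (u n \<omega>) (noise n \<omega>) (\<chi> i. U n i \<omega>)"
      using u n unfolding solution_iff by blast
    have fil: "subalgebra P (Fil (grid n))" using n by (intro Fil_subalgebra grid_mem) simp
    note data = D p tau node_mem[OF n] dW_gaussian[OF n] fil dW_indep[OF n] B(1)[OF node_mem[OF n]]
        B(2)[OF node_mem[OF n]] B(3)[OF node_mem[OF n]] HS(1)[OF node_mem[OF n], unfolded hnorm_def] HS(2)[OF node_mem[OF n], unfolded hnorm_def] un
        x[unfolded moment_def]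
    have ae1: "AE \<omega> in P. stage_eq \<tau> (noise_stage (u n \<omega>) (noise n \<omega>)) (Fs (node n) (\<chi> i. U n i \<omega>)) (\<chi> i. U n i \<omega>)"
      and ae2: "AE \<omega> in P. u (Suc n) \<omega> = update \<tau> (node n) (u n \<omega>) (noise n \<omega>) (\<chi> i. U n i \<omega>)"
      using ae by (auto elim: eventually_mono)
    have "moment P p nrm (u (Suc n)) \<le> ennreal (exp ((p / 2 + D) * \<tau>) * (x + D * (1 + noise_const p K) * \<tau>))"
      unfolding moment_def
      by (rule moment_step(1)[where s="node n" and B="\<lambda>j. B (node n j)" and u="u n" and G="dW n"
            and U="\<lambda>\<omega>. \<chi> i. U n i \<omega>" and v="u (Suc n)"]; (rule data ae1 ae2)?; assumption?)
    moreover have "moment P p nrm (\<lambda>\<omega>. (\<chi> i. U n i \<omega>) $ i) \<le> ennreal (D * (1 + noise_const p K * T powr (p / 2 - 1)) * (x + \<tau>))"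
      unfolding moment_def
      by (rule moment_step(2)[where s="node n" and B="\<lambda>j. B (node n j)" and u="u n" and G="dW n"
            and U="\<lambda>\<omega>. \<chi> i. U n i \<omega>" and v="u (Suc n)"]; (rule data ae1 ae2)?; assumption?)
    ultimately show ?thesis unfolding a_def d_def by simp
  qed
  have m0: "moment P p nrm (u 0) = ennreal m"
  proof -
    have "AE \<omega> in P. u 0 \<omega> = u0 \<omega>" using u unfolding solution_iff by blast
    then show ?thesis unfolding m(1)[symmetric] moment_def by (intro nn_integral_cong_AE) auto
  qed
  have mom: "moment P p nrm (u n) \<le> ennreal (exp (a * (real n * \<tau>)) * (m + d * (real n * \<tau>)))" if "n \<le> N" for n
    using that
  proof (induction n)
    case 0
    then show ?case using m0 by simp
  next
    case (Suc n)
    \<comment> \<open>\<open>moment_step\<close> asks for a real moment; the induction hypothesis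
      shows that it is finite.\<close>
    define x where "x = enn2real (moment P p nrm (u n))"
    have IH: "moment P p nrm (u n) \<le> ennreal (exp (a * (real n * \<tau>)) * (m + d * (real n * \<tau>)))" using Suc by simp
    have nn: "0 \<le> exp (a * (real n * \<tau>)) * (m + d * (real n * \<tau>))" using m(2) d tau(1) by simp
    have x: "moment P p nrm (u n) = ennreal x" "x \<ge> 0"
      unfolding x_def using le_less_trans[OF IH ennreal_less_top] by (auto simp: enn2real_nonneg)
    have xle: "x \<le> exp (a * (real n * \<tau>)) * (m + d * (real n * \<tau>))" using IH nn unfolding x(1) by (subst (asm) ennreal_le_iff) auto
    have "moment P p nrm (u (Suc n)) \<le> ennreal (exp (a * \<tau>) * (x + d * \<tau>))" using step[OF _ x] Suc.prems by simp
    also have "\<dots> \<le> ennreal (exp (a * (real (Suc n) * \<tau>)) * (m + d * (real (Suc n) * \<tau>)))"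
    proof (rule ennreal_leI)
      have "1 \<le> exp (a * (real n * \<tau>))" using a tau(1) by simp
      then have "d * \<tau> \<le> exp (a * (real n * \<tau>)) * (d * \<tau>)" using d tau(1) mult_right_mono[of 1 _ "d * \<tau>"] by simp
      then have "x + d * \<tau> \<le> exp (a * (real n * \<tau>)) * (m + d * (real (Suc n) * \<tau>))" using xle by (simp add: algebra_simps)
      then have "exp (a * \<tau>) * (x + d * \<tau>) \<le> exp (a * \<tau>) * (exp (a * (real n * \<tau>)) * (m + d * (real (Suc n) * \<tau>)))"
        by (intro mult_left_mono) auto
      also have "\<dots> = exp (a * (real (Suc n) * \<tau>)) * (m + d * (real (Suc n) * \<tau>))"
        unfolding mult.assoc[symmetric] exp_add[symmetric] by (simp add: algebra_simps)
      finally show "exp (a * \<tau>) * (x + d * \<tau>) \<le> exp (a * (real (Suc n) * \<tau>)) * (m + d * (real (Suc n) * \<tau>))" .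
    qed
    finally show ?case .
  qed
  show bound: "moment P p nrm (u n) \<le> ennreal (exp ((p / 2 + D) * T) * (m + D * (1 + noise_const p K) * T))" if n: "n \<le> N" for n
  proof -
    have g: "real n * \<tau> \<le> T" "0 \<le> real n * \<tau>" using grid_mem[OF n] by (auto simp: grid_def)
    have "exp (a * (real n * \<tau>)) * (m + d * (real n * \<tau>)) \<le> exp (a * T) * (m + d * T)"
      using g a d m(2) T by (intro mult_mono add_left_mono mult_left_mono) (auto intro!: mult_left_mono)
    then show ?thesis using order_trans[OF mom[OF n] ennreal_leI] by (simp add: a_def d_def)
  qed
  show "moment P p nrm (U n i) \<le> ennreal (D * (1 + noise_const p K * T powr (p / 2 - 1))) * (moment P p nrm (u n) + ennreal \<tau>)" if n: "n < N"
  proof -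
    define x where "x = enn2real (moment P p nrm (u n))"
    have x: "moment P p nrm (u n) = ennreal x" "x \<ge> 0"
      unfolding x_def using le_less_trans[OF bound ennreal_less_top] n by (auto simp: enn2real_nonneg)
    have "0 \<le> D * (1 + noise_const p K * T powr (p / 2 - 1))" using D0 noise_const_nonneg[of p K] by simp
    then show ?thesis
      using step[OF n x, THEN conjunct2, of i] x(2) tau(1) unfolding x(1) by (simp add: ennreal_mult)
  qed
qed

end

section \<open>The coefficients of the Maxwell equations\<close>

text \<open>Makes a pointwise bound by a sum of norms a bound by one function, to which the triangle
  inequality of the space applies.\<close>

definition modulus :: "('a::euclidean_space, 'b::euclidean_space) l2 \<Rightarrow> ('a, real) l2" where
  "modulus u = abs_l2 (\<lambda>x. norm (rep_l2 u x))"

lemma AE_rep_modulus: "AE x in lebesgue. rep_l2 (modulus u) x = norm (rep_l2 u x)"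
  unfolding modulus_def
  by (rule AE_rep_abs_l2) (use square_integrable_rep[of u] in \<open>simp add: square_integrable_def\<close>)

lemma norm_modulus_le: "norm (modulus u) \<le> norm u"
proof -
  have "norm (modulus u) \<le> 1 * norm u"
    by (rule norm_l2_le) (use AE_rep_modulus[of u] in \<open>auto elim: eventually_mono\<close>)
  then show ?thesis by simp
qed

lemma norm_l2_le_add:
  assumes K: "0 \<le> K" and le: "AE x in lebesgue. norm (rep_l2 w x) \<le> K * (norm (rep_l2 u x) + norm (rep_l2 v x))"
  shows "norm w \<le> K * (norm u + norm v)"
proof -
  have "norm w \<le> K * norm (modulus u + modulus v)"
  proof (rule norm_l2_le[OF K])
    show "AE x in lebesgue. norm (rep_l2 w x) \<le> K * norm (rep_l2 (modulus u + modulus v) x)"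
      using le AE_rep_add[of "modulus u" "modulus v"] AE_rep_modulus[of u] AE_rep_modulus[of v]
      by eventually_elim simp
  qed
  also have "\<dots> \<le> K * (norm u + norm v)"
    using norm_triangle_ineq[of "modulus u" "modulus v"] norm_modulus_le[of u] norm_modulus_le[of v]
    by (intro mult_left_mono[OF _ K]) linarith
  finally show ?thesis .
qed

lemma square_integrable_indicator_bounded:
  assumes "bounded D" "D \<in> sets lebesgue"
  shows "square_integrable (\<lambda>x. if x \<in> D then 1 else 0 :: real)"
proof -
  have "emeasure lebesgue D < \<infinity>"
    using bounded_set_imp_lmeasurable[OF assms] unfolding fmeasurable_def by blast
  from integrable_real_indicator[OF assms(2) this]
  have "integrable lebesgue (indicator D :: _ \<Rightarrow> real)" .
  moreover have "(\<lambda>x. (norm (if x \<in> D then 1 else 0 :: real))\<^sup>2) = indicator D" by (auto simp: indicator_def)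
  moreover have "(\<lambda>x. if x \<in> D then 1 else 0 :: real) = indicator D" by (auto simp: indicator_def)
  ultimately show ?thesis unfolding square_integrable_def using assms(2) by simp
qed

lemma norm_Pair_le_sum: "norm (x, y) \<le> norm x + norm y"
  by (simp add: norm_Pair sqrt_sum_squares_le_sum)

section \<open>Drift and diffusion as maps into the energy space\<close>

context maxwell_domain
begin

lemma id_measurable: "(\<lambda>x. x) \<in> borel_measurable (lebesgue_on D)"
  by (rule measurable_restrict_space1) (rule measurable_completion, simp)

text \<open>A continuous function after a measurable one: the position is restricted to
  \<open>D\<close>, where the current is continuous, while the representatives are Lebesgue
  measurable.\<close>

lemma composition_measurable:
  assumes J: "admissible_current D T L J" and t: "t \<in> {0..T}"
  shows "(\<lambda>x. J t x (rep_l2 u x) (rep_l2 v x)) \<in> borel_measurable (lebesgue_on D)"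
proof -
  have c: "continuous_on (D \<times> UNIV \<times> UNIV) (\<lambda>y. J t (fst y) (fst (snd y)) (snd (snd y)))"
  proof -
    have "continuous_on ({0..T} \<times> D \<times> UNIV \<times> UNIV) (\<lambda>(t, x, u, v). J t x u v)"
      using J by (simp add: admissible_current_def)
    moreover have "continuous_on (D \<times> UNIV \<times> UNIV) (\<lambda>y :: (real^3) \<times> (real^3) \<times> (real^3). (t, y))"
      by (intro continuous_intros)
    ultimately have "continuous_on (D \<times> UNIV \<times> UNIV) (\<lambda>y. (\<lambda>(t, x, u, v). J t x u v) (t, y))"
      by (rule continuous_on_compose2) (use t in auto)
    then show ?thesis by (simp add: case_prod_beta)
  qed
  have m: "(\<lambda>x. (x, rep_l2 u x, rep_l2 v x)) \<in> borel_measurable (lebesgue_on D)"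
    by (intro borel_measurable_Pair id_measurable rep_l2_measurable_on)
  have "(\<lambda>x. (x, rep_l2 u x, rep_l2 v x)) \<in> lebesgue_on D \<rightarrow>\<^sub>M restrict_space borel (D \<times> UNIV \<times> UNIV)"
    by (rule measurable_restrict_space2[OF _ m]) auto
  from measurable_compose[OF this borel_measurable_continuous_on_restrict[OF c]] show ?thesis by simp
qed

text \<open>As \<open>D\<close> is bounded, the constant in the growth bound of the current is
  square integrable on it. The factor 2 in the Lipschitz bound comes from estimating each component
  by the norm of the pair.\<close>

lemma current_component:
  assumes bd: "bounded D" and J: "admissible_current D T L J" and a: "material_coefficient D \<delta> a" and L: "L > 0" and t: "t \<in> {0..T}"
  defines "f \<equiv> \<lambda>(u::em) x. - inverse (a x) *\<^sub>R J t x (rep_l2 (fst u) x) (rep_l2 (snd u) x)"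
  shows "l2_class_on D (f u) \<in> L2_on D"
    and "norm (l2_class_on D (f u) - l2_class_on D (f v)) \<le> 2 * L / \<delta> * norm (u - v)"
    and "norm (l2_class_on D (f 0)) \<le> L / \<delta> * norm (l2_class_on D (\<lambda>_. 1) :: (real^3, real) l2)"
proof -
  have inv: "AE x in lebesgue. x \<in> D \<longrightarrow> \<bar>inverse (a x)\<bar> \<le> 1 / \<delta>" by (rule material_weights(5)[OF a])
  have Jg: "norm (J t x p q) \<le> L * (1 + norm p + norm q)" if "x \<in> D" for x p q
    using J t that by (simp add: admissible_current_def)
  have Jl: "norm (J t x p q - J t x p' q') \<le> L * (norm (p - p') + norm (q - q'))" if "x \<in> D" for x p q p' q'
  proof -
    have "norm (J t x p q - J t x p' q') \<le> L * (\<bar>t - t\<bar> + norm (p - p') + norm (q - q'))"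
      using J t that unfolding admissible_current_def by blast
    then show ?thesis by simp
  qed
  have scale: "norm (- inverse (a x) *\<^sub>R y) \<le> L / \<delta> * r" if "\<bar>inverse (a x)\<bar> \<le> 1 / \<delta>" "norm y \<le> L * r" for x r and y :: "real^3"
  proof -
    have "\<bar>inverse (a x)\<bar> * norm y \<le> 1 / \<delta> * (L * r)" using that delta by (intro mult_mono) auto
    then show ?thesis by simp
  qed
  have am: "a \<in> borel_measurable (lebesgue_on D)" using a by (simp add: material_coefficient_def)
  have sq: "sq_on D (f u)" for u
  proof (rule sq_on_bound[OF D_sets])
    have [measurable]: "(\<lambda>x. J t x (rep_l2 (fst u) x) (rep_l2 (snd u) x)) \<in> borel_measurable (lebesgue_on D)"
      by (rule composition_measurable[OF J t])
    show "f u \<in> borel_measurable (lebesgue_on D)" unfolding f_def using am by measurable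
    show "square_integrable (\<lambda>x. (if x \<in> D then 1 else 0 :: real) + norm (rep_l2 (fst u) x) + norm (rep_l2 (snd u) x))"
      using square_integrable_rep[of "fst u"] square_integrable_rep[of "snd u"]
      by (intro square_integrable_add square_integrable_indicator_bounded bd D_sets) (simp_all add: square_integrable_def)
    show "AE x in lebesgue. x \<in> D \<longrightarrow> norm (f u x) \<le>
        L / \<delta> * norm ((if x \<in> D then 1 else 0 :: real) + norm (rep_l2 (fst u) x) + norm (rep_l2 (snd u) x))"
      using inv
    proof eventually_elim
      case (elim x)
      show ?case
      proof
        assume x: "x \<in> D"
        show "norm (f u x) \<le> L / \<delta> * norm ((if x \<in> D then 1 else 0 :: real) + norm (rep_l2 (fst u) x) + norm (rep_l2 (snd u) x))"
          unfolding f_def by (rule scale) (use elim x Jg[OF x] in auto)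
      qed
    qed
  qed
  show "l2_class_on D (f u) \<in> L2_on D" by (rule class_on_in_L2_on[OF sq])
  have L\<delta>: "0 \<le> L / \<delta>" using L delta by simp
  have "norm (l2_class_on D (f u) - l2_class_on D (f v)) \<le> L / \<delta> * (norm (fst u - fst v) + norm (snd u - snd v))"
  proof (rule norm_l2_le_add[OF L\<delta>])
    show "AE x in lebesgue. norm (rep_l2 (l2_class_on D (f u) - l2_class_on D (f v)) x)
        \<le> L / \<delta> * (norm (rep_l2 (fst u - fst v) x) + norm (rep_l2 (snd u - snd v) x))"
      using inv AE_rep_class_on[OF sq[of u]] AE_rep_class_on[OF sq[of v]] AE_rep_diff[of "l2_class_on D (f u)" "l2_class_on D (f v)"]
        AE_rep_diff[of "fst u" "fst v"] AE_rep_diff[of "snd u" "snd v"]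
    proof eventually_elim
      case (elim x)
      show ?case
      proof (cases "x \<in> D")
        case True
        have "f u x - f v x = - inverse (a x) *\<^sub>R (J t x (rep_l2 (fst u) x) (rep_l2 (snd u) x) - J t x (rep_l2 (fst v) x) (rep_l2 (snd v) x))"
          by (simp add: f_def scaleR_diff_right)
        then show ?thesis
          using scale[OF _ Jl[OF True], of x "rep_l2 (fst u) x" "rep_l2 (snd u) x" "rep_l2 (fst v) x" "rep_l2 (snd v) x"] elim True by simp
      next
        case False
        then show ?thesis
          using elim mult_nonneg_nonneg[OF L\<delta>, of "norm (rep_l2 (fst u - fst v) x) + norm (rep_l2 (snd u - snd v) x)"] by simp
      qed
    qed
  qed
  also have "\<dots> \<le> L / \<delta> * (norm (u - v) + norm (u - v))"
    using norm_fst_le[of "fst u - fst v" "snd u - snd v"] norm_snd_le[of "snd u - snd v" "fst u - fst v"]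
    by (intro mult_left_mono[OF add_mono L\<delta>]) (simp_all add: minus_prod_def)
  finally show "norm (l2_class_on D (f u) - l2_class_on D (f v)) \<le> 2 * L / \<delta> * norm (u - v)" by (simp add: mult_ac)
  show "norm (l2_class_on D (f 0)) \<le> L / \<delta> * norm (l2_class_on D (\<lambda>_. 1) :: (real^3, real) l2)"
  proof (rule norm_l2_le[OF L\<delta>])
    show "AE x in lebesgue. norm (rep_l2 (l2_class_on D (f 0)) x) \<le> L / \<delta> * norm (rep_l2 (l2_class_on D (\<lambda>_. 1) :: (real^3, real) l2) x)"
      using inv AE_rep_class_on[OF sq[of 0]] AE_rep_class_on[OF square_integrable_indicator_bounded[OF bd D_sets]]
        AE_rep_zero[where 'a="real^3" and 'b="real^3"]
    proof eventually_elim
      case (elim x)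
      then show ?case using scale[of x "J t x 0 0" 1] Jg[of x 0 0] by (cases "x \<in> D") (auto simp: f_def)
    qed
  qed
qed

lemma noise_component:
  assumes J: "admissible_noise_current D T J" and K: "\<And>t x. t \<in> {0..T} \<Longrightarrow> x \<in> D \<Longrightarrow> norm (J t x) \<le> K" "K \<ge> 0"
    and a: "material_coefficient D \<delta> a" and t: "t \<in> {0..T}"
  defines "f \<equiv> \<lambda>(v :: (real^3, real) l2) x. - inverse (a x) *\<^sub>R (rep_l2 v x *\<^sub>R J t x)"
  shows "l2_class_on D (f v) \<in> L2_on D"
    and "norm (l2_class_on D (f v)) \<le> K / \<delta> * norm v"
    and "linear_on S (\<lambda>v. l2_class_on D (f v))"
proof -
  have inv: "AE x in lebesgue. x \<in> D \<longrightarrow> \<bar>inverse (a x)\<bar> \<le> 1 / \<delta>" by (rule material_weights(5)[OF a])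
  have am: "a \<in> borel_measurable (lebesgue_on D)" using a by (simp add: material_coefficient_def)
  have Jm: "J t \<in> borel_measurable (lebesgue_on D)"
  proof -
    have "continuous_on ({0..T} \<times> D) (\<lambda>(t, x). J t x)" using J by (simp add: admissible_noise_current_def)
    moreover have "continuous_on D (\<lambda>x. (t, x))" by (intro continuous_intros)
    ultimately have "continuous_on D (\<lambda>x. (\<lambda>(t, x). J t x) (t, x))"
      by (rule continuous_on_compose2) (use t in auto)
    then have c: "continuous_on D (J t)" by simp
    have "(\<lambda>x. x) \<in> lebesgue_on D \<rightarrow>\<^sub>M restrict_space borel D"
      by (rule measurable_restrict_space2[OF _ id_measurable]) auto
    from measurable_compose[OF this borel_measurable_continuous_on_restrict[OF c]] show ?thesis by simp
  qed
  have le: "AE x in lebesgue. x \<in> D \<longrightarrow> norm (f v x) \<le> K / \<delta> * norm (rep_l2 v x)" for v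
    using inv
  proof eventually_elim
    case (elim x)
    show ?case
    proof
      assume x: "x \<in> D"
      have "\<bar>inverse (a x)\<bar> * (\<bar>rep_l2 v x\<bar> * norm (J t x)) \<le> 1 / \<delta> * (\<bar>rep_l2 v x\<bar> * K)"
        using elim x K(1)[OF t x] delta by (intro mult_mono) auto
      then show "norm (f v x) \<le> K / \<delta> * norm (rep_l2 v x)" by (simp add: f_def abs_mult mult_ac)
    qed
  qed
  have sq: "sq_on D (f v)" for v
  proof (rule sq_on_bound[OF D_sets _ square_integrable_rep le])
    note [measurable] = Jm am rep_l2_measurable_on[of v D]
    show "f v \<in> borel_measurable (lebesgue_on D)" unfolding f_def by measurable
  qed
  show in_L2: "l2_class_on D (f v) \<in> L2_on D" for v by (rule class_on_in_L2_on[OF sq])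
  show "norm (l2_class_on D (f v)) \<le> K / \<delta> * norm v"
    by (rule norm_class_on_le[OF _ sq le]) (use K(2) delta in simp)
  show "linear_on S (\<lambda>v. l2_class_on D (f v))"
    unfolding linear_on_def
  proof (intro conjI ballI allI)
    fix v w :: "(real^3, real) l2" and r :: real
    show "l2_class_on D (f (v + w)) = l2_class_on D (f v) + l2_class_on D (f w)"
    proof (rule L2_on_eqI[of _ D])
      show "AE x in lebesgue. x \<in> D \<longrightarrow> rep_l2 (l2_class_on D (f (v + w))) x = rep_l2 (l2_class_on D (f v) + l2_class_on D (f w)) x"
        using AE_rep_class_on[OF sq[of v]] AE_rep_class_on[OF sq[of w]] AE_rep_class_on[OF sq[of "v + w"]]
          AE_rep_add[of "l2_class_on D (f v)" "l2_class_on D (f w)"] AE_rep_add[of v w]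
        by eventually_elim (simp add: f_def scaleR_add_left scaleR_add_right algebra_simps)
    qed (auto intro: in_L2 subspace_add[OF subspace_L2_on])
    show "l2_class_on D (f (r *\<^sub>R v)) = r *\<^sub>R l2_class_on D (f v)"
    proof (rule L2_on_eqI[of _ D])
      show "AE x in lebesgue. x \<in> D \<longrightarrow> rep_l2 (l2_class_on D (f (r *\<^sub>R v))) x = rep_l2 (r *\<^sub>R l2_class_on D (f v)) x"
        using AE_rep_class_on[OF sq[of v]] AE_rep_class_on[OF sq[of "r *\<^sub>R v"]]
          AE_rep_scaleR[of r "l2_class_on D (f v)"] AE_rep_scaleR[of r v]
        by eventually_elim (simp add: f_def mult_ac)
    qed (auto intro: in_L2 subspace_scale[OF subspace_L2_on])
  qed
qed

lemma drift_bounds: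
  assumes bd: "bounded D" and L: "L > 0" and J: "admissible_current D T L Je" "admissible_current D T L Jm" and t: "t \<in> {0..T}"
  shows "drift D eps mu Je Jm t u \<in> HH D"
    and "norm (drift D eps mu Je Jm t u - drift D eps mu Je Jm t v) \<le> 4 * L / \<delta> * norm (u - v)"
    and "norm (drift D eps mu Je Jm t 0) \<le> 2 * L / \<delta> * norm (l2_class_on D (\<lambda>_. 1) :: (real^3, real) l2)"
proof -
  note e = current_component[OF bd J(1) eps L t] and m = current_component[OF bd J(2) mu L t]
  show "drift D eps mu Je Jm t u \<in> HH D" unfolding drift_def HH_def using e(1) m(1) by blast
  show "norm (drift D eps mu Je Jm t u - drift D eps mu Je Jm t v) \<le> 4 * L / \<delta> * norm (u - v)"
    unfolding drift_def using order_trans[OF norm_Pair_le_sum add_mono[OF e(2)[of u v] m(2)[of u v]]] by simp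
  show "norm (drift D eps mu Je Jm t 0) \<le> 2 * L / \<delta> * norm (l2_class_on D (\<lambda>_. 1) :: (real^3, real) l2)"
    unfolding drift_def using order_trans[OF norm_Pair_le_sum add_mono[OF e(3) m(3)]] by simp
qed

text \<open>Bounded currents make the operator bounded on all of \<open>L\<^sup>2\<close>, so that
  it can be applied to increments outside the Cameron-Martin space.\<close>

lemma diffusion_bounds:
  assumes J: "admissible_noise_current D T Jer" "admissible_noise_current D T Jmr"
  shows "\<exists>K. \<forall>t\<in>{0..T}. linear_on S (diffusion D eps mu Jer Jmr t) \<and>
    (\<forall>v. diffusion D eps mu Jer Jmr t v \<in> HH D \<and> norm (diffusion D eps mu Jer Jmr t v) \<le> K * norm v)"
proof -
  have bd: "\<exists>K\<ge>0. \<forall>t\<in>{0..T}. \<forall>x\<in>D. norm (J t x) \<le> K" if J: "admissible_noise_current D T J" for J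
  proof -
    obtain K where "\<forall>t\<in>{0..T}. \<forall>x\<in>D. norm (J t x) \<le> K" using J unfolding admissible_noise_current_def by blast
    then have "\<forall>t\<in>{0..T}. \<forall>x\<in>D. norm (J t x) \<le> \<bar>K\<bar>" by (meson abs_ge_self order_trans)
    then show ?thesis by (intro exI[of _ "\<bar>K\<bar>"] conjI abs_ge_zero)
  qed
  obtain Ke Km where Ke: "Ke \<ge> 0" "\<forall>t\<in>{0..T}. \<forall>x\<in>D. norm (Jer t x) \<le> Ke"
    and Km: "Km \<ge> 0" "\<forall>t\<in>{0..T}. \<forall>x\<in>D. norm (Jmr t x) \<le> Km"
    using bd[OF J(1)] bd[OF J(2)] by blast
  have "linear_on S (diffusion D eps mu Jer Jmr t) \<and>
    (\<forall>v. diffusion D eps mu Jer Jmr t v \<in> HH D \<and> norm (diffusion D eps mu Jer Jmr t v) \<le> (Ke / \<delta> + Km / \<delta>) * norm v)"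
    if t: "t \<in> {0..T}" for t
  proof (intro conjI allI)
    note e = noise_component[OF J(1) _ Ke(1) eps t] and m = noise_component[OF J(2) _ Km(1) mu t]
    show "diffusion D eps mu Jer Jmr t v \<in> HH D" for v unfolding diffusion_def HH_def using e(1) m(1) Ke(2) Km(2) by blast
    show "norm (diffusion D eps mu Jer Jmr t v) \<le> (Ke / \<delta> + Km / \<delta>) * norm v" for v
    proof -
      have "norm (diffusion D eps mu Jer Jmr t v) \<le> Ke / \<delta> * norm v + Km / \<delta> * norm v"
        unfolding diffusion_def by (rule order_trans[OF norm_Pair_le_sum add_mono[OF e(2) m(2)]]) (use Ke(2) Km(2) in auto)
      then show ?thesis by (simp add: distrib_right)
    qed
    have "linear_on S (\<lambda>v. l2_class_on D (\<lambda>x. - inverse (eps x) *\<^sub>R (rep_l2 v x *\<^sub>R Jer t x)))"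
      "linear_on S (\<lambda>v. l2_class_on D (\<lambda>x. - inverse (mu x) *\<^sub>R (rep_l2 v x *\<^sub>R Jmr t x)))"
      using e(3) m(3) Ke(2) Km(2) by blast+
    then show "linear_on S (diffusion D eps mu Jer Jmr t)" unfolding linear_on_def diffusion_def by simp
  qed
  then show ?thesis by blast
qed

lemma inner_HH_nonneg: "0 \<le> inner_HH D eps mu u u"
  unfolding inner_HH_def set_lebesgue_integral_def
proof (rule integral_nonneg_AE)
  show "AE x in lebesgue. 0 \<le> indicator D x *\<^sub>R (eps x * inner (rep_l2 (fst u) x) (rep_l2 (fst u) x) + mu x * inner (rep_l2 (snd u) x) (rep_l2 (snd u) x))"
    using weights(4) weights(9) by eventually_elim (use delta in \<open>auto simp: indicator_def\<close>)
qed

text \<open>As an equality of functions it rests on nonnegativity of the form at every argument,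
  also outside \<open>HH D\<close>.\<close>

lemma norm_dom_maxwell_eq:
  "norm_dom_maxwell D eps mu = (\<lambda>x. sqrt (inner_HH D eps mu x x + inner_HH D eps mu (maxwell_op D eps mu x) (maxwell_op D eps mu x)))"
  by (rule ext) (simp add: norm_dom_maxwell_def norm_HH_def inner_HH_nonneg)

end

theorem theorem4p2:
  fixes D :: "(real^3) set" and eps mu :: "real^3 \<Rightarrow> real" and \<delta> L T :: real
    and Je Jm :: current
    and A At :: "real^'s::finite^'s" and b bt c :: "real^'s"
  assumes "open D" "connected D" "bounded D" "D \<noteq> {}"
    and "T > 0"
    and "\<delta> > 0" "material_coefficient D \<delta> eps" "material_coefficient D \<delta> mu"
    and "L > 0" "admissible_current D T L Je" "admissible_current D T L Jm"
    and "\<And>i. c $ i \<in> {0..1}"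
    and "algebraically_stable A b" "coercivity_condition A"
  shows "\<exists>(taustar :: real \<Rightarrow> real) (C :: real \<Rightarrow> real \<Rightarrow> real).
    (\<forall>r. taustar r > 0) \<and> (\<forall>p K. C p K > 0) \<and>
    (\<forall>(P :: 'w measure) Fil Q W Jer Jmr u0 p.
       let B = diffusion D eps mu Jer Jmr;
           nrm = norm_HH D eps mu;
           K = (SUP t\<in>{0..T}. norm_HS_U0_DM D eps mu Q (B t));
           sol = (\<lambda>N. srk_solution P Fil (HH D) (dom_maxwell D) (maxwell_op D eps mu)
                        (drift D eps mu Je Jm) B W A b At bt c T N u0)
       in
       p \<ge> 2 \<and>
       filtered_prob_space P T Fil \<and>
       covariance_op_on (L2_on D) Q \<and>
       q_wiener_process (L2_on D) Q P T Fil W \<and>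
       admissible_noise_current D T Jer \<and> admissible_noise_current D T Jmr \<and>
       (\<forall>t\<in>{0..T}. HS_U0_DM D eps mu Q (B t)) \<and>
       bdd_above ((\<lambda>t. norm_HS_U0_DM D eps mu Q (B t)) ` {0..T}) \<and>
       u0 \<in> borel_measurable (Fil 0) \<and> (\<forall>\<omega>\<in>space P. u0 \<omega> \<in> HH D) \<and>
       moment P p nrm u0 < \<infinity>
       \<longrightarrow>
       (\<forall>N\<ge>1. T / real N \<le> taustar (Lp_norm P p nrm u0) \<longrightarrow>
          (\<exists>u U. sol N u U) \<and>
          (\<forall>u U u' U'. sol N u U \<and> sol N u' U' \<longrightarrow>
             (AE \<omega> in P. \<forall>n\<le>N. u n \<omega> = u' n \<omega>)) \<and>
          (\<forall>u U. sol N u U \<longrightarrow>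
             (\<forall>n<N. (MAX i. moment P p nrm (U n i))
                \<le> ennreal (C p K) * (moment P p nrm (u n) + ennreal (T / real N))) \<and>
             (MAX n\<in>{1..N}. moment P p nrm (u n))
                \<le> ennreal (C p K * (1 + Lp_norm P p nrm u0 powr p)))))"
proof -
  interpret maxwell_domain D eps mu \<delta> by (rule maxwell_domain.intro) fact+
  define l where "l = 4 * L / \<delta>"
  define f0 where "f0 = 2 * L / \<delta> * norm (l2_class_on D (\<lambda>_. 1) :: (real^3, real) l2)"
  interpret rk: rk_drift "inner_HH D eps mu" "HH D" \<delta> "dom_maxwell D" "maxwell_op D eps mu" A b At bt c
    "drift D eps mu Je Jm" T l f0
  proof (intro rk_drift.intro runge_kutta.intro maxwell.skew_adjoint_axioms runge_kutta_axioms.intro rk_drift_axioms.intro)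
    note db = drift_bounds[OF \<open>bounded D\<close> \<open>L > 0\<close> \<open>admissible_current D T L Je\<close> \<open>admissible_current D T L Jm\<close>]
    show "drift D eps mu Je Jm t x \<in> HH D" if "t \<in> {0..T}" for t x by (rule db(1)[OF that])
    show "norm (drift D eps mu Je Jm t x - drift D eps mu Je Jm t y) \<le> l * norm (x - y)" if "t \<in> {0..T}" for t x y
      unfolding l_def by (rule db(2)[OF that])
    show "norm (drift D eps mu Je Jm t 0) \<le> f0" if "t \<in> {0..T}" for t unfolding f0_def by (rule db(3)[OF that])
    show "0 \<le> l" unfolding l_def using \<open>L > 0\<close> \<open>\<delta> > 0\<close> by simp
  qed fact+
  obtain \<tau>' C0 where sc: "rk.stage_constants \<tau>' C0" using rk.stage_constants_exist by blast
  \<comment> \<open>The growth constant depends on \<open>p\<close> and the deterministic data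
    alone; it is chosen before any probability space is introduced.\<close>
  have "\<forall>p. \<exists>d. p \<ge> 2 \<longrightarrow> rk.step_bound p \<tau>' d" using rk.step_bound_exists[OF sc] by blast
  from choice[OF this] obtain d where d: "\<And>p. p \<ge> 2 \<Longrightarrow> rk.step_bound p \<tau>' (d p)" by blast
  define C1 where "C1 p K = d p * (1 + rk.noise_const p K * T powr (p / 2 - 1))" for p K
  define C2 where "C2 p K = exp ((p / 2 + d p) * T) * (1 + d p * (1 + rk.noise_const p K) * T)" for p K
  \<comment> \<open>For \<open>p\<close> below 2 nothing is known about \<open>d p\<close>; the
    absolute values keep \<open>C\<close> positive for all arguments.\<close>
  define C where "C p K = 1 + \<bar>C1 p K\<bar> + \<bar>C2 p K\<bar>" for p K
  let ?sol = "\<lambda>(P :: 'w measure) Fil W B N u0. srk_solution P Fil (HH D) (dom_maxwell D) (maxwell_op D eps mu)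
                        (drift D eps mu Je Jm) B W A b At bt c T N u0"
  have main: "(\<exists>u U. ?sol P Fil W B N u0 u U) \<and>
          (\<forall>u U u' U'. ?sol P Fil W B N u0 u U \<and> ?sol P Fil W B N u0 u' U' \<longrightarrow>
             (AE \<omega> in P. \<forall>n\<le>N. u n \<omega> = u' n \<omega>)) \<and>
          (\<forall>u U. ?sol P Fil W B N u0 u U \<longrightarrow>
             (\<forall>n<N. (MAX i. moment P p (norm_HH D eps mu) (U n i))
                \<le> ennreal (C p K) * (moment P p (norm_HH D eps mu) (u n) + ennreal (T / real N))) \<and>
             (MAX n\<in>{1..N}. moment P p (norm_HH D eps mu) (u n))
                \<le> ennreal (C p K * (1 + Lp_norm P p (norm_HH D eps mu) u0 powr p)))"
    if B: "B = diffusion D eps mu Jer Jmr" and K: "K = (SUP t\<in>{0..T}. norm_HS_U0_DM D eps mu Q (B t))"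
      and p: "p \<ge> 2" and fil: "filtered_prob_space P T Fil" and Q: "covariance_op_on (L2_on D) Q"
      and W: "q_wiener_process (L2_on D) Q P T Fil W"
      and J: "admissible_noise_current D T Jer" "admissible_noise_current D T Jmr"
      and HS: "\<forall>t\<in>{0..T}. HS_U0_DM D eps mu Q (B t)"
      and bdd: "bdd_above ((\<lambda>t. norm_HS_U0_DM D eps mu Q (B t)) ` {0..T})"
      and u0: "u0 \<in> borel_measurable (Fil 0)" "\<forall>\<omega>\<in>space P. u0 \<omega> \<in> HH D"
      and fin: "moment P p (norm_HH D eps mu) u0 < \<infinity>" and N: "N \<ge> 1" "T / real N \<le> \<tau>'"
    for P :: "'w measure" and Fil Q W Jer Jmr u0 p B K and N :: nat
  proof -
    obtain KB where KB: "\<forall>t\<in>{0..T}. linear_on (L2_on D) (B t) \<and> (\<forall>v. B t v \<in> HH D \<and> norm (B t v) \<le> KB * norm v)"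
      using diffusion_bounds[OF J, of "L2_on D"] unfolding B by blast
    interpret srk_data "inner_HH D eps mu" "HH D" \<delta> "dom_maxwell D" "maxwell_op D eps mu" A b At bt c
      "drift D eps mu Je Jm" T l f0 P Fil "L2_on D" Q W B KB N \<tau>' C0
      by (intro srk_data.intro rk.rk_drift_axioms srk_data_axioms.intro fil subspace_L2_on closed_L2_on D_sets Q W sc N)
        (use KB in blast)+
    note nrm = energy_nrm[symmetric]
    define m where "m = enn2real (moment P p (norm_HH D eps mu) u0)"
    have m: "moment P p energy.nrm u0 = ennreal m" "m \<ge> 0"
      using fin unfolding m_def nrm by (auto simp: enn2real_nonneg)
    have hs: "hilbert_schmidt (cameron_martin (L2_on D) Q) (inner_cm (L2_on D) Q) (dom_maxwell D)
        (\<lambda>x. sqrt (inner_HH D eps mu x x + inner_HH D eps mu (maxwell_op D eps mu x) (maxwell_op D eps mu x))) (B t)"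
      "hs_norm (cameron_martin (L2_on D) Q) (inner_cm (L2_on D) Q)
        (\<lambda>x. sqrt (inner_HH D eps mu x x + inner_HH D eps mu (maxwell_op D eps mu x) (maxwell_op D eps mu x))) (B t) \<le> K"
      if t: "t \<in> {0..T}" for t
    proof -
      show "hilbert_schmidt (cameron_martin (L2_on D) Q) (inner_cm (L2_on D) Q) (dom_maxwell D)
        (\<lambda>x. sqrt (inner_HH D eps mu x x + inner_HH D eps mu (maxwell_op D eps mu x) (maxwell_op D eps mu x))) (B t)"
        using HS t unfolding HS_U0_DM_def norm_dom_maxwell_eq by blast
      show "hs_norm (cameron_martin (L2_on D) Q) (inner_cm (L2_on D) Q)
        (\<lambda>x. sqrt (inner_HH D eps mu x x + inner_HH D eps mu (maxwell_op D eps mu x) (maxwell_op D eps mu x))) (B t) \<le> K"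
        unfolding K norm_dom_maxwell_eq[symmetric] norm_HS_U0_DM_def[symmetric] by (rule cSUP_upper[OF t bdd])
    qed
    have d0: "d p > 0" by (rule rk.step_bound_pos[OF d[OF p]])
    have C12: "C1 p K \<le> C p K" "C2 p K \<le> C p K" "C p K \<ge> 0" unfolding C_def by auto
    have lp: "Lp_norm P p (norm_HH D eps mu) u0 powr p = m"
      using p m(2) unfolding Lp_norm_def m_def[symmetric] by (simp add: powr_powr)
    have bounds: "(\<forall>n<N. (MAX i. moment P p (norm_HH D eps mu) (U n i))
                \<le> ennreal (C p K) * (moment P p (norm_HH D eps mu) (u n) + ennreal (T / real N))) \<and>
             (MAX n\<in>{1..N}. moment P p (norm_HH D eps mu) (u n))
                \<le> ennreal (C p K * (1 + Lp_norm P p (norm_HH D eps mu) u0 powr p))"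
      if sol: "?sol P Fil W B N u0 u U" for u U
    proof -
      note mom = solution_moments[OF sol d[OF p] p hs m]
      have "(MAX i. moment P p energy.nrm (U n i)) \<le> ennreal (C p K) * (moment P p energy.nrm (u n) + ennreal \<tau>)"
        if n: "n < N" for n
      proof (rule Max.boundedI)
        fix x assume "x \<in> range (\<lambda>i. moment P p energy.nrm (U n i))"
        then obtain i where x: "x = moment P p energy.nrm (U n i)" by blast
        have "x \<le> ennreal (C1 p K) * (moment P p energy.nrm (u n) + ennreal \<tau>)"
          unfolding x C1_def by (rule mom(2)[OF _ _ n])
        also have "\<dots> \<le> ennreal (C p K) * (moment P p energy.nrm (u n) + ennreal \<tau>)"
          by (intro mult_right_mono ennreal_leI C12) auto
        finally show "x \<le> ennreal (C p K) * (moment P p energy.nrm (u n) + ennreal \<tau>)" .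
      qed auto
      moreover have "(MAX n\<in>{1..N}. moment P p energy.nrm (u n)) \<le> ennreal (C p K * (1 + m))"
      proof (rule Max.boundedI)
        fix x assume "x \<in> (\<lambda>n. moment P p energy.nrm (u n)) ` {1..N}"
        then obtain n where n: "n \<le> N" and x: "x = moment P p energy.nrm (u n)" by auto
        have "x \<le> ennreal (exp ((p / 2 + d p) * T) * (m + d p * (1 + rk.noise_const p K) * T))"
          unfolding x by (rule mom(1)[OF _ _ n])
        also have "\<dots> \<le> ennreal (C2 p K * (1 + m))"
        proof (rule ennreal_leI)
          define e where "e = d p * (1 + rk.noise_const p K) * T"
          have "0 \<le> e" unfolding e_def using d0 rk.noise_const_nonneg[of p K] \<open>T > 0\<close> by simp
          \<comment> \<open>The initial moment is factored out, since \<open>C\<close> may not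
            depend on it.\<close>
          then have "m + e \<le> (1 + e) * (1 + m)" using m(2) by (simp add: algebra_simps)
          then have "exp ((p / 2 + d p) * T) * (m + e) \<le> exp ((p / 2 + d p) * T) * ((1 + e) * (1 + m))"
            by (intro mult_left_mono) auto
          then show "exp ((p / 2 + d p) * T) * (m + d p * (1 + rk.noise_const p K) * T) \<le> C2 p K * (1 + m)"
            by (simp add: C2_def e_def mult.assoc)
        qed
        also have "\<dots> \<le> ennreal (C p K * (1 + m))" using m(2) C12 by (intro ennreal_leI mult_right_mono) auto
        finally show "x \<le> ennreal (C p K * (1 + m))" .
      qed (use N in auto)
      ultimately show ?thesis unfolding nrm lp[unfolded nrm] \<tau>_def by blast
    qed
    have "\<exists>u U. ?sol P Fil W B N u0 u U" using solution_exists[OF u0(1)] u0(2) by blast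
    moreover have "AE \<omega> in P. \<forall>n\<le>N. u n \<omega> = u' n \<omega>" if "?sol P Fil W B N u0 u U" "?sol P Fil W B N u0 u' U'" for u U u' U'
      using that by (rule solution_unique)
    ultimately show ?thesis using bounds by blast
  qed
  show ?thesis
  \<comment> \<open>The threshold comes from the stages alone and is constant in the norm of the
    initial value.\<close>
  proof (rule exI[of _ "\<lambda>_. \<tau>'"], rule exI[of _ C], intro conjI)
    show "\<forall>r. \<tau>' > 0" using rk.stage_constantsD(1)[OF sc] by simp
    show "\<forall>p K. C p K > 0" unfolding C_def by (simp add: add_pos_nonneg)
  qed (unfold Let_def, intro allI impI, elim conjE, rule main, (rule refl | assumption)+)
qed

end
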